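(* Let $k$ be a field, let $\Lambda$ and $\Gamma$ be abelian groups, $n$ and $m$ positive integers, $z_1,\ldots,z_n\in\Lambda$, $g_1,\ldots,g_m\in\Gamma$, and let $\eta_1,\ldots,\eta_n\in\widehat{\Lambda}$ and $\chi_1,\ldots,\chi_m\in\widehat{\Gamma}$ be nontrivial characters. Suppose $W\in{}_{k[\Lambda]}^{k[\Lambda]}\mathcal{YD}$ has basis $u_i\in W_{z_i}^{\eta_i}$, $1\le i\le n$, and $V\in{}_{k[\Gamma]}^{k[\Gamma]}\mathcal{YD}$ has basis $a_j\in V_{g_j}^{\chi_j}$, $1\le j\le m$. Let $\varphi : \Lambda\longrightarrow\widehat{\Gamma}$ be a group homomorphism, $s : \{1,\ldots,n\}\longrightarrow\{1,\ldots,m\}$ a function, and $\lambda_1,\ldots,\lambda_n\in k$. Let $\tau : k[\Lambda]\otimes k[\Gamma]\longrightarrow k$ and $\beta : W\otimes V\longrightarrow k$ be the linear forms defined by $$\tau(z\otimes g) = \varphi(z)(g)\quad\text{and}\quad \beta(u_i\otimes a_j) = \lambda_i\delta_{s(i),j}$$ for all $z\in\Lambda$, $g\in\Gamma$, $1\le i\le n$, $1\le j\le m$. Assume further that for all $1\le i\le n$ with $\lambda_i\ne 0$ and all $z\in\Lambda$ $$\varphi(z_i) = \chi_{s(i)}^{-1}\quad\text{and}\quad \eta_i(z) = \varphi(z)(g_{s(i)}).$$ Then $(k[\Lambda], k[\Gamma], \tau, W, V, \beta)$ is a Yetter–Drinfel'd two-cocycle twist datum, and the corresponding Hopf algebra map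 $$\Phi = (\mathfrak{B}(\beta)\#\tau)_\ell : \mathfrak{B}(W)\# k[\Lambda]\longrightarrow(\mathfrak{B}(V)\# k[\Gamma])^{o\,cop}$$ can be described as follows. For all $1\le i\le n$ there are a unique algebra map $$\gamma_i : \mathfrak{B}(V)\# k[\Gamma]\longrightarrow k\quad\text{with}\quad \gamma_i(a_j\# 1) = 0,\quad \gamma_i(1\# g) = \varphi(z_i)(g)$$ for all $1\le j\le m$ and $g\in\Gamma$, and a unique $(\varepsilon,\gamma_i)$-derivation $$\delta_i : \mathfrak{B}(V)\# k[\Gamma]\longrightarrow k\quad\text{with}\quad \delta_i(a_j\# 1) = \beta(u_i\otimes a_j),\quad \delta_i(1\# g) = 0$$ for all $1\le j\le m$ and $g\in\Gamma$. Then the algebra map $\Phi : \mathfrak{B}(W)\# k[\Lambda]\longrightarrow(\mathfrak{B}(V)\# k[\Gamma])^{o}$ is determined by $$\Phi(1\# z_i) = \gamma_i,\qquad \Phi(u_i\# 1) = \delta_i$$ for all $1\le i\le n$.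
   Context: Everything is over a field $k$. $\widehat{G}$ is the group of characters $G\to k^\times$ of a group $G$; $k[G]$ is its group Hopf algebra. For an ordinary coalgebra write $\Delta(c) = c_{(1)}\otimes c_{(2)}$; for a left comodule write $\delta(m) = m_{(-1)}\otimes m_{(0)}$. $A^o$ is the finite (Sweedler) dual bialgebra, $A^{o\,cop}$ the same algebra with opposite coproduct. For a linear form $\beta : U\otimes V\to k$ write $\beta(u,v) = \beta(u\otimes v)$; $\beta_\ell : U\to V^*$ and $\beta_r : V\to U^*$ are given by $\beta_\ell(u)(v) = \beta(u,v) = \beta_r(v)(u)$. For an algebra $B$ and algebra maps $\varepsilon,\gamma : B\to k$ (here $\varepsilon$ is the counit), an $(\varepsilon,\gamma)$-derivation is a linear map $\delta : B\to k$ with $\delta(xy) = \varepsilon(x)\delta(y)+\delta(x)\gamma(y)$ for all $x,y\in B$. Yetter–Drinfel'd modules. For a Hopf algebra $H$, ${}_H^H\mathcal{YD}$ is the category whose objects are left $H$-modules and left $H$-comodules $M$ with $h_{(1)}m_{(-1)}\otimes h_{(2)}\cdot m_{(0)} = (h_{(1)}\cdot m)_{(-1)}h_{(2)}\otimes (h_{(1)}\cdot m)_{(0)}$, and whose morphisms are module and comodule maps. It is monoidal with diagonal action and codiagonal coaction, with braiding $m\otimes n \mapsto m_{(-1)}\cdot n\otimes m_{(0)}$. The coproduct of a coalgebra in the category is written $\Delta(c) = c^{(1)}\otimes c^{(2)}$. A bialgebra in the category is an algebra and coalgebra $R$ in the category such that $\epsilon$ and $\Delta: R\to R\otimes R$ are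 algebra maps, where $(a\otimes b)(a'\otimes b') = a(b_{(-1)}\cdot a')\otimes b_{(0)}b'$. For $V\in{}_{k[\Gamma]}^{k[\Gamma]}\mathcal{YD}$, $g\in\Gamma$, $\chi\in\widehat{\Gamma}$: $V_g = \{v\in V\mid\delta(v) = g\otimes v\}$ and $V_g^\chi = \{v\in V_g\mid h\cdot v = \chi(h)v\ \text{for all}\ h\in\Gamma\}$; similarly for $\Lambda$ and $W$. Bi-product. For a bialgebra $R$ in ${}_H^H\mathcal{YD}$, $R\# H$ is the $k$-bialgebra $R\otimes H$ (with $r\# h = r\otimes h$) with product $(r\# h)(r'\# h') = r(h_{(1)}\cdot r')\# h_{(2)}h'$, coproduct $\Delta(r\# h) = (r^{(1)}\# r^{(2)}_{\ (-1)}h_{(1)})\otimes(r^{(2)}_{\ (0)}\# h_{(2)})$, unit $1\#1$, counit $\epsilon\otimes\epsilon$. Nichols algebra. For $M\in{}_H^H\mathcal{YD}$ the tensor algebra $T(M)$ is a graded bialgebra in ${}_H^H\mathcal{YD}$ with $M$ primitive. Let $I$ be the unique maximal graded subobject of $T(M)$ which is a coideal and satisfies $I\cap M = (0)$; it is an ideal, and $\mathfrak{B}(M) = T(M)/I$, a connected graded bialgebra in ${}_H^H\mathcal{YD}$, with $M = \mathfrak{B}(M)(1)$. Conditions. For bialgebras $U,A$ and a form $\tau : U\otimes A\to k$: (A.1) $\tau(u,aa') = \tau(u_{(2)},a)\tau(u_{(1)},a')$; (A.2) $\tau(1,a) = \epsilon(a)$; (A.3) $\tau(uu',a) = \tau(u,a_{(1)})\tau(u',a_{(2)})$;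 (A.4) $\tau(u,1) = \epsilon(u)$. For bialgebras $T$ in ${}_K^K\mathcal{YD}$, $R$ in ${}_H^H\mathcal{YD}$ and a form $\beta : T\otimes R\to k$ ($S$ the antipode of $H$): (B.1) $\beta(tt',r) = \beta(t, S^{-1}(r^{(2)}_{\ (-1)})\cdot r^{(1)})\beta(t', r^{(2)}_{\ (0)})$; (B.2) $\beta(1,r) = \epsilon(r)$; (B.3) $\beta(t,rr') = \beta(t^{(2)},r)\beta(t^{(1)},r')$; (B.4) $\beta(t,1) = \epsilon(t)$. For forms $\tau : K\otimes H\to k$ and $\beta : W\otimes V\to k$, $W\in{}_K^K\mathcal{YD}$, $V\in{}_H^H\mathcal{YD}$: (C.1) $\beta(k\cdot w, v) = \beta(w, v\leftharpoonup\tau_\ell(k))$; (C.2) $\beta(w\leftharpoonup\tau_r(h), v) = \beta(w, S^{-1}(h)\cdot v)$; here $x\leftharpoonup p = p(x_{(-1)})x_{(0)}$. All identities are required for all elements. A Yetter–Drinfel'd two-cocycle twist datum is a tuple $(K,H,\tau,W,V,\beta)$ where $K,H$ are Hopf algebras with bijective antipodes, $\tau : K\otimes H\to k$ satisfies (A.1)–(A.4), $W\in{}_K^K\mathcal{YD}$, $V\in{}_H^H\mathcal{YD}$, $\beta : W\otimes V\to k$ is a linear form, and $\tau,\beta$ satisfy (C.1)–(C.2). For such a datum $\mathfrak{B}(\beta) : \mathfrak{B}(W)\otimes\mathfrak{B}(V)\to k$ is the unique linear form satisfying (B.1)–(B.4) and restricting to $\beta$ on $W\otimes V$, and $\mathfrak{B}(\beta)\#\tau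 : (\mathfrak{B}(W)\# K)\otimes(\mathfrak{B}(V)\# H)\to k$ is the form $(t\# k)\otimes(r\# h)\mapsto\mathfrak{B}(\beta)(t,S^{-1}(h_{(1)})\cdot r)\,\tau(k,h_{(2)})$.
   Formalization: "Φ is determined by" its values on 1#z_i and u_i#1 is proved as uniqueness on 𝔅(W)#k[⟨z_1,…,z_n⟩]; uniqueness on all of 𝔅(W)#k[Λ] fails in general when the z_i do not generate Λ (twist by a character of Λ trivial on all z_i). *)

theory Defs
  imports "HOL-Algebra.QuotRing" "HOL-Algebra.Module" "HOL-Library.Poly_Mapping" "HOL.Hull"
begin

section \<open>Vector spaces and linear forms\<close>

text \<open>
  The ground field is a type \<open>'k\<close> of class \<^class>\<open>field\<close>. Vector spaces and (noncommutative)
  algebras over it are \<open>module\<close> records of HOL-Algebra over \<open>base_field\<close>; for a mere vector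
  space the components \<^const>\<open>mult\<close> and \<^const>\<open>one\<close> of the record carry no meaning.
\<close>

definition base_field :: "('k::field, 'k) module" where
  "base_field = \<lparr>carrier = UNIV, mult = (*), one = 1, zero = 0, add = (+), smult = (*)\<rparr>"

abbreviation kspace :: "('k::field, 'a, 'e) module_scheme \<Rightarrow> bool" where
  "kspace M \<equiv> module (base_field :: ('k, 'k) module) M"

definition linear_map ::
  "('k::field, 'a, 'e) module_scheme \<Rightarrow> ('k, 'b, 'f) module_scheme \<Rightarrow> ('a \<Rightarrow> 'b) \<Rightarrow> bool" where
  "linear_map M N f \<longleftrightarrow> f \<in> carrier M \<rightarrow> carrier N
     \<and> (\<forall>x\<in>carrier M. \<forall>y\<in>carrier M. f (x \<oplus>\<^bsub>M\<^esub> y) = f x \<oplus>\<^bsub>N\<^esub> f y)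
     \<and> (\<forall>c. \<forall>x\<in>carrier M. f (c \<odot>\<^bsub>M\<^esub> x) = c \<odot>\<^bsub>N\<^esub> f x)"

definition kspan :: "('k::field, 'a, 'e) module_scheme \<Rightarrow> 'a set \<Rightarrow> 'a set" where
  "kspan M S = (\<lambda>N. submodule N (base_field :: ('k, 'k) module) M) hull S"

definition is_basis ::
  "('k::field, 'a, 'e) module_scheme \<Rightarrow> 'i set \<Rightarrow> ('i \<Rightarrow> 'a) \<Rightarrow> bool" where
  "is_basis M I b \<longleftrightarrow> finite I \<and> b \<in> I \<rightarrow> carrier M
     \<and> (\<forall>x\<in>carrier M. \<exists>!c. c \<in> extensional I \<and> x = (\<Oplus>\<^bsub>M\<^esub>i\<in>I. c i \<odot>\<^bsub>M\<^esub> b i))"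

text \<open>
  The elements of the dual space are \<^const>\<open>extensional\<close>, so that two linear forms are equal as
  functions iff they agree on the carrier.
\<close>

definition dual :: "('k::field, 'a, 'e) module_scheme \<Rightarrow> ('k, 'a \<Rightarrow> 'k) module" where
  "dual M = \<lparr>carrier = {p \<in> extensional (carrier M). linear_map M base_field p},
     mult = undefined, one = undefined,
     zero = (\<lambda>x\<in>carrier M. 0),
     add = (\<lambda>p q. \<lambda>x\<in>carrier M. p x + q x),
     smult = (\<lambda>c p. \<lambda>x\<in>carrier M. c * p x)\<rparr>"

text \<open>
  A linear form \<open>\<beta>\<close> on a tensor product \<open>U \<otimes> V\<close> is given as a curried bilinear form,
  \<open>\<beta> u v\<close> being \<open>\<beta>(u \<otimes> v)\<close>. Hence \<open>\<beta>\<close>, read as a function into linear forms,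
  is the map \<open>\<beta>\<^sub>\<ell> : U \<rightarrow> V\<^sup>*\<close>.
\<close>

definition bilinear_form ::
  "('k::field, 'a, 'e) module_scheme \<Rightarrow> ('k, 'b, 'f) module_scheme \<Rightarrow> ('a \<Rightarrow> 'b \<Rightarrow> 'k) \<Rightarrow> bool" where
  "bilinear_form U V \<beta> \<longleftrightarrow> \<beta> \<in> extensional (carrier U) \<and> linear_map U (dual V) \<beta>"


section \<open>Quotients and tensor products\<close>

text \<open>
  Quotient of a space by a subspace, or of an algebra by an ideal; this is
  \<^const>\<open>FactRing\<close> with a scalar multiplication.
\<close>

definition quot :: "('k::field, 'a, 'e) module_scheme \<Rightarrow> 'a set \<Rightarrow> ('k, 'a set) module" where
  "quot M N = \<lparr>carrier = a_rcosets\<^bsub>M\<^esub> N, mult = rcoset_mult M N, one = N +>\<^bsub>M\<^esub> \<one>\<^bsub>M\<^esub>,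
     zero = N, add = set_add M, smult = (\<lambda>c X. \<Union>x\<in>X. N +>\<^bsub>M\<^esub> (c \<odot>\<^bsub>M\<^esub> x))\<rparr>"

definition pm_scale :: "'k::field \<Rightarrow> ('a \<Rightarrow>\<^sub>0 'k) \<Rightarrow> ('a \<Rightarrow>\<^sub>0 'k)" where
  "pm_scale c x = Poly_Mapping.map ((*) c) x"

definition free_space :: "'a set \<Rightarrow> ('k::field, 'a \<Rightarrow>\<^sub>0 'k) module" where
  "free_space S = \<lparr>carrier = {x. Poly_Mapping.keys x \<subseteq> S}, mult = undefined, one = undefined,
     zero = 0, add = (+), smult = pm_scale\<rparr>"

type_synonym ('k, 'a, 'b) tens = "('a \<times> 'b \<Rightarrow>\<^sub>0 'k) set"

definition tensor_relators ::
  "('k::field, 'a, 'e) module_scheme \<Rightarrow> ('k, 'b, 'f) module_scheme \<Rightarrow> ('a \<times> 'b \<Rightarrow>\<^sub>0 'k) set" where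
  "tensor_relators M N = (let e = (\<lambda>x y. Poly_Mapping.single (x, y) (1::'k)) in
     {e (x \<oplus>\<^bsub>M\<^esub> x') y - e x y - e x' y | x x' y.
        x \<in> carrier M \<and> x' \<in> carrier M \<and> y \<in> carrier N}
   \<union> {e x (y \<oplus>\<^bsub>N\<^esub> y') - e x y - e x y' | x y y'.
        x \<in> carrier M \<and> y \<in> carrier N \<and> y' \<in> carrier N}
   \<union> {e (c \<odot>\<^bsub>M\<^esub> x) y - pm_scale c (e x y) | c x y. x \<in> carrier M \<and> y \<in> carrier N}
   \<union> {e x (c \<odot>\<^bsub>N\<^esub> y) - pm_scale c (e x y) | c x y. x \<in> carrier M \<and> y \<in> carrier N})"

definition tensor_null ::
  "('k::field, 'a, 'e) module_scheme \<Rightarrow> ('k, 'b, 'f) module_scheme \<Rightarrow> ('a \<times> 'b \<Rightarrow>\<^sub>0 'k) set" where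
  "tensor_null M N = kspan (free_space (carrier M \<times> carrier N)) (tensor_relators M N)"

definition tensor ::
  "('k::field, 'a, 'e) module_scheme \<Rightarrow> ('k, 'b, 'f) module_scheme \<Rightarrow> ('k, ('k, 'a, 'b) tens) module" where
  "tensor M N = quot (free_space (carrier M \<times> carrier N)) (tensor_null M N)"

definition tpure ::
  "('k::field, 'a, 'e) module_scheme \<Rightarrow> ('k, 'b, 'f) module_scheme \<Rightarrow> 'a \<Rightarrow> 'b \<Rightarrow> ('k, 'a, 'b) tens" where
  "tpure M N x y = tensor_null M N +>\<^bsub>free_space (carrier M \<times> carrier N)\<^esub> Poly_Mapping.single (x, y) 1"

text \<open>
  \<open>tlift X f\<close> is the linear map into \<open>X\<close> with \<open>x \<otimes> y \<mapsto> f x y\<close>, for bilinear \<open>f\<close>: it is evaluated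
  on any representative of the tensor. It renders the Sweedler notation:
  \<open>tlift X (\<lambda>a b. f a b) (\<Delta> c)\<close> is \<open>f(c\<^sub>1, c\<^sub>2)\<close>.
\<close>

definition tlift ::
  "('k::field, 'x, 'e) module_scheme \<Rightarrow> ('a \<Rightarrow> 'b \<Rightarrow> 'x) \<Rightarrow> ('k, 'a, 'b) tens \<Rightarrow> 'x" where
  "tlift X f t = (let r = (SOME r. r \<in> t) in
     \<Oplus>\<^bsub>X\<^esub>p\<in>Poly_Mapping.keys r. Poly_Mapping.lookup r p \<odot>\<^bsub>X\<^esub> f (fst p) (snd p))"

abbreviation teval :: "('a \<Rightarrow> 'b \<Rightarrow> 'k::field) \<Rightarrow> ('k, 'a, 'b) tens \<Rightarrow> 'k" where
  "teval \<equiv> tlift base_field"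


section \<open>Bialgebras and Hopf algebras\<close>

record (overloaded) ('k::zero, 'a) bialg = "('k, 'a) module" +
  comult :: "'a \<Rightarrow> ('a \<times> 'a \<Rightarrow>\<^sub>0 'k) set"
  counit :: "'a \<Rightarrow> 'k"

record (overloaded) ('k::zero, 'a) hopf = "('k, 'a) bialg" +
  antipode :: "'a \<Rightarrow> 'a"

definition k_algebra :: "('k::field, 'a, 'e) module_scheme \<Rightarrow> bool" where
  "k_algebra A \<longleftrightarrow> kspace A \<and> ring A
     \<and> (\<forall>c. \<forall>x\<in>carrier A. \<forall>y\<in>carrier A.
          c \<odot>\<^bsub>A\<^esub> (x \<otimes>\<^bsub>A\<^esub> y) = (c \<odot>\<^bsub>A\<^esub> x) \<otimes>\<^bsub>A\<^esub> y \<and> c \<odot>\<^bsub>A\<^esub> (x \<otimes>\<^bsub>A\<^esub> y) = x \<otimes>\<^bsub>A\<^esub> (c \<odot>\<^bsub>A\<^esub> y))"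

definition algebra_map ::
  "('k::field, 'a, 'e) module_scheme \<Rightarrow> ('k, 'b, 'f) module_scheme \<Rightarrow> ('a \<Rightarrow> 'b) \<Rightarrow> bool" where
  "algebra_map A B f \<longleftrightarrow> linear_map A B f \<and> f \<one>\<^bsub>A\<^esub> = \<one>\<^bsub>B\<^esub>
     \<and> (\<forall>x\<in>carrier A. \<forall>y\<in>carrier A. f (x \<otimes>\<^bsub>A\<^esub> y) = f x \<otimes>\<^bsub>B\<^esub> f y)"

definition tensor_mult ::
  "('k::field, 'a, 'e) module_scheme \<Rightarrow> ('k, 'b, 'f) module_scheme
     \<Rightarrow> ('k, 'a, 'b) tens \<Rightarrow> ('k, 'a, 'b) tens \<Rightarrow> ('k, 'a, 'b) tens" where
  "tensor_mult A B s t = tlift (tensor A B) (\<lambda>a b. tlift (tensor A B) (\<lambda>a' b'.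
     tpure A B (a \<otimes>\<^bsub>A\<^esub> a') (b \<otimes>\<^bsub>B\<^esub> b')) t) s"

definition coalgebra :: "('k::field, 'a, 'e) bialg_scheme \<Rightarrow> bool" where
  "coalgebra C \<longleftrightarrow> kspace C \<and> linear_map C (tensor C C) (comult C) \<and> linear_map C base_field (counit C)
     \<and> (\<forall>c\<in>carrier C.
          tlift (tensor C (tensor C C)) (\<lambda>a b. tlift (tensor C (tensor C C)) (\<lambda>a1 a2.
             tpure C (tensor C C) a1 (tpure C C a2 b)) (comult C a)) (comult C c)
          = tlift (tensor C (tensor C C)) (\<lambda>a b. tpure C (tensor C C) a (comult C b)) (comult C c)
        \<and> tlift C (\<lambda>a b. counit C a \<odot>\<^bsub>C\<^esub> b) (comult C c) = c
        \<and> tlift C (\<lambda>a b. counit C b \<odot>\<^bsub>C\<^esub> a) (comult C c) = c)"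

definition bialgebra :: "('k::field, 'a, 'e) bialg_scheme \<Rightarrow> bool" where
  "bialgebra A \<longleftrightarrow> k_algebra A \<and> coalgebra A \<and> algebra_map A base_field (counit A)
     \<and> comult A \<one>\<^bsub>A\<^esub> = tpure A A \<one>\<^bsub>A\<^esub> \<one>\<^bsub>A\<^esub>
     \<and> (\<forall>x\<in>carrier A. \<forall>y\<in>carrier A.
          comult A (x \<otimes>\<^bsub>A\<^esub> y) = tensor_mult A A (comult A x) (comult A y))"

definition hopf_algebra :: "('k::field, 'a, 'e) hopf_scheme \<Rightarrow> bool" where
  "hopf_algebra H \<longleftrightarrow> bialgebra H \<and> linear_map H H (antipode H)
     \<and> (\<forall>h\<in>carrier H.
          tlift H (\<lambda>a b. antipode H a \<otimes>\<^bsub>H\<^esub> b) (comult H h) = counit H h \<odot>\<^bsub>H\<^esub> \<one>\<^bsub>H\<^esub>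
        \<and> tlift H (\<lambda>a b. a \<otimes>\<^bsub>H\<^esub> antipode H b) (comult H h) = counit H h \<odot>\<^bsub>H\<^esub> \<one>\<^bsub>H\<^esub>)"

definition antipode_inv :: "('k::field, 'a, 'e) hopf_scheme \<Rightarrow> 'a \<Rightarrow> 'a" where
  "antipode_inv H = inv_into (carrier H) (antipode H)"

text \<open>
  A bialgebra map between Hopf algebras commutes with the antipodes automatically, so this is also
  the notion of a Hopf algebra map.
\<close>

definition bialgebra_map ::
  "('k::field, 'a, 'e) bialg_scheme \<Rightarrow> ('k, 'b, 'f) bialg_scheme \<Rightarrow> ('a \<Rightarrow> 'b) \<Rightarrow> bool" where
  "bialgebra_map A B f \<longleftrightarrow> algebra_map A B f
     \<and> (\<forall>x\<in>carrier A. comult B (f x) = tlift (tensor B B) (\<lambda>a b. tpure B B (f a) (f b)) (comult A x)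
          \<and> counit B (f x) = counit A x)"

definition cop :: "('k::field, 'a) bialg \<Rightarrow> ('k, 'a) bialg" where
  "cop A = A\<lparr>comult := \<lambda>x. tlift (tensor A A) (\<lambda>a b. tpure A A b a) (comult A x)\<rparr>"

text \<open>The group algebra of an abelian group, which is written additively.\<close>

definition group_algebra :: "('k::field, 'g::ab_group_add \<Rightarrow>\<^sub>0 'k) hopf" where
  "group_algebra = (let A = \<lparr>carrier = UNIV, mult = (*), one = 1, zero = 0, add = (+), smult = pm_scale\<rparr>;
       e = (\<lambda>g. Poly_Mapping.single g (1::'k)) in
     \<lparr>carrier = UNIV, mult = (*), one = 1, zero = 0, add = (+), smult = pm_scale,
      comult = (\<lambda>x. \<Oplus>\<^bsub>tensor A A\<^esub>g\<in>Poly_Mapping.keys x.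
                   Poly_Mapping.lookup x g \<odot>\<^bsub>tensor A A\<^esub> tpure A A (e g) (e g)),
      counit = (\<lambda>x. \<Sum>g\<in>Poly_Mapping.keys x. Poly_Mapping.lookup x g),
      antipode = (\<lambda>x. \<Sum>g\<in>Poly_Mapping.keys x. pm_scale (Poly_Mapping.lookup x g) (e (- g)))\<rparr>)"

definition gelt :: "'g \<Rightarrow> ('g \<Rightarrow>\<^sub>0 'k::field)" where
  "gelt g = Poly_Mapping.single g 1"

text \<open>Since \<open>\<chi> 0 = 1\<close>, the values of a character are nonzero.\<close>

definition characters :: "('g::ab_group_add \<Rightarrow> 'k::field) set" where
  "characters = {\<chi>. \<chi> 0 = 1 \<and> (\<forall>g h. \<chi> (g + h) = \<chi> g * \<chi> h)}"

definition is_subgroup :: "'g::ab_group_add set \<Rightarrow> bool" where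
  "is_subgroup H \<longleftrightarrow> 0 \<in> H \<and> (\<forall>x\<in>H. \<forall>y\<in>H. x - y \<in> H)"


section \<open>The finite dual\<close>

definition convolution ::
  "('k::field, 'a, 'e) bialg_scheme \<Rightarrow> ('a \<Rightarrow> 'k) \<Rightarrow> ('a \<Rightarrow> 'k) \<Rightarrow> ('a \<Rightarrow> 'k)" where
  "convolution A p q = (\<lambda>x\<in>carrier A. teval (\<lambda>a b. p a * q b) (comult A x))"

definition finite_codim :: "('k::field, 'a, 'e) module_scheme \<Rightarrow> 'a set \<Rightarrow> bool" where
  "finite_codim A I \<longleftrightarrow> (\<exists>B. finite B \<and> B \<subseteq> carrier A
     \<and> (\<forall>x\<in>carrier A. \<exists>c. x \<ominus>\<^bsub>A\<^esub> (\<Oplus>\<^bsub>A\<^esub>b\<in>B. c b \<odot>\<^bsub>A\<^esub> b) \<in> I))"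

definition finite_dual_algebra :: "('k::field, 'a, 'e) bialg_scheme \<Rightarrow> ('k, 'a \<Rightarrow> 'k) module" where
  "finite_dual_algebra A = (dual A)
     \<lparr>carrier := {p \<in> carrier (dual A). \<exists>I. ideal I A \<and> finite_codim A I \<and> (\<forall>x\<in>I. p x = 0)},
      mult := convolution A,
      one := (\<lambda>x\<in>carrier A. counit A x)\<rparr>"

text \<open>The coproduct is dual to the product: \<open>\<Delta>(p)\<close> is determined by \<open>p(xy) = p\<^sub>1(x) p\<^sub>2(y)\<close>.\<close>

definition finite_dual :: "('k::field, 'a, 'e) bialg_scheme \<Rightarrow> ('k, 'a \<Rightarrow> 'k) bialg" where
  "finite_dual A = (let D = finite_dual_algebra A in module.extend D (bialg.fields
     (\<lambda>p. THE t. t \<in> carrier (tensor D D) \<and>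
        (\<forall>x\<in>carrier A. \<forall>y\<in>carrier A. teval (\<lambda>p1 p2. p1 x * p2 y) t = p (x \<otimes>\<^bsub>A\<^esub> y)))
     (\<lambda>p. p \<one>\<^bsub>A\<^esub>)))"


section \<open>Yetter--Drinfel'd modules\<close>

record (overloaded) ('k::zero, 'h, 'm) ydmod = "('k, 'm) module" +
  act :: "'h \<Rightarrow> 'm \<Rightarrow> 'm"
  coact :: "'m \<Rightarrow> ('h \<times> 'm \<Rightarrow>\<^sub>0 'k) set"

record (overloaded) ('k::zero, 'h, 'm) ydbialg = "('k, 'h, 'm) ydmod" +
  bcomult :: "'m \<Rightarrow> ('m \<times> 'm \<Rightarrow>\<^sub>0 'k) set"
  bcounit :: "'m \<Rightarrow> 'k"

definition left_module ::
  "('k::field, 'h, 'e) bialg_scheme \<Rightarrow> ('k, 'h, 'm, 'f) ydmod_scheme \<Rightarrow> bool" where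
  "left_module H M \<longleftrightarrow> kspace M
     \<and> (\<forall>h\<in>carrier H. linear_map M M (act M h))
     \<and> (\<forall>m\<in>carrier M. linear_map H M (\<lambda>h. act M h m))
     \<and> (\<forall>m\<in>carrier M. act M \<one>\<^bsub>H\<^esub> m = m)
     \<and> (\<forall>h\<in>carrier H. \<forall>h'\<in>carrier H. \<forall>m\<in>carrier M. act M (h \<otimes>\<^bsub>H\<^esub> h') m = act M h (act M h' m))"

definition left_comodule ::
  "('k::field, 'h, 'e) bialg_scheme \<Rightarrow> ('k, 'h, 'm, 'f) ydmod_scheme \<Rightarrow> bool" where
  "left_comodule H M \<longleftrightarrow> kspace M \<and> linear_map M (tensor H M) (coact M)
     \<and> (\<forall>m\<in>carrier M.
          tlift (tensor H (tensor H M)) (\<lambda>h x. tlift (tensor H (tensor H M)) (\<lambda>h1 h2.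
             tpure H (tensor H M) h1 (tpure H M h2 x)) (comult H h)) (coact M m)
          = tlift (tensor H (tensor H M)) (\<lambda>h x. tpure H (tensor H M) h (coact M x)) (coact M m)
        \<and> tlift M (\<lambda>h x. counit H h \<odot>\<^bsub>M\<^esub> x) (coact M m) = m)"

definition yd_module ::
  "('k::field, 'h, 'e) bialg_scheme \<Rightarrow> ('k, 'h, 'm, 'f) ydmod_scheme \<Rightarrow> bool" where
  "yd_module H M \<longleftrightarrow> left_module H M \<and> left_comodule H M
     \<and> (\<forall>h\<in>carrier H. \<forall>m\<in>carrier M.
          tlift (tensor H M) (\<lambda>h1 h2. tlift (tensor H M) (\<lambda>x y.
             tpure H M (h1 \<otimes>\<^bsub>H\<^esub> x) (act M h2 y)) (coact M m)) (comult H h)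
          = tlift (tensor H M) (\<lambda>h1 h2. tlift (tensor H M) (\<lambda>x y.
             tpure H M (x \<otimes>\<^bsub>H\<^esub> h2) y) (coact M (act M h1 m))) (comult H h))"

text \<open>The homogeneous component \<open>M\<^sub>g\<^sup>\<chi>\<close> of a Yetter--Drinfel'd module over a group algebra.\<close>

definition yd_component ::
  "('k::field, 'g::ab_group_add \<Rightarrow>\<^sub>0 'k, 'm, 'f) ydmod_scheme \<Rightarrow> 'g \<Rightarrow> ('g \<Rightarrow> 'k) \<Rightarrow> 'm set" where
  "yd_component M g \<chi> = {v \<in> carrier M. coact M v = tpure group_algebra M (gelt g) v
     \<and> (\<forall>h. act M (gelt h) v = \<chi> h \<odot>\<^bsub>M\<^esub> v)}"

text \<open>\<open>x \<leftharpoonup> p = p(x\<^sub>-\<^sub>1) x\<^sub>0\<close>\<close>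

definition ract :: "('k::field, 'h, 'm, 'f) ydmod_scheme \<Rightarrow> 'm \<Rightarrow> ('h \<Rightarrow> 'k) \<Rightarrow> 'm" where
  "ract M x p = tlift M (\<lambda>h y. p h \<odot>\<^bsub>M\<^esub> y) (coact M x)"

text \<open>The product \<open>(a \<otimes> b)(a' \<otimes> b') = a(b\<^sub>-\<^sub>1 \<cdot> a') \<otimes> b\<^sub>0 b'\<close> of the braided tensor square.\<close>

definition braided_mult ::
  "('k::field, 'h, 'm, 'f) ydmod_scheme
     \<Rightarrow> ('k, 'm, 'm) tens \<Rightarrow> ('k, 'm, 'm) tens \<Rightarrow> ('k, 'm, 'm) tens" where
  "braided_mult R s t = tlift (tensor R R) (\<lambda>a b. tlift (tensor R R) (\<lambda>a' b'. tlift (tensor R R)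
     (\<lambda>h b0. tpure R R (a \<otimes>\<^bsub>R\<^esub> act R h a') (b0 \<otimes>\<^bsub>R\<^esub> b')) (coact R b)) t) s"

definition biproduct ::
  "('k::field, 'h, 'r, 'f) ydbialg_scheme \<Rightarrow> ('k, 'h, 'e) bialg_scheme
     \<Rightarrow> ('k, ('k, 'r, 'h) tens) bialg" where
  "biproduct R H = (let B = tensor R H; BB = tensor B B in module.extend
     (B\<lparr>mult := \<lambda>x y. tlift B (\<lambda>r h. tlift B (\<lambda>r' h'. tlift B (\<lambda>h1 h2.
            tpure R H (r \<otimes>\<^bsub>R\<^esub> act R h1 r') (h2 \<otimes>\<^bsub>H\<^esub> h')) (comult H h)) y) x,
        one := tpure R H \<one>\<^bsub>R\<^esub> \<one>\<^bsub>H\<^esub>\<rparr>)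
     (bialg.fields
        (\<lambda>x. tlift BB (\<lambda>r h. tlift BB (\<lambda>r1 r2. tlift BB (\<lambda>l r0. tlift BB (\<lambda>h1 h2.
            tpure B B (tpure R H r1 (l \<otimes>\<^bsub>H\<^esub> h1)) (tpure R H r0 h2))
            (comult H h)) (coact R r2)) (bcomult R r)) x)
        (teval (\<lambda>r h. bcounit R r * counit H h))))"


section \<open>Tensor algebra and Nichols algebra\<close>

definition free_algebra :: "'a set \<Rightarrow> ('k::field, 'a list \<Rightarrow>\<^sub>0 'k) module" where
  "free_algebra S = (free_space (lists S))
     \<lparr>mult := \<lambda>x y. \<Sum>u\<in>Poly_Mapping.keys x. \<Sum>v\<in>Poly_Mapping.keys y.
        Poly_Mapping.single (u @ v) (Poly_Mapping.lookup x u * Poly_Mapping.lookup y v),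
      one := Poly_Mapping.single [] 1\<rparr>"

text \<open>
  \<open>T(M)\<close> is the free algebra on the letters \<open>[m]\<close>, \<open>m \<in> M\<close>, modulo the relations that make
  \<open>m \<mapsto> [m]\<close> linear.
\<close>

definition talg_null :: "('k::field, 'm, 'e) module_scheme \<Rightarrow> ('m list \<Rightarrow>\<^sub>0 'k) set" where
  "talg_null M = (let e = (\<lambda>x. Poly_Mapping.single [x] (1::'k)) in Idl\<^bsub>free_algebra (carrier M)\<^esub>
     ({e (x \<oplus>\<^bsub>M\<^esub> y) - e x - e y | x y. x \<in> carrier M \<and> y \<in> carrier M}
    \<union> {e (c \<odot>\<^bsub>M\<^esub> x) - pm_scale c (e x) | c x. x \<in> carrier M}))"

definition talg :: "('k::field, 'm, 'e) module_scheme \<Rightarrow> ('k, ('m list \<Rightarrow>\<^sub>0 'k) set) module" where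
  "talg M = quot (free_algebra (carrier M)) (talg_null M)"

definition tword :: "('k::field, 'm, 'e) module_scheme \<Rightarrow> 'm list \<Rightarrow> ('m list \<Rightarrow>\<^sub>0 'k) set" where
  "tword M w = talg_null M +>\<^bsub>free_algebra (carrier M)\<^esub> Poly_Mapping.single w 1"

text \<open>
  \<open>wlift X f\<close> is the linear map \<open>T(M) \<rightarrow> X\<close> with values \<open>f w\<close> on words \<open>w\<close>, for \<open>f\<close>
  multilinear in the letters.
\<close>

definition wlift ::
  "('k::field, 'x, 'e) module_scheme \<Rightarrow> ('m list \<Rightarrow> 'x) \<Rightarrow> ('m list \<Rightarrow>\<^sub>0 'k) set \<Rightarrow> 'x" where
  "wlift X f t = (let r = (SOME r. r \<in> t) in
     \<Oplus>\<^bsub>X\<^esub>w\<in>Poly_Mapping.keys r. Poly_Mapping.lookup r w \<odot>\<^bsub>X\<^esub> f w)"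

primrec word_act ::
  "('k::field, 'h, 'e) bialg_scheme \<Rightarrow> ('k, 'h, 'm, 'f) ydmod_scheme
     \<Rightarrow> 'm list \<Rightarrow> 'h \<Rightarrow> ('m list \<Rightarrow>\<^sub>0 'k) set" where
  "word_act H M [] = (\<lambda>h. counit H h \<odot>\<^bsub>talg M\<^esub> \<one>\<^bsub>talg M\<^esub>)"
| "word_act H M (m # w) = (\<lambda>h. tlift (talg M) (\<lambda>h1 h2.
     tword M [act M h1 m] \<otimes>\<^bsub>talg M\<^esub> word_act H M w h2) (comult H h))"

text \<open>The codiagonal coaction makes \<open>T(M) \<rightarrow> H \<otimes> T(M)\<close> an algebra map.\<close>

primrec word_coact ::
  "('k::field, 'h, 'e) bialg_scheme \<Rightarrow> ('k, 'h, 'm, 'f) ydmod_scheme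
     \<Rightarrow> 'm list \<Rightarrow> ('k, 'h, ('m list \<Rightarrow>\<^sub>0 'k) set) tens" where
  "word_coact H M [] = tpure H (talg M) \<one>\<^bsub>H\<^esub> \<one>\<^bsub>talg M\<^esub>"
| "word_coact H M (m # w) = tensor_mult H (talg M)
     (tlift (tensor H (talg M)) (\<lambda>h x. tpure H (talg M) h (tword M [x])) (coact M m))
     (word_coact H M w)"

definition talg_yd ::
  "('k::field, 'h, 'e) bialg_scheme \<Rightarrow> ('k, 'h, 'm, 'f) ydmod_scheme
     \<Rightarrow> ('k, 'h, ('m list \<Rightarrow>\<^sub>0 'k) set) ydmod" where
  "talg_yd H M = module.extend (talg M) (ydmod.fields
     (\<lambda>h. wlift (talg M) (\<lambda>w. word_act H M w h))
     (wlift (tensor H (talg M)) (word_coact H M)))"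

text \<open>The coproduct is the algebra map into the braided tensor square for which \<open>M\<close> is primitive.\<close>

primrec word_comult ::
  "('k::field, 'h, 'e) bialg_scheme \<Rightarrow> ('k, 'h, 'm, 'f) ydmod_scheme
     \<Rightarrow> 'm list \<Rightarrow> ('k, ('m list \<Rightarrow>\<^sub>0 'k) set, ('m list \<Rightarrow>\<^sub>0 'k) set) tens" where
  "word_comult H M [] = tpure (talg M) (talg M) \<one>\<^bsub>talg M\<^esub> \<one>\<^bsub>talg M\<^esub>"
| "word_comult H M (m # w) = braided_mult (talg_yd H M)
     (tpure (talg M) (talg M) (tword M [m]) \<one>\<^bsub>talg M\<^esub>
       \<oplus>\<^bsub>tensor (talg M) (talg M)\<^esub> tpure (talg M) (talg M) \<one>\<^bsub>talg M\<^esub> (tword M [m]))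
     (word_comult H M w)"

definition tensor_algebra ::
  "('k::field, 'h, 'e) bialg_scheme \<Rightarrow> ('k, 'h, 'm, 'f) ydmod_scheme
     \<Rightarrow> ('k, 'h, ('m list \<Rightarrow>\<^sub>0 'k) set) ydbialg" where
  "tensor_algebra H M = ydmod.extend (talg_yd H M) (ydbialg.fields
     (wlift (tensor (talg M) (talg M)) (word_comult H M))
     (wlift base_field (\<lambda>w. if w = [] then 1 else 0)))"

definition homogeneous_part ::
  "('k::field, 'm, 'e) module_scheme \<Rightarrow> nat \<Rightarrow> ('m list \<Rightarrow>\<^sub>0 'k) set \<Rightarrow> ('m list \<Rightarrow>\<^sub>0 'k) set" where
  "homogeneous_part M n = wlift (talg M) (\<lambda>w. if length w = n then tword M w else \<zero>\<^bsub>talg M\<^esub>)"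

definition yd_subobject ::
  "('k::field, 'h, 'e) bialg_scheme \<Rightarrow> ('k, 'h, 'm, 'f) ydmod_scheme \<Rightarrow> 'm set \<Rightarrow> bool" where
  "yd_subobject H M I \<longleftrightarrow> submodule I (base_field :: ('k, 'k) module) M
     \<and> (\<forall>h\<in>carrier H. \<forall>x\<in>I. act M h x \<in> I)
     \<and> (\<forall>x\<in>I. coact M x \<in> kspan (tensor H M) {tpure H M h y | h y. h \<in> carrier H \<and> y \<in> I})"

definition yd_coideal :: "('k::field, 'h, 'm, 'f) ydbialg_scheme \<Rightarrow> 'm set \<Rightarrow> bool" where
  "yd_coideal R I \<longleftrightarrow> (\<forall>x\<in>I. bcounit R x = 0 \<and>
     bcomult R x \<in> kspan (tensor R R)
       ({tpure R R a b | a b. a \<in> I \<and> b \<in> carrier R} \<union> {tpure R R a b | a b. a \<in> carrier R \<and> b \<in> I}))"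

text \<open>
  The greatest graded Yetter--Drinfel'd subobject of \<open>T(M)\<close> that is a coideal and meets \<open>M\<close>
  trivially. Such subobjects are closed under sums, so maximal and greatest coincide.
\<close>

definition nichols_ideal ::
  "('k::field, 'h, 'e) bialg_scheme \<Rightarrow> ('k, 'h, 'm, 'f) ydmod_scheme
     \<Rightarrow> ('m list \<Rightarrow>\<^sub>0 'k) set set" where
  "nichols_ideal H M = (GREATEST I. yd_subobject H (tensor_algebra H M) I
     \<and> (\<forall>n. \<forall>x\<in>I. homogeneous_part M n x \<in> I)
     \<and> yd_coideal (tensor_algebra H M) I
     \<and> I \<inter> (\<lambda>m. tword M [m]) ` carrier M = {\<zero>\<^bsub>talg M\<^esub>})"

definition yd_quot ::
  "('k::field, 'h, 'e) bialg_scheme \<Rightarrow> ('k, 'h, 'm, 'f) ydbialg_scheme \<Rightarrow> 'm set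
     \<Rightarrow> ('k, 'h, 'm set) ydbialg" where
  "yd_quot H R I = (let Q = quot R I; p = (\<lambda>x. I +>\<^bsub>R\<^esub> x); rep = (\<lambda>X. SOME x. x \<in> X) in
     ydmod.extend (module.extend Q (ydmod.fields
        (\<lambda>h X. p (act R h (rep X)))
        (\<lambda>X. tlift (tensor H Q) (\<lambda>h x. tpure H Q h (p x)) (coact R (rep X)))))
     (ydbialg.fields
        (\<lambda>X. tlift (tensor Q Q) (\<lambda>x y. tpure Q Q (p x) (p y)) (bcomult R (rep X)))
        (\<lambda>X. bcounit R (rep X))))"

definition nichols ::
  "('k::field, 'h, 'e) bialg_scheme \<Rightarrow> ('k, 'h, 'm, 'f) ydmod_scheme
     \<Rightarrow> ('k, 'h, ('m list \<Rightarrow>\<^sub>0 'k) set set) ydbialg" where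
  "nichols H M = yd_quot H (tensor_algebra H M) (nichols_ideal H M)"

definition nichols_incl ::
  "('k::field, 'h, 'e) bialg_scheme \<Rightarrow> ('k, 'h, 'm, 'f) ydmod_scheme
     \<Rightarrow> 'm \<Rightarrow> ('m list \<Rightarrow>\<^sub>0 'k) set set" where
  "nichols_incl H M m = nichols_ideal H M +>\<^bsub>talg M\<^esub> tword M [m]"


section \<open>Twist data\<close>

definition cond_A ::
  "('k::field, 'u, 'e) bialg_scheme \<Rightarrow> ('k, 'a, 'f) bialg_scheme \<Rightarrow> ('u \<Rightarrow> 'a \<Rightarrow> 'k) \<Rightarrow> bool" where
  "cond_A U A \<tau> \<longleftrightarrow>
     (\<forall>u\<in>carrier U. \<forall>a\<in>carrier A. \<forall>a'\<in>carrier A.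
        \<tau> u (a \<otimes>\<^bsub>A\<^esub> a') = teval (\<lambda>u1 u2. \<tau> u2 a * \<tau> u1 a') (comult U u))
   \<and> (\<forall>a\<in>carrier A. \<tau> \<one>\<^bsub>U\<^esub> a = counit A a)
   \<and> (\<forall>u\<in>carrier U. \<forall>u'\<in>carrier U. \<forall>a\<in>carrier A.
        \<tau> (u \<otimes>\<^bsub>U\<^esub> u') a = teval (\<lambda>a1 a2. \<tau> u a1 * \<tau> u' a2) (comult A a))
   \<and> (\<forall>u\<in>carrier U. \<tau> u \<one>\<^bsub>A\<^esub> = counit U u)"

definition cond_B ::
  "('k::field, 'h, 'e) hopf_scheme \<Rightarrow> ('k, 'l, 't, 'f) ydbialg_scheme
     \<Rightarrow> ('k, 'h, 'r, 'd) ydbialg_scheme \<Rightarrow> ('t \<Rightarrow> 'r \<Rightarrow> 'k) \<Rightarrow> bool" where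
  "cond_B H T R \<beta> \<longleftrightarrow>
     (\<forall>t\<in>carrier T. \<forall>t'\<in>carrier T. \<forall>r\<in>carrier R.
        \<beta> (t \<otimes>\<^bsub>T\<^esub> t') r = teval (\<lambda>r1 r2. teval (\<lambda>h r0.
           \<beta> t (act R (antipode_inv H h) r1) * \<beta> t' r0) (coact R r2)) (bcomult R r))
   \<and> (\<forall>r\<in>carrier R. \<beta> \<one>\<^bsub>T\<^esub> r = bcounit R r)
   \<and> (\<forall>t\<in>carrier T. \<forall>r\<in>carrier R. \<forall>r'\<in>carrier R.
        \<beta> t (r \<otimes>\<^bsub>R\<^esub> r') = teval (\<lambda>t1 t2. \<beta> t2 r * \<beta> t1 r') (bcomult T t))
   \<and> (\<forall>t\<in>carrier T. \<beta> t \<one>\<^bsub>R\<^esub> = bcounit T t)"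

definition cond_C ::
  "('k::field, 'l, 'e) hopf_scheme \<Rightarrow> ('k, 'h, 'f) hopf_scheme \<Rightarrow> ('l \<Rightarrow> 'h \<Rightarrow> 'k)
     \<Rightarrow> ('k, 'l, 'w, 'c) ydmod_scheme \<Rightarrow> ('k, 'h, 'v, 'd) ydmod_scheme \<Rightarrow> ('w \<Rightarrow> 'v \<Rightarrow> 'k) \<Rightarrow> bool" where
  "cond_C K H \<tau> W V \<beta> \<longleftrightarrow>
     (\<forall>l\<in>carrier K. \<forall>w\<in>carrier W. \<forall>v\<in>carrier V. \<beta> (act W l w) v = \<beta> w (ract V v (\<lambda>h. \<tau> l h)))
   \<and> (\<forall>h\<in>carrier H. \<forall>w\<in>carrier W. \<forall>v\<in>carrier V.
        \<beta> (ract W w (\<lambda>l. \<tau> l h)) v = \<beta> w (act V (antipode_inv H h) v))"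

definition twist_datum ::
  "('k::field, 'l, 'e) hopf_scheme \<Rightarrow> ('k, 'h, 'f) hopf_scheme \<Rightarrow> ('l \<Rightarrow> 'h \<Rightarrow> 'k)
     \<Rightarrow> ('k, 'l, 'w, 'c) ydmod_scheme \<Rightarrow> ('k, 'h, 'v, 'd) ydmod_scheme \<Rightarrow> ('w \<Rightarrow> 'v \<Rightarrow> 'k) \<Rightarrow> bool" where
  "twist_datum K H \<tau> W V \<beta> \<longleftrightarrow>
     hopf_algebra K \<and> bij_betw (antipode K) (carrier K) (carrier K)
   \<and> hopf_algebra H \<and> bij_betw (antipode H) (carrier H) (carrier H)
   \<and> bilinear_form K H \<tau> \<and> cond_A K H \<tau>
   \<and> yd_module K W \<and> yd_module H V
   \<and> bilinear_form W V \<beta> \<and> cond_C K H \<tau> W V \<beta>"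

definition nichols_form ::
  "('k::field, 'l, 'e) hopf_scheme \<Rightarrow> ('k, 'h, 'f) hopf_scheme
     \<Rightarrow> ('k, 'l, 'w, 'c) ydmod_scheme \<Rightarrow> ('k, 'h, 'v, 'd) ydmod_scheme \<Rightarrow> ('w \<Rightarrow> 'v \<Rightarrow> 'k)
     \<Rightarrow> ('w list \<Rightarrow>\<^sub>0 'k) set set \<Rightarrow> ('v list \<Rightarrow>\<^sub>0 'k) set set \<Rightarrow> 'k" where
  "nichols_form K H W V \<beta> = (THE B. bilinear_form (nichols K W) (nichols H V) B
     \<and> cond_B H (nichols K W) (nichols H V) B
     \<and> (\<forall>w\<in>carrier W. \<forall>v\<in>carrier V. B (nichols_incl K W w) (nichols_incl H V v) = \<beta> w v))"

definition biproduct_form ::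
  "('k::field, 'l, 'e) hopf_scheme \<Rightarrow> ('k, 'h, 'f) hopf_scheme
     \<Rightarrow> ('k, 'l, 't, 'c) ydbialg_scheme \<Rightarrow> ('k, 'h, 'r, 'd) ydbialg_scheme
     \<Rightarrow> ('t \<Rightarrow> 'r \<Rightarrow> 'k) \<Rightarrow> ('l \<Rightarrow> 'h \<Rightarrow> 'k)
     \<Rightarrow> ('k, 't, 'l) tens \<Rightarrow> ('k, 'r, 'h) tens \<Rightarrow> 'k" where
  "biproduct_form K H T R \<beta> \<tau> =
     (\<lambda>x\<in>carrier (biproduct T K). \<lambda>y\<in>carrier (biproduct R H).
        teval (\<lambda>t l. teval (\<lambda>r h. teval (\<lambda>h1 h2.
          \<beta> t (act R (antipode_inv H h1) r) * \<tau> l h2) (comult H h)) y) x)"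

definition derivation ::
  "('k::field, 'a, 'e) module_scheme \<Rightarrow> ('a \<Rightarrow> 'k) \<Rightarrow> ('a \<Rightarrow> 'k) \<Rightarrow> ('a \<Rightarrow> 'k) \<Rightarrow> bool" where
  "derivation A \<epsilon> \<gamma> d \<longleftrightarrow> d \<in> carrier (dual A)
     \<and> (\<forall>x\<in>carrier A. \<forall>y\<in>carrier A. d (x \<otimes>\<^bsub>A\<^esub> y) = \<epsilon> x * d y + d x * \<gamma> y)"

end

theory Submission
  imports Defs
begin

text \<open>
  Words in the given bases span both Nichols algebras, and the braiding is diagonal on them, so the braided
  coproduct of a word is an explicit sum over its splittings into complementary subwords. The pairing of two
  words is forced by (B.3) and by \<open>\<beta>\<close>: each letter of the right word removes a letter of the left word by
  a skew derivation. This pairing satisfies (B.1)--(B.4). It descends to the Nichols algebras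
  because in either argument it is an iterate of skew derivations that preserve the maximal coideal, which meets
  the words of length one trivially. The hypotheses on \<open>\<phi>\<close>, \<open>\<chi>\<close>, \<open>\<eta>\<close> make every nonzero pairing compatible with
  degrees and characters, and this turns (B.1)--(B.4) into (A.1)--(A.4) for the biproducts.

  By (A.1), \<open>\<Phi>(x)\<close> of a product of two elements is a finite sum of products of linear forms, so \<open>\<Phi>(x)\<close> lies in
  the finite dual. Since \<open>\<Delta>(u\<^sub>i # 1) = (u\<^sub>i # 1) \<otimes> (1 # 1) + (1 # z\<^sub>i) \<otimes> (u\<^sub>i # 1)\<close>, the same
  identity makes \<open>\<Phi>(1 # z\<^sub>i)\<close> a character and \<open>\<Phi>(u\<^sub>i # 1)\<close> a skew derivation, and both are determined
  by their values on generators.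
\<close>

section \<open>Linear maps and spans\<close>

text \<open>The Nichols ideal is known only as the greatest graded coideal subobject that meets the
  letters in 0. That it is an ideal has to be extracted from maximality, and words need not stay
  linearly independent in the quotient. Hence the pairing is set up on the tensor algebras, where
  words in the bases are independent, and pushed down afterwards. The two arguments behave
  differently: the pairing recurs along the right word, so vanishing on the ideal on the left is a
  direct induction, while the right side needs the factorisation (B.1) first. That factorisation is
  the crux: a letter of the left word that crosses other letters costs a value of \<eta>, and only
  next to a nonvanishing pairing can it be exchanged for the value of \<chi> that (B.1) demands. In
  the finite dual the coproduct is a definite description, so evaluation of tensors must be shown to
  be injective. Finally, the given values of an algebra map concern only the group elements
  \<open>z i\<close>; differences of these are reached because convolution with a character can be
  cancelled.\<close>

lemma base_field_simps [simp]:
  "carrier (base_field :: ('k::field, 'k) module) = UNIV"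
  "x \<otimes>\<^bsub>base_field :: ('k::field, 'k) module\<^esub> y = x * y"
  "\<one>\<^bsub>base_field :: ('k::field, 'k) module\<^esub> = 1"
  "\<zero>\<^bsub>base_field :: ('k::field, 'k) module\<^esub> = 0"
  "x \<oplus>\<^bsub>base_field :: ('k::field, 'k) module\<^esub> y = x + y"
  "x \<odot>\<^bsub>base_field :: ('k::field, 'k) module\<^esub> y = x * y"
  by (simp_all add: base_field_def)

lemma cring_base_field: "cring (base_field :: ('k::field, 'k) module)"
proof (rule cringI)
  show "abelian_group (base_field :: ('k::field, 'k) module)"
  proof (rule abelian_groupI)
    fix x :: 'k
    show "\<exists>y\<in>carrier base_field. y \<oplus>\<^bsub>base_field\<^esub> x = \<zero>\<^bsub>base_field\<^esub>"
      by (rule bexI[of _ "- x"]) auto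
  qed (auto simp: algebra_simps)
  show "Group.comm_monoid (base_field :: ('k::field, 'k) module)"
    by (rule comm_monoidI) auto
qed (auto simp: algebra_simps)

lemma kspaceI:
  fixes M :: "('k::field, 'a, 'e) module_scheme"
  assumes "abelian_group M"
    and "\<And>c x. x \<in> carrier M \<Longrightarrow> c \<odot>\<^bsub>M\<^esub> x \<in> carrier M"
    and "\<And>c d x. x \<in> carrier M \<Longrightarrow> (c + d) \<odot>\<^bsub>M\<^esub> x = c \<odot>\<^bsub>M\<^esub> x \<oplus>\<^bsub>M\<^esub> d \<odot>\<^bsub>M\<^esub> x"
    and "\<And>c x y. x \<in> carrier M \<Longrightarrow> y \<in> carrier M \<Longrightarrow>
      c \<odot>\<^bsub>M\<^esub> (x \<oplus>\<^bsub>M\<^esub> y) = c \<odot>\<^bsub>M\<^esub> x \<oplus>\<^bsub>M\<^esub> c \<odot>\<^bsub>M\<^esub> y"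
    and "\<And>c d x. x \<in> carrier M \<Longrightarrow> (c * d) \<odot>\<^bsub>M\<^esub> x = c \<odot>\<^bsub>M\<^esub> (d \<odot>\<^bsub>M\<^esub> x)"
    and "\<And>x. x \<in> carrier M \<Longrightarrow> 1 \<odot>\<^bsub>M\<^esub> x = x"
  shows "kspace M"
  by (rule moduleI) (use assms cring_base_field in auto)

lemma kspace_base_field: "kspace (base_field :: ('k::field, 'k) module)"
  by (rule kspaceI) (auto simp: algebra_simps cring.axioms(1)[OF cring_base_field, THEN ring.is_abelian_group])

lemma kspace_abelian_group: "kspace M \<Longrightarrow> abelian_group M"
  by (simp add: module_def)

context
  fixes M :: "('k::field, 'a, 'e) module_scheme"
  assumes kM: "kspace M"
begin

interpretation M: module "base_field :: ('k, 'k) module" M by (fact kM)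

lemma ks_zero: "\<zero>\<^bsub>M\<^esub> \<in> carrier M" by simp
lemma ks_add: "x \<in> carrier M \<Longrightarrow> y \<in> carrier M \<Longrightarrow> x \<oplus>\<^bsub>M\<^esub> y \<in> carrier M" by simp
lemma ks_minus: "x \<in> carrier M \<Longrightarrow> y \<in> carrier M \<Longrightarrow> x \<ominus>\<^bsub>M\<^esub> y \<in> carrier M" by simp
lemma ks_uminus: "x \<in> carrier M \<Longrightarrow> \<ominus>\<^bsub>M\<^esub> x \<in> carrier M" by simp
lemma ks_smul: "x \<in> carrier M \<Longrightarrow> c \<odot>\<^bsub>M\<^esub> x \<in> carrier M" by (simp add: M.smult_closed)
lemma ks_add_zero: "x \<in> carrier M \<Longrightarrow> x \<oplus>\<^bsub>M\<^esub> \<zero>\<^bsub>M\<^esub> = x" by simp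
lemma ks_zero_add: "x \<in> carrier M \<Longrightarrow> \<zero>\<^bsub>M\<^esub> \<oplus>\<^bsub>M\<^esub> x = x" by simp
lemma ks_add_comm: "x \<in> carrier M \<Longrightarrow> y \<in> carrier M \<Longrightarrow> x \<oplus>\<^bsub>M\<^esub> y = y \<oplus>\<^bsub>M\<^esub> x"
  by (simp add: M.a_comm)
lemma ks_add_assoc: "x \<in> carrier M \<Longrightarrow> y \<in> carrier M \<Longrightarrow> w \<in> carrier M \<Longrightarrow>
  (x \<oplus>\<^bsub>M\<^esub> y) \<oplus>\<^bsub>M\<^esub> w = x \<oplus>\<^bsub>M\<^esub> (y \<oplus>\<^bsub>M\<^esub> w)"
  by (simp add: M.a_assoc)
lemma ks_add_lcomm: "x \<in> carrier M \<Longrightarrow> y \<in> carrier M \<Longrightarrow> w \<in> carrier M \<Longrightarrow>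
  x \<oplus>\<^bsub>M\<^esub> (y \<oplus>\<^bsub>M\<^esub> w) = y \<oplus>\<^bsub>M\<^esub> (x \<oplus>\<^bsub>M\<^esub> w)"
  by (simp add: M.a_lcomm)
lemma ks_smul_ladd: "x \<in> carrier M \<Longrightarrow> (c + d) \<odot>\<^bsub>M\<^esub> x = c \<odot>\<^bsub>M\<^esub> x \<oplus>\<^bsub>M\<^esub> d \<odot>\<^bsub>M\<^esub> x"
  using M.smult_l_distr[of c d x] by simp
lemma ks_smul_radd: "x \<in> carrier M \<Longrightarrow> y \<in> carrier M \<Longrightarrow>
    c \<odot>\<^bsub>M\<^esub> (x \<oplus>\<^bsub>M\<^esub> y) = c \<odot>\<^bsub>M\<^esub> x \<oplus>\<^bsub>M\<^esub> c \<odot>\<^bsub>M\<^esub> y"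
  using M.smult_r_distr[of c x y] by simp
lemma ks_smul_smul: "x \<in> carrier M \<Longrightarrow> c \<odot>\<^bsub>M\<^esub> (d \<odot>\<^bsub>M\<^esub> x) = (c * d) \<odot>\<^bsub>M\<^esub> x"
  using M.smult_assoc1[of c d x] by simp
lemma ks_smul_one: "x \<in> carrier M \<Longrightarrow> 1 \<odot>\<^bsub>M\<^esub> x = x"
  using M.smult_one[of x] by simp
lemma ks_smul_0: "x \<in> carrier M \<Longrightarrow> 0 \<odot>\<^bsub>M\<^esub> x = \<zero>\<^bsub>M\<^esub>"
  using M.smult_l_null[of x] by simp
lemma ks_smul_zero: "c \<odot>\<^bsub>M\<^esub> \<zero>\<^bsub>M\<^esub> = \<zero>\<^bsub>M\<^esub>"
  using M.smult_r_null[of c] by simp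
lemma ks_uminus_eq: "x \<in> carrier M \<Longrightarrow> \<ominus>\<^bsub>M\<^esub> x = (- 1) \<odot>\<^bsub>M\<^esub> x"
proof -
  assume x: "x \<in> carrier M"
  have "(- 1) \<odot>\<^bsub>M\<^esub> x \<oplus>\<^bsub>M\<^esub> x = (- 1 + 1) \<odot>\<^bsub>M\<^esub> x"
    using x by (simp only: ks_smul_ladd ks_smul_one)
  also have "\<dots> = \<zero>\<^bsub>M\<^esub>" using x by (simp add: ks_smul_0)
  finally show ?thesis using x M.minus_equality[of "(- 1) \<odot>\<^bsub>M\<^esub> x" x] by (simp add: ks_smul)
qed
lemma ks_minus_eq: "x \<in> carrier M \<Longrightarrow> y \<in> carrier M \<Longrightarrow> x \<ominus>\<^bsub>M\<^esub> y = x \<oplus>\<^bsub>M\<^esub> (- 1) \<odot>\<^bsub>M\<^esub> y"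
  by (simp add: a_minus_def ks_uminus_eq)
lemma ks_minus_self: "x \<in> carrier M \<Longrightarrow> x \<ominus>\<^bsub>M\<^esub> x = \<zero>\<^bsub>M\<^esub>"
  by (simp add: a_minus_def M.r_neg)
lemma ks_minus_zero_iff: "x \<in> carrier M \<Longrightarrow> y \<in> carrier M \<Longrightarrow> x \<ominus>\<^bsub>M\<^esub> y = \<zero>\<^bsub>M\<^esub> \<longleftrightarrow> x = y"
  by (metis M.add.inv_closed M.add.inv_comm M.minus_equality M.minus_minus a_minus_def ks_minus_self)

lemma submoduleI':
  assumes "N \<subseteq> carrier M" "\<zero>\<^bsub>M\<^esub> \<in> N"
    and "\<And>x y. x \<in> N \<Longrightarrow> y \<in> N \<Longrightarrow> x \<oplus>\<^bsub>M\<^esub> y \<in> N"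
    and "\<And>c x. x \<in> N \<Longrightarrow> c \<odot>\<^bsub>M\<^esub> x \<in> N"
  shows "submodule N (base_field :: ('k, 'k) module) M"
  by (rule M.submoduleI) (use assms in \<open>auto simp: ks_uminus_eq subset_iff\<close>)

end

lemmas ks_simps = ks_zero ks_add ks_smul ks_minus ks_add_zero ks_zero_add ks_smul_one ks_smul_0 ks_smul_zero

lemma submoduleD:
  assumes "submodule N (base_field :: ('k::field, 'k) module) M" "kspace M"
  shows "N \<subseteq> carrier M" "\<zero>\<^bsub>M\<^esub> \<in> N"
    "x \<in> N \<Longrightarrow> y \<in> N \<Longrightarrow> x \<oplus>\<^bsub>M\<^esub> y \<in> N" "x \<in> N \<Longrightarrow> c \<odot>\<^bsub>M\<^esub> x \<in> N"
    "x \<in> N \<Longrightarrow> y \<in> N \<Longrightarrow> x \<ominus>\<^bsub>M\<^esub> y \<in> N"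
proof -
  note * = module.submoduleE[OF assms(2,1)]
  show "N \<subseteq> carrier M" "\<And>x y. x \<in> N \<Longrightarrow> y \<in> N \<Longrightarrow> x \<oplus>\<^bsub>M\<^esub> y \<in> N"
    and sm: "\<And>x c. x \<in> N \<Longrightarrow> c \<odot>\<^bsub>M\<^esub> x \<in> N"
    using * by auto
  show "\<zero>\<^bsub>M\<^esub> \<in> N"
    using submodule.axioms(1)[OF assms(1)] subgroup.one_closed[of N "add_monoid M"] by auto
  show "x \<in> N \<Longrightarrow> y \<in> N \<Longrightarrow> x \<ominus>\<^bsub>M\<^esub> y \<in> N"
    unfolding a_minus_def using * by auto
qed

lemma linear_mapI:
  assumes "\<And>x. x \<in> carrier M \<Longrightarrow> f x \<in> carrier N"
    and "\<And>x y. x \<in> carrier M \<Longrightarrow> y \<in> carrier M \<Longrightarrow> f (x \<oplus>\<^bsub>M\<^esub> y) = f x \<oplus>\<^bsub>N\<^esub> f y"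
    and "\<And>c x. x \<in> carrier M \<Longrightarrow> f (c \<odot>\<^bsub>M\<^esub> x) = c \<odot>\<^bsub>N\<^esub> f x"
  shows "linear_map M N f"
  using assms by (auto simp: linear_map_def)

lemma linear_mapD:
  assumes "linear_map M N f"
  shows "x \<in> carrier M \<Longrightarrow> f x \<in> carrier N"
    and "x \<in> carrier M \<Longrightarrow> y \<in> carrier M \<Longrightarrow> f (x \<oplus>\<^bsub>M\<^esub> y) = f x \<oplus>\<^bsub>N\<^esub> f y"
    and "x \<in> carrier M \<Longrightarrow> f (c \<odot>\<^bsub>M\<^esub> x) = c \<odot>\<^bsub>N\<^esub> f x"
  using assms by (auto simp: linear_map_def)

lemma linear_map_zero:
  assumes "linear_map M N f" "kspace M" "kspace N"
  shows "f \<zero>\<^bsub>M\<^esub> = \<zero>\<^bsub>N\<^esub>"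
  using linear_mapD(3)[OF assms(1), of "\<zero>\<^bsub>M\<^esub>" 0] linear_mapD(1)[OF assms(1) ks_zero] assms(2,3)
  by (simp add: ks_smul_0 ks_smul_zero ks_zero)

lemma linear_map_minus:
  assumes "linear_map M N f" "kspace M" "kspace N" "x \<in> carrier M" "y \<in> carrier M"
  shows "f (x \<ominus>\<^bsub>M\<^esub> y) = f x \<ominus>\<^bsub>N\<^esub> f y"
  using assms by (simp add: ks_minus_eq linear_mapD ks_smul)

lemma linear_map_cong:
  assumes "linear_map M N f" "\<And>x. x \<in> carrier M \<Longrightarrow> f x = g x" "kspace M"
  shows "linear_map M N g"
  using assms(1) assms(2) ks_add[OF assms(3)] ks_smul[OF assms(3)]
  by (auto simp: linear_map_def Pi_iff)

lemma linear_map_id: "linear_map M M (\<lambda>x. x)"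
  by (auto simp: linear_map_def)

lemma linear_map_comp:
  "linear_map N X f \<Longrightarrow> linear_map M N g \<Longrightarrow> linear_map M X (\<lambda>x. f (g x))"
  by (auto simp: linear_map_def Pi_iff)

lemma linear_map_const_zero: "kspace N \<Longrightarrow> linear_map M N (\<lambda>x. \<zero>\<^bsub>N\<^esub>)"
  by (auto simp: linear_map_def ks_simps)

lemma linear_map_add:
  "kspace N \<Longrightarrow> linear_map M N f \<Longrightarrow> linear_map M N g \<Longrightarrow> linear_map M N (\<lambda>x. f x \<oplus>\<^bsub>N\<^esub> g x)"
  by (rule linear_mapI) (simp_all add: linear_mapD ks_add ks_smul ks_smul_radd ks_add_assoc ks_add_lcomm)

lemma linear_map_smul:
  "kspace N \<Longrightarrow> linear_map M N f \<Longrightarrow> linear_map M N (\<lambda>x. c \<odot>\<^bsub>N\<^esub> f x)"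
  by (rule linear_mapI) (simp_all add: linear_mapD ks_smul ks_smul_radd ks_smul_smul mult.commute)

lemma linear_map_smul_const:
  "kspace N \<Longrightarrow> linear_map M base_field f \<Longrightarrow> v \<in> carrier N \<Longrightarrow> linear_map M N (\<lambda>x. f x \<odot>\<^bsub>N\<^esub> v)"
  by (rule linear_mapI) (simp_all add: linear_mapD ks_smul ks_smul_ladd ks_smul_smul)

lemma linear_map_times_left:
  "linear_map M base_field f \<Longrightarrow> linear_map M base_field (\<lambda>x. c * f x)"
  by (auto simp: linear_map_def algebra_simps)

lemma linear_map_times_right:
  "linear_map M base_field f \<Longrightarrow> linear_map M base_field (\<lambda>x. f x * c)"
  by (auto simp: linear_map_def algebra_simps)

lemma linear_map_plus:
  "linear_map M base_field f \<Longrightarrow> linear_map M base_field g \<Longrightarrow> linear_map M base_field (\<lambda>x. f x + g x)"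
  by (auto simp: linear_map_def algebra_simps)

text \<open>\<open>kspan\<close> is a hull of submodules, which yields minimality but no rule
  induction. This inductively generated span has one; the two agree by \<open>kspan_eq_lspan\<close>
  when the generators lie in the carrier.\<close>

inductive_set lspan :: "('k::field, 'a, 'e) module_scheme \<Rightarrow> 'a set \<Rightarrow> 'a set"
  for M S where
  lspan_zero: "\<zero>\<^bsub>M\<^esub> \<in> lspan M S"
| lspan_gen: "x \<in> S \<Longrightarrow> x \<in> lspan M S"
| lspan_add: "x \<in> lspan M S \<Longrightarrow> y \<in> lspan M S \<Longrightarrow> x \<oplus>\<^bsub>M\<^esub> y \<in> lspan M S"
| lspan_smul: "x \<in> lspan M S \<Longrightarrow> c \<odot>\<^bsub>M\<^esub> x \<in> lspan M S"

lemma lspan_closed: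
  assumes "kspace M" "S \<subseteq> carrier M" "x \<in> lspan M S"
  shows "x \<in> carrier M"
  using assms(3) by induction (simp_all add: ks_zero ks_add ks_smul assms(1) subsetD[OF assms(2)])

lemma lspan_submodule:
  assumes "kspace M" "S \<subseteq> carrier M"
  shows "submodule (lspan M S) (base_field :: ('k::field, 'k) module) M"
  by (rule submoduleI'[OF assms(1)])
    (simp_all add: lspan_zero lspan_add lspan_smul subsetI lspan_closed[OF assms])

lemma lspan_minimal:
  assumes "submodule N (base_field :: ('k::field, 'k) module) M" "kspace M" "S \<subseteq> N"
  shows "lspan M S \<subseteq> N"
proof
  fix x assume "x \<in> lspan M S"
  then show "x \<in> N"
    by induction (simp_all add: submoduleD[OF assms(1,2)] subsetD[OF assms(3)])
qed

lemma kspan_eq_lspan: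
  assumes "kspace (M :: ('k::field, 'a, 'e) module_scheme)" "S \<subseteq> carrier M"
  shows "kspan M S = lspan M S"
  unfolding kspan_def
proof (rule hull_unique)
  show "S \<subseteq> lspan M S" by (simp add: lspan_gen subsetI)
  show "submodule (lspan M S) base_field M" by (rule lspan_submodule[OF assms])
  show "lspan M S \<subseteq> N" if "S \<subseteq> N" "submodule N base_field M" for N
    by (rule lspan_minimal[OF that(2) assms(1) that(1)])
qed

lemma lspan_mono:
  assumes "x \<in> lspan M S" "\<And>s. s \<in> S \<Longrightarrow> s \<in> lspan M S'"
  shows "x \<in> lspan M S'"
  using assms(1) by induction (simp_all add: lspan_zero lspan_add lspan_smul assms(2))

lemma lspan_linear_image:
  assumes "linear_map M N f" "x \<in> lspan M S" "kspace M" "kspace N" "S \<subseteq> carrier M"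
    and "\<And>s. s \<in> S \<Longrightarrow> f s \<in> lspan N S'"
  shows "f x \<in> lspan N S'"
  using assms(2)
  by induction
    (simp_all add: linear_map_zero[OF assms(1,3,4)] linear_mapD[OF assms(1)] lspan_closed[OF assms(3,5)]
      lspan_zero lspan_add lspan_smul assms(6))

lemma lspan_linear_submodule:
  assumes "linear_map M N f" "x \<in> lspan M S" "kspace M" "kspace N" "S \<subseteq> carrier M"
    and "submodule I (base_field :: ('k::field, 'k) module) N"
    and "\<And>s. s \<in> S \<Longrightarrow> f s \<in> I"
  shows "f x \<in> I"
  using assms(2)
  by induction
    (simp_all add: linear_map_zero[OF assms(1,3,4)] linear_mapD[OF assms(1)] lspan_closed[OF assms(3,5)]
      submoduleD[OF assms(6,4)] assms(7))

lemma lspan_linear_zero: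
  assumes "linear_map M N f" "x \<in> lspan M S" "kspace M" "kspace N" "S \<subseteq> carrier M"
    and "\<And>s. s \<in> S \<Longrightarrow> f s = \<zero>\<^bsub>N\<^esub>"
  shows "f x = \<zero>\<^bsub>N\<^esub>"
  using assms(2)
  by induction
    (simp_all add: linear_map_zero[OF assms(1,3,4)] linear_mapD[OF assms(1)] lspan_closed[OF assms(3,5)]
      assms(6) ks_zero_add ks_smul_zero ks_zero assms(4))

definition spans :: "('k::field, 'a, 'e) module_scheme \<Rightarrow> 'a set \<Rightarrow> bool" where
  "spans M S \<longleftrightarrow> S \<subseteq> carrier M \<and> carrier M \<subseteq> lspan M S"

lemma spans_induct [consumes 3, case_names zero gen add smul]:
  assumes "x \<in> carrier M" "spans M S" "kspace M"
    and "P \<zero>\<^bsub>M\<^esub>" "\<And>s. s \<in> S \<Longrightarrow> P s"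
    and "\<And>x y. x \<in> carrier M \<Longrightarrow> y \<in> carrier M \<Longrightarrow> P x \<Longrightarrow> P y \<Longrightarrow> P (x \<oplus>\<^bsub>M\<^esub> y)"
    and "\<And>x c. x \<in> carrier M \<Longrightarrow> P x \<Longrightarrow> P (c \<odot>\<^bsub>M\<^esub> x)"
  shows "P x"
proof -
  have "x \<in> lspan M S" using assms by (auto simp: spans_def)
  then have "x \<in> carrier M \<and> P x"
    by induction (use assms in \<open>auto simp: ks_simps spans_def\<close>)
  then show ?thesis ..
qed

text \<open>The identities between structure maps are multilinear. This lemma, iterated one argument
  at a time in its bilinear and trilinear forms, reduces them to words and group elements.\<close>

lemma linear_eq_on_span:
  assumes "linear_map M N f" "linear_map M N g" "spans M S" "kspace M" "kspace N"
    and "\<And>s. s \<in> S \<Longrightarrow> f s = g s" "x \<in> carrier M"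
  shows "f x = g x"
  using assms(7,3,4)
  by (induction rule: spans_induct)
    (auto simp: assms(6) linear_mapD[OF assms(1)] linear_mapD[OF assms(2)]
       linear_map_zero[OF assms(1,4,5)] linear_map_zero[OF assms(2,4,5)])

lemma spansI_lspan:
  assumes "spans M S" "kspace M" "S' \<subseteq> carrier M" "\<And>s. s \<in> S \<Longrightarrow> s \<in> lspan M S'"
  shows "spans M S'"
  using assms lspan_mono[of _ M S S'] by (auto simp: spans_def)

lemma lspan_finsum:
  fixes M :: "('k::field, 'a, 'e) module_scheme"
  assumes "kspace M" "S \<subseteq> carrier M" "\<And>i. i \<in> I \<Longrightarrow> f i \<in> lspan M S"
  shows "finsum M f I \<in> lspan M S"
proof -
  interpret M: module "base_field :: ('k, 'k) module" M by (fact assms)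
  show ?thesis
    using assms(3)
  proof (induction I rule: infinite_finite_induct)
    case (insert i I)
    then have "finsum M f (insert i I) = f i \<oplus>\<^bsub>M\<^esub> finsum M f I"
      using lspan_closed[OF assms(1,2)] by (intro M.finsum_insert) auto
    then show ?case using insert by (auto intro: lspan_add)
  qed (auto intro: lspan_zero)
qed

section \<open>Bilinear maps\<close>

definition bilin :: "('k::field, 'a, 'd) module_scheme \<Rightarrow> ('k, 'b, 'e) module_scheme \<Rightarrow>
    ('k, 'c, 'f) module_scheme \<Rightarrow> ('a \<Rightarrow> 'b \<Rightarrow> 'c) \<Rightarrow> bool" where
  "bilin M N X f \<longleftrightarrow> (\<forall>x\<in>carrier M. linear_map N X (f x)) \<and> (\<forall>y\<in>carrier N. linear_map M X (\<lambda>x. f x y))"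

lemma bilinI:
  assumes "\<And>x. x \<in> carrier M \<Longrightarrow> linear_map N X (\<lambda>y. f x y)"
    and "\<And>y. y \<in> carrier N \<Longrightarrow> linear_map M X (\<lambda>x. f x y)"
  shows "bilin M N X f"
  using assms by (auto simp: bilin_def)

lemma bilinD:
  assumes "bilin M N X f"
  shows "x \<in> carrier M \<Longrightarrow> linear_map N X (f x)"
    and "y \<in> carrier N \<Longrightarrow> linear_map M X (\<lambda>x. f x y)"
    and "x \<in> carrier M \<Longrightarrow> y \<in> carrier N \<Longrightarrow> f x y \<in> carrier X"
  using assms by (auto simp: bilin_def linear_map_def)

lemma bilin_left: "bilin M N X f \<Longrightarrow> linear_map L M g \<Longrightarrow> y \<in> carrier N \<Longrightarrow> linear_map L X (\<lambda>t. f (g t) y)"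
  by (rule linear_map_comp[where f = "\<lambda>x. f x y"]) (auto simp: bilin_def)

lemma bilin_right: "bilin M N X f \<Longrightarrow> x \<in> carrier M \<Longrightarrow> linear_map L N g \<Longrightarrow> linear_map L X (\<lambda>t. f x (g t))"
  by (rule linear_map_comp[where f = "\<lambda>y. f x y"]) (auto simp: bilin_def)

lemma bilin_comp:
  "bilin M N X f \<Longrightarrow> linear_map M' M g \<Longrightarrow> linear_map N' N h \<Longrightarrow> bilin M' N' X (\<lambda>x y. f (g x) (h y))"
  by (rule bilinI; rule bilin_left[of M N X f] bilin_right[of M N X f]) (auto simp: linear_mapD)

lemma bilin_post:
  "linear_map X Y g \<Longrightarrow> bilin M N X f \<Longrightarrow> bilin M N Y (\<lambda>x y. g (f x y))"
  by (auto simp: bilin_def intro: linear_map_comp)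

lemma bilin_flip: "bilin M N X f \<Longrightarrow> bilin N M X (\<lambda>y x. f x y)"
  by (auto simp: bilin_def)

lemma bilin_times:
  "linear_map M base_field f \<Longrightarrow> linear_map N base_field g \<Longrightarrow> bilin M N base_field (\<lambda>x y. f x * g y)"
  by (auto intro!: bilinI linear_map_times_left linear_map_times_right)

lemma bilin_smul:
  "kspace X \<Longrightarrow> linear_map M base_field f \<Longrightarrow> linear_map N X g \<Longrightarrow> bilin M N X (\<lambda>x y. f x \<odot>\<^bsub>X\<^esub> g y)"
  by (auto intro!: bilinI linear_map_smul linear_map_smul_const simp: linear_mapD)

lemma bilin_smul':
  "kspace X \<Longrightarrow> linear_map M X f \<Longrightarrow> linear_map N base_field g \<Longrightarrow> bilin M N X (\<lambda>x y. g y \<odot>\<^bsub>X\<^esub> f x)"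
  by (auto intro!: bilinI linear_map_smul linear_map_smul_const simp: linear_mapD)

lemma bilin_add:
  "kspace X \<Longrightarrow> bilin M N X f \<Longrightarrow> bilin M N X g \<Longrightarrow> bilin M N X (\<lambda>x y. f x y \<oplus>\<^bsub>X\<^esub> g x y)"
  by (auto simp: bilin_def intro: linear_map_add)

lemma bilin_zero:
  assumes "bilin M N X f" "kspace M" "kspace N" "kspace X"
  shows "y \<in> carrier N \<Longrightarrow> f \<zero>\<^bsub>M\<^esub> y = \<zero>\<^bsub>X\<^esub>" "x \<in> carrier M \<Longrightarrow> f x \<zero>\<^bsub>N\<^esub> = \<zero>\<^bsub>X\<^esub>"
  using linear_map_zero[OF bilinD(2)[OF assms(1)]] linear_map_zero[OF bilinD(1)[OF assms(1)]] assms
  by auto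

lemma bilin_cong:
  assumes "bilin M N X f" "\<And>x y. x \<in> carrier M \<Longrightarrow> y \<in> carrier N \<Longrightarrow> f x y = g x y" "kspace M" "kspace N"
  shows "bilin M N X g"
proof (rule bilinI)
  show "linear_map N X (\<lambda>y. g x y)" if "x \<in> carrier M" for x
    by (rule linear_map_cong[OF bilinD(1)[OF assms(1) that]]) (use assms that in auto)
  show "linear_map M X (\<lambda>x. g x y)" if "y \<in> carrier N" for y
    by (rule linear_map_cong[OF bilinD(2)[OF assms(1) that]]) (use assms that in auto)
qed

lemma bilin_eq_on_span:
  assumes "bilin M N X f" "bilin M N X g" "spans M S" "spans N S'" "kspace M" "kspace N" "kspace X"
    and "\<And>s s'. s \<in> S \<Longrightarrow> s' \<in> S' \<Longrightarrow> f s s' = g s s'" "x \<in> carrier M" "y \<in> carrier N"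
  shows "f x y = g x y"
proof (rule linear_eq_on_span[where f = "\<lambda>x. f x y" and g = "\<lambda>x. g x y" and S = S and M = M and N = X])
  fix s assume s: "s \<in> S"
  then have sM: "s \<in> carrier M" using assms by (auto simp: spans_def)
  show "f s y = g s y"
    by (rule linear_eq_on_span[where S = S' and M = N and N = X])
      (use assms s sM in \<open>auto dest: bilinD\<close>)
qed (use assms in \<open>auto dest: bilinD\<close>)

lemma lspan_bilin:
  assumes "bilin M N X f" "x \<in> lspan M S" "y \<in> lspan N S'" "S \<subseteq> carrier M" "S' \<subseteq> carrier N"
    and "kspace M" "kspace N" "kspace X" "\<And>s s'. s \<in> S \<Longrightarrow> s' \<in> S' \<Longrightarrow> f s s' \<in> lspan X Q"
  shows "f x y \<in> lspan X Q"
proof (rule lspan_linear_image[OF bilinD(2)[OF assms(1)] assms(2,6,8,4)])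
  show "y \<in> carrier N" by (rule lspan_closed[OF assms(7,5,3)])
  fix s assume s: "s \<in> S"
  show "f s y \<in> lspan X Q"
    by (rule lspan_linear_image[OF bilinD(1)[OF assms(1)] assms(3,7,8,5)])
      (use s assms(4,9) in auto)
qed

section \<open>Finite linear combinations\<close>

lemma lookup_pm_scale [simp]: "Poly_Mapping.lookup (pm_scale c x) i = c * Poly_Mapping.lookup x i"
  unfolding pm_scale_def by (transfer) (auto simp: when_def)

lemma keys_pm_scale: "Poly_Mapping.keys (pm_scale c x) \<subseteq> Poly_Mapping.keys x"
  by (auto simp: in_keys_iff)

lemma pm_scale_single [simp]: "pm_scale c (Poly_Mapping.single i d) = Poly_Mapping.single i (c * d)"
  by (rule poly_mapping_eqI) (simp add: lookup_single when_def)

lemma free_space_simps [simp]: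
  "carrier (free_space S :: ('k::field, 'a \<Rightarrow>\<^sub>0 'k) module) = {x. Poly_Mapping.keys x \<subseteq> S}"
  "\<zero>\<^bsub>free_space S :: ('k::field, 'a \<Rightarrow>\<^sub>0 'k) module\<^esub> = 0"
  "x \<oplus>\<^bsub>free_space S :: ('k::field, 'a \<Rightarrow>\<^sub>0 'k) module\<^esub> y = x + y"
  "c \<odot>\<^bsub>free_space S :: ('k::field, 'a \<Rightarrow>\<^sub>0 'k) module\<^esub> x = pm_scale c x"
  by (simp_all add: free_space_def)

lemma keys_add_subset: "Poly_Mapping.keys x \<subseteq> S \<Longrightarrow> Poly_Mapping.keys y \<subseteq> S \<Longrightarrow> Poly_Mapping.keys (x + y) \<subseteq> S"
  using keys_add[of x y] by blast

lemma kspace_free_space: "kspace (free_space S :: ('k::field, 'a \<Rightarrow>\<^sub>0 'k) module)"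
proof (rule kspaceI)
  show "abelian_group (free_space S :: ('k::field, 'a \<Rightarrow>\<^sub>0 'k) module)"
  proof (rule abelian_groupI)
    fix x assume "x \<in> carrier (free_space S :: ('k::field, 'a \<Rightarrow>\<^sub>0 'k) module)"
    then show "\<exists>y\<in>carrier (free_space S :: ('k::field, 'a \<Rightarrow>\<^sub>0 'k) module).
        y \<oplus>\<^bsub>(free_space S :: ('k::field, 'a \<Rightarrow>\<^sub>0 'k) module)\<^esub> x = \<zero>\<^bsub>(free_space S :: ('k::field, 'a \<Rightarrow>\<^sub>0 'k) module)\<^esub>"
      by (intro bexI[of _ "- x"]) auto
  qed (simp_all add: keys_add_subset algebra_simps)
next
  fix c :: 'k and x
  show "c \<odot>\<^bsub>free_space S\<^esub> x \<in> carrier (free_space S)" if "x \<in> carrier (free_space S)"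
    using that keys_pm_scale[of c x] by auto
qed (auto simp: lookup_add algebra_simps intro!: poly_mapping_eqI)

lemma pm_induct [consumes 1, case_names zero single add]:
  fixes x :: "'a \<Rightarrow>\<^sub>0 'k::field"
  assumes "Poly_Mapping.keys x \<subseteq> S"
    and "P 0" "\<And>i c. i \<in> S \<Longrightarrow> P (Poly_Mapping.single i c)"
    and "\<And>x y. Poly_Mapping.keys x \<subseteq> S \<Longrightarrow> Poly_Mapping.keys y \<subseteq> S \<Longrightarrow> P x \<Longrightarrow> P y \<Longrightarrow> P (x + y)"
  shows "P x"
proof -
  have "Poly_Mapping.keys x \<subseteq> S \<longrightarrow> P x"
  proof (induction x rule: update_induct)
    case (update f a b)
    have eq: "Poly_Mapping.update a b f = Poly_Mapping.single a b + f"
      using update by (intro poly_mapping_eqI) (auto simp: lookup_update lookup_add lookup_single when_def in_keys_iff)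
    have k: "Poly_Mapping.keys (Poly_Mapping.update a b f) = insert a (Poly_Mapping.keys f)"
      using update by (auto simp: keys_update)
    show ?case using update eq k assms by auto
  qed (use assms in auto)
  then show ?thesis using assms by auto
qed

lemma spans_free_space: "spans (free_space S :: ('k::field, 'a \<Rightarrow>\<^sub>0 'k) module) ((\<lambda>i. Poly_Mapping.single i 1) ` S)"
proof -
  have "x \<in> lspan (free_space S) ((\<lambda>i. Poly_Mapping.single i 1) ` S)"
    if "Poly_Mapping.keys x \<subseteq> S" for x :: "'a \<Rightarrow>\<^sub>0 'k"
    using that
  proof (induction rule: pm_induct)
    case zero then show ?case using lspan_zero[of "free_space S"] by auto
  next
    case (single i c)
    then have "c \<odot>\<^bsub>free_space S\<^esub> Poly_Mapping.single i 1 \<in> lspan (free_space S :: ('k, 'a \<Rightarrow>\<^sub>0 'k) module) ((\<lambda>i. Poly_Mapping.single i 1) ` S)"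
      by (intro lspan_smul lspan_gen) auto
    then show ?case by simp
  next
    case (add x y) then show ?case using lspan_add[of x "free_space S"] by auto
  qed
  then show ?thesis by (auto simp: spans_def)
qed

text \<open>The linear extension of \<open>f\<close>, evaluated at a finitely supported coefficient
  function. \<open>tlift\<close> and \<open>wlift\<close> are \<open>lc\<close> at a chosen
  representative of a class, so their properties are inherited from it.\<close>

definition lc :: "('k::field, 'x, 'e) module_scheme \<Rightarrow> ('i \<Rightarrow> 'x) \<Rightarrow> ('i \<Rightarrow>\<^sub>0 'k) \<Rightarrow> 'x" where
  "lc X f r = (\<Oplus>\<^bsub>X\<^esub>p\<in>Poly_Mapping.keys r. Poly_Mapping.lookup r p \<odot>\<^bsub>X\<^esub> f p)"

lemma lc_superset:
  fixes X :: "('k::field, 'x, 'e) module_scheme"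
  assumes "kspace X" "f \<in> S \<rightarrow> carrier X" "Poly_Mapping.keys r \<subseteq> T" "T \<subseteq> S" "finite T"
  shows "lc X f r = (\<Oplus>\<^bsub>X\<^esub>p\<in>T. Poly_Mapping.lookup r p \<odot>\<^bsub>X\<^esub> f p)"
proof -
  interpret X: module "base_field :: ('k, 'k) module" X by (fact assms)
  show ?thesis unfolding lc_def
    by (rule X.add.finprod_mono_neutral_cong_left)
      (use assms in \<open>auto simp: in_keys_iff ks_simps Pi_iff subset_iff\<close>)
qed

lemma lc_linear:
  fixes X :: "('k::field, 'x, 'e) module_scheme"
  assumes "kspace X" "f \<in> S \<rightarrow> carrier X"
  shows "linear_map (free_space S) X (lc X f)"
proof -
  interpret X: module "base_field :: ('k, 'k) module" X by (fact assms)
  show ?thesis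
  proof (rule linear_mapI)
    fix x assume "x \<in> carrier (free_space S :: ('k, _) module)"
    then show "lc X f x \<in> carrier X"
      unfolding lc_def using assms by (intro X.finsum_closed) (auto simp: ks_simps Pi_iff subset_iff)
  next
    fix x y assume xy: "x \<in> carrier (free_space S :: ('k, _) module)" "y \<in> carrier (free_space S :: ('k, _) module)"
    let ?T = "Poly_Mapping.keys x \<union> Poly_Mapping.keys y"
    have T: "?T \<subseteq> S" "finite ?T" using xy by auto
    have f: "f p \<in> carrier X" if "p \<in> ?T" for p using that T assms by auto
    have "lc X f (x + y) = (\<Oplus>\<^bsub>X\<^esub>p\<in>?T. Poly_Mapping.lookup (x + y) p \<odot>\<^bsub>X\<^esub> f p)"
      by (rule lc_superset[OF assms _ T]) (rule keys_add)
    also have "\<dots> = (\<Oplus>\<^bsub>X\<^esub>p\<in>?T. Poly_Mapping.lookup x p \<odot>\<^bsub>X\<^esub> f p \<oplus>\<^bsub>X\<^esub> Poly_Mapping.lookup y p \<odot>\<^bsub>X\<^esub> f p)"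
      by (rule X.finsum_cong') (use f assms in \<open>auto simp: lookup_add ks_smul_ladd ks_simps\<close>)
    also have "\<dots> = lc X f x \<oplus>\<^bsub>X\<^esub> lc X f y"
      by (subst X.finsum_addf) (use f assms lc_superset[OF assms _ T, of x] lc_superset[OF assms _ T, of y] in \<open>auto simp: ks_simps\<close>)
    finally show "lc X f (x \<oplus>\<^bsub>free_space S\<^esub> y) = lc X f x \<oplus>\<^bsub>X\<^esub> lc X f y" by simp
  next
    fix c x assume x: "x \<in> carrier (free_space S :: ('k, _) module)"
    let ?T = "Poly_Mapping.keys x"
    have T: "?T \<subseteq> S" "finite ?T" using x by auto
    have f: "f p \<in> carrier X" if "p \<in> ?T" for p using that T assms by auto
    have "lc X f (pm_scale c x) = (\<Oplus>\<^bsub>X\<^esub>p\<in>?T. Poly_Mapping.lookup (pm_scale c x) p \<odot>\<^bsub>X\<^esub> f p)"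
      by (rule lc_superset[OF assms _ T]) (rule keys_pm_scale)
    also have "\<dots> = (\<Oplus>\<^bsub>X\<^esub>p\<in>?T. c \<odot>\<^bsub>X\<^esub> (Poly_Mapping.lookup x p \<odot>\<^bsub>X\<^esub> f p))"
      by (rule X.finsum_cong') (use f assms in \<open>auto simp: ks_smul_smul ks_simps\<close>)
    also have "\<dots> = c \<odot>\<^bsub>X\<^esub> lc X f x"
      unfolding lc_def by (rule X.finsum_smult_ldistr[symmetric]) (use f assms in \<open>auto simp: ks_simps\<close>)
    finally show "lc X f (c \<odot>\<^bsub>free_space S\<^esub> x) = c \<odot>\<^bsub>X\<^esub> lc X f x" by simp
  qed
qed

lemma lc_zero: "kspace X \<Longrightarrow> lc X f 0 = \<zero>\<^bsub>X\<^esub>"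
  by (simp add: lc_def module_def abelian_group_def abelian_monoid.finsum_empty)

lemma lc_single_coeff:
  fixes X :: "('k::field, 'x, 'e) module_scheme"
  assumes "kspace X" "f i \<in> carrier X"
  shows "lc X f (Poly_Mapping.single i c) = c \<odot>\<^bsub>X\<^esub> f i"
proof -
  interpret X: module "base_field :: ('k, 'k) module" X by (fact assms)
  show ?thesis using assms by (auto simp: lc_def ks_simps)
qed

lemma lc_single:
  assumes "kspace X" "f i \<in> carrier X"
  shows "lc X f (Poly_Mapping.single i 1) = f i"
  using lc_single_coeff[of X f i 1] assms by (simp add: ks_simps)

lemma lc_cong:
  fixes X :: "('k::field, 'x, 'e) module_scheme"
  assumes "kspace X" "Poly_Mapping.keys r \<subseteq> S" "\<And>i. i \<in> S \<Longrightarrow> f i = g i" "f \<in> S \<rightarrow> carrier X"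
  shows "lc X f r = lc X g r"
proof -
  interpret X: module "base_field :: ('k, 'k) module" X by (fact assms)
  show ?thesis unfolding lc_def
    by (rule X.finsum_cong') (use assms in \<open>auto simp: ks_simps Pi_iff subset_iff\<close>)
qed

lemma linear_lc:
  fixes X :: "('k::field, 'x, 'e) module_scheme"
  assumes "linear_map X Y h" "kspace X" "kspace Y" "f \<in> S \<rightarrow> carrier X" "Poly_Mapping.keys r \<subseteq> S"
  shows "h (lc X f r) = lc Y (\<lambda>i. h (f i)) r"
proof (rule linear_eq_on_span[OF _ _ spans_free_space kspace_free_space assms(3)])
  show "linear_map (free_space S) Y (\<lambda>r. h (lc X f r))"
    by (rule linear_map_comp[OF assms(1)]) (rule lc_linear[OF assms(2,4)])
  show "linear_map (free_space S) Y (lc Y (\<lambda>i. h (f i)))"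
    by (rule lc_linear[OF assms(3)]) (use assms in \<open>auto dest: linear_mapD\<close>)
  show "r \<in> carrier (free_space S)" using assms by simp
  fix s assume "s \<in> (\<lambda>i. Poly_Mapping.single i (1::'k)) ` S"
  then show "h (lc X f s) = lc Y (\<lambda>i. h (f i)) s"
    using assms by (auto simp: lc_single Pi_iff linear_mapD)
qed

lemma lc_linear_param:
  assumes "kspace X" "\<And>i. i \<in> S \<Longrightarrow> linear_map M X (\<lambda>x. F x i)" "Poly_Mapping.keys r \<subseteq> S" "kspace M"
  shows "linear_map M X (\<lambda>x. lc X (F x) r)"
  using assms(3)
proof (induction rule: pm_induct)
  case zero
  then show ?case using assms linear_map_const_zero[OF assms(1), of M] by (simp add: lc_zero)
next
  case (single i c)
  show ?case
    by (rule linear_map_cong[where f = "\<lambda>x. c \<odot>\<^bsub>X\<^esub> F x i"])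
      (use assms single linear_mapD(1)[OF assms(2)[OF single]] in \<open>auto simp: lc_single_coeff intro: linear_map_smul\<close>)
next
  case (add a b)
  have "lc X (F x) (a + b) = lc X (F x) a \<oplus>\<^bsub>X\<^esub> lc X (F x) b" if "x \<in> carrier M" for x
    using linear_mapD(2)[OF lc_linear[OF assms(1), of "F x" S], of a b] add
      linear_mapD(1)[OF assms(2) that] by auto
  then show ?case
    by (intro linear_map_cong[OF linear_map_add[OF assms(1) add(3,4)]]) (use assms in auto)
qed

lemma finsum_base_field: "finsum (base_field :: ('k::field, 'k) module) f A = sum f A"
proof -
  interpret X: module "base_field :: ('k, 'k) module" "base_field :: ('k, 'k) module" by (rule kspace_base_field)
  show ?thesis by (induction A rule: infinite_finite_induct) auto
qed

lemma ks_cancel2: "kspace X \<Longrightarrow> a \<in> carrier X \<Longrightarrow> a \<oplus>\<^bsub>X\<^esub> (- 1) \<odot>\<^bsub>X\<^esub> a = \<zero>\<^bsub>X\<^esub>"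
  using ks_minus_eq[of X a a] ks_minus_self[of X a] by simp

lemma ks_cancel3:
  assumes "kspace X" "a \<in> carrier X" "b \<in> carrier X"
  shows "(a \<oplus>\<^bsub>X\<^esub> b) \<oplus>\<^bsub>X\<^esub> (- 1) \<odot>\<^bsub>X\<^esub> a \<oplus>\<^bsub>X\<^esub> (- 1) \<odot>\<^bsub>X\<^esub> b = \<zero>\<^bsub>X\<^esub>"
proof -
  have "(a \<oplus>\<^bsub>X\<^esub> b) \<oplus>\<^bsub>X\<^esub> (- 1) \<odot>\<^bsub>X\<^esub> a \<oplus>\<^bsub>X\<^esub> (- 1) \<odot>\<^bsub>X\<^esub> b = (a \<oplus>\<^bsub>X\<^esub> b) \<oplus>\<^bsub>X\<^esub> (- 1) \<odot>\<^bsub>X\<^esub> (a \<oplus>\<^bsub>X\<^esub> b)"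
    using assms by (simp add: ks_smul_radd ks_add_assoc ks_add ks_smul)
  then show ?thesis using assms by (simp add: ks_cancel2 ks_add)
qed

lemma spans_image:
  assumes "linear_map M N f" "kspace M" "kspace N" "spans M S" "carrier N \<subseteq> f ` carrier M"
  shows "spans N (f ` S)"
  unfolding spans_def
proof
  show "f ` S \<subseteq> carrier N" using assms(4) by (auto simp: spans_def linear_mapD[OF assms(1)])
  show "carrier N \<subseteq> lspan N (f ` S)"
  proof
    fix y assume "y \<in> carrier N"
    then obtain x where x: "x \<in> carrier M" "y = f x" using assms(5) by auto
    have "f x \<in> lspan N (f ` S)"
      by (rule lspan_linear_image[OF assms(1) _ assms(2,3), of x S])
        (use assms(4) x(1) in \<open>simp_all add: spans_def subset_iff lspan_gen\<close>)
    then show "y \<in> lspan N (f ` S)" using x by simp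
  qed
qed

section \<open>Quotient spaces\<close>

lemma quot_simps:
  "carrier (quot M N) = a_rcosets\<^bsub>M\<^esub> N" "\<zero>\<^bsub>quot M N\<^esub> = N"
  "x \<oplus>\<^bsub>quot M N\<^esub> y = x <+>\<^bsub>M\<^esub> y" "c \<odot>\<^bsub>quot M N\<^esub> X = (\<Union>x\<in>X. N +>\<^bsub>M\<^esub> (c \<odot>\<^bsub>M\<^esub> x))"
  "X \<otimes>\<^bsub>quot M N\<^esub> Y = rcoset_mult M N X Y" "\<one>\<^bsub>quot M N\<^esub> = N +>\<^bsub>M\<^esub> \<one>\<^bsub>M\<^esub>"
  by (simp_all add: quot_def)

context
  fixes M :: "('k::field, 'a, 'e) module_scheme" and N
  assumes kM: "kspace M" and sN: "submodule N (base_field :: ('k, 'k) module) M"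
begin

lemma abelian_subgroup_submodule: "abelian_subgroup N M"
  by (rule abelian_subgroupI3)
    (use kM sN in \<open>auto simp: additive_subgroup_def submodule_def kspace_abelian_group\<close>)

interpretation N: abelian_subgroup N M by (rule abelian_subgroup_submodule)

lemma coset_mem_iff: "x \<in> carrier M \<Longrightarrow> y \<in> carrier M \<Longrightarrow> y \<in> N +>\<^bsub>M\<^esub> x \<longleftrightarrow> y \<ominus>\<^bsub>M\<^esub> x \<in> N"
  by (simp add: N.a_rcos_module a_minus_def)

lemma coset_carrier: "x \<in> carrier M \<Longrightarrow> y \<in> N +>\<^bsub>M\<^esub> x \<Longrightarrow> y \<in> carrier M"
  by (rule N.a_elemrcos_carrier)

lemma coset_self: "x \<in> carrier M \<Longrightarrow> x \<in> N +>\<^bsub>M\<^esub> x"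
  by (rule N.a_rcos_self)

lemma coset_eqI: "x \<in> carrier M \<Longrightarrow> y \<in> carrier M \<Longrightarrow> x \<ominus>\<^bsub>M\<^esub> y \<in> N \<Longrightarrow> N +>\<^bsub>M\<^esub> x = N +>\<^bsub>M\<^esub> y"
  by (rule N.a_repr_independence'[symmetric]) (simp_all add: coset_mem_iff)

lemma quot_carrier: "carrier (quot M N) = (\<lambda>x. N +>\<^bsub>M\<^esub> x) ` carrier M"
  by (auto simp: quot_simps A_RCOSETS_def')

lemma quot_add: "x \<in> carrier M \<Longrightarrow> y \<in> carrier M \<Longrightarrow>
    (N +>\<^bsub>M\<^esub> x) \<oplus>\<^bsub>quot M N\<^esub> (N +>\<^bsub>M\<^esub> y) = N +>\<^bsub>M\<^esub> (x \<oplus>\<^bsub>M\<^esub> y)"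
  by (simp add: quot_simps N.a_rcos_sum)

lemma quot_smul:
  assumes "x \<in> carrier M"
  shows "c \<odot>\<^bsub>quot M N\<^esub> (N +>\<^bsub>M\<^esub> x) = N +>\<^bsub>M\<^esub> (c \<odot>\<^bsub>M\<^esub> x)"
proof -
  \<comment> \<open>The scalar multiple in the quotient is a union of cosets over all members of the
    class; these cosets all coincide.\<close>
  have "N +>\<^bsub>M\<^esub> (c \<odot>\<^bsub>M\<^esub> y) = N +>\<^bsub>M\<^esub> (c \<odot>\<^bsub>M\<^esub> x)" if y: "y \<in> N +>\<^bsub>M\<^esub> x" for y
  proof (rule coset_eqI)
    have yM: "y \<in> carrier M" using coset_carrier assms y by blast
    have "c \<odot>\<^bsub>M\<^esub> (y \<ominus>\<^bsub>M\<^esub> x) \<in> N"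
      using y coset_mem_iff[OF assms yM] submoduleD(4)[OF sN kM] by blast
    then show "c \<odot>\<^bsub>M\<^esub> y \<ominus>\<^bsub>M\<^esub> c \<odot>\<^bsub>M\<^esub> x \<in> N"
      using kM yM assms by (simp add: ks_minus_eq ks_smul ks_smul_radd ks_smul_smul)
    show "c \<odot>\<^bsub>M\<^esub> y \<in> carrier M" "c \<odot>\<^bsub>M\<^esub> x \<in> carrier M" using yM assms kM by (simp_all add: ks_smul)
  qed
  then have "(\<Union>y\<in>N +>\<^bsub>M\<^esub> x. N +>\<^bsub>M\<^esub> (c \<odot>\<^bsub>M\<^esub> y)) = (\<Union>y\<in>N +>\<^bsub>M\<^esub> x. N +>\<^bsub>M\<^esub> (c \<odot>\<^bsub>M\<^esub> x))"
    by (rule SUP_cong[OF refl])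
  moreover have "N +>\<^bsub>M\<^esub> x \<noteq> {}" using coset_self[OF assms] by blast
  ultimately show ?thesis by (simp add: quot_simps)
qed

lemma quot_zero: "\<zero>\<^bsub>quot M N\<^esub> = N +>\<^bsub>M\<^esub> \<zero>\<^bsub>M\<^esub>"
  using N.a_coset_join2[OF ks_zero[OF kM] N.a_subgroup] submoduleD(2)[OF sN kM]
  by (simp add: quot_simps)

lemma kspace_quot: "kspace (quot M N)"
proof (rule kspaceI)
  show "abelian_group (quot M N)"
  proof (rule abelian_groupI)
    fix x assume "x \<in> carrier (quot M N)"
    then obtain y where y: "y \<in> carrier M" "x = N +>\<^bsub>M\<^esub> y" by (auto simp: quot_carrier)
    show "\<exists>z\<in>carrier (quot M N). z \<oplus>\<^bsub>quot M N\<^esub> x = \<zero>\<^bsub>quot M N\<^esub>"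
      by (rule bexI[of _ "N +>\<^bsub>M\<^esub> (\<ominus>\<^bsub>M\<^esub> y)"])
        (use kM y in \<open>auto simp: quot_add quot_zero quot_carrier ks_uminus N.l_neg\<close>)
  next
    fix x y assume "x \<in> carrier (quot M N)" "y \<in> carrier (quot M N)"
    then obtain x' y' where "x' \<in> carrier M" "x = N +>\<^bsub>M\<^esub> x'" "y' \<in> carrier M" "y = N +>\<^bsub>M\<^esub> y'"
      by (auto simp: quot_carrier)
    then show "x \<oplus>\<^bsub>quot M N\<^esub> y = y \<oplus>\<^bsub>quot M N\<^esub> x"
      by (simp add: quot_add ks_add_comm[OF kM, of x' y'])
  qed (use kM in \<open>auto simp: quot_carrier quot_add quot_zero ks_simps ks_add_assoc\<close>)
qed (use kM in \<open>auto simp: quot_carrier quot_add quot_smul quot_zero ks_simps ks_smul_ladd ks_smul_radd ks_smul_smul\<close>)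

lemma quot_proj_linear: "linear_map M (quot M N) (\<lambda>x. N +>\<^bsub>M\<^esub> x)"
  by (rule linear_mapI) (simp_all add: quot_carrier quot_add quot_smul)

lemma quot_spans: "spans M S \<Longrightarrow> spans (quot M N) ((\<lambda>x. N +>\<^bsub>M\<^esub> x) ` S)"
  by (rule spans_image[OF quot_proj_linear kM kspace_quot]) (simp_all add: quot_carrier)

lemma quot_rep:
  assumes "X \<in> carrier (quot M N)"
  shows "(SOME x. x \<in> X) \<in> carrier M" "(SOME x. x \<in> X) \<in> X" "N +>\<^bsub>M\<^esub> (SOME x. x \<in> X) = X"
proof -
  obtain x where x: "x \<in> carrier M" "X = N +>\<^bsub>M\<^esub> x" using assms by (auto simp: quot_carrier)
  have *: "(SOME x. x \<in> X) \<in> X" by (rule someI[of _ x]) (simp add: x coset_self)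
  then show "(SOME x. x \<in> X) \<in> X" "(SOME x. x \<in> X) \<in> carrier M" using x coset_carrier by auto
  then show "N +>\<^bsub>M\<^esub> (SOME x. x \<in> X) = X" using x coset_mem_iff coset_eqI by auto
qed

text \<open>Maps on quotients are evaluated at a representative picked by choice. It differs from
  \<open>x\<close> by an element of \<open>N\<close>, which \<open>h\<close> kills.\<close>

lemma quot_lift:
  assumes "linear_map M X h" "kspace X" "\<And>r. r \<in> N \<Longrightarrow> h r = \<zero>\<^bsub>X\<^esub>" "x \<in> carrier M"
  shows "h (SOME r. r \<in> N +>\<^bsub>M\<^esub> x) = h x"
proof -
  let ?r = "SOME r. r \<in> N +>\<^bsub>M\<^esub> x"
  have c: "N +>\<^bsub>M\<^esub> x \<in> carrier (quot M N)" using assms by (simp add: quot_carrier)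
  have r: "?r \<in> carrier M" "?r \<ominus>\<^bsub>M\<^esub> x \<in> N"
    using quot_rep(1,2)[OF c] coset_mem_iff[OF assms(4)] by auto
  have "h ?r \<ominus>\<^bsub>X\<^esub> h x = \<zero>\<^bsub>X\<^esub>"
    using assms(3)[OF r(2)] linear_map_minus[OF assms(1) kM assms(2) r(1) assms(4)] by simp
  then show ?thesis using ks_minus_zero_iff[OF assms(2)] linear_mapD(1)[OF assms(1)] r assms(4) by blast
qed

lemma quot_lift_linear:
  assumes "linear_map M X h" "kspace X" "\<And>r. r \<in> N \<Longrightarrow> h r = \<zero>\<^bsub>X\<^esub>"
  shows "linear_map (quot M N) X (\<lambda>t. h (SOME r. r \<in> t))"
  by (rule linear_mapI)
    (auto simp: quot_carrier quot_add quot_smul quot_lift[OF assms] linear_mapD[OF assms(1)] ks_add[OF kM] ks_smul[OF kM])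

end

section \<open>Tensor products\<close>

lemma pm_diff_eq: "x - y = x + pm_scale (- 1) (y :: 'a \<Rightarrow>\<^sub>0 'k::field)"
  by (rule poly_mapping_eqI) (simp add: lookup_add lookup_minus)

lemma free_space_minus:
  "x \<in> carrier (free_space S) \<Longrightarrow> y \<in> carrier (free_space S) \<Longrightarrow> x \<ominus>\<^bsub>free_space S\<^esub> y = x - (y :: 'a \<Rightarrow>\<^sub>0 'k::field)"
  by (simp add: ks_minus_eq[OF kspace_free_space] pm_diff_eq)

lemma keys_diff_subset:
  "Poly_Mapping.keys x \<subseteq> S \<Longrightarrow> Poly_Mapping.keys y \<subseteq> S \<Longrightarrow> Poly_Mapping.keys (x - (y :: 'a \<Rightarrow>\<^sub>0 'k::field)) \<subseteq> S"
  unfolding pm_diff_eq by (rule keys_add_subset) (simp_all add: order_trans[OF keys_pm_scale])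

lemma lc_diff:
  assumes "kspace X" "f \<in> S \<rightarrow> carrier X" "Poly_Mapping.keys x \<subseteq> S" "Poly_Mapping.keys y \<subseteq> S"
  shows "lc X f (x - y) = lc X f x \<oplus>\<^bsub>X\<^esub> (- 1) \<odot>\<^bsub>X\<^esub> lc X f y"
  using linear_mapD(2)[OF lc_linear[OF assms(1,2)], of x "pm_scale (- 1) y"]
    linear_mapD(3)[OF lc_linear[OF assms(1,2)], of y "- 1"] assms(3,4) keys_pm_scale[of "- 1" y]
  by (simp add: pm_diff_eq)

lemma tlift_lc: "tlift X f t = lc X (\<lambda>p. f (fst p) (snd p)) (SOME r. r \<in> t)"
  by (simp add: tlift_def lc_def Let_def)

context
  fixes M :: "('k::field, 'a, 'd) module_scheme" and N :: "('k, 'b, 'e) module_scheme"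
  assumes kM: "kspace M" and kN: "kspace N"
begin

abbreviation (input) "FS \<equiv> free_space (carrier M \<times> carrier N) :: ('k, 'a \<times> 'b \<Rightarrow>\<^sub>0 'k) module"

lemma tensor_relators_closed: "tensor_relators M N \<subseteq> carrier FS"
proof -
  have k: "Poly_Mapping.keys (Poly_Mapping.single p c) \<subseteq> carrier M \<times> carrier N"
    if "p \<in> carrier M \<times> carrier N" for p and c :: 'k using that by auto
  show ?thesis
    unfolding tensor_relators_def Let_def free_space_simps pm_scale_single
    by (intro Un_least subsetI)
      (elim CollectE exE conjE, simp only: mem_Collect_eq, intro keys_diff_subset k SigmaI,
        simp_all add: ks_add[OF kM] ks_add[OF kN] ks_smul[OF kM] ks_smul[OF kN])+
qed

lemma tensor_relatorsI:
  fixes c :: 'k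
  defines "e \<equiv> \<lambda>x y. Poly_Mapping.single (x, y) (1 :: 'k)"
  assumes "x \<in> carrier M" "x' \<in> carrier M" "y \<in> carrier N" "y' \<in> carrier N"
  shows "e (x \<oplus>\<^bsub>M\<^esub> x') y - (e x y + e x' y) \<in> tensor_relators M N"
    and "e x (y \<oplus>\<^bsub>N\<^esub> y') - (e x y + e x y') \<in> tensor_relators M N"
    and "e (c \<odot>\<^bsub>M\<^esub> x) y - pm_scale c (e x y) \<in> tensor_relators M N"
    and "e x (c \<odot>\<^bsub>N\<^esub> y) - pm_scale c (e x y) \<in> tensor_relators M N"
  using assms(2-) unfolding tensor_relators_def Let_def e_def diff_diff_eq[symmetric] by blast+

lemma tensor_null_lspan: "tensor_null M N = lspan FS (tensor_relators M N)"
  unfolding tensor_null_def by (rule kspan_eq_lspan[OF kspace_free_space tensor_relators_closed])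

lemma tensor_null_submodule: "submodule (tensor_null M N) (base_field :: ('k, 'k) module) FS"
  unfolding tensor_null_lspan by (rule lspan_submodule[OF kspace_free_space tensor_relators_closed])

lemma kspace_tensor: "kspace (tensor M N)"
  unfolding tensor_def by (rule kspace_quot[OF kspace_free_space tensor_null_submodule])

lemma tpure_closed: "x \<in> carrier M \<Longrightarrow> y \<in> carrier N \<Longrightarrow> tpure M N x y \<in> carrier (tensor M N)"
  unfolding tensor_def tpure_def quot_carrier[OF kspace_free_space tensor_null_submodule] by auto

lemma tpure_eqI:
  assumes "x \<in> carrier FS" "y \<in> carrier FS" "x - y \<in> tensor_relators M N"
  shows "tensor_null M N +>\<^bsub>FS\<^esub> x = tensor_null M N +>\<^bsub>FS\<^esub> y"
  by (rule coset_eqI[OF kspace_free_space tensor_null_submodule assms(1,2)])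
    (use assms in \<open>simp add: free_space_minus tensor_null_lspan lspan_gen del: free_space_simps\<close>)

lemma tpure_bilin: "bilin M N (tensor M N) (tpure M N)"
proof -
  note add = quot_add[OF kspace_free_space tensor_null_submodule, symmetric, unfolded free_space_simps]
  note smul = quot_smul[OF kspace_free_space tensor_null_submodule, symmetric, unfolded free_space_simps]
  let ?e = "\<lambda>x y. Poly_Mapping.single (x, y) (1 :: 'k)"
  let ?q = "\<lambda>r. tensor_null M N +>\<^bsub>FS\<^esub> r"
  have e: "?e x y \<in> carrier FS" if "x \<in> carrier M" "y \<in> carrier N" for x y using that by simp
  have qadd: "?q (r + r') = ?q r \<oplus>\<^bsub>tensor M N\<^esub> ?q r'" if "r \<in> carrier FS" "r' \<in> carrier FS" for r r'
    using quot_add[OF kspace_free_space tensor_null_submodule that] by (simp add: tensor_def)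
  have qsmul: "?q (pm_scale c r) = c \<odot>\<^bsub>tensor M N\<^esub> ?q r" if "r \<in> carrier FS" for r c
    using quot_smul[OF kspace_free_space tensor_null_submodule that] by (simp add: tensor_def)
  show ?thesis
  proof (intro bilinI linear_mapI)
    fix x x' y assume "x \<in> carrier M" "x' \<in> carrier M" "y \<in> carrier N"
    note c = this
    have "?q (?e (x \<oplus>\<^bsub>M\<^esub> x') y) = ?q (?e x y + ?e x' y)"
      by (rule tpure_eqI) (use c in \<open>simp_all add: keys_add_subset ks_add[OF kM] tensor_relatorsI\<close>)
    then show "tpure M N (x \<oplus>\<^bsub>M\<^esub> x') y = tpure M N x y \<oplus>\<^bsub>tensor M N\<^esub> tpure M N x' y"
      using c e by (simp only: qadd tpure_def)
  next
    fix x y y' assume "x \<in> carrier M" "y \<in> carrier N" "y' \<in> carrier N"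
    note c = this
    have "?q (?e x (y \<oplus>\<^bsub>N\<^esub> y')) = ?q (?e x y + ?e x y')"
      by (rule tpure_eqI) (use c in \<open>simp_all add: keys_add_subset ks_add[OF kN] tensor_relatorsI\<close>)
    then show "tpure M N x (y \<oplus>\<^bsub>N\<^esub> y') = tpure M N x y \<oplus>\<^bsub>tensor M N\<^esub> tpure M N x y'"
      using c e by (simp only: qadd tpure_def)
  next
    fix x c y assume c: "x \<in> carrier M" "y \<in> carrier N"
    have "?q (?e (c \<odot>\<^bsub>M\<^esub> x) y) = ?q (pm_scale c (?e x y))"
      by (rule tpure_eqI) (use c in \<open>simp_all add: ks_smul[OF kM] tensor_relatorsI del: pm_scale_single,
        simp_all\<close>)
    then show "tpure M N (c \<odot>\<^bsub>M\<^esub> x) y = c \<odot>\<^bsub>tensor M N\<^esub> tpure M N x y"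
      using c e by (simp only: qsmul tpure_def)
    have "?q (?e x (c \<odot>\<^bsub>N\<^esub> y)) = ?q (pm_scale c (?e x y))"
      by (rule tpure_eqI) (use c in \<open>simp_all add: ks_smul[OF kN] tensor_relatorsI del: pm_scale_single,
        simp_all\<close>)
    then show "tpure M N x (c \<odot>\<^bsub>N\<^esub> y) = c \<odot>\<^bsub>tensor M N\<^esub> tpure M N x y"
      using c e by (simp only: qsmul tpure_def)
  qed (simp_all add: tpure_closed)
qed

lemma spans_tensor_pure: "spans (tensor M N) ((\<lambda>p. tpure M N (fst p) (snd p)) ` (carrier M \<times> carrier N))"
  using quot_spans[OF kspace_free_space tensor_null_submodule spans_free_space]
  by (simp add: tensor_def tpure_def image_image)

lemma spans_tensor:
  assumes "spans M S" "spans N S'"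
  shows "spans (tensor M N) ((\<lambda>p. tpure M N (fst p) (snd p)) ` (S \<times> S'))"
proof (rule spansI_lspan[OF spans_tensor_pure kspace_tensor])
  have S: "S \<subseteq> carrier M" "S' \<subseteq> carrier N" "carrier M \<subseteq> lspan M S" "carrier N \<subseteq> lspan N S'"
    using assms by (simp_all add: spans_def)
  show "(\<lambda>p. tpure M N (fst p) (snd p)) ` (S \<times> S') \<subseteq> carrier (tensor M N)"
    using S by (auto intro!: tpure_closed)
  show "s \<in> lspan (tensor M N) ((\<lambda>p. tpure M N (fst p) (snd p)) ` (S \<times> S'))"
    if s: "s \<in> (\<lambda>p. tpure M N (fst p) (snd p)) ` (carrier M \<times> carrier N)" for s
  proof -
    obtain x y where xy: "x \<in> carrier M" "y \<in> carrier N" "s = tpure M N x y" using s by auto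
    show ?thesis
      unfolding xy(3)
      by (rule lspan_bilin[OF tpure_bilin subsetD[OF S(3) xy(1)] subsetD[OF S(4) xy(2)] S(1,2) kM kN kspace_tensor])
        (force intro: lspan_gen)
  qed
qed

context
  fixes X :: "('k, 'x, 'f) module_scheme"
  assumes kX: "kspace X"
begin

text \<open>\<open>tensor_null\<close> is a span, so it is enough to look at relators; for each of
  the four kinds the claim is one of the linearity properties of \<open>f\<close>.\<close>

lemma lc_tensor_null:
  assumes "bilin M N X f" "r \<in> tensor_null M N"
  shows "lc X (\<lambda>p. f (fst p) (snd p)) r = \<zero>\<^bsub>X\<^esub>"
proof (rule lspan_linear_zero[OF lc_linear[OF kX] _ kspace_free_space kX tensor_relators_closed])
  let ?f = "\<lambda>p. f (fst p) (snd p)"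
  show f: "?f \<in> carrier M \<times> carrier N \<rightarrow> carrier X" using bilinD(3)[OF assms(1)] by auto
  show "r \<in> lspan FS (tensor_relators M N)" using assms(2) by (simp add: tensor_null_lspan)
  note fc = bilinD(3)[OF assms(1)]
  have s: "lc X ?f (Poly_Mapping.single (x, y) c) = c \<odot>\<^bsub>X\<^esub> f x y"
    if "x \<in> carrier M" "y \<in> carrier N" for x y c
    using lc_single_coeff[of X ?f "(x, y)" c] kX fc that by simp
  note c = ks_add[OF kM] ks_add[OF kN] ks_smul[OF kM] ks_smul[OF kN] keys_diff_subset
  note l = linear_mapD(2,3)[OF bilinD(1)[OF assms(1)]] linear_mapD(2,3)[OF bilinD(2)[OF assms(1)]]
  note d = lc_diff[OF kX f]
  fix t assume "t \<in> tensor_relators M N"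
  then show "lc X ?f t = \<zero>\<^bsub>X\<^esub>"
    unfolding tensor_relators_def Let_def
    by (elim UnE CollectE exE conjE)
      (simp_all add: d s c l fc ks_smul_one[OF kX] ks_add[OF kX] ks_smul[OF kX] ks_cancel2[OF kX] ks_cancel3[OF kX])
qed

lemma tlift_linear:
  assumes "bilin M N X f"
  shows "linear_map (tensor M N) X (tlift X f)"
  unfolding tlift_lc[abs_def] tensor_def
  by (rule quot_lift_linear[OF kspace_free_space tensor_null_submodule lc_linear[OF kX] kX lc_tensor_null[OF assms]])
    (auto intro!: bilinD(3)[OF assms])

lemma tlift_tpure:
  assumes "bilin M N X f" "x \<in> carrier M" "y \<in> carrier N"
  shows "tlift X f (tpure M N x y) = f x y"
proof -
  have f: "(\<lambda>p. f (fst p) (snd p)) \<in> carrier M \<times> carrier N \<rightarrow> carrier X"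
    by (auto intro!: bilinD(3)[OF assms(1)])
  have "tlift X f (tpure M N x y) = lc X (\<lambda>p. f (fst p) (snd p)) (Poly_Mapping.single (x, y) 1)"
    unfolding tlift_lc tpure_def
    by (rule quot_lift[OF kspace_free_space tensor_null_submodule lc_linear[OF kX f] kX lc_tensor_null[OF assms(1)]])
      (use assms in auto)
  then show ?thesis using lc_single[of X "\<lambda>p. f (fst p) (snd p)" "(x, y)"] kX bilinD(3)[OF assms] by simp
qed

lemma tensor_rep:
  assumes "t \<in> carrier (tensor M N)"
  shows "Poly_Mapping.keys (SOME r. r \<in> t) \<subseteq> carrier M \<times> carrier N"
  using quot_rep(1)[OF kspace_free_space tensor_null_submodule assms[unfolded tensor_def]] by simp

lemma tlift_closed:
  assumes "\<And>x y. x \<in> carrier M \<Longrightarrow> y \<in> carrier N \<Longrightarrow> f x y \<in> carrier X" "t \<in> carrier (tensor M N)"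
  shows "tlift X f t \<in> carrier X"
  unfolding tlift_lc
  by (rule linear_mapD(1)[OF lc_linear[OF kX, of _ "carrier M \<times> carrier N"]])
    (use assms(1) tensor_rep[OF assms(2)] in auto)

lemma tlift_cong:
  assumes "\<And>x y. x \<in> carrier M \<Longrightarrow> y \<in> carrier N \<Longrightarrow> f x y \<in> carrier X"
    and "\<And>x y. x \<in> carrier M \<Longrightarrow> y \<in> carrier N \<Longrightarrow> f x y = g x y" "t \<in> carrier (tensor M N)"
  shows "tlift X f t = tlift X g t"
  unfolding tlift_lc
  by (rule lc_cong[OF kX tensor_rep[OF assms(3)]]) (auto simp: assms(2)[symmetric] intro!: assms(1))

text \<open>The tensor \<open>t\<close> is fixed, so one representative serves for all
  \<open>z\<close>, and linearity in \<open>z\<close> holds summand by summand. This provides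
  linearity in parameters before bilinearity of the lifted function is available.\<close>

lemma tlift_param:
  assumes "\<And>x y. x \<in> carrier M \<Longrightarrow> y \<in> carrier N \<Longrightarrow> linear_map L X (\<lambda>z. F z x y)"
    and "t \<in> carrier (tensor M N)" "kspace L"
  shows "linear_map L X (\<lambda>z. tlift X (F z) t)"
  unfolding tlift_lc
  by (rule lc_linear_param[OF kX _ tensor_rep[OF assms(2)] assms(3)]) (auto intro!: assms(1))

end

lemma tlift_post:
  assumes "linear_map X Y h" "kspace X" "kspace Y"
    and "\<And>x y. x \<in> carrier M \<Longrightarrow> y \<in> carrier N \<Longrightarrow> f x y \<in> carrier X" "t \<in> carrier (tensor M N)"
  shows "h (tlift X f t) = tlift Y (\<lambda>x y. h (f x y)) t"
  unfolding tlift_lc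
  by (rule linear_lc[OF assms(1-3) _ tensor_rep[OF kspace_base_field assms(5)]]) (auto intro!: assms(4))

end

text \<open>Products on tensor products are nested lifts. Linearity in the tensor being lifted comes
  from bilinearity of the function, linearity in the other tensor from
  \<open>tlift_param\<close>.\<close>

lemma tlift_tlift_bilin:
  assumes "kspace M" "kspace N" "kspace M'" "kspace N'" "kspace X"
    and "\<And>x y. x \<in> carrier M \<Longrightarrow> y \<in> carrier N \<Longrightarrow> bilin M' N' X (F x y)"
    and "\<And>x y. x \<in> carrier M' \<Longrightarrow> y \<in> carrier N' \<Longrightarrow> bilin M N X (\<lambda>a b. F a b x y)"
  shows "bilin (tensor M N) (tensor M' N') X (\<lambda>s t. tlift X (\<lambda>a b. tlift X (F a b) t) s)"
proof -
  have 1: "bilin M N X (\<lambda>a b. tlift X (F a b) t)" if "t \<in> carrier (tensor M' N')" for t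
    by (intro bilinI tlift_param[OF assms(3-5) _ that])
      (use assms(1,2,7) in \<open>auto dest: bilinD\<close>)
  show ?thesis
  proof (rule bilinI)
    show "linear_map (tensor M N) X (\<lambda>s. tlift X (\<lambda>a b. tlift X (F a b) t) s)"
      if "t \<in> carrier (tensor M' N')" for t by (rule tlift_linear[OF assms(1,2,5) 1[OF that]])
    show "linear_map (tensor M' N') X (\<lambda>t. tlift X (\<lambda>a b. tlift X (F a b) t) s)"
      if s: "s \<in> carrier (tensor M N)" for s
      by (rule tlift_param[OF assms(1,2,5) _ s kspace_tensor[OF assms(3,4)]])
        (rule tlift_linear[OF assms(3-5) assms(6)])
  qed
qed

text \<open>One vector space occurs under several record types: a tensor product and the biproduct
  on it, a quotient and the Nichols algebra on it. Spans, linearity and tensor products depend only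
  on these four components, so facts transfer by equality instead of along isomorphisms.\<close>

definition same_space :: "('k, 'a, 'e) module_scheme \<Rightarrow> ('k, 'a, 'f) module_scheme \<Rightarrow> bool" where
  "same_space M N \<longleftrightarrow> carrier M = carrier N \<and> add M = add N \<and> zero M = zero N \<and> smult M = smult N"

lemma same_space_sym: "same_space M N \<Longrightarrow> same_space N M"
  by (simp add: same_space_def)

lemma same_space_refl: "same_space M M"
  by (simp add: same_space_def)

lemma kspace_same:
  assumes "same_space M N" "kspace M"
  shows "kspace N"
proof -
  have e: "carrier N = carrier M" "add N = add M" "zero N = zero M" "smult N = smult M"
    using assms(1) by (simp_all add: same_space_def)
  note k = assms(2)
  show ?thesis
  proof (rule kspaceI)
    show "abelian_group N"
    proof (rule abelian_groupI)
      fix x assume "x \<in> carrier N"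
      then show "\<exists>y\<in>carrier N. y \<oplus>\<^bsub>N\<^esub> x = \<zero>\<^bsub>N\<^esub>"
        unfolding e by (intro bexI[of _ "\<ominus>\<^bsub>M\<^esub> x"])
          (use k in \<open>simp_all add: ks_uminus abelian_group.l_neg kspace_abelian_group\<close>)
    next
      fix x y assume "x \<in> carrier N" "y \<in> carrier N"
      then show "x \<oplus>\<^bsub>N\<^esub> y = y \<oplus>\<^bsub>N\<^esub> x" unfolding e using k by (simp add: ks_add_comm)
    qed (use k in \<open>simp_all add: e ks_simps ks_add_assoc\<close>)
  qed (use k in \<open>simp_all add: e ks_simps ks_smul_ladd ks_smul_radd ks_smul_smul\<close>)
qed

lemma linear_map_same:
  "same_space M M' \<Longrightarrow> same_space N N' \<Longrightarrow> linear_map M N f \<longleftrightarrow> linear_map M' N' f"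
  by (simp add: same_space_def linear_map_def)

lemma bilin_same:
  assumes "same_space M M'" "same_space N N'" "same_space X X'"
  shows "bilin M N X f \<longleftrightarrow> bilin M' N' X' f"
  unfolding bilin_def linear_map_same[OF assms(1,3)] linear_map_same[OF assms(2,3)]
  using assms(1,2) by (simp add: same_space_def)

lemma lspan_same_subset:
  fixes M :: "('k::field, 'a, 'e) module_scheme" and N :: "('k, 'a, 'f) module_scheme"
  assumes "same_space M N" "x \<in> lspan M S"
  shows "x \<in> lspan N S"
proof -
  have e: "add M = add N" "zero M = zero N" "smult M = smult N" using assms(1) by (simp_all add: same_space_def)
  show ?thesis
    using assms(2) by induction (simp_all add: e lspan_zero lspan_gen lspan_add lspan_smul)
qed

lemma lspan_same:
  fixes M :: "('k::field, 'a, 'e) module_scheme" and N :: "('k, 'a, 'f) module_scheme"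
  assumes "same_space M N"
  shows "lspan M S = lspan N S"
  using lspan_same_subset[OF assms] lspan_same_subset[OF same_space_sym[OF assms]] by blast

lemma spans_same: "same_space M N \<Longrightarrow> spans M S \<longleftrightarrow> spans N S"
  unfolding spans_def by (simp add: lspan_same) (simp add: same_space_def)

lemma a_r_coset_same: "same_space M N \<Longrightarrow> I +>\<^bsub>M\<^esub> x = I +>\<^bsub>N\<^esub> x"
  by (simp add: same_space_def a_r_coset_def r_coset_def)

lemma tensor_same:
  assumes "same_space M M'" "same_space N N'"
  shows "tensor M N = tensor M' N'" "tpure M N = tpure M' N'"
  using assms by (auto simp: tensor_def tpure_def tensor_null_def tensor_relators_def same_space_def fun_eq_iff)

lemma a_minus_same: "same_space M N \<Longrightarrow> x \<ominus>\<^bsub>M\<^esub> y = x \<ominus>\<^bsub>N\<^esub> y"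
  by (simp add: same_space_def a_minus_def a_inv_def m_inv_def)

lemma submodule_same:
  assumes "same_space M N" "kspace M" "submodule I (base_field :: ('k::field, 'k) module) M"
  shows "submodule I (base_field :: ('k::field, 'k) module) N"
  using submoduleD[OF assms(3,2)] assms(1)
  by (intro submoduleI'[OF kspace_same[OF assms(1,2)]]) (simp_all add: same_space_def)

lemma tensor_mult_bilin:
  assumes kA: "kspace A" and kB: "kspace B" and mA: "bilin A A A (\<otimes>\<^bsub>A\<^esub>)" and mB: "bilin B B B (\<otimes>\<^bsub>B\<^esub>)"
  shows "bilin (tensor A B) (tensor A B) (tensor A B) (tensor_mult A B)"
  unfolding tensor_mult_def[abs_def]
  by (rule tlift_tlift_bilin[OF kA kB kA kB kspace_tensor[OF kA kB]];
      rule bilin_comp[OF tpure_bilin[OF kA kB]]) (auto intro: bilinD[OF mA] bilinD[OF mB])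

lemma tensor_mult_tpure:
  assumes kA: "kspace A" and kB: "kspace B" and mA: "bilin A A A (\<otimes>\<^bsub>A\<^esub>)" and mB: "bilin B B B (\<otimes>\<^bsub>B\<^esub>)"
    and c: "a \<in> carrier A" "a' \<in> carrier A" "b \<in> carrier B" "b' \<in> carrier B"
  shows "tensor_mult A B (tpure A B a b) (tpure A B a' b') = tpure A B (a \<otimes>\<^bsub>A\<^esub> a') (b \<otimes>\<^bsub>B\<^esub> b')"
proof -
  let ?F = "\<lambda>a b a' b'. tpure A B (a \<otimes>\<^bsub>A\<^esub> a') (b \<otimes>\<^bsub>B\<^esub> b')"
  note k = kspace_tensor[OF kA kB]
  have 1: "bilin A B (tensor A B) (?F a b)" if "a \<in> carrier A" "b \<in> carrier B" for a b
    by (rule bilin_comp[OF tpure_bilin[OF kA kB]]) (use that in \<open>auto intro: bilinD[OF mA] bilinD[OF mB]\<close>)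
  have 2: "bilin A B (tensor A B) (\<lambda>a b. ?F a b a' b')"
    by (rule bilin_comp[OF tpure_bilin[OF kA kB]]) (use c in \<open>auto intro: bilinD[OF mA] bilinD[OF mB]\<close>)
  \<comment> \<open>Evaluating the outer lift requires bilinearity of the inner lift in
    \<open>a\<close> and \<open>b\<close>; once that inner lift is evaluated it becomes the function
    of \<open>2\<close>.\<close>
  have 3: "bilin A B (tensor A B) (\<lambda>a b. tlift (tensor A B) (?F a b) (tpure A B a' b'))"
    by (rule bilin_cong[OF 2 _ kA kB]) (simp add: tlift_tpure[OF kA kB k 1] c)
  show ?thesis
    unfolding tensor_mult_def by (simp add: tlift_tpure[OF kA kB k 3] tlift_tpure[OF kA kB k 1] c)
qed

section \<open>Linear forms\<close>

lemma dual_simps: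
  "carrier (dual M) = {p \<in> extensional (carrier M). linear_map M base_field p}"
  "\<zero>\<^bsub>dual M\<^esub> = (\<lambda>x\<in>carrier M. 0)" "p \<oplus>\<^bsub>dual M\<^esub> q = (\<lambda>x\<in>carrier M. p x + q x)"
  "c \<odot>\<^bsub>dual M\<^esub> p = (\<lambda>x\<in>carrier M. c * p x)"
  by (simp_all add: dual_def)

lemma linear_map_restrict:
  "kspace M \<Longrightarrow> linear_map M N (\<lambda>x\<in>carrier M. f x) \<longleftrightarrow> linear_map M N f"
  by (auto simp: linear_map_def ks_add ks_smul Pi_iff)

lemma kspace_dual:
  assumes "kspace M" shows "kspace (dual M)"
proof (rule kspaceI)
  show "abelian_group (dual M)"
  proof (rule abelian_groupI)
    fix p assume p: "p \<in> carrier (dual M)"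
    have "linear_map M base_field (\<lambda>x. - 1 * p x)"
      by (rule linear_map_times_left) (use p in \<open>simp add: dual_simps\<close>)
    then have "(\<lambda>x\<in>carrier M. - 1 * p x) \<in> carrier (dual M)"
      using assms by (simp only: dual_simps mem_Collect_eq restrict_extensional linear_map_restrict simp_thms)
    moreover have "(\<lambda>x\<in>carrier M. - 1 * p x) \<oplus>\<^bsub>dual M\<^esub> p = \<zero>\<^bsub>dual M\<^esub>"
      by (auto simp: dual_simps)
    ultimately show "\<exists>q\<in>carrier (dual M). q \<oplus>\<^bsub>dual M\<^esub> p = \<zero>\<^bsub>dual M\<^esub>" by blast
  next
    fix p q assume "p \<in> carrier (dual M)" "q \<in> carrier (dual M)"
    then show "p \<oplus>\<^bsub>dual M\<^esub> q \<in> carrier (dual M)" "p \<oplus>\<^bsub>dual M\<^esub> q = q \<oplus>\<^bsub>dual M\<^esub> p"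
      using assms by (simp_all add: dual_simps linear_map_restrict linear_map_plus add.commute)
  next
    show "\<zero>\<^bsub>dual M\<^esub> \<in> carrier (dual M)"
      using assms linear_map_const_zero[OF kspace_base_field, of M] by (simp add: dual_simps linear_map_restrict)
  next
    fix p assume "p \<in> carrier (dual M)"
    then show "\<zero>\<^bsub>dual M\<^esub> \<oplus>\<^bsub>dual M\<^esub> p = p"
      by (intro extensionalityI[of _ "carrier M"]) (simp_all add: dual_simps)
  next
    fix p q r :: "'b \<Rightarrow> 'a"
    show "p \<oplus>\<^bsub>dual M\<^esub> q \<oplus>\<^bsub>dual M\<^esub> r = p \<oplus>\<^bsub>dual M\<^esub> (q \<oplus>\<^bsub>dual M\<^esub> r)"
      by (intro extensionalityI[of _ "carrier M"]) (simp_all add: dual_simps)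
  qed
next
  fix c and p assume p: "p \<in> carrier (dual M)"
  then show "c \<odot>\<^bsub>dual M\<^esub> p \<in> carrier (dual M)"
    using assms by (simp add: dual_simps linear_map_restrict linear_map_times_left)
  show "1 \<odot>\<^bsub>dual M\<^esub> p = p"
    using p by (intro extensionalityI[of _ "carrier M"]) (simp_all add: dual_simps)
qed (rule extensionalityI[of _ "carrier M"], simp_all add: dual_simps algebra_simps)+

text \<open>A linear map into the dual space combines two things: extensionality in each argument,
  which lets forms be compared pointwise, and bilinearity on the carriers. The proofs treat them
  separately.\<close>

lemma bilinear_form_iff:
  assumes "kspace U" "kspace V"
  shows "bilinear_form U V \<beta> \<longleftrightarrow> \<beta> \<in> extensional (carrier U) \<and> (\<forall>u\<in>carrier U. \<beta> u \<in> extensional (carrier V))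
    \<and> bilin U V base_field \<beta>" (is "?L \<longleftrightarrow> ?R")
proof
  assume L: ?L
  then have lin: "linear_map U (dual V) \<beta>" by (simp add: bilinear_form_def)
  have "bilin U V base_field \<beta>"
  proof (rule bilinI)
    show "linear_map V base_field (\<lambda>y. \<beta> x y)" if "x \<in> carrier U" for x
      using linear_mapD(1)[OF lin that] by (simp add: dual_simps)
    show "linear_map U base_field (\<lambda>x. \<beta> x y)" if "y \<in> carrier V" for y
      using that by (intro linear_mapI) (simp_all add: linear_mapD(2,3)[OF lin] dual_simps)
  qed
  then show ?R using L linear_mapD(1)[OF lin] by (auto simp: bilinear_form_def dual_simps)
next
  assume R: ?R
  then have b: "bilin U V base_field \<beta>" by simp
  have "linear_map U (dual V) \<beta>"
  proof (rule linear_mapI)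
    show "\<beta> x \<in> carrier (dual V)" if "x \<in> carrier U" for x
      using R bilinD(1)[OF b that] that by (simp add: dual_simps)
    fix x y assume xy: "x \<in> carrier U" "y \<in> carrier U"
    show "\<beta> (x \<oplus>\<^bsub>U\<^esub> y) = \<beta> x \<oplus>\<^bsub>dual V\<^esub> \<beta> y"
      by (rule extensionalityI[of _ "carrier V"])
        (use R xy assms in \<open>simp_all add: dual_simps ks_add linear_mapD(2)[OF bilinD(2)[OF b]]\<close>)
  next
    fix c x assume x: "x \<in> carrier U"
    show "\<beta> (c \<odot>\<^bsub>U\<^esub> x) = c \<odot>\<^bsub>dual V\<^esub> \<beta> x"
      by (rule extensionalityI[of _ "carrier V"])
        (use R x assms in \<open>simp_all add: dual_simps ks_smul linear_mapD(3)[OF bilinD(2)[OF b]]\<close>)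
  qed
  then show ?L using R by (simp add: bilinear_form_def)
qed

section \<open>Group algebras\<close>

lemma finsum_eq_sum:
  assumes "kspace (X :: ('k::field, 'a::comm_monoid_add, 'e) module_scheme)" "carrier X = UNIV"
    "\<And>x y. x \<oplus>\<^bsub>X\<^esub> y = x + y" "\<zero>\<^bsub>X\<^esub> = 0"
  shows "finsum X f A = sum f A"
proof -
  interpret X: module "base_field :: ('k, 'k) module" X by (rule assms(1))
  show ?thesis by (induction A rule: infinite_finite_induct) (simp_all add: assms(2-4))
qed

lemma group_algebra_simps:
  "carrier (group_algebra :: ('k::field, 'g::ab_group_add \<Rightarrow>\<^sub>0 'k) hopf) = UNIV"
  "x \<otimes>\<^bsub>group_algebra :: ('k, 'g \<Rightarrow>\<^sub>0 'k) hopf\<^esub> y = x * y"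
  "\<one>\<^bsub>group_algebra :: ('k, 'g \<Rightarrow>\<^sub>0 'k) hopf\<^esub> = 1"
  "\<zero>\<^bsub>group_algebra :: ('k, 'g \<Rightarrow>\<^sub>0 'k) hopf\<^esub> = 0"
  "x \<oplus>\<^bsub>group_algebra :: ('k, 'g \<Rightarrow>\<^sub>0 'k) hopf\<^esub> y = x + y"
  "c \<odot>\<^bsub>group_algebra :: ('k, 'g \<Rightarrow>\<^sub>0 'k) hopf\<^esub> x = pm_scale c x"
  by (simp_all add: group_algebra_def Let_def)

lemma gelt_zero: "gelt 0 = 1"
  by (simp add: gelt_def)

lemma gelt_mult: "gelt g * gelt h = gelt (g + h)"
  by (simp add: gelt_def mult_single)

lemma pm_scale_eq_mult: "pm_scale c x = Poly_Mapping.single 0 c * (x :: 'g::ab_group_add \<Rightarrow>\<^sub>0 'k::field)"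
proof -
  have "Poly_Mapping.keys x \<subseteq> UNIV" by simp
  then show ?thesis
  proof (induction x rule: pm_induct)
    case zero then show ?case by (auto intro!: poly_mapping_eqI)
  next
    case (add x y)
    have "pm_scale c (x + y) = pm_scale c x + pm_scale c y"
      by (rule poly_mapping_eqI) (simp add: lookup_add algebra_simps)
    with add show ?case by (simp add: algebra_simps)
  qed (simp add: mult_single)
qed

context
  fixes H :: "('k::field, 'g::ab_group_add \<Rightarrow>\<^sub>0 'k) hopf"
  assumes H: "H = group_algebra"
begin

lemmas ga_simps = group_algebra_simps[where 'k = 'k and 'g = 'g, folded H]

lemma group_algebra_same: "same_space (free_space UNIV) H"
  by (simp add: same_space_def ga_simps fun_eq_iff)

lemma kspace_group_algebra: "kspace H"
  by (rule kspace_same[OF group_algebra_same kspace_free_space])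

lemma spans_group_algebra: "spans H (range gelt)"
  unfolding spans_same[OF group_algebra_same, symmetric] gelt_def by (rule spans_free_space)

lemma group_algebra_lc_linear:
  "kspace X \<Longrightarrow> range f \<subseteq> carrier X \<Longrightarrow> linear_map H X (lc X f)"
  unfolding linear_map_same[OF group_algebra_same same_space_refl, symmetric]
  by (rule lc_linear) auto

lemma group_algebra_lc_gelt: "kspace X \<Longrightarrow> f g \<in> carrier X \<Longrightarrow> lc X f (gelt g) = f g"
  unfolding gelt_def by (rule lc_single)

lemma group_algebra_ring: "ring H"
proof (rule ringI)
  show "abelian_group H" using kspace_group_algebra by (rule kspace_abelian_group)
  show "Group.monoid H" by (rule monoidI) (simp_all add: ga_simps mult.assoc)
qed (simp_all add: ga_simps algebra_simps)

lemma group_algebra_k_algebra: "k_algebra H"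
  unfolding k_algebra_def using kspace_group_algebra group_algebra_ring
  by (simp add: ga_simps pm_scale_eq_mult algebra_simps)

lemma group_algebra_mult_bilin: "bilin H H H (\<otimes>\<^bsub>H\<^esub>)"
  by (intro bilinI linear_mapI) (simp_all add: ga_simps pm_scale_eq_mult algebra_simps)

lemma group_algebra_comult: "comult H x = lc (tensor H H) (\<lambda>g. tpure H H (gelt g) (gelt g)) x"
proof -
  \<comment> \<open>The definition of \<open>group_algebra\<close> forms its tensor square over this
    bare record. The underlying space is that of \<open>H\<close>, hence the tensor square is the
    same.\<close>
  define A :: "('k, 'g \<Rightarrow>\<^sub>0 'k) module" where
    "A = \<lparr>carrier = UNIV, mult = (*), one = 1, zero = 0, add = (+), smult = pm_scale\<rparr>"
  have A: "same_space A H" by (simp add: same_space_def ga_simps A_def fun_eq_iff)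
  show ?thesis unfolding tensor_same[OF A A, symmetric]
    by (simp add: H group_algebra_def Let_def A_def lc_def gelt_def)
qed

lemma group_algebra_counit: "counit H x = lc base_field (\<lambda>g. 1) x"
  by (simp add: H group_algebra_def Let_def lc_def finsum_base_field)

lemma group_algebra_antipode: "antipode H x = lc H (\<lambda>g. gelt (- g)) x"
  by (subst lc_def, subst finsum_eq_sum[OF kspace_group_algebra])
    (simp_all add: ga_simps, simp add: H group_algebra_def Let_def gelt_def)

lemma ga_tpure_closed: "tpure H H x y \<in> carrier (tensor H H)"
  by (rule tpure_closed[OF kspace_group_algebra kspace_group_algebra]) (simp_all add: ga_simps)

lemma comult_linear: "linear_map H (tensor H H) (comult H)"
  unfolding group_algebra_comult[abs_def]
  by (rule group_algebra_lc_linear) (auto simp: kspace_tensor kspace_group_algebra ga_tpure_closed)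

lemma counit_linear: "linear_map H base_field (counit H)"
  unfolding group_algebra_counit[abs_def]
  by (rule group_algebra_lc_linear) (auto simp: kspace_base_field)

lemma antipode_linear: "linear_map H H (antipode H)"
  unfolding group_algebra_antipode[abs_def]
  by (rule group_algebra_lc_linear) (auto simp: kspace_group_algebra ga_simps)

lemma comult_gelt: "comult H (gelt g) = tpure H H (gelt g) (gelt g)"
  by (simp add: group_algebra_comult group_algebra_lc_gelt kspace_tensor kspace_group_algebra ga_tpure_closed)

lemma counit_gelt: "counit H (gelt g) = 1"
  by (simp add: group_algebra_counit group_algebra_lc_gelt kspace_base_field)

lemma antipode_gelt: "antipode H (gelt g) = gelt (- g)"
  by (simp add: group_algebra_antipode group_algebra_lc_gelt kspace_group_algebra ga_simps)

lemma comult_closed: "comult H h \<in> carrier (tensor H H)"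
  by (rule linear_mapD(1)[OF comult_linear]) (simp add: ga_simps)

lemma tlift_comult_linear:
  "kspace X \<Longrightarrow> bilin H H X F \<Longrightarrow> linear_map H X (\<lambda>h. tlift X F (comult H h))"
  by (rule linear_map_comp[OF tlift_linear comult_linear]) (simp_all add: kspace_group_algebra)

lemma tlift_comult_gelt:
  "kspace X \<Longrightarrow> bilin H H X F \<Longrightarrow> tlift X F (comult H (gelt g)) = F (gelt g) (gelt g)"
  by (simp add: comult_gelt tlift_tpure kspace_group_algebra ga_simps)

lemma tlift_comult:
  assumes "kspace X" "bilin H H X F"
  shows "tlift X F (comult H h) = lc X (\<lambda>g. F (gelt g) (gelt g)) h"
proof (rule linear_eq_on_span[OF tlift_comult_linear[OF assms] _ spans_group_algebra kspace_group_algebra assms(1)])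
  have c: "F (gelt g) (gelt g) \<in> carrier X" for g by (rule bilinD(3)[OF assms(2)]) (simp_all add: ga_simps)
  then show "linear_map H X (lc X (\<lambda>g. F (gelt g) (gelt g)))"
    by (intro group_algebra_lc_linear assms) auto
  show "tlift X F (comult H s) = lc X (\<lambda>g. F (gelt g) (gelt g)) s" if "s \<in> range gelt" for s
    using that c by (auto simp: tlift_comult_gelt assms group_algebra_lc_gelt)
qed (simp add: ga_simps)

lemma group_algebra_coalgebra: "coalgebra H"
proof -
  let ?T = "tensor H (tensor H H)"
  note k = kspace_group_algebra kspace_tensor[OF kspace_group_algebra kspace_group_algebra]
    kspace_tensor[OF kspace_group_algebra kspace_tensor[OF kspace_group_algebra kspace_group_algebra]]
  note p = tpure_bilin[OF k(1,1)] tpure_bilin[OF k(1,2)]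
  have b3: "bilin H H ?T (\<lambda>a1 a2. tpure H (tensor H H) a1 (tpure H H a2 b))" for b
    by (rule bilin_comp[OF p(2) linear_map_id bilinD(2)[OF p(1)]]) (simp add: ga_simps)
  have b1: "bilin H H ?T (\<lambda>a b. tlift ?T (\<lambda>a1 a2. tpure H (tensor H H) a1 (tpure H H a2 b)) (comult H a))"
  proof (rule bilinI)
    show "linear_map H ?T (\<lambda>a. tlift ?T (\<lambda>a1 a2. tpure H (tensor H H) a1 (tpure H H a2 b)) (comult H a))" for b
      by (rule tlift_comult_linear[OF k(3) b3])
    show "linear_map H ?T (\<lambda>b. tlift ?T (\<lambda>a1 a2. tpure H (tensor H H) a1 (tpure H H a2 b)) (comult H a))" for a
      by (rule tlift_param[OF k(1,1,3) _ comult_closed k(1)])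
        (rule bilin_right[OF p(2) _ bilinD(1)[OF p(1)]], simp_all)
  qed
  have b2: "bilin H H ?T (\<lambda>a b. tpure H (tensor H H) a (comult H b))"
    by (rule bilin_comp[OF p(2) linear_map_id comult_linear])
  have e1: "bilin H H H (\<lambda>a b. counit H a \<odot>\<^bsub>H\<^esub> b)"
    by (rule bilin_smul[OF k(1) counit_linear linear_map_id])
  have e2: "bilin H H H (\<lambda>a b. counit H b \<odot>\<^bsub>H\<^esub> a)"
    by (rule bilin_smul'[OF k(1) linear_map_id counit_linear])
  have "tlift ?T (\<lambda>a b. tlift ?T (\<lambda>a1 a2. tpure H (tensor H H) a1 (tpure H H a2 b)) (comult H a)) (comult H c)
      = tlift ?T (\<lambda>a b. tpure H (tensor H H) a (comult H b)) (comult H c)" for c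
    by (rule linear_eq_on_span[OF tlift_comult_linear[OF k(3) b1] tlift_comult_linear[OF k(3) b2]
          spans_group_algebra k(1,3)])
      (erule rangeE, simp only: tlift_comult_gelt[OF k(3) b1] tlift_comult_gelt[OF k(3) b2]
        tlift_comult_gelt[OF k(3) b3], simp_all add: comult_gelt ga_simps)
  moreover have "tlift H (\<lambda>a b. counit H a \<odot>\<^bsub>H\<^esub> b) (comult H c) = c" for c
    by (rule linear_eq_on_span[OF tlift_comult_linear[OF k(1) e1] linear_map_id spans_group_algebra k(1,1)])
      (auto simp: tlift_comult_gelt[OF k(1) e1] counit_gelt ks_smul_one k(1) ga_simps(1))
  moreover have "tlift H (\<lambda>a b. counit H b \<odot>\<^bsub>H\<^esub> a) (comult H c) = c" for c
    by (rule linear_eq_on_span[OF tlift_comult_linear[OF k(1) e2] linear_map_id spans_group_algebra k(1,1)])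
      (auto simp: tlift_comult_gelt[OF k(1) e2] counit_gelt ks_smul_one k(1) ga_simps(1))
  ultimately show ?thesis unfolding coalgebra_def using k(1) comult_linear counit_linear by blast
qed

lemma group_algebra_bialgebra: "bialgebra H"
proof -
  note k = kspace_group_algebra kspace_tensor[OF kspace_group_algebra kspace_group_algebra]
  note m = group_algebra_mult_bilin
  have c: "x \<in> carrier H" for x by (simp add: ga_simps)
  have tm: "bilin (tensor H H) (tensor H H) (tensor H H) (tensor_mult H H)"
    by (rule tensor_mult_bilin[OF k(1,1) m m])
  have tmp: "tensor_mult H H (tpure H H a b) (tpure H H a' b') = tpure H H (a \<otimes>\<^bsub>H\<^esub> a') (b \<otimes>\<^bsub>H\<^esub> b')" for a b a' b'
    by (rule tensor_mult_tpure[OF k(1,1) m m c c c c])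
  have "counit H (x \<otimes>\<^bsub>H\<^esub> y) = counit H x * counit H y" for x y
    by (rule bilin_eq_on_span[OF bilin_post[OF counit_linear m] bilin_times[OF counit_linear counit_linear]
          spans_group_algebra spans_group_algebra k(1,1) kspace_base_field])
      (auto simp: ga_simps gelt_mult counit_gelt)
  moreover have "comult H (x \<otimes>\<^bsub>H\<^esub> y) = tensor_mult H H (comult H x) (comult H y)" for x y
    by (rule bilin_eq_on_span[OF bilin_post[OF comult_linear m] bilin_comp[OF tm comult_linear comult_linear]
          spans_group_algebra spans_group_algebra k(1,1,2)])
      (auto simp: comult_gelt tmp, auto simp: ga_simps gelt_mult comult_gelt)
  moreover have "counit H \<one>\<^bsub>H\<^esub> = 1" "comult H \<one>\<^bsub>H\<^esub> = tpure H H \<one>\<^bsub>H\<^esub> \<one>\<^bsub>H\<^esub>"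
    using counit_gelt[of 0] comult_gelt[of 0] by (simp_all add: gelt_zero ga_simps)
  ultimately show ?thesis
    unfolding bialgebra_def algebra_map_def
    using group_algebra_k_algebra group_algebra_coalgebra counit_linear by simp
qed

lemma group_algebra_hopf: "hopf_algebra H"
proof -
  note k = kspace_group_algebra
  note m = group_algebra_mult_bilin
  have b: "bilin H H H (\<lambda>a b. antipode H a \<otimes>\<^bsub>H\<^esub> b)" "bilin H H H (\<lambda>a b. a \<otimes>\<^bsub>H\<^esub> antipode H b)"
    by (rule bilin_comp[OF m antipode_linear linear_map_id], rule bilin_comp[OF m linear_map_id antipode_linear])
  have c: "linear_map H H (\<lambda>h. counit H h \<odot>\<^bsub>H\<^esub> \<one>\<^bsub>H\<^esub>)"
    by (rule linear_map_smul_const[OF k counit_linear]) (simp add: ga_simps)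
  have "tlift H (\<lambda>a b. antipode H a \<otimes>\<^bsub>H\<^esub> b) (comult H h) = counit H h \<odot>\<^bsub>H\<^esub> \<one>\<^bsub>H\<^esub>" for h
    by (rule linear_eq_on_span[OF tlift_comult_linear[OF k b(1)] c spans_group_algebra k k])
      (erule rangeE, simp only: tlift_comult_gelt[OF k b(1)],
       simp_all add: antipode_gelt counit_gelt ga_simps gelt_mult gelt_zero pm_scale_eq_mult)
  moreover have "tlift H (\<lambda>a b. a \<otimes>\<^bsub>H\<^esub> antipode H b) (comult H h) = counit H h \<odot>\<^bsub>H\<^esub> \<one>\<^bsub>H\<^esub>" for h
    by (rule linear_eq_on_span[OF tlift_comult_linear[OF k b(2)] c spans_group_algebra k k])
      (erule rangeE, simp only: tlift_comult_gelt[OF k b(2)],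
       simp_all add: antipode_gelt counit_gelt ga_simps gelt_mult gelt_zero pm_scale_eq_mult)
  ultimately show ?thesis
    unfolding hopf_algebra_def using group_algebra_bialgebra antipode_linear by blast
qed

lemma antipode_antipode: "antipode H (antipode H h) = h"
  by (rule linear_eq_on_span[OF linear_map_comp[OF antipode_linear antipode_linear] linear_map_id
        spans_group_algebra kspace_group_algebra kspace_group_algebra])
    (auto simp: antipode_gelt ga_simps)

lemma antipode_bij: "bij_betw (antipode H) (carrier H) (carrier H)"
  unfolding ga_simps(1) by (rule o_bij[of "antipode H"]) (simp_all add: fun_eq_iff antipode_antipode)

lemma antipode_inv_eq: "antipode_inv H h = antipode H h"
  unfolding antipode_inv_def ga_simps(1)
  by (rule inv_f_eq) (use antipode_bij in \<open>simp_all add: bij_betw_def ga_simps(1) antipode_antipode\<close>)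

end

lemma characters_uminus: "\<chi> \<in> characters \<Longrightarrow> \<chi> (- h) = inverse (\<chi> h :: 'k::field)"
proof -
  assume a: "\<chi> \<in> characters"
  then have "\<chi> (- h + h) = \<chi> (- h) * \<chi> h" by (simp only: characters_def mem_Collect_eq)
  then have "\<chi> (- h) * \<chi> h = 1" using a by (simp add: characters_def)
  then show ?thesis by (metis inverse_unique mult.commute)
qed

text \<open>Group elements are group-like, so on them (A.1) and (A.3) say that \<phi> is
  multiplicative in its second and in its first argument. The reversal in (A.1) is invisible because
  both factors of the coproduct coincide.\<close>

lemma cond_A_group_algebra:
  fixes K :: "('k::field, 'l::ab_group_add \<Rightarrow>\<^sub>0 'k) hopf" and H :: "('k, 'g::ab_group_add \<Rightarrow>\<^sub>0 'k) hopf"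
  assumes K: "K = group_algebra" and H: "H = group_algebra"
    and \<tau>: "bilin K H base_field \<tau>" "\<And>y h. \<tau> (gelt y) (gelt h) = \<phi> y h"
    and \<phi>: "\<And>y. \<phi> y \<in> characters" "\<And>y y' h. \<phi> (y + y') h = \<phi> y h * \<phi> y' h"
  shows "cond_A K H \<tau>"
proof -
  note kK = kspace_group_algebra[OF K] and kH = kspace_group_algebra[OF H] and kB = kspace_base_field
  note l = bilinD(1)[OF \<tau>(1)] and r = bilinD(2)[OF \<tau>(1)]
  have c: "x \<in> carrier K" "y \<in> carrier H" for x y
    by (simp_all add: group_algebra_simps K H)
  \<comment> \<open>The value is nonzero because it divides \<phi> 0 0 = 1, and it equals its own
    square; so it is 1.\<close>
  have \<phi>0: "\<phi> 0 h = 1" for h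
  proof -
    have "\<phi> 0 (h + - h) = \<phi> 0 h * \<phi> 0 (- h)" "\<phi> 0 0 = 1"
      using \<phi>(1)[of 0] by (simp_all only: characters_def mem_Collect_eq)
    then have "\<phi> 0 h \<noteq> 0" by auto
    then show ?thesis using \<phi>(2)[of 0 0 h] by simp
  qed
  have bK: "bilin K K base_field (\<lambda>u1 u2. \<tau> u2 a * \<tau> u1 a')" for a a'
    using bilin_flip[OF bilin_times[OF r[of a] r[of a']]] c by simp
  have bH: "bilin H H base_field (\<lambda>a1 a2. \<tau> u a1 * \<tau> u' a2)" for u u'
    by (rule bilin_times) (use l c in auto)
  note tK = tlift_comult_linear[OF K kB bK] tlift_comult_gelt[OF K kB bK]
  note tH = tlift_comult_linear[OF H kB bH] tlift_comult_gelt[OF H kB bH]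
  have "\<tau> u (a \<otimes>\<^bsub>H\<^esub> a') = teval (\<lambda>u1 u2. \<tau> u2 a * \<tau> u1 a') (comult K u)" for u a a'
  proof (rule linear_eq_on_span[where f = "\<lambda>u. \<tau> u (a \<otimes>\<^bsub>H\<^esub> a')", OF r tK(1) spans_group_algebra[OF K] kK kB])
    fix s :: "'l \<Rightarrow>\<^sub>0 'k" assume "s \<in> range gelt"
    then obtain y where y: "s = gelt y" by auto
    have "\<tau> s (a \<otimes>\<^bsub>H\<^esub> a') = \<tau> s a * \<tau> s a'"
      by (rule bilin_eq_on_span[OF bilin_post[OF l group_algebra_mult_bilin[OF H]] bilin_times[OF l l]
            spans_group_algebra[OF H] spans_group_algebra[OF H] kH kH kB])
        (use \<phi>(1)[of y] in \<open>auto simp: c y \<tau>(2) group_algebra_simps H gelt_mult characters_def\<close>)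
    then show "\<tau> s (a \<otimes>\<^bsub>H\<^esub> a') = teval (\<lambda>u1 u2. \<tau> u2 a * \<tau> u1 a') (comult K s)"
      by (simp add: y tK(2))
  qed (simp_all add: c)
  moreover have "\<tau> (u \<otimes>\<^bsub>K\<^esub> u') a = teval (\<lambda>a1 a2. \<tau> u a1 * \<tau> u' a2) (comult H a)" for u u' a
  proof (rule linear_eq_on_span[where f = "\<lambda>a. \<tau> (u \<otimes>\<^bsub>K\<^esub> u') a", OF l tH(1) spans_group_algebra[OF H] kH kB])
    fix s :: "'g \<Rightarrow>\<^sub>0 'k" assume "s \<in> range gelt"
    then obtain y where y: "s = gelt y" by auto
    have "\<tau> (u \<otimes>\<^bsub>K\<^esub> u') s = \<tau> u s * \<tau> u' s"
      by (rule bilin_eq_on_span[OF bilin_post[OF r group_algebra_mult_bilin[OF K]] bilin_times[OF r r]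
            spans_group_algebra[OF K] spans_group_algebra[OF K] kK kK kB])
        (auto simp: c y \<tau>(2) group_algebra_simps K gelt_mult \<phi>)
    then show "\<tau> (u \<otimes>\<^bsub>K\<^esub> u') s = teval (\<lambda>a1 a2. \<tau> u a1 * \<tau> u' a2) (comult H s)"
      by (simp add: y tH(2))
  qed (simp_all add: c)
  moreover have "\<tau> \<one>\<^bsub>K\<^esub> a = counit H a" for a
    by (rule linear_eq_on_span[OF l counit_linear[OF H] spans_group_algebra[OF H] kH kB])
      (auto simp: c counit_gelt[OF H], simp add: K group_algebra_simps \<tau>(2) \<phi>0 flip: gelt_zero)
  moreover have "\<tau> u \<one>\<^bsub>H\<^esub> = counit K u" for u
    by (rule linear_eq_on_span[OF r counit_linear[OF K] spans_group_algebra[OF K] kK kB])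
      (use \<phi>(1) in \<open>auto simp: c counit_gelt[OF K] H group_algebra_simps \<tau>(2) characters_def simp flip: gelt_zero\<close>)
  ultimately show ?thesis by (simp add: cond_A_def)
qed

section \<open>Algebras and their quotients\<close>

lemma k_algebraD:
  assumes "k_algebra A"
  shows "kspace A" "ring A"
    "x \<in> carrier A \<Longrightarrow> y \<in> carrier A \<Longrightarrow> (c \<odot>\<^bsub>A\<^esub> x) \<otimes>\<^bsub>A\<^esub> y = c \<odot>\<^bsub>A\<^esub> (x \<otimes>\<^bsub>A\<^esub> y)"
    "x \<in> carrier A \<Longrightarrow> y \<in> carrier A \<Longrightarrow> x \<otimes>\<^bsub>A\<^esub> (c \<odot>\<^bsub>A\<^esub> y) = c \<odot>\<^bsub>A\<^esub> (x \<otimes>\<^bsub>A\<^esub> y)"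
    "x \<in> carrier A \<Longrightarrow> y \<in> carrier A \<Longrightarrow> x \<otimes>\<^bsub>A\<^esub> y \<in> carrier A" "\<one>\<^bsub>A\<^esub> \<in> carrier A"
proof -
  show kA: "kspace A" and rA: "ring A"
    and "x \<in> carrier A \<Longrightarrow> y \<in> carrier A \<Longrightarrow> (c \<odot>\<^bsub>A\<^esub> x) \<otimes>\<^bsub>A\<^esub> y = c \<odot>\<^bsub>A\<^esub> (x \<otimes>\<^bsub>A\<^esub> y)"
    and "x \<in> carrier A \<Longrightarrow> y \<in> carrier A \<Longrightarrow> x \<otimes>\<^bsub>A\<^esub> (c \<odot>\<^bsub>A\<^esub> y) = c \<odot>\<^bsub>A\<^esub> (x \<otimes>\<^bsub>A\<^esub> y)"
    using assms unfolding k_algebra_def by metis+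
  show "x \<in> carrier A \<Longrightarrow> y \<in> carrier A \<Longrightarrow> x \<otimes>\<^bsub>A\<^esub> y \<in> carrier A" "\<one>\<^bsub>A\<^esub> \<in> carrier A"
    using rA by (simp_all add: ring.ring_simprules)
qed

lemma k_algebra_mult_bilin:
  assumes "k_algebra A" shows "bilin A A A (\<otimes>\<^bsub>A\<^esub>)"
proof -
  interpret ring A by (rule k_algebraD[OF assms])
  show ?thesis
    by (intro bilinI linear_mapI) (simp_all add: k_algebraD[OF assms] l_distr r_distr)
qed

lemma k_algebraI:
  assumes "kspace A" "bilin A A A (\<otimes>\<^bsub>A\<^esub>)" "\<one>\<^bsub>A\<^esub> \<in> carrier A"
    and "\<And>x y w. x \<in> carrier A \<Longrightarrow> y \<in> carrier A \<Longrightarrow> w \<in> carrier A \<Longrightarrow>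
      (x \<otimes>\<^bsub>A\<^esub> y) \<otimes>\<^bsub>A\<^esub> w = x \<otimes>\<^bsub>A\<^esub> (y \<otimes>\<^bsub>A\<^esub> w)"
    and "\<And>x. x \<in> carrier A \<Longrightarrow> \<one>\<^bsub>A\<^esub> \<otimes>\<^bsub>A\<^esub> x = x" "\<And>x. x \<in> carrier A \<Longrightarrow> x \<otimes>\<^bsub>A\<^esub> \<one>\<^bsub>A\<^esub> = x"
  shows "k_algebra A"
proof -
  note l = linear_mapD[OF bilinD(1)[OF assms(2)]] and r = linear_mapD[OF bilinD(2)[OF assms(2)]]
  have "ring A"
  proof (rule ringI)
    show "abelian_group A" using assms(1) by (rule kspace_abelian_group)
    show "Group.monoid A" by (rule monoidI) (simp_all add: assms(3-) l)
  qed (simp_all add: l r)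
  then show ?thesis by (simp add: k_algebra_def assms(1) l r)
qed

lemma k_algebraI_span:
  assumes kA: "kspace A" and m: "bilin A A A (\<otimes>\<^bsub>A\<^esub>)" and one: "\<one>\<^bsub>A\<^esub> \<in> carrier A" and S: "spans A S"
    and assoc: "\<And>x y w. x \<in> S \<Longrightarrow> y \<in> S \<Longrightarrow> w \<in> S \<Longrightarrow> (x \<otimes>\<^bsub>A\<^esub> y) \<otimes>\<^bsub>A\<^esub> w = x \<otimes>\<^bsub>A\<^esub> (y \<otimes>\<^bsub>A\<^esub> w)"
    and unit: "\<And>x. x \<in> S \<Longrightarrow> \<one>\<^bsub>A\<^esub> \<otimes>\<^bsub>A\<^esub> x = x" "\<And>x. x \<in> S \<Longrightarrow> x \<otimes>\<^bsub>A\<^esub> \<one>\<^bsub>A\<^esub> = x"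
  shows "k_algebra A"
proof (rule k_algebraI[OF kA m one])
  have SA: "s \<in> carrier A" if "s \<in> S" for s using S that by (auto simp: spans_def)
  show "(x \<otimes>\<^bsub>A\<^esub> y) \<otimes>\<^bsub>A\<^esub> w = x \<otimes>\<^bsub>A\<^esub> (y \<otimes>\<^bsub>A\<^esub> w)"
    if c: "x \<in> carrier A" "y \<in> carrier A" "w \<in> carrier A" for x y w
  proof (rule linear_eq_on_span[where f = "\<lambda>x. (x \<otimes>\<^bsub>A\<^esub> y) \<otimes>\<^bsub>A\<^esub> w" and g = "\<lambda>x. x \<otimes>\<^bsub>A\<^esub> (y \<otimes>\<^bsub>A\<^esub> w)",
        OF _ _ S kA kA _ c(1)])
    show "linear_map A A (\<lambda>x. (x \<otimes>\<^bsub>A\<^esub> y) \<otimes>\<^bsub>A\<^esub> w)"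
      by (rule bilin_left[OF m bilinD(2)[OF m c(2)] c(3)])
    show "linear_map A A (\<lambda>x. x \<otimes>\<^bsub>A\<^esub> (y \<otimes>\<^bsub>A\<^esub> w))"
      by (rule bilinD(2)[OF m bilinD(3)[OF m c(2,3)]])
    fix s assume s: "s \<in> S"
    show "(s \<otimes>\<^bsub>A\<^esub> y) \<otimes>\<^bsub>A\<^esub> w = s \<otimes>\<^bsub>A\<^esub> (y \<otimes>\<^bsub>A\<^esub> w)"
    proof (rule bilin_eq_on_span[where f = "\<lambda>y w. (s \<otimes>\<^bsub>A\<^esub> y) \<otimes>\<^bsub>A\<^esub> w" and g = "\<lambda>y w. s \<otimes>\<^bsub>A\<^esub> (y \<otimes>\<^bsub>A\<^esub> w)",
          OF _ _ S S kA kA kA assoc[OF s] c(2,3)])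
      show "bilin A A A (\<lambda>y w. (s \<otimes>\<^bsub>A\<^esub> y) \<otimes>\<^bsub>A\<^esub> w)"
        by (rule bilin_comp[OF m bilinD(1)[OF m SA[OF s]] linear_map_id])
      show "bilin A A A (\<lambda>y w. s \<otimes>\<^bsub>A\<^esub> (y \<otimes>\<^bsub>A\<^esub> w))"
        by (rule bilin_post[OF bilinD(1)[OF m SA[OF s]] m])
    qed
  qed
  show "\<one>\<^bsub>A\<^esub> \<otimes>\<^bsub>A\<^esub> x = x" if "x \<in> carrier A" for x
    by (rule linear_eq_on_span[OF bilinD(1)[OF m one] linear_map_id S kA kA unit(1) that])
  show "x \<otimes>\<^bsub>A\<^esub> \<one>\<^bsub>A\<^esub> = x" if "x \<in> carrier A" for x
    by (rule linear_eq_on_span[OF bilinD(2)[OF m one] linear_map_id S kA kA unit(2) that])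
qed

lemma ideal_submodule:
  assumes "k_algebra A" "ideal I A"
  shows "submodule I (base_field :: ('k::field, 'k) module) A"
proof (rule submoduleI'[OF k_algebraD(1)[OF assms(1)]])
  interpret ideal I A by (rule assms(2))
  show "I \<subseteq> carrier A" "\<zero>\<^bsub>A\<^esub> \<in> I" by auto
  show "x \<oplus>\<^bsub>A\<^esub> y \<in> I" if "x \<in> I" "y \<in> I" for x y using that by auto
  fix c x assume x: "x \<in> I"
  then have xA: "x \<in> carrier A" by auto
  have "(c \<odot>\<^bsub>A\<^esub> \<one>\<^bsub>A\<^esub>) \<otimes>\<^bsub>A\<^esub> x \<in> I"
    using x by (intro I_l_closed) (simp_all add: ks_smul[OF k_algebraD(1)[OF assms(1)]])
  then show "c \<odot>\<^bsub>A\<^esub> x \<in> I" using xA by (simp add: k_algebraD(3)[OF assms(1)])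
qed

lemma submodule_idealI:
  assumes "k_algebra A" "submodule I (base_field :: ('k::field, 'k) module) A"
    and "\<And>a x. a \<in> I \<Longrightarrow> x \<in> carrier A \<Longrightarrow> x \<otimes>\<^bsub>A\<^esub> a \<in> I" "\<And>a x. a \<in> I \<Longrightarrow> x \<in> carrier A \<Longrightarrow> a \<otimes>\<^bsub>A\<^esub> x \<in> I"
  shows "ideal I A"
  by (rule idealI) (use assms in \<open>auto simp: k_algebraD(2) submodule_def\<close>)

context
  fixes A :: "('k::field, 'a, 'e) module_scheme" and I
  assumes A: "k_algebra A" and I: "ideal I A"
begin

lemma quot_mult: "x \<in> carrier A \<Longrightarrow> y \<in> carrier A \<Longrightarrow>
    (I +>\<^bsub>A\<^esub> x) \<otimes>\<^bsub>quot A I\<^esub> (I +>\<^bsub>A\<^esub> y) = I +>\<^bsub>A\<^esub> (x \<otimes>\<^bsub>A\<^esub> y)"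
  by (simp add: quot_simps ideal.rcoset_mult_add[OF I])

lemma k_algebra_quot: "k_algebra (quot A I)"
proof -
  note sub = ideal_submodule[OF A I]
  note kA = k_algebraD(1)[OF A]
  interpret ring A by (rule k_algebraD[OF A])
  note qs = quot_carrier[OF kA sub] quot_add[OF kA sub] quot_smul[OF kA sub] quot_mult
    k_algebraD[OF A] ks_smul[OF kA] ks_add[OF kA] quot_simps(6)
  show ?thesis
    by (rule k_algebraI; (intro bilinI linear_mapI)?)
      (auto simp: kspace_quot[OF kA sub] qs l_distr r_distr m_assoc)
qed

end

section \<open>The tensor algebra\<close>

definition fmult :: "('a list \<Rightarrow>\<^sub>0 'k::field) \<Rightarrow> ('a list \<Rightarrow>\<^sub>0 'k) \<Rightarrow> ('a list \<Rightarrow>\<^sub>0 'k)" where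
  "fmult x y = (\<Sum>u\<in>Poly_Mapping.keys x. \<Sum>v\<in>Poly_Mapping.keys y.
        Poly_Mapping.single (u @ v) (Poly_Mapping.lookup x u * Poly_Mapping.lookup y v))"

lemma free_algebra_simps:
  "carrier (free_algebra S :: ('k::field, 'a list \<Rightarrow>\<^sub>0 'k) module) = {x. Poly_Mapping.keys x \<subseteq> lists S}"
  "(\<otimes>\<^bsub>free_algebra S\<^esub>) = fmult" "\<one>\<^bsub>free_algebra S :: ('k::field, 'a list \<Rightarrow>\<^sub>0 'k) module\<^esub> = Poly_Mapping.single [] 1"
  "\<zero>\<^bsub>free_algebra S :: ('k::field, 'a list \<Rightarrow>\<^sub>0 'k) module\<^esub> = 0" "x \<oplus>\<^bsub>free_algebra S\<^esub> y = x + y"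
  "c \<odot>\<^bsub>free_algebra S\<^esub> x = pm_scale c x"
  by (simp_all add: free_algebra_def fmult_def[abs_def] free_space_def)

lemma free_algebra_same: "same_space (free_space (lists S)) (free_algebra S :: ('k::field, 'a list \<Rightarrow>\<^sub>0 'k) module)"
  by (simp add: same_space_def free_algebra_def)

lemma pm_scale_sum: "pm_scale c (sum f A) = (\<Sum>i\<in>A. pm_scale c (f i))"
  by (rule poly_mapping_eqI) (simp add: lookup_sum sum_distrib_left)

lemma lc_free_space_UNIV: "lc (free_space UNIV) f r = (\<Sum>p\<in>Poly_Mapping.keys r. pm_scale (Poly_Mapping.lookup r p) (f p))"
  unfolding lc_def by (subst finsum_eq_sum[OF kspace_free_space]) simp_all

lemma fmult_lc: "fmult x y = lc (free_space UNIV) (\<lambda>u. lc (free_space UNIV) (\<lambda>v. Poly_Mapping.single (u @ v) 1) y) x"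
  by (simp add: fmult_def lc_free_space_UNIV pm_scale_sum)

lemma fmult_bilin_UNIV: "bilin (free_space UNIV) (free_space UNIV) (free_space UNIV) fmult"
proof -
  note k = kspace_free_space
  show ?thesis unfolding fmult_lc[abs_def]
  proof (rule bilinI)
    show "linear_map (free_space UNIV) (free_space UNIV)
      (\<lambda>y. lc (free_space UNIV) (\<lambda>u. lc (free_space UNIV) (\<lambda>v. Poly_Mapping.single (u @ v) 1) y) x)" for x :: "'a list \<Rightarrow>\<^sub>0 'b"
      by (rule lc_linear_param[OF k lc_linear[OF k] _ k]) auto
    show "linear_map (free_space UNIV) (free_space UNIV)
      (\<lambda>x. lc (free_space UNIV) (\<lambda>u. lc (free_space UNIV) (\<lambda>v. Poly_Mapping.single (u @ v) 1) y) x)" for y :: "'a list \<Rightarrow>\<^sub>0 'b"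
      by (rule lc_linear[OF k]) auto
  qed
qed

lemma fmult_single: "fmult (Poly_Mapping.single u c) (Poly_Mapping.single v d) = Poly_Mapping.single (u @ v) (c * d)"
  by (simp add: fmult_def)

text \<open>Transfers the bilinearity of \<open>fmult\<close> from words over all letters to words
  over \<open>S\<close>, where only closure remains to be checked.\<close>

lemma linear_map_subspace:
  "linear_map M N f \<Longrightarrow> carrier M' \<subseteq> carrier M \<Longrightarrow> add M' = add M \<Longrightarrow> smult M' = smult M \<Longrightarrow>
   (\<And>x. x \<in> carrier M' \<Longrightarrow> f x \<in> carrier N') \<Longrightarrow> add N' = add N \<Longrightarrow> smult N' = smult N \<Longrightarrow> linear_map M' N' f"
  by (auto simp: linear_map_def subset_iff)

lemma fmult_closed:
  assumes "Poly_Mapping.keys x \<subseteq> lists S" "Poly_Mapping.keys (y :: _ \<Rightarrow>\<^sub>0 'k::field) \<subseteq> lists S"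
  shows "Poly_Mapping.keys (fmult x y) \<subseteq> lists S"
proof -
  have "Poly_Mapping.keys (sum f A) \<subseteq> T"
    if "\<And>i. i \<in> A \<Longrightarrow> Poly_Mapping.keys (f i) \<subseteq> T" for f :: "'d \<Rightarrow> 'c \<Rightarrow>\<^sub>0 'k" and A T
    using that by (induction A rule: infinite_finite_induct) (simp_all add: keys_add_subset)
  note * = this
  show ?thesis unfolding fmult_def
    by (intro *) (use assms in auto)
qed

lemma free_algebra_mult_bilin:
  "bilin (free_algebra S) (free_algebra S) (free_algebra S :: ('k::field, 'a list \<Rightarrow>\<^sub>0 'k) module) (\<otimes>\<^bsub>free_algebra S\<^esub>)"
proof (rule bilinI)
  let ?A = "free_algebra S :: ('k, 'a list \<Rightarrow>\<^sub>0 'k) module"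
  have e: "add ?A = add (free_space UNIV)" "smult ?A = smult (free_space UNIV)" "carrier ?A \<subseteq> carrier (free_space UNIV)"
    by (simp_all add: free_algebra_simps fun_eq_iff)
  fix x assume x: "x \<in> carrier ?A"
  then have x': "x \<in> carrier (free_space UNIV)" by simp
  have c: "fmult x y \<in> carrier ?A" "fmult y x \<in> carrier ?A" if "y \<in> carrier ?A" for y
    using x that by (simp_all add: free_algebra_simps fmult_closed)
  show "linear_map ?A ?A (\<lambda>y. x \<otimes>\<^bsub>?A\<^esub> y)" "linear_map ?A ?A (\<lambda>y. y \<otimes>\<^bsub>?A\<^esub> x)"
    unfolding free_algebra_simps(2)
    by (rule linear_map_subspace[OF bilinD(1)[OF fmult_bilin_UNIV x'] e(3,1,2) c(1) e(1,2)],
        assumption,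
        rule linear_map_subspace[OF bilinD(2)[OF fmult_bilin_UNIV x'] e(3,1,2) c(2) e(1,2)])
qed

lemma spans_free_algebra:
  "spans (free_algebra S :: ('k::field, 'a list \<Rightarrow>\<^sub>0 'k) module) ((\<lambda>w. Poly_Mapping.single w 1) ` lists S)"
  unfolding spans_same[OF free_algebra_same, symmetric] by (rule spans_free_space)

lemma kspace_free_algebra: "kspace (free_algebra S :: ('k::field, 'a list \<Rightarrow>\<^sub>0 'k) module)"
  by (rule kspace_same[OF free_algebra_same kspace_free_space])

lemma k_algebra_free_algebra: "k_algebra (free_algebra S :: ('k::field, 'a list \<Rightarrow>\<^sub>0 'k) module)"
  by (rule k_algebraI_span[OF kspace_free_algebra free_algebra_mult_bilin _ spans_free_algebra])
    (auto simp: free_algebra_simps fmult_single)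

text \<open>Linearity in each letter with the others fixed: the condition under which a function on
  words factors through \<open>talg\<close>.\<close>

definition multilin :: "('k::field, 'm, 'e) module_scheme \<Rightarrow> ('k, 'x, 'f) module_scheme \<Rightarrow> ('m list \<Rightarrow> 'x) \<Rightarrow> bool" where
  "multilin M X f \<longleftrightarrow> (\<forall>w\<in>lists (carrier M). f w \<in> carrier X) \<and>
    (\<forall>p\<in>lists (carrier M). \<forall>q\<in>lists (carrier M). linear_map M X (\<lambda>x. f (p @ x # q)))"

text \<open>For functions defined by recursion on the first letter, such as
  \<open>word_coact\<close> and \<open>word_comult\<close>, bilinearity of one step is enough: the
  letter that varies is reached by peeling off the prefix before it.\<close>

lemma multilin_rec:
  assumes "bilin M X X F" "f [] \<in> carrier X" "\<And>m w. f (m # w) = F m (f w)"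
  shows "multilin M X f"
proof -
  have c: "f w \<in> carrier X" if "w \<in> lists (carrier M)" for w
    using that by induction (simp_all add: assms bilinD(3)[OF assms(1)])
  have "linear_map M X (\<lambda>x. f (p @ x # q))" if "p \<in> lists (carrier M)" "q \<in> lists (carrier M)" for p q
    using that(1)
  proof induction
    case Nil
    then show ?case using bilinD(2)[OF assms(1) c[OF that(2)]] by (simp add: assms(3))
  next
    case (Cons m p)
    then show ?case using bilin_right[OF assms(1), of m M] by (simp add: assms(3))
  qed
  then show ?thesis using c by (simp add: multilin_def)
qed

lemma wlift_lc: "wlift X f t = lc X f (SOME r. r \<in> t)"
  by (simp add: wlift_def lc_def Let_def)

context
  fixes M :: "('k::field, 'm, 'e) module_scheme"
  assumes kM: "kspace M"
begin

abbreviation (input) "FA \<equiv> free_algebra (carrier M) :: ('k, 'm list \<Rightarrow>\<^sub>0 'k) module"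
abbreviation (input) "letter \<equiv> \<lambda>x. Poly_Mapping.single [x] (1 :: 'k)"

definition talg_relators :: "('m list \<Rightarrow>\<^sub>0 'k) set" where
  "talg_relators = {letter (x \<oplus>\<^bsub>M\<^esub> y) - letter x - letter y | x y. x \<in> carrier M \<and> y \<in> carrier M}
    \<union> {letter (c \<odot>\<^bsub>M\<^esub> x) - pm_scale c (letter x) | c x. x \<in> carrier M}"

lemma talg_null_eq: "talg_null M = Idl\<^bsub>FA\<^esub> talg_relators"
  by (simp add: talg_null_def talg_relators_def Let_def)

lemma talg_relators_closed: "talg_relators \<subseteq> carrier FA"
proof -
  have k: "Poly_Mapping.keys (Poly_Mapping.single p c) \<subseteq> lists (carrier M)"
    if "p \<in> lists (carrier M)" for p and c :: 'k using that by auto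
  show ?thesis
    unfolding talg_relators_def free_algebra_simps pm_scale_single
    by (intro Un_least subsetI)
      (elim CollectE exE conjE, simp only: mem_Collect_eq, intro keys_diff_subset k lists.intros,
        simp_all add: ks_add[OF kM] ks_smul[OF kM])+
qed

lemma talg_null_ideal: "ideal (talg_null M) FA"
  unfolding talg_null_eq by (rule ring.genideal_ideal[OF k_algebraD(2)[OF k_algebra_free_algebra] talg_relators_closed])

lemma talg_relators_null: "r \<in> talg_relators \<Longrightarrow> r \<in> talg_null M"
  unfolding talg_null_eq using ring.genideal_self[OF k_algebraD(2)[OF k_algebra_free_algebra] talg_relators_closed] by auto

lemma k_algebra_talg: "k_algebra (talg M)"
  unfolding talg_def by (rule k_algebra_quot[OF k_algebra_free_algebra talg_null_ideal])

lemma kspace_talg: "kspace (talg M)"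
  by (rule k_algebraD(1)[OF k_algebra_talg])

lemmas talg_null_submodule = ideal_submodule[OF k_algebra_free_algebra talg_null_ideal]

lemma single_closed: "w \<in> lists (carrier M) \<Longrightarrow> Poly_Mapping.single w c \<in> carrier FA"
  by (auto simp: free_algebra_simps)

lemma tword_closed: "w \<in> lists (carrier M) \<Longrightarrow> tword M w \<in> carrier (talg M)"
  using single_closed[of w 1]
  by (auto simp: talg_def tword_def quot_carrier[OF kspace_free_algebra talg_null_submodule])

lemma tword_mult: "w \<in> lists (carrier M) \<Longrightarrow> w' \<in> lists (carrier M) \<Longrightarrow>
    tword M w \<otimes>\<^bsub>talg M\<^esub> tword M w' = tword M (w @ w')"
  unfolding talg_def tword_def
  by (subst quot_mult[OF k_algebra_free_algebra talg_null_ideal]) (simp_all add: single_closed, simp add: free_algebra_simps fmult_single)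

lemma tword_Nil: "tword M [] = \<one>\<^bsub>talg M\<^esub>"
  by (simp add: talg_def tword_def quot_simps free_algebra_simps)

lemma spans_talg: "spans (talg M) (tword M ` lists (carrier M))"
  using quot_spans[OF kspace_free_algebra talg_null_submodule spans_free_algebra]
  by (simp add: talg_def tword_def[abs_def] image_image)

lemma tword_letter_linear: "linear_map M (talg M) (\<lambda>m. tword M [m])"
proof -
  note s = single_closed
  note free_algebra_minus = free_space_minus[of _ "lists (carrier M)", unfolded a_minus_same[OF free_algebra_same]]
  have eqI: "talg_null M +>\<^bsub>FA\<^esub> x = talg_null M +>\<^bsub>FA\<^esub> y"
    if "x \<in> carrier FA" "y \<in> carrier FA" "x - y \<in> talg_relators" for x y
    by (rule coset_eqI[OF kspace_free_algebra talg_null_submodule that(1,2)])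
      (use that in \<open>simp add: free_algebra_minus talg_relators_null free_algebra_simps\<close>)
  show ?thesis
  proof (rule linear_mapI)
    fix x y assume c: "x \<in> carrier M" "y \<in> carrier M"
    have "tword M [x \<oplus>\<^bsub>M\<^esub> y] = talg_null M +>\<^bsub>FA\<^esub> (letter x + letter y)"
      unfolding tword_def
    proof (rule eqI)
      show "letter (x \<oplus>\<^bsub>M\<^esub> y) - (letter x + letter y) \<in> talg_relators"
        using c unfolding talg_relators_def diff_diff_eq[symmetric] by blast
    qed (use c in \<open>simp_all add: free_algebra_simps keys_add_subset ks_add[OF kM]\<close>)
    also have "\<dots> = tword M [x] \<oplus>\<^bsub>talg M\<^esub> tword M [y]"
      using quot_add[OF kspace_free_algebra talg_null_submodule s[of "[x]" 1] s[of "[y]" 1]] c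
      by (simp add: talg_def tword_def free_algebra_simps)
    finally show "tword M [x \<oplus>\<^bsub>M\<^esub> y] = tword M [x] \<oplus>\<^bsub>talg M\<^esub> tword M [y]" .
  next
    fix c x assume c: "x \<in> carrier M"
    have "tword M [c \<odot>\<^bsub>M\<^esub> x] = talg_null M +>\<^bsub>FA\<^esub> (pm_scale c (letter x))"
      unfolding tword_def
    proof (rule eqI)
      show "letter (c \<odot>\<^bsub>M\<^esub> x) - pm_scale c (letter x) \<in> talg_relators"
        using c unfolding talg_relators_def by blast
    qed (use c in \<open>simp_all add: free_algebra_simps ks_smul[OF kM]\<close>)
    also have "\<dots> = c \<odot>\<^bsub>talg M\<^esub> tword M [x]"
      using quot_smul[OF kspace_free_algebra talg_null_submodule s[of "[x]" 1]] c
      by (simp add: talg_def tword_def free_algebra_simps)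
    finally show "tword M [c \<odot>\<^bsub>M\<^esub> x] = c \<odot>\<^bsub>talg M\<^esub> tword M [x]" .
  qed (simp add: tword_closed)
qed

lemma tword_Cons: "m \<in> carrier M \<Longrightarrow> w \<in> lists (carrier M) \<Longrightarrow> tword M (m # w) = tword M [m] \<otimes>\<^bsub>talg M\<^esub> tword M w"
  by (simp add: tword_mult)

context
  fixes X :: "('k, 'x, 'f) module_scheme" and f :: "'m list \<Rightarrow> 'x"
  assumes kX: "kspace X" and f: "multilin M X f"
begin

lemma multilin_closed: "w \<in> lists (carrier M) \<Longrightarrow> f w \<in> carrier X"
  using f by (simp add: multilin_def)

lemma multilin_linear: "p \<in> lists (carrier M) \<Longrightarrow> q \<in> lists (carrier M) \<Longrightarrow> linear_map M X (\<lambda>x. f (p @ x # q))"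
  using f by (simp add: multilin_def)

lemma multilin_lc_linear: "linear_map FA X (lc X f)"
  unfolding linear_map_same[OF free_algebra_same same_space_refl, symmetric]
  by (rule lc_linear[OF kX]) (auto intro: multilin_closed)

text \<open>\<open>talg_null\<close> is the two-sided ideal generated by the relators, not merely
  their span. The elements \<open>x\<close> for which the extension of \<open>f\<close> kills
  \<open>p x q\<close> for all words \<open>p\<close> and \<open>q\<close> form an ideal.
  Multilinearity puts the relators into it, and empty \<open>p\<close> and \<open>q\<close> give the
  claim.\<close>

lemma lc_talg_null:
  assumes "r \<in> talg_null M"
  shows "lc X f r = \<zero>\<^bsub>X\<^esub>"
proof -
  note A = k_algebra_free_algebra[of "carrier M"]
  note kA = kspace_free_algebra
  note m = free_algebra_mult_bilin[of "carrier M", where 'k = 'k]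
  note cl = k_algebraD(5)[OF A]
  let ?s = "\<lambda>w. Poly_Mapping.single w (1 :: 'k)"
  \<comment> \<open>\<open>L p q\<close> reads \<open>x\<close> in the context of a prefix and a
    suffix. A factor next to \<open>x\<close> can be absorbed into this context, which is what makes
    \<open>I\<close> an ideal.\<close>
  define L where "L p q x = lc X f (fmult (fmult (?s p) x) (?s q))" for p q x
  have Ll: "linear_map FA X (L p q)" if "p \<in> lists (carrier M)" "q \<in> lists (carrier M)" for p q
    unfolding L_def
    by (rule linear_map_comp[OF multilin_lc_linear, of FA])
      (use bilin_left[OF m bilinD(1)[OF m single_closed[OF that(1), of 1]] single_closed[OF that(2), of 1]]
        in \<open>simp add: free_algebra_simps\<close>)
  have Ls: "L p q (Poly_Mapping.single w c) = c \<odot>\<^bsub>X\<^esub> f (p @ w @ q)"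
    if "p \<in> lists (carrier M)" "q \<in> lists (carrier M)" "w \<in> lists (carrier M)" for p q w c
    using that multilin_closed[of "p @ w @ q"] by (simp add: L_def fmult_single lc_single_coeff kX)
  define I where "I = {x \<in> carrier FA. \<forall>p\<in>lists (carrier M). \<forall>q\<in>lists (carrier M). L p q x = \<zero>\<^bsub>X\<^esub>}"
  have sub: "submodule I (base_field :: ('k, 'k) module) FA"
  proof (rule submoduleI'[OF kA])
    show "\<zero>\<^bsub>FA\<^esub> \<in> I" using linear_map_zero[OF Ll kA kX] by (auto simp: I_def ks_zero[OF kA])
    show "x \<oplus>\<^bsub>FA\<^esub> y \<in> I" if "x \<in> I" "y \<in> I" for x y
      using that by (auto simp: I_def ks_add[OF kA] linear_mapD(2)[OF Ll] ks_zero_add[OF kX] ks_zero[OF kX])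
    show "c \<odot>\<^bsub>FA\<^esub> x \<in> I" if "x \<in> I" for c x
      using that by (auto simp: I_def ks_smul[OF kA] linear_mapD(3)[OF Ll] ks_smul_zero[OF kX])
  qed (auto simp: I_def)
  have assoc: "fmult (fmult x y) w = fmult x (fmult y w)"
    if "x \<in> carrier FA" "y \<in> carrier FA" "w \<in> carrier FA" for x y w
    using Group.monoid.m_assoc[OF ring.is_monoid[OF k_algebraD(2)[OF A]] that] by (simp only: free_algebra_simps)
  have left: "fmult x a \<in> I" if a: "a \<in> I" and x: "x \<in> carrier FA" for a x
  proof -
    have aA: "a \<in> carrier FA" using a by (simp add: I_def)
    have "L p q (fmult x a) = \<zero>\<^bsub>X\<^esub>" if pq: "p \<in> lists (carrier M)" "q \<in> lists (carrier M)" for p q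
    proof (rule linear_eq_on_span[OF _ linear_map_const_zero[OF kX] spans_free_algebra kA kX _ x])
      show "linear_map FA X (\<lambda>x. L p q (fmult x a))"
        by (rule linear_map_comp[OF Ll[OF pq]]) (use bilinD(2)[OF m aA] in \<open>simp add: free_algebra_simps\<close>)
      fix s assume "s \<in> ?s ` lists (carrier M)"
      then obtain w where w: "w \<in> lists (carrier M)" "s = ?s w" by auto
      have "fmult (?s p) (fmult s a) = fmult (?s (p @ w)) a"
        using assoc[OF single_closed[OF pq(1), of 1] single_closed[OF w(1), of 1] aA] w by (simp add: fmult_single)
      then have "L p q (fmult s a) = L (p @ w) q a" by (simp add: L_def)
      also have "\<dots> = \<zero>\<^bsub>X\<^esub>" using a pq w by (simp add: I_def)
      finally show "L p q (fmult s a) = \<zero>\<^bsub>X\<^esub>" .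
    qed
    then show ?thesis using cl[OF x aA] by (simp add: I_def free_algebra_simps)
  qed
  have right: "fmult a x \<in> I" if a: "a \<in> I" and x: "x \<in> carrier FA" for a x
  proof -
    have aA: "a \<in> carrier FA" using a by (simp add: I_def)
    have "L p q (fmult a x) = \<zero>\<^bsub>X\<^esub>" if pq: "p \<in> lists (carrier M)" "q \<in> lists (carrier M)" for p q
    proof (rule linear_eq_on_span[OF _ linear_map_const_zero[OF kX] spans_free_algebra kA kX _ x])
      show "linear_map FA X (\<lambda>x. L p q (fmult a x))"
        by (rule linear_map_comp[OF Ll[OF pq]]) (use bilinD(1)[OF m aA] in \<open>simp add: free_algebra_simps\<close>)
      fix s assume "s \<in> ?s ` lists (carrier M)"
      then obtain w where w: "w \<in> lists (carrier M)" "s = ?s w" by auto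
      note pc = single_closed[OF pq(1), of 1] and qc = single_closed[OF pq(2), of 1]
        and wc = single_closed[OF w(1), of 1]
      have pa: "fmult (?s p) a \<in> carrier FA" using cl[OF pc aA] by (simp add: free_algebra_simps)
      have "fmult (fmult (?s p) (fmult a s)) (?s q) = fmult (fmult (fmult (?s p) a) s) (?s q)"
        using assoc[OF pc aA wc] w by simp
      also have "\<dots> = fmult (fmult (?s p) a) (?s (w @ q))"
        using assoc[OF pa wc qc] w by (simp add: fmult_single)
      finally have "L p q (fmult a s) = L p (w @ q) a" by (simp add: L_def)
      also have "\<dots> = \<zero>\<^bsub>X\<^esub>" using a pq w by (simp add: I_def)
      finally show "L p q (fmult a s) = \<zero>\<^bsub>X\<^esub>" .
    qed
    then show ?thesis using cl[OF aA x] by (simp add: I_def free_algebra_simps)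
  qed
  have ideal: "ideal I FA"
    by (rule submodule_idealI[OF A sub]) (use left right in \<open>simp_all add: free_algebra_simps(2)\<close>)
  have "talg_relators \<subseteq> I"
  proof
    fix r assume r: "r \<in> talg_relators"
    have "L p q r = \<zero>\<^bsub>X\<^esub>" if pq: "p \<in> lists (carrier M)" "q \<in> lists (carrier M)" for p q
    proof -
      note l = linear_mapD[OF Ll[OF pq], unfolded free_algebra_simps(5,6)]
      have lf: "f (p @ (x \<oplus>\<^bsub>M\<^esub> y) # q) = f (p @ x # q) \<oplus>\<^bsub>X\<^esub> f (p @ y # q)"
        "f (p @ (c \<odot>\<^bsub>M\<^esub> x) # q) = c \<odot>\<^bsub>X\<^esub> f (p @ x # q)" "f (p @ x # q) \<in> carrier X"
        if "x \<in> carrier M" "y \<in> carrier M" for x y c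
        using linear_mapD[OF multilin_linear[OF pq]] that by auto
      have c: "Poly_Mapping.single [x] d \<in> carrier FA" if "x \<in> carrier M" for x d
        using that by (intro single_closed) auto
      have c2: "x + y \<in> carrier FA" if "x \<in> carrier FA" "y \<in> carrier FA" for x y
        using ks_add[OF kA that] by (simp only: free_algebra_simps)
      show ?thesis
        using r unfolding talg_relators_def
        by (elim UnE CollectE exE conjE)
          (simp_all add: pm_diff_eq l Ls pq c c2 ks_add[OF kM] ks_smul[OF kM] lf ks_smul_one[OF kX] ks_add[OF kX]
            ks_smul[OF kX] ks_smul_smul[OF kX] ks_cancel2[OF kX] ks_cancel3[OF kX]
            ks_smul_ladd[OF kX, symmetric] ks_smul_0[OF kX] del: single_uminus pm_scale_single free_algebra_simps(1),
           simp_all add: l Ls pq c c2 ks_add[OF kM] ks_smul[OF kM] lf ks_smul_one[OF kX] ks_add[OF kX]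
            ks_smul[OF kX] ks_smul_smul[OF kX] ks_cancel2[OF kX] ks_cancel3[OF kX]
            ks_smul_ladd[OF kX, symmetric] ks_smul_0[OF kX])
    qed
    then show "r \<in> I" using r talg_relators_closed by (auto simp: I_def)
  qed
  then have "talg_null M \<subseteq> I"
    unfolding talg_null_eq by (intro ring.genideal_minimal[OF k_algebraD(2)[OF A] ideal])
  then have "L [] [] r = \<zero>\<^bsub>X\<^esub>" "r \<in> carrier FA" using assms by (auto simp: I_def)
  moreover have "fmult (fmult (?s []) r) (?s []) = r"
    using \<open>r \<in> carrier FA\<close> ring.ring_simprules(12)[OF k_algebraD(2)[OF A]]
      Group.monoid.l_one[OF ring.is_monoid[OF k_algebraD(2)[OF A]], of r]
      Group.monoid.r_one[OF ring.is_monoid[OF k_algebraD(2)[OF A]], of r]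
    by (simp add: free_algebra_simps)
  ultimately show ?thesis by (simp add: L_def)
qed

lemma wlift_linear: "linear_map (talg M) X (wlift X f)"
  unfolding wlift_lc[abs_def] talg_def
  by (rule quot_lift_linear[OF kspace_free_algebra talg_null_submodule multilin_lc_linear kX lc_talg_null])

lemma wlift_tword: "w \<in> lists (carrier M) \<Longrightarrow> wlift X f (tword M w) = f w"
  unfolding wlift_lc tword_def
  by (subst quot_lift[OF kspace_free_algebra talg_null_submodule multilin_lc_linear kX lc_talg_null single_closed])
    (simp_all add: lc_single kX multilin_closed)

end

lemma talg_rep:
  assumes "t \<in> carrier (talg M)"
  shows "Poly_Mapping.keys (SOME r. r \<in> t) \<subseteq> lists (carrier M)"
  using quot_rep(1)[OF kspace_free_algebra talg_null_submodule assms[unfolded talg_def]] by (simp add: free_algebra_simps)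

lemma wlift_param:
  assumes "kspace X" "kspace L" "\<And>w. w \<in> lists (carrier M) \<Longrightarrow> linear_map L X (\<lambda>z. F z w)"
    and "t \<in> carrier (talg M)"
  shows "linear_map L X (\<lambda>z. wlift X (F z) t)"
  unfolding wlift_lc by (rule lc_linear_param[OF assms(1) assms(3) talg_rep[OF assms(4)] assms(2)])

lemma multilin_tword_map:
  assumes "linear_map M M A"
  shows "multilin M (talg M) (\<lambda>w. tword M (map A w))"
proof -
  have AC: "map A w \<in> lists (carrier M)" if "w \<in> lists (carrier M)" for w
    using that by induction (simp_all add: linear_mapD[OF assms])
  note m = k_algebra_mult_bilin[OF k_algebra_talg]
  have "linear_map M (talg M) (\<lambda>x. tword M (map A (p @ x # q)))"
    if pq: "p \<in> lists (carrier M)" "q \<in> lists (carrier M)" for p q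
  proof (rule linear_map_cong[OF _ _ kM])
    show "linear_map M (talg M) (\<lambda>x. (tword M (map A p) \<otimes>\<^bsub>talg M\<^esub> tword M [A x]) \<otimes>\<^bsub>talg M\<^esub> tword M (map A q))"
      by (rule bilin_left[OF m bilin_right[OF m _ linear_map_comp[OF tword_letter_linear assms]]])
        (simp_all add: tword_closed AC pq)
    show "(tword M (map A p) \<otimes>\<^bsub>talg M\<^esub> tword M [A x]) \<otimes>\<^bsub>talg M\<^esub> tword M (map A q) = tword M (map A (p @ x # q))"
      if "x \<in> carrier M" for x
      using that pq by (simp add: tword_mult AC linear_mapD[OF assms])
  qed
  then show ?thesis by (simp add: multilin_def tword_closed AC)
qed

end

section \<open>Words with degrees and characters\<close>

declare in_lists_conv_set [simp del] in_listsD [rule del] lists.Nil [simp]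

definition wdeg :: "(nat \<Rightarrow> 'g::ab_group_add) \<Rightarrow> nat list \<Rightarrow> 'g" where
  "wdeg g l = sum_list (map g l)"

definition wchar :: "(nat \<Rightarrow> 'g \<Rightarrow> 'k::field) \<Rightarrow> nat list \<Rightarrow> 'g \<Rightarrow> 'k" where
  "wchar \<chi> l h = prod_list (map (\<lambda>j. \<chi> j h) l)"

lemma wdeg_simps [simp]: "wdeg g [] = 0" "wdeg g (j # l) = g j + wdeg g l" "wdeg g (l @ l') = wdeg g l + wdeg g l'"
  by (simp_all add: wdeg_def)

lemma wchar_simps [simp]: "wchar \<chi> [] h = 1" "wchar \<chi> (j # l) h = \<chi> j h * wchar \<chi> l h"
  "wchar \<chi> (l @ l') h = wchar \<chi> l h * wchar \<chi> l' h"
  by (simp_all add: wchar_def)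

lemma characters_mult: "\<chi> \<in> characters \<Longrightarrow> \<chi> (g + h) = \<chi> g * \<chi> h"
  "\<chi> \<in> characters \<Longrightarrow> \<chi> 0 = 1"
  by (simp_all add: characters_def)

lemma wchar_character:
  assumes "\<And>j. \<chi> j \<in> characters" shows "wchar \<chi> l \<in> characters"
  by (induction l) (simp_all add: characters_def characters_mult[OF assms])

text \<open>
  \<open>wsplit g \<chi> X w F\<close> is the sum of \<open>F(w', w'')\<close> over the terms \<open>w' \<otimes> w''\<close> of the braided coproduct of the
  word \<open>w\<close>, i.e. over all ways to split \<open>w\<close> into two complementary subwords, with the braiding
  coefficients.
\<close>

primrec wsplit :: "(nat \<Rightarrow> 'g::ab_group_add) \<Rightarrow> (nat \<Rightarrow> 'g \<Rightarrow> 'k::field) \<Rightarrow> ('k, 'x, 'e) module_scheme \<Rightarrow>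
    nat list \<Rightarrow> (nat list \<Rightarrow> nat list \<Rightarrow> 'x) \<Rightarrow> 'x" where
  "wsplit g \<chi> X [] F = F [] []"
| "wsplit g \<chi> X (j # w) F =
     wsplit g \<chi> X w (\<lambda>x y. F (j # x) y \<oplus>\<^bsub>X\<^esub> wchar \<chi> x (g j) \<odot>\<^bsub>X\<^esub> F x (j # y))"

lemma wsplit_cong:
  assumes "w \<in> lists S" "\<And>x y. x \<in> lists S \<Longrightarrow> y \<in> lists S \<Longrightarrow> F x y = G x y"
  shows "wsplit g \<chi> X w F = wsplit g \<chi> X w G"
  using assms
proof (induction w arbitrary: F G rule: list.induct)
  case (Cons j w)
  show ?case unfolding wsplit.simps by (rule Cons.IH) (use Cons.prems(1) in \<open>simp_all add: Cons.prems(2-)\<close>)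
qed simp

lemma linear_wsplit:
  assumes "linear_map X Y f" "kspace X" "w \<in> lists S" "\<And>x y. x \<in> lists S \<Longrightarrow> y \<in> lists S \<Longrightarrow> F x y \<in> carrier X"
  shows "f (wsplit g \<chi> X w F) = wsplit g \<chi> Y w (\<lambda>x y. f (F x y))"
  using assms(3,4)
proof (induction w arbitrary: F rule: list.induct)
  case (Cons j w)
  have "f (wsplit g \<chi> X (j # w) F)
      = wsplit g \<chi> Y w (\<lambda>x y. f (F (j # x) y \<oplus>\<^bsub>X\<^esub> wchar \<chi> x (g j) \<odot>\<^bsub>X\<^esub> F x (j # y)))"
    unfolding wsplit.simps
    by (rule Cons.IH) (use Cons.prems(1) in \<open>simp_all add: Cons.prems(2-) assms(2) ks_add ks_smul\<close>)
  also have "\<dots> = wsplit g \<chi> Y w (\<lambda>x y. f (F (j # x) y) \<oplus>\<^bsub>Y\<^esub> wchar \<chi> x (g j) \<odot>\<^bsub>Y\<^esub> f (F x (j # y)))"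
    by (rule wsplit_cong[of w S])
      (use Cons.prems(1) in \<open>simp_all add: Cons.prems(2-) assms(2) ks_smul linear_mapD(2,3)[OF assms(1)]\<close>)
  finally show ?case by simp
qed simp

lemma wsplit_add:
  assumes "kspace X" "w \<in> lists S" "\<And>x y. x \<in> lists S \<Longrightarrow> y \<in> lists S \<Longrightarrow> F x y \<in> carrier X"
    "\<And>x y. x \<in> lists S \<Longrightarrow> y \<in> lists S \<Longrightarrow> G x y \<in> carrier X"
  shows "wsplit g \<chi> X w (\<lambda>x y. F x y \<oplus>\<^bsub>X\<^esub> G x y) = wsplit g \<chi> X w F \<oplus>\<^bsub>X\<^esub> wsplit g \<chi> X w G"
  using assms(2-4)
proof (induction w arbitrary: F G rule: list.induct)
  case (Cons j w)
  let ?F = "\<lambda>F x y. F (j # x) y \<oplus>\<^bsub>X\<^esub> wchar \<chi> x (g j) \<odot>\<^bsub>X\<^esub> F x (j # y)"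
  have "wsplit g \<chi> X (j # w) (\<lambda>x y. F x y \<oplus>\<^bsub>X\<^esub> G x y) = wsplit g \<chi> X w (\<lambda>x y. ?F F x y \<oplus>\<^bsub>X\<^esub> ?F G x y)"
    unfolding wsplit.simps
    by (rule wsplit_cong[of w S])
      (use Cons.prems(1) in \<open>simp_all add: Cons.prems(2-) assms(1) ks_add ks_smul ks_smul_radd ks_add_assoc ks_add_lcomm\<close>)
  also have "\<dots> = wsplit g \<chi> X w (?F F) \<oplus>\<^bsub>X\<^esub> wsplit g \<chi> X w (?F G)"
    by (rule Cons.IH) (use Cons.prems(1) in \<open>simp_all add: Cons.prems(2-) assms(1) ks_add ks_smul\<close>)
  finally show ?case by simp
qed simp

section \<open>Diagonal Yetter--Drinfel'd modules and their tensor algebras\<close>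

lemma braided_mult_bilin:
  assumes kH: "kspace H" and kR: "kspace R" and m: "bilin R R R (\<otimes>\<^bsub>R\<^esub>)" and a: "bilin H R R (act R)"
    and c: "linear_map R (tensor H R) (coact R)"
  shows "bilin (tensor R R) (tensor R R) (tensor R R) (braided_mult R)"
proof -
  note kT = kspace_tensor[OF kR kR] and kHR = kspace_tensor[OF kH kR] and p = tpure_bilin[OF kR kR]
  note mc = bilinD(3)[OF m] and ac = bilinD(3)[OF a] and cc = linear_mapD(1)[OF c]
  let ?G = "\<lambda>a b' a' h b0. tpure R R (a \<otimes>\<^bsub>R\<^esub> act R h a') (b0 \<otimes>\<^bsub>R\<^esub> b')"
  let ?F = "\<lambda>a b a' b'. tlift (tensor R R) (?G a b' a') (coact R b)"
  have G: "bilin H R (tensor R R) (?G a b' a')" if "a \<in> carrier R" "b' \<in> carrier R" "a' \<in> carrier R" for a b' a'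
    by (rule bilin_comp[OF p bilin_right[OF m that(1) bilinD(2)[OF a that(3)]] bilinD(2)[OF m that(2)]])
  show ?thesis
    unfolding braided_mult_def[abs_def]
  proof (rule tlift_tlift_bilin[OF kR kR kR kR kT]; rule bilinI)
    fix a b a' assume ab: "a \<in> carrier R" "b \<in> carrier R" "a' \<in> carrier R"
    show "linear_map R (tensor R R) (\<lambda>b'. ?F a b a' b')"
      by (rule tlift_param[OF kH kR kT _ cc[OF ab(2)] kR])
        (rule bilin_right[OF p _ bilinD(1)[OF m]], simp_all add: mc ac ab)
  next
    fix a b b' assume ab: "a \<in> carrier R" "b \<in> carrier R" "b' \<in> carrier R"
    show "linear_map R (tensor R R) (\<lambda>a'. ?F a b a' b')"
      by (rule tlift_param[OF kH kR kT _ cc[OF ab(2)] kR])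
        (rule bilin_left[OF p bilin_right[OF m ab(1) bilinD(1)[OF a]]], simp_all add: mc ab)
  next
    fix a' b' a assume ab: "a' \<in> carrier R" "b' \<in> carrier R" "a \<in> carrier R"
    show "linear_map R (tensor R R) (\<lambda>b. ?F a b a' b')"
      by (rule linear_map_comp[OF tlift_linear[OF kH kR kT G[OF ab(3,2,1)]] c])
  next
    fix a' b' b assume ab: "a' \<in> carrier R" "b' \<in> carrier R" "b \<in> carrier R"
    show "linear_map R (tensor R R) (\<lambda>a. ?F a b a' b')"
      by (rule tlift_param[OF kH kR kT _ cc[OF ab(3)] kR])
        (rule bilin_left[OF p bilinD(2)[OF m]], simp_all add: mc ac ab)
  qed
qed

text \<open>When \<open>y\<close> is homogeneous for the coaction, the sum over the terms of its
  coaction reduces to a single one.\<close>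

lemma braided_mult_tpure:
  assumes kH: "kspace H" and kR: "kspace R" and m: "bilin R R R (\<otimes>\<^bsub>R\<^esub>)" and a: "bilin H R R (act R)"
    and c: "linear_map R (tensor H R) (coact R)"
    and cl: "x \<in> carrier R" "y \<in> carrier R" "x' \<in> carrier R" "y' \<in> carrier R"
    and y: "h \<in> carrier H" "coact R y = tpure H R h y"
  shows "braided_mult R (tpure R R x y) (tpure R R x' y') = tpure R R (x \<otimes>\<^bsub>R\<^esub> act R h x') (y \<otimes>\<^bsub>R\<^esub> y')"
proof -
  note kT = kspace_tensor[OF kR kR] and kHR = kspace_tensor[OF kH kR] and p = tpure_bilin[OF kR kR]
  note mc = bilinD(3)[OF m] and ac = bilinD(3)[OF a] and cc = linear_mapD(1)[OF c]
  let ?G = "\<lambda>a b' a' h b0. tpure R R (a \<otimes>\<^bsub>R\<^esub> act R h a') (b0 \<otimes>\<^bsub>R\<^esub> b')"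
  let ?F = "\<lambda>a b a' b'. tlift (tensor R R) (?G a b' a') (coact R b)"
  have G: "bilin H R (tensor R R) (?G a b' a')" if "a \<in> carrier R" "b' \<in> carrier R" "a' \<in> carrier R" for a b' a'
    by (rule bilin_comp[OF p bilin_right[OF m that(1) bilinD(2)[OF a that(3)]] bilinD(2)[OF m that(2)]])
  have F1: "bilin R R (tensor R R) (\<lambda>a' b'. ?F a b a' b')" if "a \<in> carrier R" "b \<in> carrier R" for a b
  proof (rule bilinI)
    show "linear_map R (tensor R R) (\<lambda>b'. ?F a b a' b')" if "a' \<in> carrier R" for a'
      by (rule tlift_param[OF kH kR kT _ cc[OF \<open>b \<in> carrier R\<close>] kR])
        (rule bilin_right[OF p _ bilinD(1)[OF m]], simp_all add: mc ac that \<open>a \<in> carrier R\<close>)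
    show "linear_map R (tensor R R) (\<lambda>a'. ?F a b a' b')" if "b' \<in> carrier R" for b'
      by (rule tlift_param[OF kH kR kT _ cc[OF \<open>b \<in> carrier R\<close>] kR])
        (rule bilin_left[OF p bilin_right[OF m \<open>a \<in> carrier R\<close> bilinD(1)[OF a]]], simp_all add: mc that)
  qed
  have F2: "bilin R R (tensor R R) (\<lambda>a b. ?F a b x' y')"
  proof (rule bilinI)
    show "linear_map R (tensor R R) (\<lambda>b. ?F a b x' y')" if "a \<in> carrier R" for a
      by (rule linear_map_comp[OF tlift_linear[OF kH kR kT G[OF that cl(4,3)]] c])
    show "linear_map R (tensor R R) (\<lambda>a. ?F a b x' y')" if "b \<in> carrier R" for b
      by (rule tlift_param[OF kH kR kT _ cc[OF that] kR])
        (rule bilin_left[OF p bilinD(2)[OF m]], simp_all add: mc ac cl)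
  qed
  have F3: "bilin R R (tensor R R) (\<lambda>a b. tlift (tensor R R) (\<lambda>a' b'. ?F a b a' b') (tpure R R x' y'))"
    by (rule bilin_cong[OF F2 _ kR kR]) (simp add: tlift_tpure[OF kR kR kT F1] cl)
  show ?thesis
    unfolding braided_mult_def
    by (simp only: tlift_tpure[OF kR kR kT F3 cl(1,2)] tlift_tpure[OF kR kR kT F1[OF cl(1,2)] cl(3,4)])
      (simp only: y tlift_tpure[OF kH kR kT G[OF cl(1,4,3)] y(1) cl(2)])
qed

text \<open>The basis diagonalises both action and coaction, so the braiding multiplies basis words
  by scalars. Indices outside \<open>J\<close> carry a character too, so that
  \<open>wchar \<chi> l\<close> is a character for every list \<open>l\<close>.\<close>

locale diag_yd =
  fixes H :: "('k::field, 'g::ab_group_add \<Rightarrow>\<^sub>0 'k) hopf" and M :: "('k, 'g \<Rightarrow>\<^sub>0 'k, 'm) ydmod"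
    and J :: "nat set" and b :: "nat \<Rightarrow> 'm" and g :: "nat \<Rightarrow> 'g" and \<chi> :: "nat \<Rightarrow> 'g \<Rightarrow> 'k"
  assumes H: "H = group_algebra" and yd: "yd_module H M" and basis: "is_basis M J b"
    and comp: "\<And>j. j \<in> J \<Longrightarrow> b j \<in> yd_component M (g j) (\<chi> j)"
    and char: "\<And>j. \<chi> j \<in> characters"
begin

lemma finJ: "finite J" and bM: "j \<in> J \<Longrightarrow> b j \<in> carrier M"
  using basis by (auto simp: is_basis_def)

lemma kM: "kspace M"
  using yd by (simp add: yd_module_def left_module_def)

lemmas kH = kspace_group_algebra[OF H]
lemmas spanH = spans_group_algebra[OF H]

lemma Hc: "h \<in> carrier H"
  by (simp add: H group_algebra_simps)

lemma act_linear: "linear_map M M (act M h)"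
  using yd Hc by (simp add: yd_module_def left_module_def)

lemma act_bilin: "bilin H M M (act M)"
  using yd by (auto simp: yd_module_def left_module_def bilin_def)

lemma coact_linear: "linear_map M (tensor H M) (coact M)"
  using yd by (simp add: yd_module_def left_comodule_def)

lemma act_b: "j \<in> J \<Longrightarrow> act M (gelt h) (b j) = \<chi> j h \<odot>\<^bsub>M\<^esub> b j"
  and coact_b: "j \<in> J \<Longrightarrow> coact M (b j) = tpure H M (gelt (g j)) (b j)"
  using comp[of j] by (auto simp: yd_component_def H)

lemma spanM: "spans M (b ` J)"
  unfolding spans_def
proof
  show "b ` J \<subseteq> carrier M" using bM by auto
  show "carrier M \<subseteq> lspan M (b ` J)"
  proof
    fix x assume "x \<in> carrier M"
    then obtain c where "x = (\<Oplus>\<^bsub>M\<^esub>i\<in>J. c i \<odot>\<^bsub>M\<^esub> b i)" using basis by (auto simp: is_basis_def)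
    then show "x \<in> lspan M (b ` J)"
      by (force intro!: lspan_finsum[OF kM] lspan_smul simp: bM lspan_gen)
  qed
qed

section \<open>Structure maps of the tensor algebra on basis words\<close>

abbreviation "T \<equiv> talg M"
abbreviation "TB \<equiv> tensor_algebra H M"

lemmas kT = kspace_talg[OF kM]
lemmas T_alg = k_algebra_talg[OF kM]
lemmas T_mult = k_algebra_mult_bilin[OF T_alg]
lemmas kHT = kspace_tensor[OF kH kT]
lemmas kTT = kspace_tensor[OF kT kT]

lemma talg_yd_simps:
  "act (talg_yd H M) = (\<lambda>h. wlift T (\<lambda>w. word_act H M w h))"
  "coact (talg_yd H M) = wlift (tensor H T) (word_coact H M)"
  "mult (talg_yd H M) = mult T" "one (talg_yd H M) = one T"
  by (simp_all add: talg_yd_def module.defs ydmod.defs)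

lemma tensor_algebra_simps:
  "act TB = act (talg_yd H M)" "coact TB = coact (talg_yd H M)" "mult TB = mult T" "one TB = one T"
  "bcomult TB = wlift (tensor T T) (word_comult H M)"
  "bcounit TB = wlift base_field (\<lambda>w. if w = [] then 1 else 0)"
  by (simp_all add: tensor_algebra_def talg_yd_def ydmod.defs module.defs ydbialg.defs)

lemma same_TY: "same_space T (talg_yd H M)"
  by (simp add: same_space_def talg_yd_def module.defs ydmod.defs)

lemma same_TB: "same_space T TB"
  by (simp add: same_space_def tensor_algebra_def talg_yd_def module.defs ydmod.defs ydbialg.defs)

lemma carrier_TB: "carrier TB = carrier T"
  using same_TB by (simp add: same_space_def)

text \<open>The diagonal action of a general \<open>h\<close> involves iterated coproducts.
  Expanding \<open>h\<close> in group elements avoids them, since a group element acts on each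
  letter separately.\<close>

lemma word_act_eq:
  assumes "w \<in> lists (carrier M)"
  shows "word_act H M w h = lc T (\<lambda>y. tword M (map (act M (gelt y)) w)) h"
  using assms
proof (induction arbitrary: h)
  case Nil
  have "counit H h \<odot>\<^bsub>T\<^esub> tword M [] = lc T (\<lambda>y. tword M []) h"
    by (rule linear_eq_on_span[OF linear_map_smul_const[OF kT counit_linear[OF H]] group_algebra_lc_linear[OF H kT]
          spanH kH kT _ Hc])
      (auto simp: tword_closed[OF kM] counit_gelt[OF H] group_algebra_lc_gelt[OF H kT] ks_smul_one[OF kT])
  then show ?case by (simp add: tword_Nil[OF kM])
next
  case (Cons m w)
  have c: "tword M (map (act M (gelt y)) w) \<in> carrier T" for y
    using Cons(2) by (intro tword_closed[OF kM]) (auto simp: linear_mapD(1)[OF act_linear] in_lists_conv_set)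
  have c1: "act M y m \<in> carrier M" for y using Cons(1) linear_mapD(1)[OF act_linear] by simp
  have "linear_map H T (word_act H M w)"
    unfolding Cons.IH[abs_def] by (rule group_algebra_lc_linear[OF H kT]) (use c in auto)
  then have b: "bilin H H T (\<lambda>h1 h2. tword M [act M h1 m] \<otimes>\<^bsub>T\<^esub> word_act H M w h2)"
    by (intro bilin_comp[OF T_mult] linear_map_comp[OF tword_letter_linear[OF kM]] bilinD(2)[OF act_bilin] Cons)
  have wg: "word_act H M w (gelt y) = tword M (map (act M (gelt y)) w)" for y
    using c by (simp add: Cons.IH group_algebra_lc_gelt[OF H kT])
  have "tword M [act M (gelt y) m] \<otimes>\<^bsub>T\<^esub> word_act H M w (gelt y) = tword M (map (act M (gelt y)) (m # w))" for y
    using c1 Cons(2) unfolding wg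
    by (subst tword_mult[OF kM]) (auto simp: linear_mapD(1)[OF act_linear] in_lists_conv_set)
  then show ?case unfolding word_act.simps tlift_comult[OF H kT b] by simp
qed

lemma word_act_multilin: "multilin M T (\<lambda>w. word_act H M w h)"
proof -
  have m: "multilin M T (\<lambda>w. tword M (map (act M (gelt y)) w))" for y
    by (rule multilin_tword_map[OF kM act_linear])
  have "linear_map M T (\<lambda>x. word_act H M (p @ x # q) h)"
    if pq: "p \<in> lists (carrier M)" "q \<in> lists (carrier M)" for p q
  proof (rule linear_map_cong[OF lc_linear_param[OF kT, of UNIV M]])
    show "linear_map M T (\<lambda>x. tword M (map (act M (gelt y)) (p @ x # q)))" for y
      by (rule multilin_linear[OF kM kT m pq])
  qed (use pq in \<open>simp_all add: kM word_act_eq\<close>)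
  moreover have "word_act H M w h \<in> carrier T" if "w \<in> lists (carrier M)" for w
    unfolding word_act_eq[OF that]
    by (rule linear_mapD(1)[OF group_algebra_lc_linear[OF H kT] Hc]) (use multilin_closed[OF kM kT m that] in auto)
  ultimately show ?thesis by (simp add: multilin_def)
qed

lemma act_T_bilin: "bilin H T T (act TB)"
  unfolding tensor_algebra_simps talg_yd_simps
proof (rule bilinI)
  show "linear_map T T (wlift T (\<lambda>w. word_act H M w h))" for h
    by (rule wlift_linear[OF kM kT word_act_multilin])
  show "linear_map H T (\<lambda>h. wlift T (\<lambda>w. word_act H M w h) t)" if t: "t \<in> carrier T" for t
  proof (rule wlift_param[OF kM kT kH _ t])
    fix w assume w: "w \<in> lists (carrier M)"
    have "tword M (map (act M (gelt y)) w) \<in> carrier T" for y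
      by (rule multilin_closed[OF kM kT multilin_tword_map[OF kM act_linear] w])
    then show "linear_map H T (\<lambda>h. word_act H M w h)"
      unfolding word_act_eq[OF w] by (intro group_algebra_lc_linear[OF H kT]) auto
  qed
qed

definition bw :: "nat list \<Rightarrow> ('m list \<Rightarrow>\<^sub>0 'k) set" where
  "bw l = tword M (map b l)"

lemma map_b: "l \<in> lists J \<Longrightarrow> map b l \<in> lists (carrier M)"
  using bM by (auto simp: in_lists_conv_set)

lemma bw_closed: "l \<in> lists J \<Longrightarrow> bw l \<in> carrier T"
  by (simp add: bw_def tword_closed[OF kM] map_b)

lemma bw_mult: "l \<in> lists J \<Longrightarrow> l' \<in> lists J \<Longrightarrow> bw l \<otimes>\<^bsub>T\<^esub> bw l' = bw (l @ l')"
  using map_b by (simp add: bw_def tword_mult[OF kM])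

lemma bw_Nil: "bw [] = \<one>\<^bsub>T\<^esub>"
  by (simp add: bw_def tword_Nil[OF kM])

lemma tword_span: "w \<in> lists (carrier M) \<Longrightarrow> tword M w \<in> lspan T (bw ` lists J)"
proof (induction rule: lists.induct)
  case Nil
  then show ?case by (intro lspan_gen image_eqI[of _ _ "[]"]) (simp_all add: bw_def)
next
  case (Cons m w)
  have bc: "bw ` lists J \<subseteq> carrier T" by (auto simp: bw_closed)
  have m: "m \<in> lspan M (b ` J)" using spanM Cons(1) by (auto simp: spans_def)
  have "tword M [m] \<in> lspan T (bw ` lists J)"
    by (rule lspan_linear_image[OF tword_letter_linear[OF kM] m kM kT])
      (use bM in \<open>auto simp: bw_def intro!: lspan_gen image_eqI[of _ _ "[_]"]\<close>)
  then show ?case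
    unfolding tword_Cons[OF kM Cons(1,2)]
    by (rule lspan_bilin[OF T_mult _ Cons(3) bc bc kT kT kT])
      (use bw_mult in \<open>auto intro!: lspan_gen\<close>)
qed

lemma spanT: "spans T (bw ` lists J)"
  by (rule spansI_lspan[OF spans_talg[OF kM] kT]) (auto simp: bw_closed tword_span)

lemma tword_scale:
  assumes "l \<in> lists J"
  shows "tword M (map (\<lambda>j. c j \<odot>\<^bsub>M\<^esub> b j) l) = prod_list (map c l) \<odot>\<^bsub>T\<^esub> bw l"
  using assms
proof induction
  case Nil
  then show ?case by (simp add: bw_def ks_smul_one[OF kT] tword_closed[OF kM])
next
  case (Cons j l)
  have cM: "map (\<lambda>j. c j \<odot>\<^bsub>M\<^esub> b j) l \<in> lists (carrier M)" using Cons(2) bM by (auto simp: ks_smul[OF kM] in_lists_conv_set)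
  have "tword M (map (\<lambda>j. c j \<odot>\<^bsub>M\<^esub> b j) (j # l))
      = tword M [c j \<odot>\<^bsub>M\<^esub> b j] \<otimes>\<^bsub>T\<^esub> (prod_list (map c l) \<odot>\<^bsub>T\<^esub> bw l)"
    using tword_Cons[OF kM ks_smul[OF kM bM[OF Cons(1)]] cM, of "c j"] Cons(3) by simp
  also have "\<dots> = (c j \<odot>\<^bsub>T\<^esub> bw [j]) \<otimes>\<^bsub>T\<^esub> (prod_list (map c l) \<odot>\<^bsub>T\<^esub> bw l)"
    using linear_mapD(3)[OF tword_letter_linear[OF kM] bM[OF Cons(1)]] by (simp add: bw_def)
  also have "\<dots> = prod_list (map c (j # l)) \<odot>\<^bsub>T\<^esub> bw (j # l)"
    using Cons(1,2) bw_mult[of "[j]" l]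
    by (simp add: k_algebraD(3,4)[OF T_alg] bw_closed ks_smul[OF kT] ks_smul_smul[OF kT] mult.commute)
  finally show ?case .
qed

lemma act_bw: "l \<in> lists J \<Longrightarrow> act TB (gelt h) (bw l) = wchar \<chi> l h \<odot>\<^bsub>T\<^esub> bw l"
proof -
  assume l: "l \<in> lists J"
  have "act TB (gelt h) (bw l) = word_act H M (map b l) (gelt h)"
    unfolding tensor_algebra_simps talg_yd_simps bw_def
    by (rule wlift_tword[OF kM kT word_act_multilin map_b[OF l]])
  also have "\<dots> = tword M (map (act M (gelt h)) (map b l))"
    by (simp add: word_act_eq[OF map_b[OF l]] group_algebra_lc_gelt[OF H kT]
        multilin_closed[OF kM kT multilin_tword_map[OF kM act_linear] map_b[OF l]] del: map_map)
  also have "map (act M (gelt h)) (map b l) = map (\<lambda>j. \<chi> j h \<odot>\<^bsub>M\<^esub> b j) l"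
    using l by (auto simp: act_b in_lists_conv_set)
  finally show ?thesis using l by (simp add: tword_scale wchar_def)
qed

lemma tm_HT: "bilin (tensor H T) (tensor H T) (tensor H T) (tensor_mult H T)"
  by (rule tensor_mult_bilin[OF kH kT group_algebra_mult_bilin[OF H] T_mult])

lemma letter_coact_bilin: "bilin H M (tensor H T) (\<lambda>h x. tpure H T h (tword M [x]))"
  by (rule bilin_comp[OF tpure_bilin[OF kH kT] linear_map_id tword_letter_linear[OF kM]])

lemma word_coact_multilin: "multilin M (tensor H T) (word_coact H M)"
proof (rule multilin_rec)
  show "bilin M (tensor H T) (tensor H T)
    (\<lambda>m X. tensor_mult H T (tlift (tensor H T) (\<lambda>h x. tpure H T h (tword M [x])) (coact M m)) X)"
    by (rule bilin_comp[OF tm_HT linear_map_comp[OF tlift_linear[OF kH kM kHT letter_coact_bilin] coact_linear]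
          linear_map_id])
qed (simp_all add: Hc tpure_closed[OF kH kT] k_algebraD(6)[OF T_alg])

lemma coact_T_linear: "linear_map T (tensor H T) (coact TB)"
  unfolding tensor_algebra_simps talg_yd_simps by (rule wlift_linear[OF kM kHT word_coact_multilin])

lemma coact_bw: "l \<in> lists J \<Longrightarrow> coact TB (bw l) = tpure H T (gelt (wdeg g l)) (bw l)"
proof -
  assume l: "l \<in> lists J"
  have "coact TB (bw l) = word_coact H M (map b l)"
    unfolding tensor_algebra_simps talg_yd_simps bw_def
    by (rule wlift_tword[OF kM kHT word_coact_multilin map_b[OF l]])
  also have "\<dots> = tpure H T (gelt (wdeg g l)) (bw l)"
    using l
  proof induction
    case Nil
    then show ?case by (simp add: bw_Nil H group_algebra_simps gelt_zero)
  next
    case (Cons j l)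
    have "tlift (tensor H T) (\<lambda>h x. tpure H T h (tword M [x])) (coact M (b j)) = tpure H T (gelt (g j)) (bw [j])"
      using Cons(1) by (simp add: coact_b tlift_tpure[OF kH kM kHT letter_coact_bilin] Hc bM bw_def)
    then show ?case
      using Cons bw_mult[of "[j]" l]
      by (simp add: tensor_mult_tpure[OF kH kT group_algebra_mult_bilin[OF H] T_mult] Hc bw_closed)
        (simp add: H group_algebra_simps gelt_mult)
  qed
  finally show ?thesis .
qed

lemma mult_TY: "bilin (talg_yd H M) (talg_yd H M) (talg_yd H M) (\<otimes>\<^bsub>talg_yd H M\<^esub>)"
  unfolding talg_yd_simps bilin_same[OF same_TY same_TY same_TY, symmetric] by (rule T_mult)

lemma act_TY: "bilin H (talg_yd H M) (talg_yd H M) (act (talg_yd H M))"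
  using act_T_bilin unfolding bilin_same[OF same_space_refl same_TY same_TY, symmetric] tensor_algebra_simps .

lemma coact_TY: "linear_map (talg_yd H M) (tensor H (talg_yd H M)) (coact (talg_yd H M))"
  unfolding tensor_same[OF same_space_refl same_TY, symmetric] linear_map_same[OF same_TY same_space_refl, symmetric]
  using coact_T_linear unfolding tensor_algebra_simps .

lemmas kTY = kspace_same[OF same_TY kT]

lemma bm_bilin: "bilin (tensor T T) (tensor T T) (tensor T T) (braided_mult (talg_yd H M))"
  using braided_mult_bilin[OF kH kTY mult_TY act_TY coact_TY]
  unfolding tensor_same[OF same_TY same_TY, symmetric] .

lemma bm_tpure:
  assumes "x \<in> carrier T" "l \<in> lists J" "x' \<in> carrier T" "y' \<in> carrier T"
  shows "braided_mult (talg_yd H M) (tpure T T x (bw l)) (tpure T T x' y')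
    = tpure T T (x \<otimes>\<^bsub>T\<^esub> act TB (gelt (wdeg g l)) x') (bw l \<otimes>\<^bsub>T\<^esub> y')"
proof -
  have e: "carrier (talg_yd H M) = carrier T" using same_TY by (simp add: same_space_def)
  show ?thesis
    using braided_mult_tpure[OF kH kTY mult_TY act_TY coact_TY, of x "bw l" x' y' "gelt (wdeg g l)"] coact_bw[OF assms(2)]
      assms bw_closed[OF assms(2)]
    unfolding tensor_same[OF same_TY same_TY, symmetric] tensor_same[OF same_space_refl[of H] same_TY, symmetric] e
      talg_yd_simps(3) tensor_algebra_simps(1,2)
    by (simp add: Hc)
qed

lemma tpTT: "x \<in> carrier T \<Longrightarrow> y \<in> carrier T \<Longrightarrow> tpure T T x y \<in> carrier (tensor T T)"
  by (rule tpure_closed[OF kT kT])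

abbreviation "prim m \<equiv> tpure T T (tword M [m]) \<one>\<^bsub>T\<^esub> \<oplus>\<^bsub>tensor T T\<^esub> tpure T T \<one>\<^bsub>T\<^esub> (tword M [m])"

lemma word_comult_multilin: "multilin M (tensor T T) (word_comult H M)"
proof (rule multilin_rec)
  note tb = tpure_bilin[OF kT kT] and o = k_algebraD(6)[OF T_alg] and tl = tword_letter_linear[OF kM]
  show "bilin M (tensor T T) (tensor T T) (\<lambda>m X. braided_mult (talg_yd H M) (prim m) X)"
    by (rule bilin_comp[OF bm_bilin linear_map_add[OF kTT] linear_map_id])
      (rule bilin_left[OF tb tl o], rule bilin_right[OF tb o tl])
qed (simp_all add: tpTT k_algebraD(6)[OF T_alg])

lemma comult_T_linear: "linear_map T (tensor T T) (bcomult TB)"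
  unfolding tensor_algebra_simps by (rule wlift_linear[OF kM kTT word_comult_multilin])

text \<open>Multiplying x \<otimes> y on the left by m \<otimes> 1 + 1 \<otimes> m in the braided
  square gives m x \<otimes> y and (h \<cdot> x) \<otimes> m y, where h is the degree of m. On basis
  words the action is the scalar \<open>wchar \<chi> x (g j)\<close>, and this is the recursion of
  \<open>wsplit\<close>.\<close>

lemma comult_bw: "l \<in> lists J \<Longrightarrow> bcomult TB (bw l) = wsplit g \<chi> (tensor T T) l (\<lambda>x y. tpure T T (bw x) (bw y))"
proof -
  assume l: "l \<in> lists J"
  have "bcomult TB (bw l) = word_comult H M (map b l)"
    unfolding tensor_algebra_simps bw_def
    by (rule wlift_tword[OF kM kTT word_comult_multilin map_b[OF l]])
  also have "\<dots> = wsplit g \<chi> (tensor T T) l (\<lambda>x y. tpure T T (bw x) (bw y))"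
    using l
  proof induction
    case Nil
    then show ?case by (simp add: bw_Nil)
  next
    case (Cons j l)
    have j: "[j] \<in> lists J" using Cons(1) by simp
    have o: "\<one>\<^bsub>T\<^esub> = bw []" by (rule bw_Nil[symmetric])
    have tj: "tword M [b j] = bw [j]" by (simp add: bw_def)
    have pc: "tpure T T (bw x) (bw y) \<in> carrier (tensor T T)" if "x \<in> lists J" "y \<in> lists J" for x y
      using that by (simp add: tpTT bw_closed)
    have pr: "prim (b j) \<in> carrier (tensor T T)"
      using j by (simp add: o tj pc ks_add[OF kTT])
    have "word_comult H M (map b (j # l))
      = wsplit g \<chi> (tensor T T) l (\<lambda>x y. braided_mult (talg_yd H M) (prim (b j)) (tpure T T (bw x) (bw y)))"
      unfolding list.map word_comult.simps Cons.IH
      by (rule linear_wsplit[OF bilinD(1)[OF bm_bilin pr] kTT Cons(2)]) (rule pc)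
    also have "\<dots> = wsplit g \<chi> (tensor T T) (j # l) (\<lambda>x y. tpure T T (bw x) (bw y))"
      unfolding wsplit.simps
    proof (rule wsplit_cong[OF Cons(2)])
      fix x y assume xy: "x \<in> lists J" "y \<in> lists J"
      have "braided_mult (talg_yd H M) (prim (b j)) (tpure T T (bw x) (bw y))
          = braided_mult (talg_yd H M) (tpure T T (bw [j]) (bw [])) (tpure T T (bw x) (bw y))
          \<oplus>\<^bsub>tensor T T\<^esub> braided_mult (talg_yd H M) (tpure T T (bw []) (bw [j])) (tpure T T (bw x) (bw y))"
        unfolding o tj by (rule linear_mapD(2)[OF bilinD(2)[OF bm_bilin]]) (use xy j in \<open>simp_all add: pc\<close>)
      \<comment> \<open>The empty word has degree 0, so it passes \<open>x\<close> without a
        coefficient.\<close>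
      also have "braided_mult (talg_yd H M) (tpure T T (bw [j]) (bw [])) (tpure T T (bw x) (bw y)) = tpure T T (bw (j # x)) (bw y)"
        using xy j act_bw[OF xy(1), of 0] bw_mult[of "[j]" x] bw_mult[of "[]" y] wchar_character[of \<chi> x, OF char]
        by (simp add: bm_tpure bw_closed characters_mult(2) ks_smul_one[OF kT])
      \<comment> \<open>Here a letter of degree \<open>g j\<close> moves past \<open>x\<close>, and
        the coefficient of \<open>wsplit\<close> appears.\<close>
      also have "braided_mult (talg_yd H M) (tpure T T (bw []) (bw [j])) (tpure T T (bw x) (bw y))
          = wchar \<chi> x (g j) \<odot>\<^bsub>tensor T T\<^esub> tpure T T (bw x) (bw (j # y))"
        using xy j bw_mult[of "[]" x] bw_mult[of "[j]" y]
          linear_mapD(3)[OF bilinD(2)[OF tpure_bilin[OF kT kT]], of "bw (j # y)" "bw x" "wchar \<chi> x (g j)"]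
        by (simp add: bm_tpure bw_closed act_bw k_algebraD(4)[OF T_alg])
      finally show "braided_mult (talg_yd H M) (prim (b j)) (tpure T T (bw x) (bw y))
        = tpure T T (bw (j # x)) (bw y) \<oplus>\<^bsub>tensor T T\<^esub> wchar \<chi> x (g j) \<odot>\<^bsub>tensor T T\<^esub> tpure T T (bw x) (bw (j # y))" .
    qed
    finally show ?case .
  qed
  finally show ?thesis .
qed

lemma counit_multilin: "multilin M base_field (\<lambda>w. if w = [] then 1 else 0)"
  by (simp add: multilin_def linear_map_const_zero[OF kspace_base_field, simplified])

lemma counit_T_linear: "linear_map T base_field (bcounit TB)"
  unfolding tensor_algebra_simps by (rule wlift_linear[OF kM kspace_base_field counit_multilin])

lemma counit_bw: "l \<in> lists J \<Longrightarrow> bcounit TB (bw l) = (if l = [] then 1 else 0)"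
  unfolding tensor_algebra_simps bw_def
  by (subst wlift_tword[OF kM kspace_base_field counit_multilin]) (use map_b in auto)

lemma homogeneous_multilin: "multilin M T (\<lambda>w. if length w = n then tword M w else \<zero>\<^bsub>T\<^esub>)"
proof -
  have t: "multilin M T (tword M)" using multilin_tword_map[OF kM linear_map_id] by (simp add: map_idI)
  have "linear_map M T (\<lambda>x. if length (p @ x # q) = n then tword M (p @ x # q) else \<zero>\<^bsub>T\<^esub>)"
    if "p \<in> lists (carrier M)" "q \<in> lists (carrier M)" for p q
    using multilin_linear[OF kM kT t that] linear_map_const_zero[OF kT, of M]
    by (cases "length p + Suc (length q) = n") simp_all
  then show ?thesis using multilin_closed[OF kM kT t] by (simp add: multilin_def ks_zero[OF kT])
qed

lemma homogeneous_linear: "linear_map T T (homogeneous_part M n)"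
  unfolding homogeneous_part_def by (rule wlift_linear[OF kM kT homogeneous_multilin])

lemma homogeneous_tword: "w \<in> lists (carrier M) \<Longrightarrow>
    homogeneous_part M n (tword M w) = (if length w = n then tword M w else \<zero>\<^bsub>T\<^esub>)"
  unfolding homogeneous_part_def by (rule wlift_tword[OF kM kT homogeneous_multilin])

lemma homogeneous_bw: "l \<in> lists J \<Longrightarrow> homogeneous_part M n (bw l) = (if length l = n then bw l else \<zero>\<^bsub>T\<^esub>)"
  using homogeneous_tword[OF map_b] by (simp add: bw_def)

section \<open>Coordinates and linear forms on the tensor algebra\<close>

definition coord :: "'m \<Rightarrow> nat \<Rightarrow> 'k" where
  "coord x = (THE c. c \<in> extensional J \<and> x = (\<Oplus>\<^bsub>M\<^esub>i\<in>J. c i \<odot>\<^bsub>M\<^esub> b i))"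

lemma coord_unique:
  assumes "x \<in> carrier M" "x = (\<Oplus>\<^bsub>M\<^esub>i\<in>J. c i \<odot>\<^bsub>M\<^esub> b i)" "j \<in> J"
  shows "coord x j = c j"
proof -
  interpret M: module "base_field :: ('k, 'k) module" M by (rule kM)
  have "x = (\<Oplus>\<^bsub>M\<^esub>i\<in>J. restrict c J i \<odot>\<^bsub>M\<^esub> b i)"
    unfolding assms(2) by (rule M.finsum_cong') (auto simp: bM ks_smul[OF kM])
  then have "coord x = restrict c J"
    unfolding coord_def using basis assms(1) by (intro the1_equality) (auto simp: is_basis_def)
  then show ?thesis using assms(3) by simp
qed

lemma coord_sum: "x \<in> carrier M \<Longrightarrow> x = (\<Oplus>\<^bsub>M\<^esub>i\<in>J. coord x i \<odot>\<^bsub>M\<^esub> b i)"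
  unfolding coord_def using basis theI'[of "\<lambda>c. c \<in> extensional J \<and> x = (\<Oplus>\<^bsub>M\<^esub>i\<in>J. c i \<odot>\<^bsub>M\<^esub> b i)"]
  by (auto simp: is_basis_def)

lemma coord_linear:
  assumes "j \<in> J" shows "linear_map M base_field (\<lambda>x. coord x j)"
proof -
  interpret M: module "base_field :: ('k, 'k) module" M by (rule kM)
  have c: "(\<lambda>i. f i \<odot>\<^bsub>M\<^esub> b i) \<in> J \<rightarrow> carrier M" for f by (auto simp: bM ks_smul[OF kM])
  show ?thesis
  proof (rule linear_mapI)
    fix x y assume xy: "x \<in> carrier M" "y \<in> carrier M"
    have "(\<Oplus>\<^bsub>M\<^esub>i\<in>J. (coord x i + coord y i) \<odot>\<^bsub>M\<^esub> b i)
        = (\<Oplus>\<^bsub>M\<^esub>i\<in>J. coord x i \<odot>\<^bsub>M\<^esub> b i \<oplus>\<^bsub>M\<^esub> coord y i \<odot>\<^bsub>M\<^esub> b i)"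
      by (rule M.finsum_cong') (auto simp: bM ks_smul[OF kM] ks_smul_ladd[OF kM])
    also have "\<dots> = (\<Oplus>\<^bsub>M\<^esub>i\<in>J. coord x i \<odot>\<^bsub>M\<^esub> b i) \<oplus>\<^bsub>M\<^esub> (\<Oplus>\<^bsub>M\<^esub>i\<in>J. coord y i \<odot>\<^bsub>M\<^esub> b i)"
      by (rule M.finsum_addf) (rule c)+
    also have "\<dots> = x \<oplus>\<^bsub>M\<^esub> y" using xy by (simp flip: coord_sum)
    finally have e: "(\<Oplus>\<^bsub>M\<^esub>i\<in>J. (coord x i + coord y i) \<odot>\<^bsub>M\<^esub> b i) = x \<oplus>\<^bsub>M\<^esub> y" .
    show "coord (x \<oplus>\<^bsub>M\<^esub> y) j = coord x j \<oplus>\<^bsub>base_field\<^esub> coord y j"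
      by (rule trans[OF coord_unique[OF ks_add[OF kM xy] e[symmetric] assms]]) simp
  next
    fix c' x assume x: "x \<in> carrier M"
    have "(\<Oplus>\<^bsub>M\<^esub>i\<in>J. (c' * coord x i) \<odot>\<^bsub>M\<^esub> b i) = (\<Oplus>\<^bsub>M\<^esub>i\<in>J. c' \<odot>\<^bsub>M\<^esub> (coord x i \<odot>\<^bsub>M\<^esub> b i))"
      by (rule M.finsum_cong') (auto simp: bM ks_smul[OF kM] ks_smul_smul[OF kM])
    also have "\<dots> = c' \<odot>\<^bsub>M\<^esub> (\<Oplus>\<^bsub>M\<^esub>i\<in>J. coord x i \<odot>\<^bsub>M\<^esub> b i)"
      by (rule M.finsum_smult_ldistr[symmetric]) (use c finJ in auto)
    also have "\<dots> = c' \<odot>\<^bsub>M\<^esub> x" using x by (simp flip: coord_sum)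
    finally have e: "(\<Oplus>\<^bsub>M\<^esub>i\<in>J. (c' * coord x i) \<odot>\<^bsub>M\<^esub> b i) = c' \<odot>\<^bsub>M\<^esub> x" .
    show "coord (c' \<odot>\<^bsub>M\<^esub> x) j = c' \<odot>\<^bsub>base_field\<^esub> coord x j"
      by (rule trans[OF coord_unique[OF ks_smul[OF kM x] e[symmetric] assms]]) simp
  qed simp
qed

lemma coord_b: "i \<in> J \<Longrightarrow> j \<in> J \<Longrightarrow> coord (b i) j = (if i = j then 1 else 0)"
proof -
  assume ij: "i \<in> J" "j \<in> J"
  interpret M: module "base_field :: ('k, 'k) module" M by (rule kM)
  have "(\<Oplus>\<^bsub>M\<^esub>k\<in>J. (if i = k then 1 else 0) \<odot>\<^bsub>M\<^esub> b k) = (\<Oplus>\<^bsub>M\<^esub>k\<in>J. if i = k then b k else \<zero>\<^bsub>M\<^esub>)"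
    by (rule M.finsum_cong') (auto simp: bM ks_smul_one[OF kM] ks_smul_0[OF kM])
  also have "\<dots> = b i" using ij finJ by (intro M.finsum_singleton) (auto simp: bM)
  finally have e: "(\<Oplus>\<^bsub>M\<^esub>k\<in>J. (if i = k then 1 else 0) \<odot>\<^bsub>M\<^esub> b k) = b i" .
  show ?thesis by (rule trans[OF coord_unique[OF bM[OF ij(1)] e[symmetric] ij(2)]]) simp
qed

text \<open>The multilinear extension of \<open>f\<close> from index words to arbitrary words, which
  is what \<open>tfun\<close> passes to the tensor algebra.\<close>

primrec wcoord :: "'m list \<Rightarrow> (nat list \<Rightarrow> 'k) \<Rightarrow> 'k" where
  "wcoord [] f = f []"
| "wcoord (m # w) f = (\<Sum>j\<in>J. coord m j * wcoord w (\<lambda>l. f (j # l)))"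

lemma linear_map_sum:
  "(\<And>i. i \<in> I \<Longrightarrow> linear_map L base_field (f i)) \<Longrightarrow> linear_map L base_field (\<lambda>x. \<Sum>i\<in>I. f i x)"
  by (induction I rule: infinite_finite_induct)
    (simp_all add: linear_map_plus linear_map_const_zero[OF kspace_base_field, simplified])

lemma wcoord_multilin: "multilin M base_field (\<lambda>w. wcoord w f)"
proof -
  have "linear_map M base_field (\<lambda>x. wcoord (p @ x # q) f)" for p q
  proof (induction p arbitrary: f)
    case Nil
    then show ?case by (auto intro!: linear_map_sum linear_map_times_right coord_linear)
  next
    case (Cons m p)
    then show ?case by (auto intro!: linear_map_sum linear_map_times_left)
  qed
  then show ?thesis by (simp add: multilin_def)
qed

lemma wcoord_b: "l \<in> lists J \<Longrightarrow> wcoord (map b l) f = f l"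
proof (induction arbitrary: f rule: lists.induct)
  case (Cons i l)
  have "(\<Sum>j\<in>J. coord (b i) j * wcoord (map b l) (\<lambda>l. f (j # l))) = (\<Sum>j\<in>J. if i = j then f (i # l) else 0)"
    by (rule sum.cong) (simp_all add: coord_b Cons)
  then show ?case using Cons finJ by simp
qed simp

lemma wcoord_param:
  "(\<And>l. linear_map L base_field (\<lambda>x. F x l)) \<Longrightarrow> linear_map L base_field (\<lambda>x. wcoord w (F x))"
  by (induction w arbitrary: F) (auto intro!: linear_map_sum linear_map_times_left)

text \<open>That the values on basis words can be prescribed at will expresses their linear
  independence in the tensor algebra. In the Nichols algebra this fails in general, so the pairing
  is built here first.\<close>

definition tfun :: "(nat list \<Rightarrow> 'k) \<Rightarrow> ('m list \<Rightarrow>\<^sub>0 'k) set \<Rightarrow> 'k" where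
  "tfun f = wlift base_field (\<lambda>w. wcoord w f)"

lemma tfun_linear: "linear_map T base_field (tfun f)"
  unfolding tfun_def by (rule wlift_linear[OF kM kspace_base_field wcoord_multilin])

lemma tfun_bw: "l \<in> lists J \<Longrightarrow> tfun f (bw l) = f l"
  unfolding tfun_def bw_def
  by (simp add: wlift_tword[OF kM kspace_base_field wcoord_multilin map_b] wcoord_b)

lemma tfun_param:
  "(\<And>l. linear_map L base_field (\<lambda>x. F x l)) \<Longrightarrow> kspace L \<Longrightarrow> t \<in> carrier T \<Longrightarrow>
    linear_map L base_field (\<lambda>x. tfun (F x) t)"
  unfolding tfun_def by (rule wlift_param[OF kM kspace_base_field]) (auto intro: wcoord_param)

end

text \<open>Multiplicativity of the braided coproduct on words: the left part \<open>x'\<close> of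
  the second word has to pass the right part \<open>y\<close> of the first, which costs
  \<open>wchar \<chi> x' (wdeg g y)\<close>.\<close>

lemma wsplit_append:
  assumes char: "\<And>j. \<chi> j \<in> characters" and kX: "kspace X"
    and "w \<in> lists S" "w' \<in> lists S" "\<And>x y. x \<in> lists S \<Longrightarrow> y \<in> lists S \<Longrightarrow> F x y \<in> carrier X"
  shows "wsplit g \<chi> X (w @ w') F = wsplit g \<chi> X w (\<lambda>x y. wsplit g \<chi> X w' (\<lambda>x' y'.
    wchar \<chi> x' (wdeg g y) \<odot>\<^bsub>X\<^esub> F (x @ x') (y @ y')))"
  using assms(3,5)
proof (induction w arbitrary: F rule: list.induct)
  case Nil
  have "wchar \<chi> x' 0 = 1" for x' using wchar_character[of \<chi> x', OF char] by (rule characters_mult)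
  then have "wsplit g \<chi> X w' F = wsplit g \<chi> X w' (\<lambda>x' y'. wchar \<chi> x' 0 \<odot>\<^bsub>X\<^esub> F x' y')"
    by (intro wsplit_cong[OF assms(4)]) (simp add: Nil.prems(2) ks_smul_one[OF kX])
  then show ?case by simp
next
  case (Cons j w)
  have jw: "j \<in> S" "w \<in> lists S" using Cons.prems(1) by simp_all
  note F = Cons.prems(2)
  let ?F = "\<lambda>x y. F (j # x) y \<oplus>\<^bsub>X\<^esub> wchar \<chi> x (g j) \<odot>\<^bsub>X\<^esub> F x (j # y)"
  let ?A = "\<lambda>x y x' y'. wchar \<chi> x' (wdeg g y) \<odot>\<^bsub>X\<^esub> F (x @ x') (y @ y')"
  have c: "wchar \<chi> x (h + h') = wchar \<chi> x h * wchar \<chi> x h'" for x h h'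
    using wchar_character[of \<chi> x, OF char] by (rule characters_mult)
  have "wsplit g \<chi> X ((j # w) @ w') F = wsplit g \<chi> X w (\<lambda>x y. wsplit g \<chi> X w' (\<lambda>x' y'.
      wchar \<chi> x' (wdeg g y) \<odot>\<^bsub>X\<^esub> ?F (x @ x') (y @ y')))"
    unfolding append_Cons wsplit.simps
    by (rule Cons.IH) (simp_all add: jw F ks_add[OF kX] ks_smul[OF kX])
  also have "\<dots> = wsplit g \<chi> X w (\<lambda>x y. wsplit g \<chi> X w' (?A (j # x) y) \<oplus>\<^bsub>X\<^esub>
      wchar \<chi> x (g j) \<odot>\<^bsub>X\<^esub> wsplit g \<chi> X w' (?A x (j # y)))"
  proof (rule wsplit_cong[OF jw(2)])
    fix x y assume xy: "x \<in> lists S" "y \<in> lists S"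
    have "wsplit g \<chi> X w' (\<lambda>x' y'. wchar \<chi> x' (wdeg g y) \<odot>\<^bsub>X\<^esub> ?F (x @ x') (y @ y'))
      = wsplit g \<chi> X w' (\<lambda>x' y'. ?A (j # x) y x' y' \<oplus>\<^bsub>X\<^esub> wchar \<chi> x (g j) \<odot>\<^bsub>X\<^esub> ?A x (j # y) x' y')"
      by (rule wsplit_cong[OF assms(4)])
        (simp add: jw F xy ks_smul[OF kX] ks_smul_radd[OF kX] ks_smul_smul[OF kX] c mult_ac)
    also have "\<dots> = wsplit g \<chi> X w' (?A (j # x) y) \<oplus>\<^bsub>X\<^esub>
        wsplit g \<chi> X w' (\<lambda>x' y'. wchar \<chi> x (g j) \<odot>\<^bsub>X\<^esub> ?A x (j # y) x' y')"
      by (rule wsplit_add[OF kX assms(4)]) (simp_all add: jw F xy ks_smul[OF kX])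
    also have "wsplit g \<chi> X w' (\<lambda>x' y'. wchar \<chi> x (g j) \<odot>\<^bsub>X\<^esub> ?A x (j # y) x' y')
        = wchar \<chi> x (g j) \<odot>\<^bsub>X\<^esub> wsplit g \<chi> X w' (?A x (j # y))"
      by (rule linear_wsplit[OF linear_map_smul[OF kX linear_map_id] kX assms(4), symmetric])
        (simp add: jw F xy ks_smul[OF kX])
    finally show "wsplit g \<chi> X w' (\<lambda>x' y'. wchar \<chi> x' (wdeg g y) \<odot>\<^bsub>X\<^esub> ?F (x @ x') (y @ y'))
      = wsplit g \<chi> X w' (?A (j # x) y) \<oplus>\<^bsub>X\<^esub> wchar \<chi> x (g j) \<odot>\<^bsub>X\<^esub> wsplit g \<chi> X w' (?A x (j # y))" .
  qed
  finally show ?case by simp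
qed

lemma quot_same:
  assumes "same_space M M'" "mult M = mult M'" "one M = one M'"
  shows "quot M I = quot M' I"
  using assms a_r_coset_same[OF assms(1)]
  by (simp add: quot_def same_space_def A_RCOSETS_def' rcoset_mult_def set_add_def set_mult_def fun_eq_iff)

section \<open>The Nichols ideal\<close>

context diag_yd
begin

definition nichols_admissible :: "('m list \<Rightarrow>\<^sub>0 'k) set set \<Rightarrow> bool" where
  "nichols_admissible I \<longleftrightarrow> yd_subobject H TB I \<and> (\<forall>n. \<forall>x\<in>I. homogeneous_part M n x \<in> I)
     \<and> yd_coideal TB I \<and> I \<inter> (\<lambda>m. tword M [m]) ` carrier M = {\<zero>\<^bsub>T\<^esub>}"

abbreviation "HI I \<equiv> {tpure H T h y | h y. y \<in> I}"
abbreviation "TI I \<equiv> {tpure T T x y | x y. x \<in> I \<and> y \<in> carrier T} \<union> {tpure T T x y | x y. x \<in> carrier T \<and> y \<in> I}"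

lemma HI_closed: "I \<subseteq> carrier T \<Longrightarrow> HI I \<subseteq> carrier (tensor H T)"
  by (auto intro!: tpure_closed[OF kH kT] Hc)

lemma TI_closed: "I \<subseteq> carrier T \<Longrightarrow> TI I \<subseteq> carrier (tensor T T)"
  by (auto intro!: tpTT)

lemma tword_zero: "tword M [\<zero>\<^bsub>M\<^esub>] = \<zero>\<^bsub>T\<^esub>"
  by (rule linear_map_zero[OF tword_letter_linear[OF kM] kM kT])

lemma tensor_TB: "tensor H TB = tensor H T" "tpure H TB = tpure H T" "tensor TB TB = tensor T T" "tpure TB TB = tpure T T"
  using tensor_same[OF same_space_refl[of H] same_TB] tensor_same[OF same_TB same_TB] by simp_all

text \<open>Moves the conditions to the plain tensor algebra and to spans that admit rule induction,
  and turns the trivial intersection with the letters into an implication.\<close>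

lemma nichols_admissible_iff:
  "nichols_admissible I \<longleftrightarrow> submodule I (base_field :: ('k, 'k) module) T \<and> (\<forall>h. \<forall>x\<in>I. act TB h x \<in> I)
    \<and> (\<forall>x\<in>I. coact TB x \<in> lspan (tensor H T) (HI I)) \<and> (\<forall>n. \<forall>x\<in>I. homogeneous_part M n x \<in> I)
    \<and> (\<forall>x\<in>I. bcounit TB x = 0) \<and> (\<forall>x\<in>I. bcomult TB x \<in> lspan (tensor T T) (TI I))
    \<and> (\<forall>m\<in>carrier M. tword M [m] \<in> I \<longrightarrow> tword M [m] = \<zero>\<^bsub>T\<^esub>)"
proof -
  have s: "submodule I (base_field :: ('k, 'k) module) TB \<longleftrightarrow> submodule I (base_field :: ('k, 'k) module) T"
    using submodule_same[OF same_TB kT] submodule_same[OF same_space_sym[OF same_TB] kspace_same[OF same_TB kT]] by blast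
  show ?thesis
  proof (cases "submodule I (base_field :: ('k, 'k) module) T")
    case True
    note IT = submoduleD(1)[OF True kT] and I0 = submoduleD(2)[OF True kT]
    have "I \<inter> (\<lambda>m. tword M [m]) ` carrier M = {\<zero>\<^bsub>T\<^esub>} \<longleftrightarrow>
      (\<forall>m\<in>carrier M. tword M [m] \<in> I \<longrightarrow> tword M [m] = \<zero>\<^bsub>T\<^esub>)"
    proof -
      have "\<zero>\<^bsub>T\<^esub> \<in> I \<inter> (\<lambda>m. tword M [m]) ` carrier M"
        using I0 tword_zero ks_zero[OF kM] by (metis IntI imageI)
      then show ?thesis by blast
    qed
    moreover have "kspan (tensor H T) {tpure H T h y |h y. h \<in> carrier H \<and> y \<in> I} = lspan (tensor H T) (HI I)"
      using kspan_eq_lspan[OF kHT HI_closed[OF IT]] by (simp add: Hc)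
    moreover have "kspan (tensor T T) (TI I) = lspan (tensor T T) (TI I)"
      by (rule kspan_eq_lspan[OF kTT TI_closed[OF IT]])
    moreover have "(\<forall>h\<in>carrier H. \<forall>x\<in>I. act TB h x \<in> I) \<longleftrightarrow> (\<forall>h. \<forall>x\<in>I. act TB h x \<in> I)"
      using Hc by blast
    ultimately show ?thesis
      unfolding nichols_admissible_def yd_subobject_def yd_coideal_def tensor_TB s carrier_TB
      by (simp only: True simp_thms ball_conj_distrib conj_assoc)
  next
    case False
    then show ?thesis by (simp add: nichols_admissible_def yd_subobject_def s)
  qed
qed

lemma nichols_admissibleD:
  assumes "nichols_admissible I"
  shows "submodule I (base_field :: ('k, 'k) module) T" "x \<in> I \<Longrightarrow> act TB h x \<in> I"
    "x \<in> I \<Longrightarrow> coact TB x \<in> lspan (tensor H T) (HI I)" "x \<in> I \<Longrightarrow> homogeneous_part M n x \<in> I"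
    "x \<in> I \<Longrightarrow> bcounit TB x = 0" "x \<in> I \<Longrightarrow> bcomult TB x \<in> lspan (tensor T T) (TI I)"
    "m \<in> carrier M \<Longrightarrow> tword M [m] \<in> I \<Longrightarrow> tword M [m] = \<zero>\<^bsub>T\<^esub>"
  using assms unfolding nichols_admissible_iff by (elim conjE, simp)+

lemma HI_mono: "x \<in> lspan (tensor H T) (HI I) \<Longrightarrow> I \<subseteq> I' \<Longrightarrow> x \<in> lspan (tensor H T) (HI I')"
  by (erule lspan_mono) (rule lspan_gen, blast)

lemma TI_mono: "x \<in> lspan (tensor T T) (TI I) \<Longrightarrow> I \<subseteq> I' \<Longrightarrow> x \<in> lspan (tensor T T) (TI I')"
  by (erule lspan_mono) (rule lspan_gen, blast)

text \<open>All closure conditions are linear and can be tested on generators. Trivial intersection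
  with the letters is not inherited by sums; it is replaced by the vanishing of the degree one
  component, which is again a linear condition.\<close>

lemma nichols_admissible_lspan:
  assumes ST: "S \<subseteq> carrier T" and I: "I = lspan T S"
    and a: "\<And>h x. x \<in> S \<Longrightarrow> act TB (gelt h) x \<in> I"
    and c: "\<And>x. x \<in> S \<Longrightarrow> coact TB x \<in> lspan (tensor H T) (HI I)"
    and h: "\<And>n x. x \<in> S \<Longrightarrow> homogeneous_part M n x \<in> I"
    and e: "\<And>x. x \<in> S \<Longrightarrow> bcounit TB x = 0"
    and d: "\<And>x. x \<in> S \<Longrightarrow> bcomult TB x \<in> lspan (tensor T T) (TI I)"
    and h1: "\<And>x. x \<in> S \<Longrightarrow> homogeneous_part M 1 x = \<zero>\<^bsub>T\<^esub>"
  shows "nichols_admissible I"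
  unfolding nichols_admissible_iff
proof (intro conjI allI ballI impI)
  show sub: "submodule I (base_field :: ('k, 'k) module) T" unfolding I by (rule lspan_submodule[OF kT ST])
  note IT = submoduleD(1)[OF sub kT]
  have lin: "f x \<in> I'" if "linear_map T X f" "kspace X" "submodule I' (base_field :: ('k, 'k) module) X"
      "\<And>s. s \<in> S \<Longrightarrow> f s \<in> I'" "x \<in> I" for f x I' and X :: "('k, 'z, 'y) module_scheme"
    using lspan_linear_submodule[OF that(1) _ kT that(2) ST that(3,4)] that(5) by (simp add: I)
  have linz: "f x = \<zero>\<^bsub>X\<^esub>" if "linear_map T X f" "kspace X" "\<And>s. s \<in> S \<Longrightarrow> f s = \<zero>\<^bsub>X\<^esub>" "x \<in> I"
    for f x and X :: "('k, 'z, 'y) module_scheme"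
    using lspan_linear_zero[OF that(1) _ kT that(2) ST that(3)] that(4) by (simp add: I)
  fix x assume x: "x \<in> I"
  then have xT: "x \<in> carrier T" using IT by auto
  \<comment> \<open>Two reductions in turn: from \<open>h\<close> to group elements, then from
    \<open>x\<close> to the generators.\<close>
  show "act TB h x \<in> I" for h
  proof (rule lspan_linear_submodule[OF bilinD(2)[OF act_T_bilin xT] _ kH kT _ sub])
    show "h \<in> lspan H (range gelt)" using spanH Hc by (auto simp: spans_def)
    show "range gelt \<subseteq> carrier H" using Hc by auto
    fix s :: "'g \<Rightarrow>\<^sub>0 'k" assume "s \<in> range gelt"
    then obtain y where y: "s = gelt y" by auto
    show "act TB s x \<in> I" unfolding y by (rule lin[OF bilinD(1)[OF act_T_bilin Hc] kT sub a x])
  qed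
  show "coact TB x \<in> lspan (tensor H T) (HI I)"
    by (rule lin[OF coact_T_linear kHT lspan_submodule[OF kHT HI_closed[OF IT]] c x])
  show "homogeneous_part M n x \<in> I" for n by (rule lin[OF homogeneous_linear kT sub h x])
  show "bcounit TB x = 0" using linz[OF counit_T_linear kspace_base_field _ x] e by simp
  show "bcomult TB x \<in> lspan (tensor T T) (TI I)"
    by (rule lin[OF comult_T_linear kTT lspan_submodule[OF kTT TI_closed[OF IT]] d x])
next
  have linz: "f x = \<zero>\<^bsub>X\<^esub>" if "linear_map T X f" "kspace X" "\<And>s. s \<in> S \<Longrightarrow> f s = \<zero>\<^bsub>X\<^esub>" "x \<in> I"
    for f x and X :: "('k, 'z, 'y) module_scheme"
    using lspan_linear_zero[OF that(1) _ kT that(2) ST that(3)] that(4) by (simp add: I)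
  fix m assume m: "m \<in> carrier M" and "tword M [m] \<in> I"
  then have "homogeneous_part M 1 (tword M [m]) = \<zero>\<^bsub>T\<^esub>"
    by (intro linz[OF homogeneous_linear kT h1])
  then show "tword M [m] = \<zero>\<^bsub>T\<^esub>" using m by (simp add: homogeneous_tword)
qed

text \<open>The letters form a subspace because \<open>tword M [m]\<close> is linear in
  \<open>m\<close>; so the degree one part of a linear combination of words is again a single
  letter.\<close>

lemma homogeneous_1_letter:
  assumes "x \<in> carrier T"
  shows "\<exists>m\<in>carrier M. homogeneous_part M 1 x = tword M [m]"
proof (rule spans_induct[where P = "\<lambda>x. \<exists>m\<in>carrier M. homogeneous_part M 1 x = tword M [m]",
      OF assms spans_talg[OF kM] kT], goal_cases)
  case 1
  have "homogeneous_part M 1 \<zero>\<^bsub>T\<^esub> = tword M [\<zero>\<^bsub>M\<^esub>]"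
    by (simp only: linear_map_zero[OF homogeneous_linear kT kT] tword_zero)
  then show ?case by (rule bexI[OF _ ks_zero[OF kM]])
next
  case (2 s)
  then obtain w where w: "w \<in> lists (carrier M)" "s = tword M w" by auto
  show ?case
  proof (cases "length w = 1")
    case True
    then obtain m where "w = [m]" by (cases w) auto
    then show ?thesis using w by (auto simp: homogeneous_tword)
  next
    case False
    then have "homogeneous_part M 1 s = tword M [\<zero>\<^bsub>M\<^esub>]" using w by (simp add: homogeneous_tword tword_zero)
    then show ?thesis by (rule bexI[OF _ ks_zero[OF kM]])
  qed
next
  case (3 x y)
  then obtain m m' where m: "m \<in> carrier M" "homogeneous_part M 1 x = tword M [m]"
    "m' \<in> carrier M" "homogeneous_part M 1 y = tword M [m']" by blast
  have "homogeneous_part M 1 (x \<oplus>\<^bsub>T\<^esub> y) = tword M [m \<oplus>\<^bsub>M\<^esub> m']"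
    by (simp only: linear_mapD(2)[OF homogeneous_linear 3(1,2)] m linear_mapD(2)[OF tword_letter_linear[OF kM] m(1,3)])
  then show ?case by (rule bexI[OF _ ks_add[OF kM m(1,3)]])
next
  case (4 x c)
  then obtain m where m: "m \<in> carrier M" "homogeneous_part M 1 x = tword M [m]" by blast
  have "homogeneous_part M 1 (c \<odot>\<^bsub>T\<^esub> x) = tword M [c \<odot>\<^bsub>M\<^esub> m]"
    by (simp only: linear_mapD(3)[OF homogeneous_linear 4(1)] m linear_mapD(3)[OF tword_letter_linear[OF kM] m(1)])
  then show ?case by (rule bexI[OF _ ks_smul[OF kM m(1)]])
qed

definition NI :: "('m list \<Rightarrow>\<^sub>0 'k) set set" where
  "NI = lspan T (\<Union>{I. nichols_admissible I})"

lemma admissible_subset_NI: "nichols_admissible I \<Longrightarrow> I \<subseteq> NI"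
  unfolding NI_def by (auto intro: lspan_gen)

text \<open>\<open>nichols_ideal\<close> is a \<open>GREATEST\<close>, whose meaning rests on the
  existence of a greatest admissible subobject; the sum of all of them turns out to be one.\<close>

lemma NI_admissible: "nichols_admissible NI"
proof (rule nichols_admissible_lspan[OF _ NI_def])
  show "\<Union>{I. nichols_admissible I} \<subseteq> carrier T"
    using submoduleD(1)[OF nichols_admissibleD(1) kT] by (intro Union_least) simp
  fix x assume "x \<in> \<Union>{I. nichols_admissible I}"
  then obtain I where I: "nichols_admissible I" "x \<in> I" by auto
  note II = nichols_admissibleD[OF I(1)] and sub = admissible_subset_NI[OF I(1)]
  show "act TB (gelt h) x \<in> NI" for h by (rule subsetD[OF sub II(2)[OF I(2)]])
  show "homogeneous_part M n x \<in> NI" for n by (rule subsetD[OF sub II(4)[OF I(2)]])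
  show "bcounit TB x = 0" by (rule II(5)[OF I(2)])
  show "coact TB x \<in> lspan (tensor H T) (HI NI)" by (rule HI_mono[OF II(3)[OF I(2)] sub])
  show "bcomult TB x \<in> lspan (tensor T T) (TI NI)" by (rule TI_mono[OF II(6)[OF I(2)] sub])
  have "x \<in> carrier T" using submoduleD(1)[OF II(1) kT] I(2) by auto
  from homogeneous_1_letter[OF this] obtain m where m: "m \<in> carrier M" "homogeneous_part M 1 x = tword M [m]" ..
  \<comment> \<open>The degree one part of \<open>x\<close> is a letter, and it lies in
    \<open>I\<close> because \<open>I\<close> is graded; so it vanishes.\<close>
  show "homogeneous_part M 1 x = \<zero>\<^bsub>T\<^esub>"
    using II(7)[OF m(1)] II(4)[OF I(2), of 1] by (simp only: m(2))
qed

lemma nichols_ideal_eq: "nichols_ideal H M = NI"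
  unfolding nichols_ideal_def nichols_admissible_def[symmetric]
  by (rule Greatest_equality) (use NI_admissible admissible_subset_NI in auto)

lemmas NI_sub = nichols_admissibleD(1)[OF NI_admissible]
lemmas NI_act = nichols_admissibleD(2)[OF NI_admissible]
lemmas NI_coact = nichols_admissibleD(3)[OF NI_admissible]
lemmas NI_hom = nichols_admissibleD(4)[OF NI_admissible]
lemmas NI_counit = nichols_admissibleD(5)[OF NI_admissible]
lemmas NI_comult = nichols_admissibleD(6)[OF NI_admissible]

lemma NI_T: "x \<in> NI \<Longrightarrow> x \<in> carrier T"
  using submoduleD(1)[OF NI_sub kT] by auto

lemma NI_hom1: "x \<in> NI \<Longrightarrow> homogeneous_part M 1 x = \<zero>\<^bsub>T\<^esub>"
proof -
  assume x: "x \<in> NI"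
  from homogeneous_1_letter[OF NI_T[OF x]] obtain m where m: "m \<in> carrier M" "homogeneous_part M 1 x = tword M [m]" ..
  show ?thesis
    using nichols_admissibleD(7)[OF NI_admissible m(1)] NI_hom[OF x, of 1] by (simp only: m(2))
qed

lemma homogeneous_0: "x \<in> carrier T \<Longrightarrow> homogeneous_part M 0 x = bcounit TB x \<odot>\<^bsub>T\<^esub> \<one>\<^bsub>T\<^esub>"
  by (rule linear_eq_on_span[OF homogeneous_linear linear_map_smul_const[OF kT counit_T_linear] spanT kT kT])
    (auto simp: homogeneous_bw counit_bw k_algebraD(6)[OF T_alg] ks_smul_one[OF kT] ks_smul_0[OF kT] bw_Nil)

lemma NI_hom0: "x \<in> NI \<Longrightarrow> homogeneous_part M 0 x = \<zero>\<^bsub>T\<^esub>"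
  by (simp add: homogeneous_0 NI_T NI_counit ks_smul_0[OF kT] k_algebraD(6)[OF T_alg])

section \<open>Multiplication by letters; the Nichols ideal is an ideal\<close>

lemma lb: "j \<in> J \<Longrightarrow> bw [j] \<in> carrier T"
  by (simp add: bw_closed)

lemma Tm: "x \<in> carrier T \<Longrightarrow> y \<in> carrier T \<Longrightarrow> x \<otimes>\<^bsub>T\<^esub> y \<in> carrier T"
  by (rule k_algebraD(5)[OF T_alg])

lemma act_mult:
  "x \<in> carrier T \<Longrightarrow> y \<in> carrier T \<Longrightarrow> act TB (gelt h) (x \<otimes>\<^bsub>T\<^esub> y) = act TB (gelt h) x \<otimes>\<^bsub>T\<^esub> act TB (gelt h) y"
proof -
  note al = bilinD(1)[OF act_T_bilin Hc, of "gelt h"]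
  show "x \<in> carrier T \<Longrightarrow> y \<in> carrier T \<Longrightarrow> ?thesis"
    by (rule bilin_eq_on_span[OF bilin_post[OF al T_mult] bilin_comp[OF T_mult al al] spanT spanT kT kT kT])
      (auto simp: bw_mult act_bw bw_closed k_algebraD(3,4)[OF T_alg] ks_smul[OF kT] ks_smul_smul[OF kT] mult.commute)
qed

lemma coact_mult:
  "x \<in> carrier T \<Longrightarrow> y \<in> carrier T \<Longrightarrow> coact TB (x \<otimes>\<^bsub>T\<^esub> y) = tensor_mult H T (coact TB x) (coact TB y)"
  by (rule bilin_eq_on_span[OF bilin_post[OF coact_T_linear T_mult] bilin_comp[OF tm_HT coact_T_linear coact_T_linear]
        spanT spanT kT kT kHT])
    (auto simp: bw_mult coact_bw tensor_mult_tpure[OF kH kT group_algebra_mult_bilin[OF H] T_mult] Hc bw_closed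
      ga_simps(2)[OF H] gelt_mult)

lemma homogeneous_left:
  assumes "j \<in> J" "x \<in> carrier T"
  shows "homogeneous_part M (Suc n) (bw [j] \<otimes>\<^bsub>T\<^esub> x) = bw [j] \<otimes>\<^bsub>T\<^esub> homogeneous_part M n x"
    and "homogeneous_part M (Suc n) (x \<otimes>\<^bsub>T\<^esub> bw [j]) = homogeneous_part M n x \<otimes>\<^bsub>T\<^esub> bw [j]"
    and "homogeneous_part M 0 (bw [j] \<otimes>\<^bsub>T\<^esub> x) = \<zero>\<^bsub>T\<^esub>" "homogeneous_part M 0 (x \<otimes>\<^bsub>T\<^esub> bw [j]) = \<zero>\<^bsub>T\<^esub>"
    and "bcounit TB (bw [j] \<otimes>\<^bsub>T\<^esub> x) = 0" "bcounit TB (x \<otimes>\<^bsub>T\<^esub> bw [j]) = 0"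
proof -
  note l = bilinD(1)[OF T_mult lb[OF assms(1)]] and r = bilinD(2)[OF T_mult lb[OF assms(1)]]
  note h = homogeneous_linear
  note z = linear_map_zero[OF l kT kT] linear_map_zero[OF r kT kT]
  show "homogeneous_part M (Suc n) (bw [j] \<otimes>\<^bsub>T\<^esub> x) = bw [j] \<otimes>\<^bsub>T\<^esub> homogeneous_part M n x"
    by (rule linear_eq_on_span[OF linear_map_comp[OF h l] linear_map_comp[OF l h] spanT kT kT _ assms(2)])
      (use assms(1) in \<open>auto simp: bw_mult homogeneous_bw z\<close>)
  show "homogeneous_part M (Suc n) (x \<otimes>\<^bsub>T\<^esub> bw [j]) = homogeneous_part M n x \<otimes>\<^bsub>T\<^esub> bw [j]"
    by (rule linear_eq_on_span[OF linear_map_comp[OF h r] linear_map_comp[OF r h] spanT kT kT _ assms(2)])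
      (use assms(1) in \<open>auto simp: bw_mult homogeneous_bw z\<close>)
  show "homogeneous_part M 0 (bw [j] \<otimes>\<^bsub>T\<^esub> x) = \<zero>\<^bsub>T\<^esub>"
    by (rule linear_eq_on_span[OF linear_map_comp[OF h l] linear_map_const_zero[OF kT] spanT kT kT _ assms(2)])
      (use assms(1) in \<open>auto simp: bw_mult homogeneous_bw z\<close>)
  show "homogeneous_part M 0 (x \<otimes>\<^bsub>T\<^esub> bw [j]) = \<zero>\<^bsub>T\<^esub>"
    by (rule linear_eq_on_span[OF linear_map_comp[OF h r] linear_map_const_zero[OF kT] spanT kT kT _ assms(2)])
      (use assms(1) in \<open>auto simp: bw_mult homogeneous_bw z\<close>)
  note c0 = linear_map_const_zero[OF kspace_base_field, of T, simplified]
  show "bcounit TB (bw [j] \<otimes>\<^bsub>T\<^esub> x) = 0"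
    by (rule linear_eq_on_span[OF linear_map_comp[OF counit_T_linear l] c0 spanT kT kspace_base_field _ assms(2)])
      (use assms(1) in \<open>auto simp: bw_mult counit_bw\<close>)
  show "bcounit TB (x \<otimes>\<^bsub>T\<^esub> bw [j]) = 0"
    by (rule linear_eq_on_span[OF linear_map_comp[OF counit_T_linear r] c0 spanT kT kspace_base_field _ assms(2)])
      (use assms(1) in \<open>auto simp: bw_mult counit_bw\<close>)
qed

text \<open>Evaluates an arbitrary function \<psi> on the degree of the argument and rescales by it.
  Because it is built from the coaction, it preserves \<open>NI\<close> for every \<psi>.\<close>

definition coact_twist :: "('g \<Rightarrow> 'k) \<Rightarrow> ('m list \<Rightarrow>\<^sub>0 'k) set \<Rightarrow> ('m list \<Rightarrow>\<^sub>0 'k) set" where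
  "coact_twist \<psi> x = tlift T (\<lambda>h y. lc base_field \<psi> h \<odot>\<^bsub>T\<^esub> y) (coact TB x)"

lemma coact_twist_bilin: "bilin H T T (\<lambda>h y. lc base_field \<psi> h \<odot>\<^bsub>T\<^esub> y)"
  by (rule bilin_smul[OF kT group_algebra_lc_linear[OF H kspace_base_field] linear_map_id]) simp

lemma coact_twist_linear: "linear_map T T (coact_twist \<psi>)"
  unfolding coact_twist_def[abs_def]
  by (rule linear_map_comp[OF tlift_linear[OF kH kT kT coact_twist_bilin] coact_T_linear])

lemma coact_twist_bw: "l \<in> lists J \<Longrightarrow> coact_twist \<psi> (bw l) = \<psi> (wdeg g l) \<odot>\<^bsub>T\<^esub> bw l"
  by (simp add: coact_twist_def coact_bw tlift_tpure[OF kH kT kT coact_twist_bilin] Hc bw_closed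
      group_algebra_lc_gelt[OF H kspace_base_field])

lemma coact_twist_NI: "x \<in> NI \<Longrightarrow> coact_twist \<psi> x \<in> NI"
  unfolding coact_twist_def
proof (rule lspan_linear_submodule[OF tlift_linear[OF kH kT kT coact_twist_bilin] NI_coact kHT kT _ NI_sub])
  show "HI NI \<subseteq> carrier (tensor H T)" by (rule HI_closed) (auto simp: NI_T)
  fix s assume "s \<in> HI NI"
  then obtain h y where s: "s = tpure H T h y" "y \<in> NI" by auto
  show "tlift T (\<lambda>h y. lc base_field \<psi> h \<odot>\<^bsub>T\<^esub> y) s \<in> NI"
    using s submoduleD(4)[OF NI_sub kT] by (simp add: tlift_tpure[OF kH kT kT coact_twist_bilin] Hc NI_T)
qed

definition comult_left :: "nat \<Rightarrow> ('m list \<Rightarrow>\<^sub>0 'k) set \<Rightarrow> ('m list \<Rightarrow>\<^sub>0 'k) set \<Rightarrow> _" where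
  "comult_left j x y = tpure T T (bw [j] \<otimes>\<^bsub>T\<^esub> x) y \<oplus>\<^bsub>tensor T T\<^esub> tpure T T (act TB (gelt (g j)) x) (bw [j] \<otimes>\<^bsub>T\<^esub> y)"

text \<open>Right multiplication of x \<otimes> y by the coproduct of a letter. Before the letter
  reaches \<open>x\<close> it must pass \<open>y\<close>, which costs the value of
  \<open>\<chi> j\<close> at the degree of \<open>y\<close>: a \<open>coact_twist\<close>. For a
  letter on the left, in \<open>comult_left\<close>, the cost appears as the action of the letter's
  degree on \<open>x\<close>.\<close>

definition comult_right :: "nat \<Rightarrow> ('m list \<Rightarrow>\<^sub>0 'k) set \<Rightarrow> ('m list \<Rightarrow>\<^sub>0 'k) set \<Rightarrow> _" where
  "comult_right j x y = tpure T T (x \<otimes>\<^bsub>T\<^esub> bw [j]) (coact_twist (\<chi> j) y) \<oplus>\<^bsub>tensor T T\<^esub> tpure T T x (y \<otimes>\<^bsub>T\<^esub> bw [j])"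

lemma comult_left_bilin: "j \<in> J \<Longrightarrow> bilin T T (tensor T T) (comult_left j)"
  unfolding comult_left_def[abs_def]
  by (intro bilin_add[OF kTT] bilin_comp[OF tpure_bilin[OF kT kT]] bilinD(1)[OF T_mult] lb linear_map_id
      bilinD(1)[OF act_T_bilin] Hc)

lemma comult_right_bilin: "j \<in> J \<Longrightarrow> bilin T T (tensor T T) (comult_right j)"
  unfolding comult_right_def[abs_def]
  by (intro bilin_add[OF kTT] bilin_comp[OF tpure_bilin[OF kT kT]] bilinD(2)[OF T_mult] lb linear_map_id
      coact_twist_linear)

lemma tpure_smul:
  "x \<in> carrier T \<Longrightarrow> y \<in> carrier T \<Longrightarrow> tpure T T (c \<odot>\<^bsub>T\<^esub> x) y = c \<odot>\<^bsub>tensor T T\<^esub> tpure T T x y"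
  "x \<in> carrier T \<Longrightarrow> y \<in> carrier T \<Longrightarrow> tpure T T x (c \<odot>\<^bsub>T\<^esub> y) = c \<odot>\<^bsub>tensor T T\<^esub> tpure T T x y"
  using linear_mapD(3)[OF bilinD(2)[OF tpure_bilin[OF kT kT]]] linear_mapD(3)[OF bilinD(1)[OF tpure_bilin[OF kT kT]]]
  by auto

lemma pure_bw: "x \<in> lists J \<Longrightarrow> y \<in> lists J \<Longrightarrow> tpure T T (bw x) (bw y) \<in> carrier (tensor T T)"
  by (simp add: tpTT bw_closed)

lemma comult_mult_left:
  assumes j: "j \<in> J" and x: "x \<in> carrier T"
  shows "bcomult TB (bw [j] \<otimes>\<^bsub>T\<^esub> x) = tlift (tensor T T) (comult_left j) (bcomult TB x)"
proof (rule linear_eq_on_span[OF linear_map_comp[OF comult_T_linear bilinD(1)[OF T_mult lb[OF j]]] _ spanT kT kTT _ x])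
  note tl = tlift_linear[OF kT kT kTT comult_left_bilin[OF j]]
  show "linear_map T (tensor T T) (\<lambda>x. tlift (tensor T T) (comult_left j) (bcomult TB x))"
    by (rule linear_map_comp[OF tl comult_T_linear])
  fix s assume "s \<in> bw ` lists J"
  then obtain l where l: "l \<in> lists J" "s = bw l" by auto
  have "tlift (tensor T T) (comult_left j) (bcomult TB s)
    = wsplit g \<chi> (tensor T T) l (\<lambda>x y. tlift (tensor T T) (comult_left j) (tpure T T (bw x) (bw y)))"
    unfolding l(2) comult_bw[OF l(1)] by (rule linear_wsplit[OF tl kTT l(1) pure_bw])
  also have "\<dots> = bcomult TB (bw [j] \<otimes>\<^bsub>T\<^esub> s)"
    unfolding l(2) using j l(1)
    by (simp add: bw_mult comult_bw)
      (rule wsplit_cong[OF l(1)], simp add: tlift_tpure[OF kT kT kTT comult_left_bilin] bw_closed,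
       simp add: comult_left_def bw_mult act_bw tpure_smul bw_closed)
  finally show "bcomult TB (bw [j] \<otimes>\<^bsub>T\<^esub> s) = tlift (tensor T T) (comult_left j) (bcomult TB s)" ..
qed

text \<open>On basis words both sides run over the splittings of \<open>l @ [j]\<close>, as computed
  by \<open>wsplit_append\<close> with a second word of one letter.\<close>

lemma comult_mult_right:
  assumes j: "j \<in> J" and x: "x \<in> carrier T"
  shows "bcomult TB (x \<otimes>\<^bsub>T\<^esub> bw [j]) = tlift (tensor T T) (comult_right j) (bcomult TB x)"
proof (rule linear_eq_on_span[OF linear_map_comp[OF comult_T_linear bilinD(2)[OF T_mult lb[OF j]]] _ spanT kT kTT _ x])
  note tl = tlift_linear[OF kT kT kTT comult_right_bilin[OF j]]
  show "linear_map T (tensor T T) (\<lambda>x. tlift (tensor T T) (comult_right j) (bcomult TB x))"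
    by (rule linear_map_comp[OF tl comult_T_linear])
  fix s assume "s \<in> bw ` lists J"
  then obtain l where l: "l \<in> lists J" "s = bw l" by auto
  have j': "[j] \<in> lists J" using j by simp
  have ch0: "\<chi> j 0 = 1" using char by (rule characters_mult)
  have "tlift (tensor T T) (comult_right j) (bcomult TB s)
    = wsplit g \<chi> (tensor T T) l (\<lambda>x y. tlift (tensor T T) (comult_right j) (tpure T T (bw x) (bw y)))"
    unfolding l(2) comult_bw[OF l(1)] by (rule linear_wsplit[OF tl kTT l(1) pure_bw])
  also have "\<dots> = wsplit g \<chi> (tensor T T) l (\<lambda>x y. wsplit g \<chi> (tensor T T) [j] (\<lambda>x' y'.
    wchar \<chi> x' (wdeg g y) \<odot>\<^bsub>tensor T T\<^esub> tpure T T (bw (x @ x')) (bw (y @ y'))))"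
  proof (rule wsplit_cong[OF l(1)])
    fix x y assume xy: "x \<in> lists J" "y \<in> lists J"
    have "wchar \<chi> x 0 = 1" for x using wchar_character[of \<chi> x, OF char] by (rule characters_mult)
    then show "tlift (tensor T T) (comult_right j) (tpure T T (bw x) (bw y)) = wsplit g \<chi> (tensor T T) [j] (\<lambda>x' y'.
      wchar \<chi> x' (wdeg g y) \<odot>\<^bsub>tensor T T\<^esub> tpure T T (bw (x @ x')) (bw (y @ y')))"
      using xy j
      by (simp add: tlift_tpure[OF kT kT kTT comult_right_bilin] bw_closed)
        (simp add: comult_right_def bw_mult coact_twist_bw tpure_smul bw_closed ks_smul_one[OF kTT] pure_bw)
  qed

  also have "wsplit g \<chi> (tensor T T) l (\<lambda>x y. wsplit g \<chi> (tensor T T) [j] (\<lambda>x' y'.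
    wchar \<chi> x' (wdeg g y) \<odot>\<^bsub>tensor T T\<^esub> tpure T T (bw (x @ x')) (bw (y @ y')))) = bcomult TB (s \<otimes>\<^bsub>T\<^esub> bw [j])"
    unfolding l(2) using l(1) j'
    by (simp only: bw_mult comult_bw append_in_lists_conv simp_thms wsplit_append[OF char kTT l(1) j' pure_bw])
  finally show "bcomult TB (s \<otimes>\<^bsub>T\<^esub> bw [j]) = tlift (tensor T T) (comult_right j) (bcomult TB s)" ..
qed

text \<open>By maximality it suffices that \<open>NI\<close>, enlarged by its products with letters
  on both sides, is still admissible. The degree one condition survives because elements of
  \<open>NI\<close> have no component in degree 0, so their products with a letter have none in
  degree 1.\<close>

lemma NI_mult_letter:
  assumes "j \<in> J" "x \<in> NI"
  shows "bw [j] \<otimes>\<^bsub>T\<^esub> x \<in> NI" "x \<otimes>\<^bsub>T\<^esub> bw [j] \<in> NI"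
proof -
  define S where "S = NI \<union> (\<lambda>p. bw [fst p] \<otimes>\<^bsub>T\<^esub> snd p) ` (J \<times> NI) \<union> (\<lambda>p. snd p \<otimes>\<^bsub>T\<^esub> bw [fst p]) ` (J \<times> NI)"
  define I where "I = lspan T S"
  have ST: "S \<subseteq> carrier T" by (auto simp: S_def NI_T lb intro!: Tm)
  have sub: "submodule I (base_field :: ('k, 'k) module) T" unfolding I_def by (rule lspan_submodule[OF kT ST])
  note sD = submoduleD[OF sub kT]
  have NII: "y \<in> I" if "y \<in> NI" for y using that by (auto simp: I_def S_def intro: lspan_gen)
  then have NII': "NI \<subseteq> I" by auto
  have lI: "bw [i] \<otimes>\<^bsub>T\<^esub> y \<in> I" "y \<otimes>\<^bsub>T\<^esub> bw [i] \<in> I" if "i \<in> J" "y \<in> NI" for i y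
    using that unfolding I_def S_def by (force intro: lspan_gen)+
  have IT: "y \<in> carrier T" if "y \<in> I" for y using sD(1) that by auto
  have TIc: "TI NI \<subseteq> carrier (tensor T T)" by (rule TI_closed) (auto simp: NI_T)
  have HIc: "HI NI \<subseteq> carrier (tensor H T)" by (rule HI_closed) (auto simp: NI_T)
  have t1: "tpure T T p q \<in> lspan (tensor T T) (TI I)" if "p \<in> I" "q \<in> carrier T" for p q
    using that by (intro lspan_gen) blast
  have t2: "tpure T T p q \<in> lspan (tensor T T) (TI I)" if "p \<in> carrier T" "q \<in> I" for p q
    using that by (intro lspan_gen) blast
  have t3: "tpure H T h q \<in> lspan (tensor H T) (HI I)" if "q \<in> I" for h q
    using that by (intro lspan_gen) blast
  have "nichols_admissible I"
  proof (rule nichols_admissible_lspan[OF ST I_def])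
    fix s assume "s \<in> S"
    then consider (NI) "s \<in> NI" | (left) i y where "i \<in> J" "y \<in> NI" "s = bw [i] \<otimes>\<^bsub>T\<^esub> y"
      | (right) i y where "i \<in> J" "y \<in> NI" "s = y \<otimes>\<^bsub>T\<^esub> bw [i]"
      unfolding S_def by force
    then have "(\<forall>h. act TB (gelt h) s \<in> I) \<and> coact TB s \<in> lspan (tensor H T) (HI I) \<and> (\<forall>n. homogeneous_part M n s \<in> I)
      \<and> bcounit TB s = 0 \<and> bcomult TB s \<in> lspan (tensor T T) (TI I) \<and> homogeneous_part M 1 s = \<zero>\<^bsub>T\<^esub>"
    proof cases
      case NI
      then show ?thesis
        using NI_act NII NI_hom NI_counit NI_hom1 HI_mono[OF NI_coact NII'] TI_mono[OF NI_comult NII'] by blast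
    next
      case left
      note c = lb[OF left(1)] NI_T[OF left(2)]
      have "act TB (gelt h) s \<in> I" for h
        using lI(1)[OF left(1) NI_act[OF left(2)], of "gelt h"] sD(4)
        by (simp add: left(3) act_mult c act_bw left(1) k_algebraD(3)[OF T_alg] NI_T NI_act left(2))
      moreover have "coact TB s \<in> lspan (tensor H T) (HI I)"
        unfolding left(3) coact_mult[OF c]
      proof (rule lspan_linear_image[OF bilinD(1)[OF tm_HT linear_mapD(1)[OF coact_T_linear c(1)]] NI_coact[OF left(2)] kHT kHT HIc])
        fix t assume "t \<in> HI NI"
        then obtain h w where t: "t = tpure H T h w" "w \<in> NI" by auto
        show "tensor_mult H T (coact TB (bw [i])) t \<in> lspan (tensor H T) (HI I)"
          using lI(1)[OF left(1) t(2)] left(1) c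
          by (simp add: t coact_bw tensor_mult_tpure[OF kH kT group_algebra_mult_bilin[OF H] T_mult] Hc NI_T t3)
      qed
      moreover have "homogeneous_part M n s \<in> I" for n
        using lI(1)[OF left(1) NI_hom[OF left(2)]] sD(2)
        by (cases n) (simp_all add: left homogeneous_left[OF left(1) c(2)])
      moreover have "bcounit TB s = 0" by (simp add: left homogeneous_left[OF left(1) c(2)])
      moreover have "homogeneous_part M 1 s = \<zero>\<^bsub>T\<^esub>"
        using linear_map_zero[OF bilinD(1)[OF T_mult c(1)] kT kT]
        by (simp add: left homogeneous_left(1)[OF left(1) c(2), of 0] NI_hom0)
      \<comment> \<open>The coproduct of \<open>y\<close> is a combination of tensors with a factor
        in \<open>NI\<close>. After multiplication by the letter each summand still has a factor in
        \<open>NI\<close> or in the product of \<open>NI\<close> with the letter, since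
        \<open>NI\<close> is stable under the action.\<close>
      moreover have "bcomult TB s \<in> lspan (tensor T T) (TI I)"
        unfolding left(3) comult_mult_left[OF left(1) c(2)]
      proof (rule lspan_linear_image[OF tlift_linear[OF kT kT kTT comult_left_bilin[OF left(1)]] NI_comult[OF left(2)] kTT kTT TIc])
        fix t assume "t \<in> TI NI"
        then obtain p q where t: "t = tpure T T p q" "p \<in> carrier T" "q \<in> carrier T" "p \<in> NI \<or> q \<in> NI" by (auto simp: NI_T)
        have a: "act TB (gelt (g i)) p \<in> carrier T" by (rule bilinD(3)[OF act_T_bilin Hc t(2)])
        have "comult_left i p q \<in> lspan (tensor T T) (TI I)"
          unfolding comult_left_def using t(4)
        proof
          assume "p \<in> NI"
          then show "tpure T T (bw [i] \<otimes>\<^bsub>T\<^esub> p) q \<oplus>\<^bsub>tensor T T\<^esub> tpure T T (act TB (gelt (g i)) p) (bw [i] \<otimes>\<^bsub>T\<^esub> q) \<in> lspan (tensor T T) (TI I)"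
            using t c by (intro lspan_add t1 lI NII NI_act Tm left(1))
        next
          assume "q \<in> NI"
          then show "tpure T T (bw [i] \<otimes>\<^bsub>T\<^esub> p) q \<oplus>\<^bsub>tensor T T\<^esub> tpure T T (act TB (gelt (g i)) p) (bw [i] \<otimes>\<^bsub>T\<^esub> q) \<in> lspan (tensor T T) (TI I)"
            using t c a by (intro lspan_add t2 lI NII Tm left(1))
        qed
        then show "tlift (tensor T T) (comult_left i) t \<in> lspan (tensor T T) (TI I)"
          by (simp add: t(1-3) tlift_tpure[OF kT kT kTT comult_left_bilin[OF left(1)]])
      qed
      ultimately show ?thesis by blast
    next
      case right
      note c = lb[OF right(1)] NI_T[OF right(2)]
      have "act TB (gelt h) s \<in> I" for h
        using lI(2)[OF right(1) NI_act[OF right(2)], of "gelt h"] sD(4)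
        by (simp add: right(3) act_mult c act_bw right(1) k_algebraD(4)[OF T_alg] NI_T NI_act right(2))
      moreover have "coact TB s \<in> lspan (tensor H T) (HI I)"
        unfolding right(3) coact_mult[OF c(2,1)]
      proof (rule lspan_linear_image[OF bilinD(2)[OF tm_HT linear_mapD(1)[OF coact_T_linear c(1)]] NI_coact[OF right(2)] kHT kHT HIc])
        fix t assume "t \<in> HI NI"
        then obtain h w where t: "t = tpure H T h w" "w \<in> NI" by auto
        show "tensor_mult H T t (coact TB (bw [i])) \<in> lspan (tensor H T) (HI I)"
          using lI(2)[OF right(1) t(2)] right(1) c
          by (simp add: t coact_bw tensor_mult_tpure[OF kH kT group_algebra_mult_bilin[OF H] T_mult] Hc NI_T t3)
      qed
      moreover have "homogeneous_part M n s \<in> I" for n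
        using lI(2)[OF right(1) NI_hom[OF right(2)]] sD(2)
        by (cases n) (simp_all add: right homogeneous_left[OF right(1) c(2)])
      moreover have "bcounit TB s = 0" by (simp add: right homogeneous_left[OF right(1) c(2)])
      moreover have "homogeneous_part M 1 s = \<zero>\<^bsub>T\<^esub>"
        using linear_map_zero[OF bilinD(2)[OF T_mult c(1)] kT kT]
        by (simp add: right homogeneous_left(2)[OF right(1) c(2), of 0] NI_hom0)
      moreover have "bcomult TB s \<in> lspan (tensor T T) (TI I)"
        unfolding right(3) comult_mult_right[OF right(1) c(2)]
      proof (rule lspan_linear_image[OF tlift_linear[OF kT kT kTT comult_right_bilin[OF right(1)]] NI_comult[OF right(2)] kTT kTT TIc])
        fix t assume "t \<in> TI NI"
        then obtain p q where t: "t = tpure T T p q" "p \<in> carrier T" "q \<in> carrier T" "p \<in> NI \<or> q \<in> NI" by (auto simp: NI_T)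
        have a: "coact_twist (\<chi> i) q \<in> carrier T" by (rule linear_mapD(1)[OF coact_twist_linear t(3)])
        have "comult_right i p q \<in> lspan (tensor T T) (TI I)"
          unfolding comult_right_def using t(4)
        proof
          assume "p \<in> NI"
          then show "tpure T T (p \<otimes>\<^bsub>T\<^esub> bw [i]) (coact_twist (\<chi> i) q) \<oplus>\<^bsub>tensor T T\<^esub> tpure T T p (q \<otimes>\<^bsub>T\<^esub> bw [i]) \<in> lspan (tensor T T) (TI I)"
            using t c a by (intro lspan_add t1 lI NII Tm right(1))
        next
          assume "q \<in> NI"
          then show "tpure T T (p \<otimes>\<^bsub>T\<^esub> bw [i]) (coact_twist (\<chi> i) q) \<oplus>\<^bsub>tensor T T\<^esub> tpure T T p (q \<otimes>\<^bsub>T\<^esub> bw [i]) \<in> lspan (tensor T T) (TI I)"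
            using t c a by (intro lspan_add t2 lI NII Tm coact_twist_NI right(1))
        qed
        then show "tlift (tensor T T) (comult_right i) t \<in> lspan (tensor T T) (TI I)"
          by (simp add: t(1-3) tlift_tpure[OF kT kT kTT comult_right_bilin[OF right(1)]])
      qed
      ultimately show ?thesis by blast
    qed
    then show "\<And>h. act TB (gelt h) s \<in> I" "coact TB s \<in> lspan (tensor H T) (HI I)" "\<And>n. homogeneous_part M n s \<in> I"
      "bcounit TB s = 0" "bcomult TB s \<in> lspan (tensor T T) (TI I)" "homogeneous_part M 1 s = \<zero>\<^bsub>T\<^esub>" by blast+
  qed
  from admissible_subset_NI[OF this] show "bw [j] \<otimes>\<^bsub>T\<^esub> x \<in> NI" "x \<otimes>\<^bsub>T\<^esub> bw [j] \<in> NI"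
    using lI[OF assms] by auto
qed

lemma NI_ideal: "ideal NI T"
proof (rule submodule_idealI[OF T_alg NI_sub])
  interpret ring T by (rule k_algebraD(2)[OF T_alg])
  fix a x assume a: "a \<in> NI" and x: "x \<in> carrier T"
  have bwT: "bw ` lists J \<subseteq> carrier T" using spanT by (simp add: spans_def)
  have xs: "x \<in> lspan T (bw ` lists J)" using spanT x by (auto simp: spans_def)
  have l: "bw l \<otimes>\<^bsub>T\<^esub> a \<in> NI" if "l \<in> lists J" for l
    using that
  proof induction
    case (Cons j l)
    have "bw (j # l) \<otimes>\<^bsub>T\<^esub> a = bw [j] \<otimes>\<^bsub>T\<^esub> (bw l \<otimes>\<^bsub>T\<^esub> a)"
      using bw_mult[of "[j]" l] Cons(1,2) NI_T[OF a] by (simp add: bw_closed flip: m_assoc)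
    then show ?case using NI_mult_letter(1)[OF Cons(1,3)] by simp
  qed (use a NI_T in \<open>simp add: bw_Nil\<close>)
  show "x \<otimes>\<^bsub>T\<^esub> a \<in> NI"
    by (rule lspan_linear_submodule[OF bilinD(2)[OF T_mult NI_T[OF a]] xs kT kT bwT NI_sub]) (use l in auto)
  have r: "a \<otimes>\<^bsub>T\<^esub> bw l \<in> NI" if "l \<in> lists J" for l
    using that a
  proof (induction arbitrary: a)
    case (Cons j l)
    have "a \<otimes>\<^bsub>T\<^esub> bw (j # l) = (a \<otimes>\<^bsub>T\<^esub> bw [j]) \<otimes>\<^bsub>T\<^esub> bw l"
      using bw_mult[of "[j]" l] Cons(1,2,4) NI_T by (simp add: bw_closed m_assoc)
    then show ?case using Cons(3) NI_mult_letter(2)[OF Cons(1,4)] by simp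
  qed (use NI_T in \<open>simp add: bw_Nil\<close>)
  show "a \<otimes>\<^bsub>T\<^esub> x \<in> NI"
    by (rule lspan_linear_submodule[OF bilinD(1)[OF T_mult NI_T[OF a]] xs kT kT bwT NI_sub]) (use r in auto)
qed

end

section \<open>Diagonal braided bialgebras and their biproducts\<close>

text \<open>Interface to a Nichols algebra: words span, possibly with linear relations, and every
  structure map is known on words. The biproduct and the conditions (B.1)-(B.4) are treated from
  this alone, for both Nichols algebras.\<close>

locale diag_alg =
  fixes H :: "('k::field, 'g::ab_group_add \<Rightarrow>\<^sub>0 'k) hopf" and N :: "('k, 'g \<Rightarrow>\<^sub>0 'k, 'n) ydbialg"
    and J :: "nat set" and g :: "nat \<Rightarrow> 'g" and \<chi> :: "nat \<Rightarrow> 'g \<Rightarrow> 'k" and cl :: "nat list \<Rightarrow> 'n"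
  assumes H: "H = group_algebra" and char: "\<And>j. \<chi> j \<in> characters"
    and N_alg: "k_algebra N" and spanN: "spans N (cl ` lists J)"
    and cl_mult: "\<And>l l'. l \<in> lists J \<Longrightarrow> l' \<in> lists J \<Longrightarrow> cl l \<otimes>\<^bsub>N\<^esub> cl l' = cl (l @ l')"
    and one_cl: "\<one>\<^bsub>N\<^esub> = cl []"
    and act_bilin: "bilin H N N (act N)"
    and act_cl: "\<And>l h. l \<in> lists J \<Longrightarrow> act N (gelt h) (cl l) = wchar \<chi> l h \<odot>\<^bsub>N\<^esub> cl l"
    and coact_linear: "linear_map N (tensor H N) (coact N)"
    and coact_cl: "\<And>l. l \<in> lists J \<Longrightarrow> coact N (cl l) = tpure H N (gelt (wdeg g l)) (cl l)"
    and comult_lin: "linear_map N (tensor N N) (bcomult N)"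
    and comult_cl: "\<And>l. l \<in> lists J \<Longrightarrow> bcomult N (cl l) = wsplit g \<chi> (tensor N N) l (\<lambda>x y. tpure N N (cl x) (cl y))"
    and counit_lin: "linear_map N base_field (bcounit N)"
    and counit_cl: "\<And>l. l \<in> lists J \<Longrightarrow> bcounit N (cl l) = (if l = [] then 1 else 0)"

text \<open>The corresponding interface to a biproduct; \<open>pr l h\<close> stands for the word
  \<open>l\<close> tensored with the group element \<open>h\<close>.\<close>

locale diag_smash =
  fixes A :: "('k::field, 'a) bialg" and J :: "nat set" and g :: "nat \<Rightarrow> 'g::ab_group_add" and \<chi> :: "nat \<Rightarrow> 'g \<Rightarrow> 'k"
    and pr :: "nat list \<Rightarrow> 'g \<Rightarrow> 'a"
  assumes char: "\<And>j. \<chi> j \<in> characters" and A_alg: "k_algebra A"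
    and spanA: "spans A ((\<lambda>p. pr (fst p) (snd p)) ` (lists J \<times> UNIV))"
    and pr_mult: "\<And>l l' h h'. l \<in> lists J \<Longrightarrow> l' \<in> lists J \<Longrightarrow>
      pr l h \<otimes>\<^bsub>A\<^esub> pr l' h' = wchar \<chi> l' h \<odot>\<^bsub>A\<^esub> pr (l @ l') (h + h')"
    and one_pr: "\<one>\<^bsub>A\<^esub> = pr [] 0"
    and comultA_linear: "linear_map A (tensor A A) (comult A)"
    and comult_pr: "\<And>l h. l \<in> lists J \<Longrightarrow> comult A (pr l h) =
      wsplit g \<chi> (tensor A A) l (\<lambda>x y. tpure A A (pr x (wdeg g y + h)) (pr y h))"
    and counitA_linear: "linear_map A base_field (counit A)"
    and counit_pr: "\<And>l h. l \<in> lists J \<Longrightarrow> counit A (pr l h) = (if l = [] then 1 else 0)"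

section \<open>The Nichols algebra in terms of words\<close>

context diag_yd
begin

abbreviation "N \<equiv> nichols H M"
abbreviation "Q \<equiv> quot T NI"

definition proj :: "('m list \<Rightarrow>\<^sub>0 'k) set \<Rightarrow> ('m list \<Rightarrow>\<^sub>0 'k) set set" where
  "proj x = NI +>\<^bsub>T\<^esub> x"

definition cl :: "nat list \<Rightarrow> ('m list \<Rightarrow>\<^sub>0 'k) set set" where
  "cl l = proj (bw l)"

lemma quot_TB: "quot TB NI = Q"
  by (rule quot_same[OF same_space_sym[OF same_TB]]) (simp_all add: tensor_algebra_simps)

lemma coset_TB: "NI +>\<^bsub>TB\<^esub> x = proj x"
  unfolding proj_def by (rule a_r_coset_same[OF same_space_sym[OF same_TB]])

lemma nichols_simps:
  "carrier N = carrier Q" "mult N = mult Q" "one N = one Q" "zero N = zero Q" "add N = add Q" "smult N = smult Q"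
  "act N = (\<lambda>h X. proj (act TB h (SOME x. x \<in> X)))"
  "coact N = (\<lambda>X. tlift (tensor H Q) (\<lambda>h x. tpure H Q h (proj x)) (coact TB (SOME x. x \<in> X)))"
  "bcomult N = (\<lambda>X. tlift (tensor Q Q) (\<lambda>x y. tpure Q Q (proj x) (proj y)) (bcomult TB (SOME x. x \<in> X)))"
  "bcounit N = (\<lambda>X. bcounit TB (SOME x. x \<in> X))"
  unfolding nichols_def nichols_ideal_eq yd_quot_def Let_def coset_TB quot_TB
  by (simp_all add: ydmod.defs module.defs ydbialg.defs)

lemma same_QN: "same_space Q N"
  by (simp add: same_space_def nichols_simps)

lemmas kQ = kspace_quot[OF kT NI_sub]
lemmas kN = kspace_same[OF same_QN kQ]

lemma tensor_QN: "tensor H Q = tensor H N" "tpure H Q = tpure H N" "tensor Q Q = tensor N N" "tpure Q Q = tpure N N"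
  using tensor_same[OF same_space_refl[of H] same_QN] tensor_same[OF same_QN same_QN] by simp_all

lemma proj_linear: "linear_map T N proj"
  unfolding linear_map_same[OF same_space_refl same_QN, symmetric] proj_def[abs_def]
  by (rule quot_proj_linear[OF kT NI_sub])

lemma proj_mult: "x \<in> carrier T \<Longrightarrow> y \<in> carrier T \<Longrightarrow> proj x \<otimes>\<^bsub>N\<^esub> proj y = proj (x \<otimes>\<^bsub>T\<^esub> y)"
  unfolding nichols_simps proj_def by (rule quot_mult[OF T_alg NI_ideal])

lemma proj_one: "\<one>\<^bsub>N\<^esub> = proj \<one>\<^bsub>T\<^esub>"
  unfolding nichols_simps proj_def by (simp add: quot_simps)

lemma proj_NI: "x \<in> NI \<Longrightarrow> proj x = \<zero>\<^bsub>N\<^esub>"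
  using coset_eqI[OF kT NI_sub NI_T ks_zero[OF kT], of x] submoduleD(5)[OF NI_sub kT, of x, OF _ submoduleD(2)[OF NI_sub kT]]
  unfolding proj_def nichols_simps quot_zero[OF kT NI_sub] by simp

lemma carrier_N: "carrier N = proj ` carrier T"
  unfolding nichols_simps proj_def[abs_def] by (rule quot_carrier[OF kT NI_sub])

lemma N_algebra: "k_algebra N"
proof -
  note Q = k_algebra_quot[OF T_alg NI_ideal]
  interpret ring Q by (rule k_algebraD(2)[OF Q])
  show ?thesis
  proof (rule k_algebraI[OF kN])
    show "bilin N N N (\<otimes>\<^bsub>N\<^esub>)"
      unfolding bilin_same[OF same_QN same_QN same_QN, symmetric] nichols_simps by (rule k_algebra_mult_bilin[OF Q])
  qed (simp_all add: nichols_simps m_assoc)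
qed

text \<open>\<open>yd_quot\<close> applies the maps of the tensor algebra to a chosen representative
  of a class; for a map that kills \<open>NI\<close> the choice does not affect the value.\<close>

lemma descend:
  assumes "linear_map T X h" "kspace X" "\<forall>x\<in>NI. h x = \<zero>\<^bsub>X\<^esub>"
  shows "linear_map N X (\<lambda>t. h (SOME x. x \<in> t))"
    and "x \<in> carrier T \<Longrightarrow> h (SOME r. r \<in> proj x) = h x"
  unfolding linear_map_same[OF same_QN same_space_refl, symmetric] proj_def
  using quot_lift_linear[OF kT NI_sub assms(1,2)] quot_lift[OF kT NI_sub assms(1,2)] assms(3) by auto

lemma cl_closed: "l \<in> lists J \<Longrightarrow> cl l \<in> carrier N"
  by (auto simp: carrier_N cl_def bw_closed)

lemma span_cl: "spans N (cl ` lists J)"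
proof -
  have "spans N (proj ` bw ` lists J)"
    by (rule spans_image[OF proj_linear kT kN spanT]) (simp add: carrier_N)
  then show ?thesis by (simp add: cl_def[abs_def] image_image)
qed

lemma nichols_incl_b: "nichols_incl H M (b j) = cl [j]"
  by (simp add: nichols_incl_def nichols_ideal_eq cl_def proj_def bw_def)

lemma proj_coact_bilin: "bilin H T (tensor H N) (\<lambda>h x. tpure H N h (proj x))"
  by (rule bilin_comp[OF tpure_bilin[OF kH kN] linear_map_id proj_linear])

lemma proj_comult_bilin: "bilin T T (tensor N N) (\<lambda>x y. tpure N N (proj x) (proj y))"
  by (rule bilin_comp[OF tpure_bilin[OF kN kN] proj_linear proj_linear])

lemmas kHN = kspace_tensor[OF kH kN]
lemmas kNN = kspace_tensor[OF kN kN]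

lemma proj_coact_NI:
  assumes "x \<in> NI"
  shows "tlift (tensor H N) (\<lambda>h x. tpure H N h (proj x)) (coact TB x) = \<zero>\<^bsub>tensor H N\<^esub>"
proof (rule lspan_linear_zero[OF tlift_linear[OF kH kT kHN proj_coact_bilin] NI_coact[OF assms] kHT kHN])
  show "HI NI \<subseteq> carrier (tensor H T)" by (rule HI_closed) (auto simp: NI_T)
  fix s assume "s \<in> HI NI"
  then obtain h y where s: "s = tpure H T h y" "y \<in> NI" by auto
  show "tlift (tensor H N) (\<lambda>h x. tpure H N h (proj x)) s = \<zero>\<^bsub>tensor H N\<^esub>"
    using s(2) bilin_zero(2)[OF tpure_bilin[OF kH kN] kH kN kHN Hc]
    by (simp add: s(1) tlift_tpure[OF kH kT kHN proj_coact_bilin] Hc NI_T proj_NI)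
qed

lemma proj_comult_NI:
  assumes "x \<in> NI"
  shows "tlift (tensor N N) (\<lambda>x y. tpure N N (proj x) (proj y)) (bcomult TB x) = \<zero>\<^bsub>tensor N N\<^esub>"
proof (rule lspan_linear_zero[OF tlift_linear[OF kT kT kNN proj_comult_bilin] NI_comult[OF assms] kTT kNN])
  show "TI NI \<subseteq> carrier (tensor T T)" by (rule TI_closed) (auto simp: NI_T)
  fix s assume "s \<in> TI NI"
  then obtain p q where t: "s = tpure T T p q" "p \<in> carrier T" "q \<in> carrier T" "p \<in> NI \<or> q \<in> NI" by (auto simp: NI_T)
  note z = bilin_zero[OF tpure_bilin[OF kN kN] kN kN kNN] and pc = linear_mapD(1)[OF proj_linear]
  show "tlift (tensor N N) (\<lambda>x y. tpure N N (proj x) (proj y)) s = \<zero>\<^bsub>tensor N N\<^esub>"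
    using t(4) z(1)[OF pc[OF t(3)]] z(2)[OF pc[OF t(2)]]
    by (auto simp: t(1-3) tlift_tpure[OF kT kT kNN proj_comult_bilin] proj_NI)
qed

lemma nichols_diag_alg: "diag_alg H N J g \<chi> cl"
proof
  show "H = group_algebra" by (rule H)
  show "\<chi> j \<in> characters" for j by (rule char)
  show "k_algebra N" by (rule N_algebra)
  show "spans N (cl ` lists J)" by (rule span_cl)
  show "cl l \<otimes>\<^bsub>N\<^esub> cl l' = cl (l @ l')" if "l \<in> lists J" "l' \<in> lists J" for l l'
    using that by (simp add: cl_def proj_mult bw_closed bw_mult)
  show "\<one>\<^bsub>N\<^esub> = cl []" by (simp add: cl_def proj_one bw_Nil)
  have al: "linear_map T N (\<lambda>x. proj (act TB h x))" for h
    by (rule linear_map_comp[OF proj_linear bilinD(1)[OF act_T_bilin Hc]])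
  have a0: "\<forall>x\<in>NI. proj (act TB h x) = \<zero>\<^bsub>N\<^esub>" for h
    by (simp add: proj_NI NI_act)
  note ad = descend[OF al kN a0]
  show "bilin H N N (act N)"
    unfolding nichols_simps(7)
  proof (rule bilinI)
    show "linear_map N N (\<lambda>X. proj (act TB h (SOME x. x \<in> X)))" for h by (rule ad(1))
    fix X assume "X \<in> carrier N"
    then obtain x where x: "x \<in> carrier T" "X = proj x" by (auto simp: carrier_N)
    show "linear_map H N (\<lambda>h. proj (act TB h (SOME x. x \<in> X)))"
      unfolding x(2) ad(2)[OF x(1)] by (rule linear_map_comp[OF proj_linear bilinD(2)[OF act_T_bilin x(1)]])
  qed
  show "act N (gelt h) (cl l) = wchar \<chi> l h \<odot>\<^bsub>N\<^esub> cl l" if "l \<in> lists J" for l h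
    unfolding nichols_simps(7) cl_def using that
    by (simp add: ad(2) bw_closed act_bw linear_mapD(3)[OF proj_linear])
  have c0: "\<forall>x\<in>NI. tlift (tensor H N) (\<lambda>h x. tpure H N h (proj x)) (coact TB x) = \<zero>\<^bsub>tensor H N\<^esub>"
    by (simp add: proj_coact_NI)
  note cd = descend[OF linear_map_comp[OF tlift_linear[OF kH kT kHN proj_coact_bilin] coact_T_linear] kHN c0]
  show "linear_map N (tensor H N) (coact N)"
    unfolding nichols_simps(8) tensor_QN by (rule cd(1))
  show "coact N (cl l) = tpure H N (gelt (wdeg g l)) (cl l)" if "l \<in> lists J" for l
    unfolding nichols_simps(8) tensor_QN cl_def using that
    by (simp add: cd(2) bw_closed coact_bw tlift_tpure[OF kH kT kHN proj_coact_bilin] Hc)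
  note dl = tlift_linear[OF kT kT kNN proj_comult_bilin]
  have d0: "\<forall>x\<in>NI. tlift (tensor N N) (\<lambda>x y. tpure N N (proj x) (proj y)) (bcomult TB x) = \<zero>\<^bsub>tensor N N\<^esub>"
    by (simp add: proj_comult_NI)
  note dd = descend[OF linear_map_comp[OF dl comult_T_linear] kNN d0]
  show "linear_map N (tensor N N) (bcomult N)"
    unfolding nichols_simps(9) tensor_QN by (rule dd(1))
  show "bcomult N (cl l) = wsplit g \<chi> (tensor N N) l (\<lambda>x y. tpure N N (cl x) (cl y))" if l: "l \<in> lists J" for l
  proof -
    have "bcomult N (cl l) = tlift (tensor N N) (\<lambda>x y. tpure N N (proj x) (proj y)) (bcomult TB (bw l))"
      unfolding nichols_simps(9) tensor_QN cl_def by (rule dd(2)[OF bw_closed[OF l]])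
    also have "\<dots> = wsplit g \<chi> (tensor N N) l (\<lambda>x y. tlift (tensor N N) (\<lambda>x y. tpure N N (proj x) (proj y)) (tpure T T (bw x) (bw y)))"
      unfolding comult_bw[OF l] by (rule linear_wsplit[OF dl kTT l pure_bw])
    also have "\<dots> = wsplit g \<chi> (tensor N N) l (\<lambda>x y. tpure N N (cl x) (cl y))"
      by (rule wsplit_cong[OF l]) (simp add: tlift_tpure[OF kT kT kNN proj_comult_bilin] bw_closed cl_def)
    finally show ?thesis .
  qed
  have z: "\<forall>x\<in>NI. bcounit TB x = \<zero>\<^bsub>base_field\<^esub>" by (simp add: NI_counit)
  note ed = descend[OF counit_T_linear kspace_base_field z]
  show "linear_map N base_field (bcounit N)"
    unfolding nichols_simps(10) by (rule ed(1))
  show "bcounit N (cl l) = (if l = [] then 1 else 0)" if "l \<in> lists J" for l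
    unfolding nichols_simps(10) cl_def using that by (simp add: ed(2) bw_closed counit_bw)
qed

end

section \<open>The biproduct in terms of words and group elements\<close>

context diag_alg
begin

abbreviation "B \<equiv> tensor N H"
abbreviation "A \<equiv> biproduct N H"

definition pr :: "nat list \<Rightarrow> 'g \<Rightarrow> ('k, 'n, 'g \<Rightarrow>\<^sub>0 'k) tens" where
  "pr l h = tpure N H (cl l) (gelt h)"

lemmas kH = kspace_group_algebra[OF H]
lemmas spanH = spans_group_algebra[OF H]
lemmas kN = k_algebraD(1)[OF N_alg]
lemmas mN = k_algebra_mult_bilin[OF N_alg]
lemmas mH = group_algebra_mult_bilin[OF H]
lemmas kB = kspace_tensor[OF kN kH]
lemmas kNN = kspace_tensor[OF kN kN]
lemmas pB = tpure_bilin[OF kN kH]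

lemma Hc: "h \<in> carrier H"
  by (simp add: H group_algebra_simps)

lemma cl_closed: "l \<in> lists J \<Longrightarrow> cl l \<in> carrier N"
  using spanN by (auto simp: spans_def)

lemma biproduct_simps:
  "carrier A = carrier B" "zero A = zero B" "add A = add B" "smult A = smult B"
  "mult A = (\<lambda>x y. tlift B (\<lambda>r h. tlift B (\<lambda>r' h'. tlift B (\<lambda>h1 h2.
            tpure N H (r \<otimes>\<^bsub>N\<^esub> act N h1 r') (h2 \<otimes>\<^bsub>H\<^esub> h')) (comult H h)) y) x)"
  "one A = tpure N H \<one>\<^bsub>N\<^esub> \<one>\<^bsub>H\<^esub>"
  "comult A = (\<lambda>x. tlift (tensor B B) (\<lambda>r h. tlift (tensor B B) (\<lambda>r1 r2. tlift (tensor B B) (\<lambda>l r0.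
     tlift (tensor B B) (\<lambda>h1 h2. tpure B B (tpure N H r1 (l \<otimes>\<^bsub>H\<^esub> h1)) (tpure N H r0 h2))
            (comult H h)) (coact N r2)) (bcomult N r)) x)"
  "counit A = teval (\<lambda>r h. bcounit N r * counit H h)"
  by (simp_all add: biproduct_def Let_def module.defs bialg.defs)

lemma same_BA: "same_space B A"
  by (simp add: same_space_def biproduct_simps)

lemmas kA = kspace_same[OF same_BA kB]

text \<open>The product is a triple lift whose innermost function depends on \<open>r\<close>,
  \<open>h\<close>, \<open>r'\<close> and \<open>h'\<close>. Linearity in each of the four is shown
  separately; the value on pure tensors then follows by peeling off one lift after the
  other.\<close>

lemma mult_biproduct_bilin: "bilin A A A (\<otimes>\<^bsub>A\<^esub>)"
  and pr_mult: "l \<in> lists J \<Longrightarrow> l' \<in> lists J \<Longrightarrow> pr l h \<otimes>\<^bsub>A\<^esub> pr l' h' = wchar \<chi> l' h \<odot>\<^bsub>A\<^esub> pr (l @ l') (h + h')"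
proof -
  let ?F = "\<lambda>r r' h' h1 h2. tpure N H (r \<otimes>\<^bsub>N\<^esub> act N h1 r') (h2 \<otimes>\<^bsub>H\<^esub> h')"
  let ?G = "\<lambda>r h r' h'. tlift B (?F r r' h') (comult H h)"
  note ac = bilinD(3)[OF act_bilin Hc] and mc = bilinD(3)[OF mN] and mHc = bilinD(3)[OF mH Hc Hc]
  have F: "bilin H H B (?F r r' h')" if "r \<in> carrier N" "r' \<in> carrier N" for r r' h'
    by (rule bilin_comp[OF pB bilin_right[OF mN that(1) bilinD(2)[OF act_bilin that(2)]] bilinD(2)[OF mH Hc]])
  note cc = comult_closed[OF H]
  have Gr: "linear_map N B (\<lambda>r. ?G r h r' h')" if "r' \<in> carrier N" for r' h h'
    by (rule tlift_param[OF kH kH kB _ cc kN]) (rule bilin_left[OF pB bilinD(2)[OF mN ac[OF that]]], rule mHc)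
  have Gh: "linear_map H B (\<lambda>h. ?G r h r' h')" if "r \<in> carrier N" "r' \<in> carrier N" for r r' h'
    by (rule tlift_comult_linear[OF H kB F[OF that]])
  have Gr': "linear_map N B (\<lambda>r'. ?G r h r' h')" if "r \<in> carrier N" for r h h'
    by (rule tlift_param[OF kH kH kB _ cc kN])
      (rule bilin_left[OF pB bilin_right[OF mN that bilinD(1)[OF act_bilin]] mHc], rule Hc)
  have Gh': "linear_map H B (\<lambda>h'. ?G r h r' h')" if "r \<in> carrier N" "r' \<in> carrier N" for r r' h
    by (rule tlift_param[OF kH kH kB _ cc kH])
      (rule bilin_right[OF pB mc[OF that(1) ac[OF that(2)]] bilinD(1)[OF mH Hc]])
  have G1: "bilin N H B (?G r h)" if "r \<in> carrier N" for r h
    by (rule bilinI) (rule Gh' Gr', (rule that | assumption)+)+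
  have G2: "bilin N H B (\<lambda>r h. ?G r h r' h')" if "r' \<in> carrier N" for r' h'
    by (rule bilinI) (rule Gh Gr, (rule that | assumption)+)+
  show "bilin A A A (\<otimes>\<^bsub>A\<^esub>)"
    unfolding bilin_same[OF same_BA same_BA same_BA, symmetric] biproduct_simps(5)
    by (rule tlift_tlift_bilin[OF kN kH kN kH kB G1 G2])
  show "pr l h \<otimes>\<^bsub>A\<^esub> pr l' h' = wchar \<chi> l' h \<odot>\<^bsub>A\<^esub> pr (l @ l') (h + h')"
    if l: "l \<in> lists J" "l' \<in> lists J"
  proof -
    have G3: "bilin N H B (\<lambda>r h. tlift B (?G r h) (tpure N H (cl l') (gelt h')))"
      by (rule bilin_cong[OF G2[OF cl_closed[OF l(2)], of "gelt h'"] _ kN kH])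
        (simp add: tlift_tpure[OF kN kH kB G1] cl_closed l Hc)
    have "pr l h \<otimes>\<^bsub>A\<^esub> pr l' h' = ?G (cl l) (gelt h) (cl l') (gelt h')"
      unfolding biproduct_simps(5) pr_def
      by (simp only: tlift_tpure[OF kN kH kB G3 cl_closed[OF l(1)] Hc]
          tlift_tpure[OF kN kH kB G1[OF cl_closed[OF l(1)]] cl_closed[OF l(2)] Hc])
    also have "\<dots> = tpure N H (cl l \<otimes>\<^bsub>N\<^esub> act N (gelt h) (cl l')) (gelt h \<otimes>\<^bsub>H\<^esub> gelt h')"
      by (rule tlift_comult_gelt[OF H kB F]) (simp_all add: cl_closed l)
    also have "\<dots> = wchar \<chi> l' h \<odot>\<^bsub>B\<^esub> pr (l @ l') (h + h')"
      using l by (simp add: act_cl k_algebraD(4)[OF N_alg] cl_closed cl_mult ga_simps(2)[OF H] gelt_mult pr_def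
          linear_mapD(3)[OF bilinD(2)[OF pB]] Hc)
    finally show ?thesis by (simp add: biproduct_simps)
  qed
qed

lemma pr_closed: "l \<in> lists J \<Longrightarrow> pr l h \<in> carrier A"
  unfolding biproduct_simps pr_def by (rule tpure_closed[OF kN kH]) (simp_all add: cl_closed Hc)

lemma span_pr: "spans A ((\<lambda>p. pr (fst p) (snd p)) ` (lists J \<times> UNIV))"
proof -
  have e: "(\<lambda>p. tpure N H (fst p) (snd p)) ` (cl ` lists J \<times> range gelt) = (\<lambda>p. pr (fst p) (snd p)) ` (lists J \<times> UNIV)"
    unfolding pr_def by (auto simp: image_iff) blast+
  show ?thesis
    using spans_tensor[OF kN kH spanN spanH] unfolding spans_same[OF same_BA] e .
qed

text \<open>Four nested lifts, handled from the inside: \<open>?F\<close>, \<open>?D\<close>,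
  \<open>?E\<close> and \<open>?C\<close> are the successive stages. On words the coaction has a
  single term of degree \<open>wdeg g y\<close>, and this degree is multiplied into the group
  element of the left factor.\<close>

lemma comult_biproduct_linear: "linear_map A (tensor A A) (comult A)"
  and comult_pr: "l \<in> lists J \<Longrightarrow> comult A (pr l h) =
      wsplit g \<chi> (tensor A A) l (\<lambda>x y. tpure A A (pr x (wdeg g y + h)) (pr y h))"
proof -
  let ?X = "tensor B B"
  let ?F = "\<lambda>r1 l r0 h1 h2. tpure B B (tpure N H r1 (l \<otimes>\<^bsub>H\<^esub> h1)) (tpure N H r0 h2)"
  let ?D = "\<lambda>r1 l r0 h. tlift ?X (?F r1 l r0) (comult H h)"
  let ?E = "\<lambda>r1 r2 h. tlift ?X (\<lambda>l r0. ?D r1 l r0 h) (coact N r2)"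
  let ?C = "\<lambda>r h. tlift ?X (\<lambda>r1 r2. ?E r1 r2 h) (bcomult N r)"
  note kX = kspace_tensor[OF kB kB] and pX = tpure_bilin[OF kB kB]
  note cc = comult_closed[OF H] and mHc = bilinD(3)[OF mH Hc Hc] and pc = tpure_closed[OF kN kH _ Hc]
  note coc = linear_mapD(1)[OF coact_linear] and cmc = linear_mapD(1)[OF comult_lin]
  have F: "bilin H H ?X (?F r1 l r0)" if "r1 \<in> carrier N" "r0 \<in> carrier N" for r1 l r0
    by (rule bilin_comp[OF pX bilin_right[OF pB that(1) bilinD(1)[OF mH Hc]] bilinD(1)[OF pB that(2)]])
  have Dr1: "linear_map N ?X (\<lambda>r1. ?D r1 l r0 h)" if "r0 \<in> carrier N" for l r0 h
    by (rule tlift_param[OF kH kH kX _ cc kN]) (rule bilin_left[OF pX bilinD(2)[OF pB mHc] pc[OF that]])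
  have Dl: "linear_map H ?X (\<lambda>l. ?D r1 l r0 h)" if "r1 \<in> carrier N" "r0 \<in> carrier N" for r1 r0 h
    by (rule tlift_param[OF kH kH kX _ cc kH])
      (rule bilin_left[OF pX bilin_right[OF pB that(1) bilinD(2)[OF mH Hc]] pc[OF that(2)]])
  have Dr0: "linear_map N ?X (\<lambda>r0. ?D r1 l r0 h)" if "r1 \<in> carrier N" for r1 l h
    by (rule tlift_param[OF kH kH kX _ cc kN])
      (rule bilin_right[OF pX pc[OF that] bilinD(2)[OF pB Hc]])
  have Dh: "linear_map H ?X (\<lambda>h. ?D r1 l r0 h)" if "r1 \<in> carrier N" "r0 \<in> carrier N" for r1 l r0
    by (rule tlift_comult_linear[OF H kX F[OF that]])
  have D: "bilin H N ?X (\<lambda>l r0. ?D r1 l r0 h)" if "r1 \<in> carrier N" for r1 h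
    by (rule bilinI) (rule Dl Dr0, (rule that | assumption)+)+
  have Er1: "linear_map N ?X (\<lambda>r1. ?E r1 r2 h)" if "r2 \<in> carrier N" for r2 h
    by (rule tlift_param[OF kH kN kX _ coc[OF that] kN]) (rule Dr1)
  have Er2: "linear_map N ?X (\<lambda>r2. ?E r1 r2 h)" if "r1 \<in> carrier N" for r1 h
    by (rule linear_map_comp[OF tlift_linear[OF kH kN kX D[OF that]] coact_linear])
  have Eh: "linear_map H ?X (\<lambda>h. ?E r1 r2 h)" if "r1 \<in> carrier N" "r2 \<in> carrier N" for r1 r2
    by (rule tlift_param[OF kH kN kX _ coc[OF that(2)] kH]) (rule Dh[OF that(1)])
  have E: "bilin N N ?X (\<lambda>r1 r2. ?E r1 r2 h)" for h
    by (rule bilinI) (rule Er1 Er2, assumption)+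
  have C: "bilin N H ?X ?C"
  proof (rule bilinI)
    show "linear_map H ?X (?C r)" if "r \<in> carrier N" for r
      by (rule tlift_param[OF kN kN kX _ cmc[OF that] kH]) (rule Eh)
    show "linear_map N ?X (\<lambda>r. ?C r h)" for h
      by (rule linear_map_comp[OF tlift_linear[OF kN kN kX E] comult_lin])
  qed
  have eX: "?X = tensor A A" and eP: "tpure B B = tpure A A"
    using tensor_same[OF same_BA same_BA] by simp_all
  show "linear_map A (tensor A A) (comult A)"
    unfolding biproduct_simps(7) eX[symmetric] linear_map_same[OF same_BA same_space_refl, symmetric]
    by (rule tlift_linear[OF kN kH kX C])
  show "comult A (pr l h) = wsplit g \<chi> (tensor A A) l (\<lambda>x y. tpure A A (pr x (wdeg g y + h)) (pr y h))"
    if l: "l \<in> lists J"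
  proof -
    have "comult A (pr l h) = ?C (cl l) (gelt h)"
      unfolding biproduct_simps(7) pr_def by (rule tlift_tpure[OF kN kH kX C cl_closed[OF l] Hc])
    also have "\<dots> = wsplit g \<chi> ?X l (\<lambda>x y. tlift ?X (\<lambda>r1 r2. ?E r1 r2 (gelt h)) (tpure N N (cl x) (cl y)))"
      unfolding comult_cl[OF l]
      by (rule linear_wsplit[OF tlift_linear[OF kN kN kX E] kNN l]) (simp add: tpure_closed[OF kN kN] cl_closed)
    also have "\<dots> = wsplit g \<chi> ?X l (\<lambda>x y. tpure B B (pr x (wdeg g y + h)) (pr y h))"
    proof (rule wsplit_cong[OF l])
      fix x y assume xy: "x \<in> lists J" "y \<in> lists J"
      have "tlift ?X (\<lambda>r1 r2. ?E r1 r2 (gelt h)) (tpure N N (cl x) (cl y)) = ?E (cl x) (cl y) (gelt h)"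
        by (rule tlift_tpure[OF kN kN kX E]) (simp_all add: cl_closed xy)
      also have "\<dots> = ?D (cl x) (gelt (wdeg g y)) (cl y) (gelt h)"
        unfolding coact_cl[OF xy(2)] by (rule tlift_tpure[OF kH kN kX D]) (simp_all add: cl_closed xy Hc)
      also have "\<dots> = ?F (cl x) (gelt (wdeg g y)) (cl y) (gelt h) (gelt h)"
        by (rule tlift_comult_gelt[OF H kX F]) (simp_all add: cl_closed xy)
      finally show "tlift ?X (\<lambda>r1 r2. ?E r1 r2 (gelt h)) (tpure N N (cl x) (cl y)) = tpure B B (pr x (wdeg g y + h)) (pr y h)"
        by (simp add: pr_def ga_simps(2)[OF H] gelt_mult)
    qed
    finally show ?thesis unfolding eX eP .
  qed
qed

lemma counit_biproduct_bilin: "bilin N H base_field (\<lambda>r h. bcounit N r * counit H h)"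
  by (rule bilin_times[OF counit_lin counit_linear[OF H]])

lemma biproduct_diag_smash: "diag_smash A J g \<chi> pr"
proof
  show "\<chi> j \<in> characters" for j by (rule char)
  show one: "\<one>\<^bsub>A\<^esub> = pr [] 0" by (simp add: biproduct_simps pr_def one_cl ga_simps[OF H] gelt_zero)
  have ch: "wchar \<chi> l (h + h') = wchar \<chi> l h * wchar \<chi> l h'" "wchar \<chi> l 0 = 1" for l h h'
    using characters_mult[OF wchar_character[of \<chi> l, OF char]] by auto
  note m = mult_biproduct_bilin
  show "k_algebra A"
  proof (rule k_algebraI_span[OF kA m _ span_pr])
    show "\<one>\<^bsub>A\<^esub> \<in> carrier A" by (simp add: one pr_closed)
    fix x y w assume xyw: "x \<in> (\<lambda>p. pr (fst p) (snd p)) ` (lists J \<times> UNIV)" "y \<in> (\<lambda>p. pr (fst p) (snd p)) ` (lists J \<times> UNIV)"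
      "w \<in> (\<lambda>p. pr (fst p) (snd p)) ` (lists J \<times> UNIV)"
    then obtain l h l' h' k i where e: "x = pr l h" "y = pr l' h'" "w = pr k i" "l \<in> lists J" "l' \<in> lists J" "k \<in> lists J"
      by auto
    have sl: "(c \<odot>\<^bsub>A\<^esub> x) \<otimes>\<^bsub>A\<^esub> y = c \<odot>\<^bsub>A\<^esub> (x \<otimes>\<^bsub>A\<^esub> y)" "x \<otimes>\<^bsub>A\<^esub> (c \<odot>\<^bsub>A\<^esub> y) = c \<odot>\<^bsub>A\<^esub> (x \<otimes>\<^bsub>A\<^esub> y)"
      if "x \<in> carrier A" "y \<in> carrier A" for x y c
      using linear_mapD(3)[OF bilinD(2)[OF m that(2)] that(1)] linear_mapD(3)[OF bilinD(1)[OF m that(1)] that(2)] by auto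
    show "(x \<otimes>\<^bsub>A\<^esub> y) \<otimes>\<^bsub>A\<^esub> w = x \<otimes>\<^bsub>A\<^esub> (y \<otimes>\<^bsub>A\<^esub> w)"
      using e(4-) by (simp add: e(1-3) pr_mult sl pr_closed ks_smul_smul[OF kA] ch add.assoc mult_ac)
  next
    fix x assume "x \<in> (\<lambda>p. pr (fst p) (snd p)) ` (lists J \<times> UNIV)"
    then obtain l h where e: "x = pr l h" "l \<in> lists J" by auto
    show "\<one>\<^bsub>A\<^esub> \<otimes>\<^bsub>A\<^esub> x = x" "x \<otimes>\<^bsub>A\<^esub> \<one>\<^bsub>A\<^esub> = x"
      using e(2) by (simp_all add: e(1) one pr_mult ch ks_smul_one[OF kA] pr_closed)
  qed
  show "spans A ((\<lambda>p. pr (fst p) (snd p)) ` (lists J \<times> UNIV))" by (rule span_pr)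
  show "linear_map A base_field (counit A)"
    unfolding biproduct_simps(8) linear_map_same[OF same_BA same_space_refl, symmetric]
    by (rule tlift_linear[OF kN kH kspace_base_field counit_biproduct_bilin])
  show "counit A (pr l h) = (if l = [] then 1 else 0)" if "l \<in> lists J" for l h
    unfolding biproduct_simps(8) pr_def using that
    by (simp add: tlift_tpure[OF kN kH kspace_base_field counit_biproduct_bilin] cl_closed Hc counit_cl counit_gelt[OF H])
qed (rule pr_mult comult_biproduct_linear comult_pr; assumption?)+

end

section \<open>The pairing of words\<close>

abbreviation ws :: "(nat \<Rightarrow> 'g::ab_group_add) \<Rightarrow> (nat \<Rightarrow> 'g \<Rightarrow> 'k::field) \<Rightarrow> nat list \<Rightarrow>
    (nat list \<Rightarrow> nat list \<Rightarrow> 'k) \<Rightarrow> 'k" where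
  "ws g \<chi> w F \<equiv> wsplit g \<chi> (base_field :: ('k, 'k) module) w F"

lemma ws_cong: "(\<And>x y. F x y = G x y) \<Longrightarrow> ws g \<chi> w F = ws g \<chi> w G"
  by (rule wsplit_cong[of w UNIV]) simp_all

lemma ws_add: "ws g \<chi> w (\<lambda>x y. F x y + G x y) = ws g \<chi> w F + ws g \<chi> w G"
  using wsplit_add[OF kspace_base_field, of w UNIV F G g \<chi>] by simp

lemma ws_times: "ws g \<chi> w (\<lambda>x y. c * F x y) = c * ws g \<chi> w F"
  using linear_wsplit[OF linear_map_times_left[OF linear_map_id] kspace_base_field, of w UNIV F c g \<chi>] by simp

text \<open>A splitting distributes the letters of \<open>w\<close> between \<open>x\<close> and
  \<open>y\<close>, so a weight that is multiplicative in the letters is the same for all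
  splittings.\<close>

lemma ws_prod:
  "ws g \<chi> w (\<lambda>x y. (prod_list (map c x) * prod_list (map c y)) * F x y) = prod_list (map c w) * ws g \<chi> w F"
proof (induction w arbitrary: F)
  case (Cons j w)
  let ?m = "\<lambda>x. prod_list (map c x)"
  have "ws g \<chi> (j # w) (\<lambda>x y. (?m x * ?m y) * F x y)
      = ws g \<chi> w (\<lambda>x y. (?m x * ?m y) * (c j * (F (j # x) y + wchar \<chi> x (g j) * F x (j # y))))"
    by (simp add: algebra_simps cong: ws_cong)
  also have "\<dots> = ?m w * (c j * ws g \<chi> (j # w) F)" by (simp add: Cons.IH ws_times)
  finally show ?case by (simp add: mult_ac)
qed simp

text \<open>The new letter goes to one of three subwords. When it passes a word that is itself split
  further, the coefficient of that word must be distributed over the two pieces, which is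
  \<open>ws_prod\<close>.\<close>

lemma ws_coassoc:
  "ws g \<chi> w (\<lambda>x y. ws g \<chi> x (\<lambda>x1 x2. G x1 x2 y)) = ws g \<chi> w (\<lambda>x y. ws g \<chi> y (\<lambda>y1 y2. G x y1 y2))"
proof (induction w arbitrary: G)
  case (Cons j w)
  let ?q = "\<lambda>x. wchar \<chi> x (g j)"
  have q: "wchar \<chi> x (g j) * ws g \<chi> x F = ws g \<chi> x (\<lambda>x1 x2. (?q x1 * ?q x2) * F x1 x2)" for x F
    unfolding wchar_def by (rule ws_prod[symmetric])
  let ?G = "\<lambda>x1 x2 y. G (j # x1) x2 y + ?q x1 * G x1 (j # x2) y + (?q x1 * ?q x2) * G x1 x2 (j # y)"
  have "ws g \<chi> (j # w) (\<lambda>x y. ws g \<chi> x (\<lambda>x1 x2. G x1 x2 y)) = ws g \<chi> w (\<lambda>x y. ws g \<chi> x (\<lambda>x1 x2. ?G x1 x2 y))"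
    by (simp add: q flip: ws_add)
  also have "\<dots> = ws g \<chi> w (\<lambda>x y. ws g \<chi> y (\<lambda>y1 y2. ?G x y1 y2))" by (rule Cons.IH)
  also have "\<dots> = ws g \<chi> (j # w) (\<lambda>x y. ws g \<chi> y (\<lambda>y1 y2. G x y1 y2))"
    by (simp add: add.assoc mult.assoc distrib_left flip: ws_add ws_times)
  finally show ?case .
qed simp

lemma ws_counit_right: "ws g \<chi> w (\<lambda>x y. (if y = [] then 1 else 0) * F x) = F w"
proof (induction w arbitrary: F)
  case (Cons j w)
  then show ?case using Cons.IH[of "\<lambda>x. F (j # x)"] by simp
qed simp

lemma ws_swap:
  "ws g \<chi> w (\<lambda>x y. ws g' \<chi>' v (\<lambda>a b. G x y a b)) = ws g' \<chi>' v (\<lambda>a b. ws g \<chi> w (\<lambda>x y. G x y a b))"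
proof (induction w arbitrary: G)
  case (Cons j w)
  have "ws g \<chi> (j # w) (\<lambda>x y. ws g' \<chi>' v (G x y))
      = ws g \<chi> w (\<lambda>x y. ws g' \<chi>' v (\<lambda>a b. G (j # x) y a b + wchar \<chi> x (g j) * G x (j # y) a b))"
    by (simp add: ws_add ws_times)
  then show ?case by (simp add: Cons.IH)
qed simp

lemma ws_append:
  assumes "\<And>j. \<chi> j \<in> characters"
  shows "ws g \<chi> (w @ w') F = ws g \<chi> w (\<lambda>x y. ws g \<chi> w' (\<lambda>x' y'.
    wchar \<chi> x' (wdeg g y) * F (x @ x') (y @ y')))"
  using wsplit_append[OF assms kspace_base_field, of w UNIV w' F g] by simp

lemma ws_param:
  assumes "w \<in> lists S" "\<And>x y. x \<in> lists S \<Longrightarrow> y \<in> lists S \<Longrightarrow> linear_map L base_field (\<lambda>t. F t x y)"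
  shows "linear_map L base_field (\<lambda>t. ws g \<chi> w (F t))"
  using assms
proof (induction w arbitrary: F rule: list.induct)
  case (Cons j w)
  show ?case unfolding wsplit.simps base_field_simps
    by (rule Cons.IH) (use Cons.prems(1) in \<open>simp_all add: Cons.prems(2) linear_map_plus linear_map_times_left\<close>)
qed simp

lemma ws_bilin_param:
  assumes "w \<in> lists S" "\<And>x y. x \<in> lists S \<Longrightarrow> y \<in> lists S \<Longrightarrow> bilin L L' base_field (\<lambda>t t'. F t t' x y)"
  shows "bilin L L' base_field (\<lambda>t t'. ws g \<chi> w (F t t'))"
  by (intro bilinI ws_param[OF assms(1)]) (simp_all add: bilinD[OF assms(2)])

text \<open>The data on which the pairing of words depends, without the modules that the words come
  from and without index ranges. In the theorem, indices outside the ranges receive trivial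
  characters and coefficient 0.\<close>

locale word_pairing =
  fixes z :: "nat \<Rightarrow> 'l::ab_group_add" and \<eta> :: "nat \<Rightarrow> 'l \<Rightarrow> 'k::field"
    and g :: "nat \<Rightarrow> 'g::ab_group_add" and \<chi> :: "nat \<Rightarrow> 'g \<Rightarrow> 'k"
    and \<phi> :: "'l \<Rightarrow> 'g \<Rightarrow> 'k" and s :: "nat \<Rightarrow> nat" and lam :: "nat \<Rightarrow> 'k"
  assumes \<eta>_char: "\<And>i. \<eta> i \<in> characters" and \<chi>_char: "\<And>j. \<chi> j \<in> characters" and \<phi>_char: "\<And>y. \<phi> y \<in> characters"
    and \<phi>_add: "\<And>y y' h. \<phi> (y + y') h = \<phi> y h * \<phi> y' h"
    and \<phi>_z: "\<And>i h. lam i \<noteq> 0 \<Longrightarrow> \<phi> (z i) h = inverse (\<chi> (s i) h)"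
    and \<eta>_\<phi>: "\<And>i y. lam i \<noteq> 0 \<Longrightarrow> \<eta> i y = \<phi> y (g (s i))"
begin

text \<open>The form \<beta> between a word and the letter \<open>j\<close>, extended by 0 to words
  that are not single letters; (B.1), (B.2) and (B.4) force this extension.\<close>

definition lp :: "nat list \<Rightarrow> nat \<Rightarrow> 'k" where
  "lp y j = (case y of [i] \<Rightarrow> if s i = j then lam i else 0 | _ \<Rightarrow> 0)"

lemma lp_simps [simp]: "lp [] j = 0" "lp [i] j = (if s i = j then lam i else 0)" "lp (i # i' # y) j = 0"
  by (simp_all add: lp_def)

lemma lp_length: "lp y j \<noteq> 0 \<Longrightarrow> length y = 1"
  by (auto simp: lp_def split: list.splits)

text \<open>The arguments are swapped: \<open>wpair v w\<close> is the value of the Nichols form at \<open>(w, v)\<close>, and the recursion is (B.3).\<close>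

primrec wpair :: "nat list \<Rightarrow> nat list \<Rightarrow> 'k" where
  "wpair [] w = (if w = [] then 1 else 0)"
| "wpair (j # v) w = ws z \<eta> w (\<lambda>x y. lp y j * wpair v x)"

text \<open>
  If the pairing of the words \<open>w\<close> and \<open>v\<close> does not vanish, then \<open>v\<close> is a rearrangement of \<open>map s w\<close> and all
  letters of \<open>w\<close> have a nonzero \<open>lam\<close>.
\<close>

lemma wpair_support:
  assumes "\<And>i. lam i \<noteq> 0 \<Longrightarrow> c i = d (s i)"
  shows "prod_list (map c w) * wpair v w = prod_list (map d v) * wpair v w"
proof (induction v arbitrary: w)
  case (Cons j v)
  let ?m = "\<lambda>x. prod_list (map c x)"
  have l: "?m y * lp y j = d j * lp y j" for y
    using assms by (cases y rule: remdups_adj.cases) auto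
  have "?m w * wpair (j # v) w = ws z \<eta> w (\<lambda>x y. (?m x * ?m y) * (lp y j * wpair v x))"
    by (simp add: ws_prod)
  also have "\<dots> = ws z \<eta> w (\<lambda>x y. (d j * prod_list (map d v)) * (lp y j * wpair v x))"
  proof (rule ws_cong)
    fix x y
    have "(?m x * ?m y) * (lp y j * wpair v x) = (?m y * lp y j) * (?m x * wpair v x)" by (simp add: mult_ac)
    also have "\<dots> = (d j * prod_list (map d v)) * (lp y j * wpair v x)"
      unfolding l Cons.IH by (simp add: mult_ac)
    finally show "(?m x * ?m y) * (lp y j * wpair v x) = (d j * prod_list (map d v)) * (lp y j * wpair v x)" .
  qed
  finally show ?case by (simp add: ws_times)
qed simp

lemma \<phi>_wdeg_right: "\<phi> y (wdeg g v) = prod_list (map (\<lambda>j. \<phi> y (g j)) v)"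
  by (induction v) (simp_all add: characters_mult[OF \<phi>_char])

lemma \<phi>_0: "\<phi> 0 h = 1"
proof -
  have "\<phi> 0 (h + - h) = \<phi> 0 h * \<phi> 0 (- h)" "\<phi> 0 0 = 1" by (simp_all only: characters_mult[OF \<phi>_char])
  then have "\<phi> 0 h \<noteq> 0" by auto
  then show ?thesis using \<phi>_add[of 0 0 h] by simp
qed

lemma \<phi>_wdeg_left: "\<phi> (wdeg z w) h = prod_list (map (\<lambda>i. \<phi> (z i) h) w)"
  by (induction w) (simp_all add: \<phi>_add \<phi>_0)

text \<open>Wherever the pairing does not vanish, the character of the left word is given by \<phi>
  at the degree of the right word; \<open>wpair_\<phi>\<close> is the statement with the two sides
  exchanged. Both extend the hypotheses on single letters multiplicatively.\<close>

lemma wpair_\<eta>: "wchar \<eta> w y * wpair v w = \<phi> y (wdeg g v) * wpair v w"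
  unfolding wchar_def \<phi>_wdeg_right by (rule wpair_support) (rule \<eta>_\<phi>)

lemma wpair_\<phi>: "\<phi> (wdeg z w) h * wpair v w = wchar \<chi> v (- h) * wpair v w"
  unfolding wchar_def \<phi>_wdeg_left
  by (rule wpair_support) (simp add: \<phi>_z characters_uminus[OF \<chi>_char])

text \<open>This is (B.3) for words. The recursion of \<open>wpair\<close> is the case of a single
  letter, and coassociativity of the splittings does the rest.\<close>

lemma wpair_append_left: "wpair (v @ v') w = ws z \<eta> w (\<lambda>x y. wpair v y * wpair v' x)"
proof (induction v arbitrary: w)
  case Nil
  show ?case by (simp add: ws_counit_right)
next
  case (Cons j v)
  have "wpair ((j # v) @ v') w = ws z \<eta> w (\<lambda>x y. ws z \<eta> x (\<lambda>x1 x2. lp y j * (wpair v x2 * wpair v' x1)))"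
    by (simp add: Cons.IH ws_times)
  also have "\<dots> = ws z \<eta> w (\<lambda>x y. ws z \<eta> y (\<lambda>y1 y2. lp y2 j * (wpair v y1 * wpair v' x)))"
    by (rule ws_coassoc)
  also have "\<dots> = ws z \<eta> w (\<lambda>x y. wpair (j # v) y * wpair v' x)"
    by (rule ws_cong) (simp add: mult_ac flip: ws_times)
  finally show ?case .
qed

text \<open>A concatenation is a single letter only if one of its parts is empty.\<close>

lemma lp_append: "lp (y @ y') j = lp y j * (if y' = [] then 1 else 0) + (if y = [] then 1 else 0) * lp y' j"
  by (cases y rule: remdups_adj.cases; cases y') auto

lemma wpair_Nil_right: "wpair v [] = (if v = [] then 1 else 0)"
  by (cases v) simp_all

text \<open>Only splittings whose second word is one letter \<open>i\<close> with
  \<open>s i = j\<close> and \<open>lam i\<close> nonzero contribute; for these the hypotheses on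
  \<phi> are available.\<close>

lemma ws_lp_cong:
  assumes "\<And>x i. lam i \<noteq> 0 \<Longrightarrow> s i = j \<Longrightarrow> F x [i] = G x [i]"
  shows "ws z \<eta> w (\<lambda>x y. lp y j * F x y) = ws z \<eta> w (\<lambda>x y. lp y j * G x y)"
proof (rule ws_cong)
  show "lp y j * F x y = lp y j * G x y" for x y
    using assms by (cases y rule: remdups_adj.cases) auto
qed

text \<open>This is (B.1) for words, by induction on the right word: its first letter removes a
  letter either of \<open>w\<close> or of \<open>w'\<close>. The two cases correspond to the two
  terms in the splitting of \<open>j # v\<close>, and the work lies in matching their
  coefficients.\<close>

lemma wpair_append_right:
  "wpair v (w @ w') = ws g \<chi> v (\<lambda>x y. wchar \<chi> x (- wdeg g y) * (wpair x w * wpair y w'))"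
proof (induction v arbitrary: w w')
  case Nil
  show ?case by simp
next
  case (Cons j v)
  let ?k = "\<lambda>x y. wchar \<chi> x (- wdeg g y)"

  have "wpair (j # v) (w @ w') = ws z \<eta> w (\<lambda>x y. ws z \<eta> w' (\<lambda>x' y'.
      wchar \<eta> x' (wdeg z y) * (lp (y @ y') j * wpair v (x @ x'))))"
    unfolding wpair.simps by (rule ws_append[OF \<eta>_char])
  also have "\<dots> = ws z \<eta> w (\<lambda>x y. lp y j * (wchar \<eta> w' (wdeg z y) * wpair v (x @ w')))
      + ws z \<eta> w' (\<lambda>x' y'. lp y' j * wpair v (w @ x'))"
  proof -
    have "ws z \<eta> w' (\<lambda>x' y'. wchar \<eta> x' (wdeg z y) * (lp (y @ y') j * wpair v (x @ x')))
      = lp y j * (wchar \<eta> w' (wdeg z y) * wpair v (x @ w'))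
        + (if y = [] then 1 else 0) * ws z \<eta> w' (\<lambda>x' y'. lp y' j * wpair v (x @ x'))" for x y
    proof -
      have "ws z \<eta> w' (\<lambda>x' y'. wchar \<eta> x' (wdeg z y) * (lp (y @ y') j * wpair v (x @ x')))
        = ws z \<eta> w' (\<lambda>x' y'. lp y j * ((if y' = [] then 1 else 0) * (wchar \<eta> x' (wdeg z y) * wpair v (x @ x')))
          + (if y = [] then 1 else 0) * (lp y' j * wpair v (x @ x')))"
        by (rule ws_cong)
          (auto simp: lp_append algebra_simps characters_mult[OF wchar_character[of \<eta>, OF \<eta>_char]])
      then show ?thesis by (simp only: ws_add ws_times ws_counit_right)
    qed
    then show ?thesis by (simp add: ws_add) (rule trans[OF ws_cong ws_counit_right], simp)
  qed
  \<comment> \<open>The removed letter lies in \<open>w\<close> and has to cross \<open>w'\<close>,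
    which costs \<open>wchar \<eta> w'\<close> at its degree. Next to the pairing of
    \<open>w'\<close>, \<open>wpair_\<eta>\<close> and \<open>\<phi>_z\<close> turn this into the
    factor that \<open>j\<close> contributes to
    \<open>wchar \<chi> (j # a) (- wdeg g b)\<close>.\<close>
  also have "ws z \<eta> w (\<lambda>x y. lp y j * (wchar \<eta> w' (wdeg z y) * wpair v (x @ w')))
      = ws g \<chi> v (\<lambda>a b. ?k (j # a) b * (wpair (j # a) w * wpair b w'))"
  proof -
    have "ws z \<eta> w (\<lambda>x y. lp y j * (wchar \<eta> w' (wdeg z y) * wpair v (x @ w')))
      = ws z \<eta> w (\<lambda>x y. lp y j * ws g \<chi> v (\<lambda>a b. ?k (j # a) b * (wpair a x * wpair b w')))"
    proof (rule ws_lp_cong)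
      fix x i assume i: "lam i \<noteq> 0" "s i = j"
      have "wchar \<eta> w' (z i) * (?k a b * (wpair a x * wpair b w')) = ?k (j # a) b * (wpair a x * wpair b w')" for a b
      proof -
        have "wchar \<eta> w' (z i) * wpair b w' = \<chi> j (- wdeg g b) * wpair b w'"
          unfolding wpair_\<eta> using \<phi>_z[OF i(1)] i(2) by (simp add: characters_uminus[OF \<chi>_char])
        then show ?thesis by (simp add: mult_ac)
      qed
      then show "wchar \<eta> w' (wdeg z [i]) * wpair v (x @ w') = ws g \<chi> v (\<lambda>a b. ?k (j # a) b * (wpair a x * wpair b w'))"
        by (simp only: Cons.IH ws_times[symmetric] wdeg_simps add_0_right)
    qed
    also have "\<dots> = ws z \<eta> w (\<lambda>x y. ws g \<chi> v (\<lambda>a b. lp y j * (?k (j # a) b * (wpair a x * wpair b w'))))"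
      by (simp add: ws_times)
    also have "\<dots> = ws g \<chi> v (\<lambda>a b. ws z \<eta> w (\<lambda>x y. lp y j * (?k (j # a) b * (wpair a x * wpair b w'))))"
      by (rule ws_swap)
    also have "\<dots> = ws g \<chi> v (\<lambda>a b. ?k (j # a) b * (wpair (j # a) w * wpair b w'))"
    proof (rule ws_cong)
      fix a b
      have "ws z \<eta> w (\<lambda>x y. lp y j * (?k (j # a) b * (wpair a x * wpair b w')))
        = ws z \<eta> w (\<lambda>x y. (?k (j # a) b * wpair b w') * (lp y j * wpair a x))"
        by (rule ws_cong) (simp add: mult_ac)
      also have "\<dots> = (?k (j # a) b * wpair b w') * wpair (j # a) w" by (simp only: ws_times wpair.simps)
      finally show "ws z \<eta> w (\<lambda>x y. lp y j * (?k (j # a) b * (wpair a x * wpair b w')))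
        = ?k (j # a) b * (wpair (j # a) w * wpair b w')" by (simp only: mult_ac)
    qed
    finally show ?thesis .
  qed
  \<comment> \<open>The removed letter lies in \<open>w'\<close>. The coefficient
    \<open>wchar \<chi> a (g j)\<close> of the splitting cancels what \<open>j\<close> adds to the
    negated degree of \<open>j # b\<close>.\<close>
  also have "ws z \<eta> w' (\<lambda>x' y'. lp y' j * wpair v (w @ x'))
      = ws g \<chi> v (\<lambda>a b. wchar \<chi> a (g j) * (?k a (j # b) * (wpair a w * wpair (j # b) w')))"
  proof -
    have "ws z \<eta> w' (\<lambda>x' y'. lp y' j * wpair v (w @ x'))
      = ws g \<chi> v (\<lambda>a b. ws z \<eta> w' (\<lambda>x' y'. lp y' j * (?k a b * (wpair a w * wpair b x'))))"
      unfolding Cons.IH ws_times[symmetric] by (rule ws_swap)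
    also have "\<dots> = ws g \<chi> v (\<lambda>a b. wchar \<chi> a (g j) * (?k a (j # b) * (wpair a w * wpair (j # b) w')))"
    proof (rule ws_cong)
      fix a b
      note ca = wchar_character[of \<chi> a, OF \<chi>_char]
      have k: "wchar \<chi> a (g j) * ?k a (j # b) = ?k a b"
        using characters_mult(1)[OF ca, of "g j" "- wdeg g (j # b)"] by simp
      have "ws z \<eta> w' (\<lambda>x' y'. lp y' j * (?k a b * (wpair a w * wpair b x')))
        = ws z \<eta> w' (\<lambda>x' y'. (?k a b * wpair a w) * (lp y' j * wpair b x'))"
        by (rule ws_cong) (simp add: mult_ac)
      also have "\<dots> = ?k a b * (wpair a w * wpair (j # b) w')" by (simp only: ws_times wpair.simps mult.assoc)
      finally show "ws z \<eta> w' (\<lambda>x' y'. lp y' j * (?k a b * (wpair a w * wpair b x')))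
        = wchar \<chi> a (g j) * (?k a (j # b) * (wpair a w * wpair (j # b) w'))" by (simp only: k mult.assoc[symmetric])
    qed
    finally show ?thesis .
  qed
  also have "ws g \<chi> v (\<lambda>a b. ?k (j # a) b * (wpair (j # a) w * wpair b w'))
      + ws g \<chi> v (\<lambda>a b. wchar \<chi> a (g j) * (?k a (j # b) * (wpair a w * wpair (j # b) w')))
      = ws g \<chi> (j # v) (\<lambda>a b. ?k a b * (wpair a w * wpair b w'))"
    by (simp only: wsplit.simps base_field_simps ws_add)
  finally show ?case .
qed

lemma wpair_letter: "wpair v [i] = (if v = [s i] then lam i else 0)"
  by (cases v rule: remdups_adj.cases) (auto simp: characters_mult[OF \<eta>_char])

end

section \<open>The pairing of diagonal braided bialgebras\<close>

lemma trilin_eq_on_span: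
  assumes "\<And>x. x \<in> carrier L \<Longrightarrow> bilin M N X (f x)" "\<And>x. x \<in> carrier L \<Longrightarrow> bilin M N X (f' x)"
    and "\<And>y w. y \<in> carrier M \<Longrightarrow> w \<in> carrier N \<Longrightarrow> linear_map L X (\<lambda>x. f x y w)"
    and "\<And>y w. y \<in> carrier M \<Longrightarrow> w \<in> carrier N \<Longrightarrow> linear_map L X (\<lambda>x. f' x y w)"
    and "spans L R" "spans M S" "spans N S'" "kspace L" "kspace M" "kspace N" "kspace X"
    and "\<And>r s s'. r \<in> R \<Longrightarrow> s \<in> S \<Longrightarrow> s' \<in> S' \<Longrightarrow> f r s s' = f' r s s'"
    and "x \<in> carrier L" "y \<in> carrier M" "w \<in> carrier N"
  shows "f x y w = f' x y w"
proof (rule linear_eq_on_span[OF assms(3,4)[OF assms(14,15)] assms(5,8,11) _ assms(13)])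
  fix r assume r: "r \<in> R"
  then have rL: "r \<in> carrier L" using assms(5) by (auto simp: spans_def)
  show "f r y w = f' r y w"
    by (rule bilin_eq_on_span[OF assms(1,2)[OF rL] assms(6,7,9,10,11) assms(12)[OF r] assms(14,15)])
qed

lemma cond_BD:
  assumes "cond_B H T R \<beta>"
  shows "t \<in> carrier T \<Longrightarrow> t' \<in> carrier T \<Longrightarrow> r \<in> carrier R \<Longrightarrow> \<beta> (t \<otimes>\<^bsub>T\<^esub> t') r =
      teval (\<lambda>r1 r2. teval (\<lambda>h r0. \<beta> t (act R (antipode_inv H h) r1) * \<beta> t' r0) (coact R r2)) (bcomult R r)"
    and "r \<in> carrier R \<Longrightarrow> \<beta> \<one>\<^bsub>T\<^esub> r = bcounit R r"
    and "t \<in> carrier T \<Longrightarrow> r \<in> carrier R \<Longrightarrow> r' \<in> carrier R \<Longrightarrow>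
      \<beta> t (r \<otimes>\<^bsub>R\<^esub> r') = teval (\<lambda>t1 t2. \<beta> t2 r * \<beta> t1 r') (bcomult T t)"
    and "t \<in> carrier T \<Longrightarrow> \<beta> t \<one>\<^bsub>R\<^esub> = bcounit T t"
  using assms unfolding cond_B_def by (elim conjE, simp only:)+

locale alg_pairing = word_pairing z \<eta> g \<chi> \<phi> s lam + NT: diag_alg K NT JT z \<eta> clT + NR: diag_alg H NR JR g \<chi> clR
  for K :: "('k::field, 'l::ab_group_add \<Rightarrow>\<^sub>0 'k) hopf" and H :: "('k, 'g::ab_group_add \<Rightarrow>\<^sub>0 'k) hopf"
    and NT :: "('k, 'l \<Rightarrow>\<^sub>0 'k, 't) ydbialg" and NR :: "('k, 'g \<Rightarrow>\<^sub>0 'k, 'r) ydbialg"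
    and JT JR :: "nat set" and z :: "nat \<Rightarrow> 'l" and g :: "nat \<Rightarrow> 'g"
    and \<eta> :: "nat \<Rightarrow> 'l \<Rightarrow> 'k" and \<chi> :: "nat \<Rightarrow> 'g \<Rightarrow> 'k" and \<phi> :: "'l \<Rightarrow> 'g \<Rightarrow> 'k"
    and s :: "nat \<Rightarrow> nat" and lam :: "nat \<Rightarrow> 'k"
    and clT :: "nat list \<Rightarrow> 't" and clR :: "nat list \<Rightarrow> 'r"
begin

context
  fixes \<beta> :: "'t \<Rightarrow> 'r \<Rightarrow> 'k"
  assumes \<beta>: "bilin NT NR base_field \<beta>"
begin

text \<open>The right-hand side of (B.1) at a word, for any bilinear form: it serves to verify (B.1)
  for the constructed form and to exploit it for a competing one. The inverse antipode is what
  negates the degree of \<open>y\<close>.\<close>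

lemma comult_pair_right:
  assumes t: "t \<in> carrier NT" "t' \<in> carrier NT" and v: "v \<in> lists JR"
  shows "teval (\<lambda>r1 r2. teval (\<lambda>h r0. \<beta> t (act NR (antipode_inv H h) r1) * \<beta> t' r0) (coact NR r2)) (bcomult NR (clR v))
    = ws g \<chi> v (\<lambda>x y. wchar \<chi> x (- wdeg g y) * (\<beta> t (clR x) * \<beta> t' (clR y)))" (is "?L = ?R")
    and "linear_map NR base_field
      (\<lambda>r. teval (\<lambda>r1 r2. teval (\<lambda>h r0. \<beta> t (act NR (antipode_inv H h) r1) * \<beta> t' r0) (coact NR r2)) (bcomult NR r))"
proof -
  note b1 = bilinD(1)[OF \<beta> t(1)] and b2 = bilinD(1)[OF \<beta> t(2)]
  note kB = kspace_base_field
  have ah: "linear_map H base_field (\<lambda>h. \<beta> t (act NR (antipode_inv H h) r1))" if "r1 \<in> carrier NR" for r1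
    unfolding antipode_inv_eq[OF NR.H]
    by (rule linear_map_comp[OF b1]) (rule bilin_left[OF NR.act_bilin antipode_linear[OF NR.H] that])
  have F: "bilin H NR base_field (\<lambda>h r0. \<beta> t (act NR (antipode_inv H h) r1) * \<beta> t' r0)" if "r1 \<in> carrier NR" for r1
    by (rule bilin_times[OF ah[OF that] b2])
  let ?E = "\<lambda>r1 r2. teval (\<lambda>h r0. \<beta> t (act NR (antipode_inv H h) r1) * \<beta> t' r0) (coact NR r2)"
  have E: "bilin NR NR base_field ?E"
  proof (rule bilinI)
    show "linear_map NR base_field (?E r1)" if "r1 \<in> carrier NR" for r1
      by (rule linear_map_comp[OF tlift_linear[OF NR.kH NR.kN kB F[OF that]] NR.coact_linear])
    show "linear_map NR base_field (\<lambda>r1. ?E r1 r2)" if "r2 \<in> carrier NR" for r2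
      by (rule tlift_param[OF NR.kH NR.kN kB _ linear_mapD(1)[OF NR.coact_linear that] NR.kN])
        (rule linear_map_times_right[OF linear_map_comp[OF b1 bilinD(1)[OF NR.act_bilin NR.Hc]]])
  qed
  note tE = tlift_linear[OF NR.kN NR.kN kB E]
  show "linear_map NR base_field (\<lambda>r. teval ?E (bcomult NR r))"
    by (rule linear_map_comp[OF tE NR.comult_lin])
  have "?L = ws g \<chi> v (\<lambda>x y. teval ?E (tpure NR NR (clR x) (clR y)))"
    unfolding NR.comult_cl[OF v]
    by (rule linear_wsplit[OF tE NR.kNN v]) (simp add: tpure_closed[OF NR.kN NR.kN] NR.cl_closed)
  also have "\<dots> = ?R"
  proof (rule wsplit_cong[OF v])
    fix x y assume xy: "x \<in> lists JR" "y \<in> lists JR"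
    have "teval ?E (tpure NR NR (clR x) (clR y)) = ?E (clR x) (clR y)"
      by (rule tlift_tpure[OF NR.kN NR.kN kB E]) (simp_all add: NR.cl_closed xy)
    also have "\<dots> = \<beta> t (act NR (antipode_inv H (gelt (wdeg g y))) (clR x)) * \<beta> t' (clR y)"
      unfolding NR.coact_cl[OF xy(2)]
      by (rule tlift_tpure[OF NR.kH NR.kN kB F]) (simp_all add: NR.cl_closed xy NR.Hc)
    also have "\<dots> = wchar \<chi> x (- wdeg g y) * (\<beta> t (clR x) * \<beta> t' (clR y))"
      by (simp add: antipode_inv_eq[OF NR.H] antipode_gelt[OF NR.H] NR.act_cl xy NR.cl_closed linear_mapD(3)[OF b1])
    finally show "teval ?E (tpure NR NR (clR x) (clR y)) = wchar \<chi> x (- wdeg g y) * (\<beta> t (clR x) * \<beta> t' (clR y))" .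
  qed
  finally show "?L = ?R" .
qed

lemma comult_pair_left:
  assumes r: "r \<in> carrier NR" "r' \<in> carrier NR" and w: "w \<in> lists JT"
  shows "teval (\<lambda>t1 t2. \<beta> t2 r * \<beta> t1 r') (bcomult NT (clT w)) = ws z \<eta> w (\<lambda>x y. \<beta> (clT y) r * \<beta> (clT x) r')"
    and "linear_map NT base_field (\<lambda>t. teval (\<lambda>t1 t2. \<beta> t2 r * \<beta> t1 r') (bcomult NT t))"
proof -
  note kB = kspace_base_field
  have F: "bilin NT NT base_field (\<lambda>t1 t2. \<beta> t2 r * \<beta> t1 r')"
    using bilin_flip[OF bilin_times[OF bilinD(2)[OF \<beta> r(1)] bilinD(2)[OF \<beta> r(2)]]] .
  note tF = tlift_linear[OF NT.kN NT.kN kB F]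
  show "linear_map NT base_field (\<lambda>t. teval (\<lambda>t1 t2. \<beta> t2 r * \<beta> t1 r') (bcomult NT t))"
    by (rule linear_map_comp[OF tF NT.comult_lin])
  have "teval (\<lambda>t1 t2. \<beta> t2 r * \<beta> t1 r') (bcomult NT (clT w))
      = ws z \<eta> w (\<lambda>x y. teval (\<lambda>t1 t2. \<beta> t2 r * \<beta> t1 r') (tpure NT NT (clT x) (clT y)))"
    unfolding NT.comult_cl[OF w]
    by (rule linear_wsplit[OF tF NT.kNN w]) (simp add: tpure_closed[OF NT.kN NT.kN] NT.cl_closed)
  also have "\<dots> = ws z \<eta> w (\<lambda>x y. \<beta> (clT y) r * \<beta> (clT x) r')"
    by (rule wsplit_cong[OF w]) (simp add: tlift_tpure[OF NT.kN NT.kN kB F] NT.cl_closed)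
  finally show "teval (\<lambda>t1 t2. \<beta> t2 r * \<beta> t1 r') (bcomult NT (clT w)) = ws z \<eta> w (\<lambda>x y. \<beta> (clT y) r * \<beta> (clT x) r')" .
qed

lemma cond_B_pair:
  assumes "\<And>w v. w \<in> lists JT \<Longrightarrow> v \<in> lists JR \<Longrightarrow> \<beta> (clT w) (clR v) = wpair v w"
  shows "cond_B H NT NR \<beta>"
proof -
  note kB = kspace_base_field
  note mT = NT.mN and mR = NR.mN
  have "\<beta> (t \<otimes>\<^bsub>NT\<^esub> t') r = teval (\<lambda>r1 r2. teval (\<lambda>h r0. \<beta> t (act NR (antipode_inv H h) r1) * \<beta> t' r0) (coact NR r2)) (bcomult NR r)"
    if c: "t \<in> carrier NT" "t' \<in> carrier NT" "r \<in> carrier NR" for t t' r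
  \<comment> \<open>\<open>lists.Nil\<close> fills the word premise that the linearity conclusion
    shares with the formula on words.\<close>
  proof (rule linear_eq_on_span[OF _ comult_pair_right(2)[OF c(1,2) lists.Nil] NR.spanN NR.kN kB _ c(3)])
    show "linear_map NR base_field (\<beta> (t \<otimes>\<^bsub>NT\<^esub> t'))" by (rule bilinD(1)[OF \<beta> bilinD(3)[OF mT c(1,2)]])
    fix q assume "q \<in> clR ` lists JR"
    then obtain v where v: "v \<in> lists JR" "q = clR v" by auto
    have "\<beta> (t \<otimes>\<^bsub>NT\<^esub> t') (clR v) = ws g \<chi> v (\<lambda>x y. wchar \<chi> x (- wdeg g y) * (\<beta> t (clR x) * \<beta> t' (clR y)))"
    proof (rule bilin_eq_on_span[where f = "\<lambda>t t'. \<beta> (t \<otimes>\<^bsub>NT\<^esub> t') (clR v)", OF bilin_post[OF bilinD(2)[OF \<beta>] mT]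
          ws_bilin_param[OF v(1)] NT.spanN NT.spanN NT.kN NT.kN kB _ c(1,2)])
      show "clR v \<in> carrier NR" using v by (simp add: NR.cl_closed)
      show "bilin NT NT base_field (\<lambda>t t'. wchar \<chi> x (- wdeg g y) * (\<beta> t (clR x) * \<beta> t' (clR y)))"
        if "x \<in> lists JR" "y \<in> lists JR" for x y
        by (rule bilin_post[OF linear_map_times_left[OF linear_map_id]])
          (rule bilin_times; rule bilinD(2)[OF \<beta>]; simp add: NR.cl_closed that)
      fix p p' assume "p \<in> clT ` lists JT" "p' \<in> clT ` lists JT"
      then obtain w w' where w: "w \<in> lists JT" "p = clT w" "w' \<in> lists JT" "p' = clT w'" by auto
      show "\<beta> (p \<otimes>\<^bsub>NT\<^esub> p') (clR v) = ws g \<chi> v (\<lambda>x y. wchar \<chi> x (- wdeg g y) * (\<beta> p (clR x) * \<beta> p' (clR y)))"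
        using w v by (simp add: NT.cl_mult assms wpair_append_right) (rule wsplit_cong[OF v(1)], simp add: assms)
    qed
    then show "\<beta> (t \<otimes>\<^bsub>NT\<^esub> t') q = teval (\<lambda>r1 r2. teval (\<lambda>h r0. \<beta> t (act NR (antipode_inv H h) r1) * \<beta> t' r0) (coact NR r2)) (bcomult NR q)"
      unfolding v(2) comult_pair_right(1)[OF c(1,2) v(1)] .
  qed
  moreover have "\<beta> t (r \<otimes>\<^bsub>NR\<^esub> r') = teval (\<lambda>t1 t2. \<beta> t2 r * \<beta> t1 r') (bcomult NT t)"
    if c: "t \<in> carrier NT" "r \<in> carrier NR" "r' \<in> carrier NR" for t r r'
  proof (rule linear_eq_on_span[where f = "\<lambda>t. \<beta> t (r \<otimes>\<^bsub>NR\<^esub> r')", OF _ comult_pair_left(2)[OF c(2,3) lists.Nil] NT.spanN NT.kN kB _ c(1)])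
    show "linear_map NT base_field (\<lambda>t. \<beta> t (r \<otimes>\<^bsub>NR\<^esub> r'))" by (rule bilinD(2)[OF \<beta> bilinD(3)[OF mR c(2,3)]])
    fix q assume "q \<in> clT ` lists JT"
    then obtain w where w: "w \<in> lists JT" "q = clT w" by auto
    have "\<beta> (clT w) (r \<otimes>\<^bsub>NR\<^esub> r') = ws z \<eta> w (\<lambda>x y. \<beta> (clT y) r * \<beta> (clT x) r')"
    proof (rule bilin_eq_on_span[OF bilin_post[OF bilinD(1)[OF \<beta>] mR] ws_bilin_param[OF w(1)] NR.spanN NR.spanN NR.kN NR.kN kB _ c(2,3)])
      show "clT w \<in> carrier NT" using w by (simp add: NT.cl_closed)
      show "bilin NR NR base_field (\<lambda>r r'. \<beta> (clT y) r * \<beta> (clT x) r')" if "x \<in> lists JT" "y \<in> lists JT" for x y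
        by (rule bilin_times; rule bilinD(1)[OF \<beta>]; simp add: NT.cl_closed that)
      fix p p' assume "p \<in> clR ` lists JR" "p' \<in> clR ` lists JR"
      then obtain v v' where v: "v \<in> lists JR" "p = clR v" "v' \<in> lists JR" "p' = clR v'" by auto
      show "\<beta> (clT w) (p \<otimes>\<^bsub>NR\<^esub> p') = ws z \<eta> w (\<lambda>x y. \<beta> (clT y) p * \<beta> (clT x) p')"
        using w v by (simp add: NR.cl_mult assms wpair_append_left) (rule wsplit_cong[OF w(1)], simp add: assms)
    qed
    then show "\<beta> q (r \<otimes>\<^bsub>NR\<^esub> r') = teval (\<lambda>t1 t2. \<beta> t2 r * \<beta> t1 r') (bcomult NT q)"
      unfolding w(2) comult_pair_left(1)[OF c(2,3) w(1)] .
  qed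
  moreover have "\<beta> \<one>\<^bsub>NT\<^esub> r = bcounit NR r" if c: "r \<in> carrier NR" for r
    by (rule linear_eq_on_span[OF bilinD(1)[OF \<beta> k_algebraD(6)[OF NT.N_alg]] NR.counit_lin NR.spanN NR.kN kB _ c])
      (auto simp: NT.one_cl NR.counit_cl assms wpair_Nil_right)
  moreover have "\<beta> t \<one>\<^bsub>NR\<^esub> = bcounit NT t" if c: "t \<in> carrier NT" for t
    by (rule linear_eq_on_span[OF bilinD(2)[OF \<beta> k_algebraD(6)[OF NR.N_alg]] NT.counit_lin NT.spanN NT.kN kB _ c])
      (auto simp: NR.one_cl NT.counit_cl assms)
  ultimately show ?thesis unfolding cond_B_def by simp
qed

text \<open>(B.3) removes the letters of the right word one by one, so it remains to pair words with
  a single letter. A left word of length at least 2 then gives 0: by (B.1) every term contains a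
  factor with a nonempty left word and the empty right word, which vanishes by (B.4).\<close>

lemma cond_B_unique:
  assumes B: "cond_B H NT NR \<beta>" and letters: "\<And>i j. i \<in> JT \<Longrightarrow> j \<in> JR \<Longrightarrow> \<beta> (clT [i]) (clR [j]) = (if s i = j then lam i else 0)"
    and w: "w \<in> lists JT" and v: "v \<in> lists JR"
  shows "\<beta> (clT w) (clR v) = wpair v w"
proof -
  note c = NT.cl_closed NR.cl_closed
  have B1: "\<beta> (clT (w @ w')) (clR v) = ws g \<chi> v (\<lambda>x y. wchar \<chi> x (- wdeg g y) * (\<beta> (clT w) (clR x) * \<beta> (clT w') (clR y)))"
    if "w \<in> lists JT" "w' \<in> lists JT" "v \<in> lists JR" for w w' v
    unfolding NT.cl_mult[OF that(1,2), symmetric] comult_pair_right(1)[OF c(1)[OF that(1)] c(1)[OF that(2)] that(3), symmetric]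
    by (rule cond_BD(1)[OF B c(1)[OF that(1)] c(1)[OF that(2)] c(2)[OF that(3)]])
  have B2: "\<beta> (clT []) (clR v) = (if v = [] then 1 else 0)" if "v \<in> lists JR" for v
    using cond_BD(2)[OF B c(2)[OF that]] that by (simp add: NR.counit_cl NT.one_cl)
  have B3: "\<beta> (clT w) (clR (v @ v')) = ws z \<eta> w (\<lambda>x y. \<beta> (clT y) (clR v) * \<beta> (clT x) (clR v'))"
    if "w \<in> lists JT" "v \<in> lists JR" "v' \<in> lists JR" for w v v'
    unfolding NR.cl_mult[OF that(2,3), symmetric] comult_pair_left(1)[OF c(2)[OF that(2)] c(2)[OF that(3)] that(1), symmetric]
    by (rule cond_BD(3)[OF B c(1)[OF that(1)] c(2)[OF that(2)] c(2)[OF that(3)]])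
  have B4: "\<beta> (clT w) (clR []) = (if w = [] then 1 else 0)" if "w \<in> lists JT" for w
    using cond_BD(4)[OF B c(1)[OF that]] that by (simp add: NT.counit_cl NR.one_cl)
  have l: "\<beta> (clT y) (clR [j]) = lp y j" if "y \<in> lists JT" "j \<in> JR" for y j
  proof (cases y rule: remdups_adj.cases)
    case 1
    then show ?thesis using that by (simp add: B2)
  next
    case (2 i)
    then show ?thesis using that by (simp add: letters)
  next
    case (3 i i' y')
    then show ?thesis using B1[of "[i]" "i' # y'" "[j]"] that by (simp add: B4)
  qed
  show ?thesis
    using v w
  proof (induction v arbitrary: w rule: list.induct)
    case Nil
    then show ?case by (simp add: B4)
  next
    case (Cons j v)
    have "\<beta> (clT w) (clR ([j] @ v)) = ws z \<eta> w (\<lambda>x y. \<beta> (clT y) (clR [j]) * \<beta> (clT x) (clR v))"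
      using Cons.prems by (intro B3) simp_all
    also have "\<dots> = ws z \<eta> w (\<lambda>x y. lp y j * wpair v x)"
      by (rule wsplit_cong[OF Cons.prems(2)]) (use Cons in \<open>simp add: l\<close>)
    finally show ?case by simp
  qed
qed

end

end

section \<open>The pairing of Nichols algebras\<close>

context diag_yd
begin

lemma tfun_degree_one:
  assumes "\<And>l. length l \<noteq> 1 \<Longrightarrow> f l = 0" "x \<in> carrier T"
  shows "tfun f (homogeneous_part M 1 x) = tfun f x"
  by (rule linear_eq_on_span[OF linear_map_comp[OF tfun_linear homogeneous_linear] tfun_linear spanT kT kspace_base_field _ assms(2)])
    (auto simp: homogeneous_bw tfun_bw assms(1) linear_map_zero[OF tfun_linear kT kspace_base_field, simplified])

lemma tfun_degree_one_NI:
  assumes "\<And>l. length l \<noteq> 1 \<Longrightarrow> f l = 0" "x \<in> NI"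
  shows "tfun f x = 0"
  using tfun_degree_one[OF assms(1) NI_T[OF assms(2)]] NI_hom1[OF assms(2)]
  by (simp add: linear_map_zero[OF tfun_linear kT kspace_base_field, simplified])

text \<open>Contracts the second factor of the coproduct with a linear form. For \<open>f\<close>
  supported on single letters this is a skew derivation that removes one letter;
  \<open>deriv_left\<close> contracts the first factor and rescales what remains by a function of
  its degree.\<close>

definition deriv_right :: "(nat list \<Rightarrow> 'k) \<Rightarrow> ('m list \<Rightarrow>\<^sub>0 'k) set \<Rightarrow> ('m list \<Rightarrow>\<^sub>0 'k) set" where
  "deriv_right f x = tlift T (\<lambda>p q. tfun f q \<odot>\<^bsub>T\<^esub> p) (bcomult TB x)"

definition deriv_left :: "(nat list \<Rightarrow> 'k) \<Rightarrow> ('g \<Rightarrow> 'k) \<Rightarrow> ('m list \<Rightarrow>\<^sub>0 'k) set \<Rightarrow> ('m list \<Rightarrow>\<^sub>0 'k) set" where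
  "deriv_left f \<psi> x = tlift T (\<lambda>p q. tfun f p \<odot>\<^bsub>T\<^esub> coact_twist \<psi> q) (bcomult TB x)"

lemma deriv_right_bilin: "bilin T T T (\<lambda>p q. tfun f q \<odot>\<^bsub>T\<^esub> p)"
  by (rule bilin_smul'[OF kT linear_map_id tfun_linear])

lemma deriv_left_bilin: "bilin T T T (\<lambda>p q. tfun f p \<odot>\<^bsub>T\<^esub> coact_twist \<psi> q)"
  by (rule bilin_smul[OF kT tfun_linear coact_twist_linear])

lemma deriv_linear: "linear_map T T (deriv_right f)" "linear_map T T (deriv_left f \<psi>)"
  unfolding deriv_right_def[abs_def] deriv_left_def[abs_def]
  by (rule linear_map_comp[OF tlift_linear[OF kT kT kT deriv_right_bilin] comult_T_linear],
      rule linear_map_comp[OF tlift_linear[OF kT kT kT deriv_left_bilin] comult_T_linear])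

lemma deriv_right_bw: "l \<in> lists J \<Longrightarrow> deriv_right f (bw l) = wsplit g \<chi> T l (\<lambda>x y. f y \<odot>\<^bsub>T\<^esub> bw x)"
  unfolding deriv_right_def comult_bw
  by (rule trans[OF linear_wsplit[OF tlift_linear[OF kT kT kT deriv_right_bilin] kTT _ pure_bw]], assumption+,
      rule wsplit_cong, assumption, simp add: tlift_tpure[OF kT kT kT deriv_right_bilin] bw_closed tfun_bw)

lemma deriv_left_bw: "l \<in> lists J \<Longrightarrow>
    deriv_left f \<psi> (bw l) = wsplit g \<chi> T l (\<lambda>x y. (f x * \<psi> (wdeg g y)) \<odot>\<^bsub>T\<^esub> bw y)"
  unfolding deriv_left_def comult_bw
  by (rule trans[OF linear_wsplit[OF tlift_linear[OF kT kT kT deriv_left_bilin] kTT _ pure_bw]], assumption+,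
      rule wsplit_cong, assumption, simp add: tlift_tpure[OF kT kT kT deriv_left_bilin] bw_closed tfun_bw
        coact_twist_bw ks_smul_smul[OF kT])

text \<open>A form supported on single letters kills \<open>NI\<close>, whose elements have no
  component in degree 1. So for each tensor occurring in the coproduct either the form vanishes or
  the remaining factor lies in \<open>NI\<close>.\<close>

lemma deriv_NI:
  assumes f: "\<And>l. length l \<noteq> 1 \<Longrightarrow> f l = 0" and x: "x \<in> NI"
  shows "deriv_right f x \<in> NI" "deriv_left f \<psi> x \<in> NI"
proof -
  have TIc: "TI NI \<subseteq> carrier (tensor T T)" by (rule TI_closed) (auto simp: NI_T)
  note sD = submoduleD[OF NI_sub kT]
  have "tlift T (\<lambda>p q. tfun f q \<odot>\<^bsub>T\<^esub> p) t \<in> NI \<and> tlift T (\<lambda>p q. tfun f p \<odot>\<^bsub>T\<^esub> coact_twist \<psi> q) t \<in> NI" if t: "t \<in> TI NI" for t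
  proof -
    obtain p q where t: "t = tpure T T p q" "p \<in> carrier T" "q \<in> carrier T" "p \<in> NI \<or> q \<in> NI" using t by (auto simp: NI_T)
    have "tfun f q \<odot>\<^bsub>T\<^esub> p \<in> NI" "tfun f p \<odot>\<^bsub>T\<^esub> coact_twist \<psi> q \<in> NI"
      using t(4) tfun_degree_one_NI[OF f] sD(2,4) coact_twist_NI t(2,3) linear_mapD(1)[OF coact_twist_linear]
      by (auto simp: ks_smul_0[OF kT])
    then show ?thesis
      by (simp add: t(1-3) tlift_tpure[OF kT kT kT deriv_right_bilin] tlift_tpure[OF kT kT kT deriv_left_bilin])
  qed
  note * = this
  show "deriv_right f x \<in> NI" unfolding deriv_right_def
    by (rule lspan_linear_submodule[OF tlift_linear[OF kT kT kT deriv_right_bilin] NI_comult[OF x] kTT kT TIc NI_sub])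
      (rule conjunct1[OF *])
  show "deriv_left f \<psi> x \<in> NI" unfolding deriv_left_def
    by (rule lspan_linear_submodule[OF tlift_linear[OF kT kT kT deriv_left_bilin] NI_comult[OF x] kTT kT TIc NI_sub])
      (rule conjunct2[OF *])
qed

lemma tfun_counit_NI: "x \<in> NI \<Longrightarrow> tfun (\<lambda>l. if l = [] then 1 else 0) x = 0"
proof -
  assume x: "x \<in> NI"
  have "tfun (\<lambda>l. if l = [] then 1 else 0) x = bcounit TB x"
    by (rule linear_eq_on_span[OF tfun_linear counit_T_linear spanT kT kspace_base_field _ NI_T[OF x]])
      (auto simp: tfun_bw counit_bw)
  then show ?thesis by (simp add: NI_counit[OF x])
qed

end

locale nichols_pairing = word_pairing z \<eta> g \<chi> \<phi> s lam + W: diag_yd K W JW u z \<eta> + V: diag_yd H V JV a g \<chi>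
  for K :: "('k::field, 'l::ab_group_add \<Rightarrow>\<^sub>0 'k) hopf" and H :: "('k, 'g::ab_group_add \<Rightarrow>\<^sub>0 'k) hopf"
    and W :: "('k, 'l \<Rightarrow>\<^sub>0 'k, 'w) ydmod" and V :: "('k, 'g \<Rightarrow>\<^sub>0 'k, 'v) ydmod"
    and JW JV :: "nat set" and u :: "nat \<Rightarrow> 'w" and a :: "nat \<Rightarrow> 'v"
    and z :: "nat \<Rightarrow> 'l" and g :: "nat \<Rightarrow> 'g"
    and \<eta> :: "nat \<Rightarrow> 'l \<Rightarrow> 'k" and \<chi> :: "nat \<Rightarrow> 'g \<Rightarrow> 'k" and \<phi> :: "'l \<Rightarrow> 'g \<Rightarrow> 'k"
    and s :: "nat \<Rightarrow> nat" and lam :: "nat \<Rightarrow> 'k"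

sublocale nichols_pairing \<subseteq> P: alg_pairing K H W.N V.N JW JV z g \<eta> \<chi> \<phi> s lam W.cl V.cl
  by (intro alg_pairing.intro word_pairing_axioms W.nichols_diag_alg V.nichols_diag_alg)

section \<open>Descent of the word pairing to the Nichols algebras\<close>

context nichols_pairing
begin

text \<open>Pairing with \<open>j # v\<close> is pairing with \<open>v\<close> after the skew
  derivation that contracts with letters over \<open>j\<close>. The derivation stays inside the
  ideal, and the empty word leaves the counit.\<close>

lemma tfun_wpair_NI_left: "x \<in> W.NI \<Longrightarrow> W.tfun (wpair v) x = 0"
proof (induction v arbitrary: x)
  case Nil
  have "wpair [] = (\<lambda>l. if l = [] then 1 else 0)" by (simp add: fun_eq_iff)
  then show ?case using W.tfun_counit_NI[OF Nil] by simp
next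
  case (Cons j v)
  let ?d = "W.deriv_right (\<lambda>y. lp y j)"
  have "W.tfun (wpair (j # v)) x = W.tfun (wpair v) (?d x)"
  proof (rule linear_eq_on_span[OF W.tfun_linear linear_map_comp[OF W.tfun_linear W.deriv_linear(1)] W.spanT W.kT
        kspace_base_field _ W.NI_T[OF Cons.prems]])
    fix t assume "t \<in> W.bw ` lists JW"
    then obtain w where w: "w \<in> lists JW" "t = W.bw w" by auto
    have "W.tfun (wpair v) (?d t) = ws z \<eta> w (\<lambda>x y. W.tfun (wpair v) (lp y j \<odot>\<^bsub>W.T\<^esub> W.bw x))"
      unfolding w(2) W.deriv_right_bw[OF w(1)]
      by (rule linear_wsplit[OF W.tfun_linear W.kT w(1)]) (simp add: W.bw_closed ks_smul[OF W.kT])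
    also have "\<dots> = ws z \<eta> w (\<lambda>x y. lp y j * wpair v x)"
      by (rule wsplit_cong[OF w(1)]) (simp add: W.bw_closed W.tfun_bw linear_mapD(3)[OF W.tfun_linear])
    finally show "W.tfun (wpair (j # v)) t = W.tfun (wpair v) (?d t)" by (simp add: w W.tfun_bw)
  qed
  also have "\<dots> = 0"
    by (rule Cons.IH[OF W.deriv_NI(1)[OF _ Cons.prems]]) (use lp_length in blast)
  finally show ?case .
qed

text \<open>The recursion of \<open>wpair\<close> runs along the other word, so the first letter of
  \<open>w\<close> is removed by \<open>wpair_append_right\<close> instead. Its coefficient depends
  on the degree of the remaining word, whence the twist in \<open>deriv_left\<close>.\<close>

lemma tfun_wpair_NI_right: "x \<in> V.NI \<Longrightarrow> V.tfun (\<lambda>v. wpair v w) x = 0"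
proof (induction w arbitrary: x)
  case Nil
  have "(\<lambda>v. wpair v []) = (\<lambda>l. if l = [] then 1 else 0)" by (simp add: fun_eq_iff wpair_Nil_right)
  then show ?case using V.tfun_counit_NI[OF Nil] by simp
next
  case (Cons i w)
  let ?f = "\<lambda>x. if x = [s i] then lam i else 0"
  let ?d = "V.deriv_left ?f (\<lambda>h. \<chi> (s i) (- h))"
  let ?t = "V.tfun (\<lambda>v. wpair v w)"
  have "V.tfun (\<lambda>v. wpair v (i # w)) x = ?t (?d x)"
  proof (rule linear_eq_on_span[OF V.tfun_linear linear_map_comp[OF V.tfun_linear V.deriv_linear(2)] V.spanT V.kT
        kspace_base_field _ V.NI_T[OF Cons.prems]])
    fix t assume "t \<in> V.bw ` lists JV"
    then obtain v where v: "v \<in> lists JV" "t = V.bw v" by auto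
    have "?t (?d t) = ws g \<chi> v (\<lambda>x y. ?t ((?f x * \<chi> (s i) (- wdeg g y)) \<odot>\<^bsub>V.T\<^esub> V.bw y))"
      unfolding v(2) V.deriv_left_bw[OF v(1)]
      by (rule linear_wsplit[OF V.tfun_linear V.kT v(1)]) (simp add: V.bw_closed ks_smul[OF V.kT])
    also have "\<dots> = ws g \<chi> v (\<lambda>x y. wchar \<chi> x (- wdeg g y) * (wpair x [i] * wpair y w))"
      by (rule wsplit_cong[OF v(1)]) (simp add: V.bw_closed V.tfun_bw linear_mapD(3)[OF V.tfun_linear] wpair_letter)
    also have "\<dots> = wpair v (i # w)" using wpair_append_right[of v "[i]" w] by simp
    finally show "V.tfun (\<lambda>v. wpair v (i # w)) t = ?t (?d t)" by (simp add: v V.tfun_bw)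
  qed
  also have "\<dots> = 0"
    by (rule Cons.IH[OF V.deriv_NI(2)[OF _ Cons.prems]]) auto
  finally show ?case .
qed

abbreviation "NW \<equiv> W.N"
abbreviation "NV \<equiv> V.N"

definition NB :: "('w list \<Rightarrow>\<^sub>0 'k) set set \<Rightarrow> ('v list \<Rightarrow>\<^sub>0 'k) set set \<Rightarrow> 'k" where
  "NB = (\<lambda>X\<in>carrier NW. \<lambda>Y\<in>carrier NV.
    W.tfun (\<lambda>w. V.tfun (\<lambda>v. wpair v w) (SOME y. y \<in> Y)) (SOME x. x \<in> X))"

lemma NB_proj:
  assumes "x \<in> carrier W.T" "y \<in> carrier V.T"
  shows "NB (W.proj x) (V.proj y) = W.tfun (\<lambda>w. V.tfun (\<lambda>v. wpair v w) y) x"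
proof -
  have "V.tfun (\<lambda>v. wpair v w) (SOME r. r \<in> V.proj y) = V.tfun (\<lambda>v. wpair v w) y" for w
    by (rule V.descend(2)[OF V.tfun_linear kspace_base_field _ assms(2)]) (simp add: tfun_wpair_NI_right)
  moreover have "W.tfun (\<lambda>w. V.tfun (\<lambda>v. wpair v w) y) (SOME r. r \<in> W.proj x) = W.tfun (\<lambda>w. V.tfun (\<lambda>v. wpair v w) y) x"
  proof (rule W.descend(2)[OF W.tfun_linear kspace_base_field ballI assms(1)])
    fix x' assume x': "x' \<in> W.NI"
    \<comment> \<open>For general \<open>y\<close> the inner form is a combination of the forms
      \<open>wpair v\<close>, to which \<open>tfun_wpair_NI_left\<close> applies; so
      \<open>y\<close> is first reduced to basis words.\<close>
    show "W.tfun (\<lambda>w. V.tfun (\<lambda>v. wpair v w) y) x' = \<zero>\<^bsub>base_field\<^esub>"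
    proof (rule linear_eq_on_span[where f = "\<lambda>y. W.tfun (\<lambda>w. V.tfun (\<lambda>v. wpair v w) y) x'",
          OF _ linear_map_const_zero[OF kspace_base_field] V.spanT V.kT kspace_base_field _ assms(2)])
      show "linear_map V.T base_field (\<lambda>y. W.tfun (\<lambda>w. V.tfun (\<lambda>v. wpair v w) y) x')"
        by (rule W.tfun_param[OF V.tfun_linear V.kT W.NI_T[OF x']])
      fix t assume "t \<in> V.bw ` lists JV"
      then obtain v where v: "v \<in> lists JV" "t = V.bw v" by auto
      have "(\<lambda>w. V.tfun (\<lambda>v. wpair v w) t) = wpair v" using v by (simp add: V.tfun_bw fun_eq_iff)
      then show "W.tfun (\<lambda>w. V.tfun (\<lambda>v. wpair v w) t) x' = \<zero>\<^bsub>base_field\<^esub>"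
        using tfun_wpair_NI_left[OF x'] by simp
    qed
  qed
  moreover have "W.proj x \<in> carrier NW" "V.proj y \<in> carrier NV"
    using assms by (simp_all add: W.carrier_N V.carrier_N)
  ultimately show ?thesis by (simp add: NB_def)
qed

lemma NB_bilin: "bilin NW NV base_field NB"
proof (rule bilinI; rule linear_mapI)
  note pW = W.proj_linear and pV = V.proj_linear
  have b: "bilin W.T V.T base_field (\<lambda>x y. W.tfun (\<lambda>w. V.tfun (\<lambda>v. wpair v w) y) x)"
    by (intro bilinI W.tfun_linear W.tfun_param V.tfun_linear V.kT)
  note l = linear_mapD(2,3)[OF bilinD(1)[OF b]] linear_mapD(2,3)[OF bilinD(2)[OF b]]
  note s = linear_mapD(2,3)[OF pW, symmetric] linear_mapD(2,3)[OF pV, symmetric]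
  fix X Y Y' c assume "X \<in> carrier NW" "Y \<in> carrier NV" "Y' \<in> carrier NV"
  then obtain x y y' where e: "x \<in> carrier W.T" "X = W.proj x" "y \<in> carrier V.T" "Y = V.proj y" "y' \<in> carrier V.T" "Y' = V.proj y'"
    by (auto simp: W.carrier_N V.carrier_N)
  then show "NB X (Y \<oplus>\<^bsub>NV\<^esub> Y') = NB X Y \<oplus>\<^bsub>base_field\<^esub> NB X Y'"
    by (simp add: s NB_proj ks_add[OF V.kT] l)
next
  note pV = V.proj_linear
  have b: "bilin W.T V.T base_field (\<lambda>x y. W.tfun (\<lambda>w. V.tfun (\<lambda>v. wpair v w) y) x)"
    by (intro bilinI W.tfun_linear W.tfun_param V.tfun_linear V.kT)
  fix X Y c assume "X \<in> carrier NW" "Y \<in> carrier NV"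
  then obtain x y where e: "x \<in> carrier W.T" "X = W.proj x" "y \<in> carrier V.T" "Y = V.proj y"
    by (auto simp: W.carrier_N V.carrier_N)
  then show "NB X (c \<odot>\<^bsub>NV\<^esub> Y) = c \<odot>\<^bsub>base_field\<^esub> NB X Y"
    by (simp add: linear_mapD(3)[OF pV, symmetric] NB_proj ks_smul[OF V.kT] linear_mapD(3)[OF bilinD(1)[OF b]])
next
  note pW = W.proj_linear
  fix Y X X' assume "Y \<in> carrier NV" "X \<in> carrier NW" "X' \<in> carrier NW"
  then obtain x x' y where e: "x \<in> carrier W.T" "X = W.proj x" "y \<in> carrier V.T" "Y = V.proj y" "x' \<in> carrier W.T" "X' = W.proj x'"
    by (auto simp: W.carrier_N V.carrier_N)
  then show "NB (X \<oplus>\<^bsub>NW\<^esub> X') Y = NB X Y \<oplus>\<^bsub>base_field\<^esub> NB X' Y"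
    by (simp add: linear_mapD(2)[OF pW, symmetric] NB_proj ks_add[OF W.kT] linear_mapD(2)[OF W.tfun_linear])
next
  note pW = W.proj_linear
  fix Y X c assume "Y \<in> carrier NV" "X \<in> carrier NW"
  then obtain x y where e: "x \<in> carrier W.T" "X = W.proj x" "y \<in> carrier V.T" "Y = V.proj y"
    by (auto simp: W.carrier_N V.carrier_N)
  then show "NB (c \<odot>\<^bsub>NW\<^esub> X) Y = c \<odot>\<^bsub>base_field\<^esub> NB X Y"
    by (simp add: linear_mapD(3)[OF pW, symmetric] NB_proj ks_smul[OF W.kT] linear_mapD(3)[OF W.tfun_linear])
qed simp_all

lemma NB_cl: "w \<in> lists JW \<Longrightarrow> v \<in> lists JV \<Longrightarrow> NB (W.cl w) (V.cl v) = wpair v w"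
  by (simp add: W.cl_def V.cl_def NB_proj W.bw_closed V.bw_closed W.tfun_bw V.tfun_bw)

lemma NB_bilinear_form: "bilinear_form NW NV NB"
  unfolding bilinear_form_iff[OF W.kN V.kN] using NB_bilin by (simp add: NB_def)

lemma NB_cond_B: "cond_B H NW NV NB"
  by (rule P.cond_B_pair[OF NB_bilin NB_cl])

lemma nichols_incl_linear: "linear_map W NW (nichols_incl K W)" "linear_map V NV (nichols_incl H V)"
proof -
  have "nichols_incl K W = (\<lambda>m. W.proj (tword W [m]))" "nichols_incl H V = (\<lambda>m. V.proj (tword V [m]))"
    by (simp_all add: nichols_incl_def W.nichols_ideal_eq V.nichols_ideal_eq W.proj_def V.proj_def fun_eq_iff)
  then show "linear_map W NW (nichols_incl K W)" "linear_map V NV (nichols_incl H V)"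
    using linear_map_comp[OF W.proj_linear tword_letter_linear[OF W.kM]]
      linear_map_comp[OF V.proj_linear tword_letter_linear[OF V.kM]] by simp_all
qed

text \<open>Existence is the form \<open>NB\<close>; for uniqueness, \<open>cond_B_unique\<close>
  fixes a competitor on words, hence on the carriers, and extensionality upgrades this to equality
  of functions.\<close>

lemma nichols_form_eq:
  assumes \<beta>: "bilin W V base_field \<beta>"
    and "\<And>i j. i \<in> JW \<Longrightarrow> j \<in> JV \<Longrightarrow> \<beta> (u i) (a j) = (if s i = j then lam i else 0)"
  shows "nichols_form K H W V \<beta> = NB"
  unfolding nichols_form_def
proof (rule the_equality)
  have "NB (nichols_incl K W w) (nichols_incl H V v) = \<beta> w v" if "w \<in> carrier W" "v \<in> carrier V" for w v
    by (rule bilin_eq_on_span[OF bilin_comp[OF NB_bilin nichols_incl_linear] \<beta> W.spanM V.spanM W.kM V.kM kspace_base_field _ that])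
      (auto simp: W.nichols_incl_b V.nichols_incl_b NB_cl assms(2) wpair_letter)
  then show "bilinear_form NW NV NB \<and> cond_B H NW NV NB \<and>
      (\<forall>w\<in>carrier W. \<forall>v\<in>carrier V. NB (nichols_incl K W w) (nichols_incl H V v) = \<beta> w v)"
    using NB_bilinear_form NB_cond_B by blast
  fix B assume B: "bilinear_form NW NV B \<and> cond_B H NW NV B \<and>
      (\<forall>w\<in>carrier W. \<forall>v\<in>carrier V. B (nichols_incl K W w) (nichols_incl H V v) = \<beta> w v)"
  then have Bb: "bilin NW NV base_field B" and Bx: "B \<in> extensional (carrier NW)" "\<And>X. X \<in> carrier NW \<Longrightarrow> B X \<in> extensional (carrier NV)"
    by (simp_all add: bilinear_form_iff[OF W.kN V.kN])
  have Bl: "B (W.cl [i]) (V.cl [j]) = (if s i = j then lam i else 0)" if "i \<in> JW" "j \<in> JV" for i j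
    using B W.bM[OF that(1)] V.bM[OF that(2)] that assms(2)[OF that] by (simp flip: W.nichols_incl_b V.nichols_incl_b)
  have e: "B X Y = NB X Y" if "X \<in> carrier NW" "Y \<in> carrier NV" for X Y
    by (rule bilin_eq_on_span[OF Bb NB_bilin W.span_cl V.span_cl W.kN V.kN kspace_base_field _ that])
      (use P.cond_B_unique[OF Bb _ Bl] B in \<open>auto simp: NB_cl\<close>)
  show "B = NB"
  proof (rule extensionalityI[OF Bx(1)])
    show "NB \<in> extensional (carrier NW)" by (simp add: NB_def)
    fix X assume X: "X \<in> carrier NW"
    show "B X = NB X"
      by (rule extensionalityI[OF Bx(2)[OF X]]) (use X e in \<open>simp_all add: NB_def\<close>)
  qed
qed

end

section \<open>Finite duals\<close>

text \<open>Translates the coefficient sums of \<open>finite_codim\<close> into spans, which are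
  easier to enlarge and to add.\<close>

lemma lspan_finite_sum:
  fixes A :: "('k::field, 'a, 'e) module_scheme"
  assumes kA: "kspace A" and B: "finite B" "B \<subseteq> carrier A"
  shows "s \<in> lspan A B \<longleftrightarrow> (\<exists>c. s = (\<Oplus>\<^bsub>A\<^esub>b\<in>B. c b \<odot>\<^bsub>A\<^esub> b))"
proof
  interpret A: module "base_field :: ('k, 'k) module" A by (rule kA)
  have cl: "(\<lambda>b. c b \<odot>\<^bsub>A\<^esub> b) \<in> B \<rightarrow> carrier A" for c using B(2) by (auto intro: ks_smul[OF kA])
  show "\<exists>c. s = (\<Oplus>\<^bsub>A\<^esub>b\<in>B. c b \<odot>\<^bsub>A\<^esub> b)" if "s \<in> lspan A B"
    using that
  proof induction
    case lspan_zero
    have "(\<Oplus>\<^bsub>A\<^esub>b\<in>B. 0 \<odot>\<^bsub>A\<^esub> b) = \<zero>\<^bsub>A\<^esub>"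
      by (rule A.add.finprod_one_eqI) (use B(2) in \<open>auto intro: ks_smul_0[OF kA]\<close>)
    then show ?case by (intro exI[of _ "\<lambda>b. 0"]) simp
  next
    case (lspan_gen x)
    have "(\<Oplus>\<^bsub>A\<^esub>b\<in>B. (if x = b then 1 else 0) \<odot>\<^bsub>A\<^esub> b) = (\<Oplus>\<^bsub>A\<^esub>b\<in>B. if x = b then b else \<zero>\<^bsub>A\<^esub>)"
      by (rule A.finsum_cong') (use B(2) in \<open>auto simp: ks_smul_one[OF kA] ks_smul_0[OF kA]\<close>)
    also have "\<dots> = x" by (rule A.finsum_singleton[OF lspan_gen B(1)]) (use B(2) in auto)
    finally show ?case by (intro exI[of _ "\<lambda>b. if x = b then 1 else 0"]) simp
  next
    case (lspan_add x y)
    then obtain c d where cd: "x = (\<Oplus>\<^bsub>A\<^esub>b\<in>B. c b \<odot>\<^bsub>A\<^esub> b)" "y = (\<Oplus>\<^bsub>A\<^esub>b\<in>B. d b \<odot>\<^bsub>A\<^esub> b)" by blast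
    have "x \<oplus>\<^bsub>A\<^esub> y = (\<Oplus>\<^bsub>A\<^esub>b\<in>B. c b \<odot>\<^bsub>A\<^esub> b \<oplus>\<^bsub>A\<^esub> d b \<odot>\<^bsub>A\<^esub> b)"
      unfolding cd by (rule A.finsum_addf[symmetric]) (rule cl)+
    also have "\<dots> = (\<Oplus>\<^bsub>A\<^esub>b\<in>B. (c b + d b) \<odot>\<^bsub>A\<^esub> b)"
      by (rule A.finsum_cong') (use B(2) in \<open>auto simp: ks_smul_ladd[OF kA] ks_smul[OF kA]\<close>)
    finally show ?case by (rule exI[of _ "\<lambda>b. c b + d b"])
  next
    case (lspan_smul x c)
    then obtain d where d: "x = (\<Oplus>\<^bsub>A\<^esub>b\<in>B. d b \<odot>\<^bsub>A\<^esub> b)" by blast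
    have "c \<odot>\<^bsub>A\<^esub> x = (\<Oplus>\<^bsub>A\<^esub>b\<in>B. c \<odot>\<^bsub>A\<^esub> (d b \<odot>\<^bsub>A\<^esub> b))"
      unfolding d by (rule A.finsum_smult_ldistr) (use B(1) cl in auto)
    also have "\<dots> = (\<Oplus>\<^bsub>A\<^esub>b\<in>B. (c * d b) \<odot>\<^bsub>A\<^esub> b)"
      by (rule A.finsum_cong') (use B(2) in \<open>auto simp: ks_smul_smul[OF kA] ks_smul[OF kA]\<close>)
    finally show ?case by (rule exI[of _ "\<lambda>b. c * d b"])
  qed
  show "s \<in> lspan A B" if "\<exists>c. s = (\<Oplus>\<^bsub>A\<^esub>b\<in>B. c b \<odot>\<^bsub>A\<^esub> b)"
    using that by (auto intro!: lspan_finsum[OF kA B(2)] lspan_smul intro: lspan_gen)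
qed

text \<open>Finite codimension relative to a subspace \<open>X\<close>, with representatives taken
  from \<open>X\<close> itself. The relative form allows intersections to be handled in two
  stages.\<close>

definition cofinite_in :: "('k::field, 'a, 'e) module_scheme \<Rightarrow> 'a set \<Rightarrow> 'a set \<Rightarrow> bool" where
  "cofinite_in A X I \<longleftrightarrow> (\<exists>B. finite B \<and> B \<subseteq> X \<and> (\<forall>x\<in>X. \<exists>s\<in>lspan A B. x \<ominus>\<^bsub>A\<^esub> s \<in> I))"

lemma finite_codim_iff:
  assumes "kspace A" shows "finite_codim A I \<longleftrightarrow> cofinite_in A (carrier A) I"
proof -
  have "(\<exists>c. x \<ominus>\<^bsub>A\<^esub> (\<Oplus>\<^bsub>A\<^esub>b\<in>B. c b \<odot>\<^bsub>A\<^esub> b) \<in> I) \<longleftrightarrow> (\<exists>s\<in>lspan A B. x \<ominus>\<^bsub>A\<^esub> s \<in> I)"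
    if "finite B" "B \<subseteq> carrier A" for B x
    using lspan_finite_sum[OF assms that] by auto
  then show ?thesis unfolding finite_codim_def cofinite_in_def by (intro ex_cong1) auto
qed

lemma cofiniteI:
  "finite B \<Longrightarrow> B \<subseteq> X \<Longrightarrow> (\<And>x. x \<in> X \<Longrightarrow> \<exists>s\<in>lspan A B. x \<ominus>\<^bsub>A\<^esub> s \<in> I) \<Longrightarrow> cofinite_in A X I"
  by (auto simp: cofinite_in_def)

lemma cofiniteE:
  assumes "cofinite_in A X I"
  obtains B where "finite B" "B \<subseteq> X" "\<forall>x\<in>X. \<exists>s\<in>lspan A B. x \<ominus>\<^bsub>A\<^esub> s \<in> I"
  using assms by (auto simp: cofinite_in_def)

lemma cofinite_mono: "cofinite_in A X I \<Longrightarrow> I \<subseteq> I' \<Longrightarrow> cofinite_in A X I'"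
  unfolding cofinite_in_def by (meson subsetD)

section \<open>Intersections and kernels of finite codimension\<close>

context
  fixes A :: "('k::field, 'a, 'e) module_scheme"
  assumes kA: "kspace A"
begin

lemma submodule_Int:
  assumes "submodule I (base_field :: ('k, 'k) module) A" "submodule J (base_field :: ('k, 'k) module) A"
  shows "submodule (I \<inter> J) (base_field :: ('k, 'k) module) A"
  by (rule submoduleI'[OF kA]) (use submoduleD[OF assms(1) kA] submoduleD[OF assms(2) kA] in auto)

lemma submodule_add_line:
  assumes J: "submodule J (base_field :: ('k, 'k) module) A" and c: "c \<in> carrier A"
  shows "submodule {j \<oplus>\<^bsub>A\<^esub> d \<odot>\<^bsub>A\<^esub> c | j d. j \<in> J} (base_field :: ('k, 'k) module) A" (is "submodule ?J _ A")
proof (rule submoduleI'[OF kA])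
  note D = submoduleD[OF J kA]
  have JA: "j \<in> carrier A" if "j \<in> J" for j using D(1) that by auto
  show "?J \<subseteq> carrier A" using c by (auto simp: ks_add[OF kA] ks_smul[OF kA] JA)
  have "\<zero>\<^bsub>A\<^esub> = \<zero>\<^bsub>A\<^esub> \<oplus>\<^bsub>A\<^esub> 0 \<odot>\<^bsub>A\<^esub> c" using c by (simp add: ks_simps kA)
  then show "\<zero>\<^bsub>A\<^esub> \<in> ?J" using D(2) by blast
  fix x y assume "x \<in> ?J" "y \<in> ?J"
  then obtain j d j' d' where e: "x = j \<oplus>\<^bsub>A\<^esub> d \<odot>\<^bsub>A\<^esub> c" "j \<in> J" "y = j' \<oplus>\<^bsub>A\<^esub> d' \<odot>\<^bsub>A\<^esub> c" "j' \<in> J" by blast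
  have "x \<oplus>\<^bsub>A\<^esub> y = (j \<oplus>\<^bsub>A\<^esub> j') \<oplus>\<^bsub>A\<^esub> (d + d') \<odot>\<^bsub>A\<^esub> c"
    using e(2,4) c by (simp add: e(1,3) ks_smul_ladd[OF kA] ks_add_assoc[OF kA] ks_add_lcomm[OF kA] ks_add[OF kA] ks_smul[OF kA] JA)
  then show "x \<oplus>\<^bsub>A\<^esub> y \<in> ?J" using D(3)[OF e(2,4)] by blast
next
  note D = submoduleD[OF J kA]
  fix c' x assume "x \<in> ?J"
  then obtain j d where e: "x = j \<oplus>\<^bsub>A\<^esub> d \<odot>\<^bsub>A\<^esub> c" "j \<in> J" by blast
  have "j \<in> carrier A" using D(1) e(2) by auto
  then have "c' \<odot>\<^bsub>A\<^esub> x = c' \<odot>\<^bsub>A\<^esub> j \<oplus>\<^bsub>A\<^esub> (c' * d) \<odot>\<^bsub>A\<^esub> c"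
    using c by (simp add: e(1) ks_smul_radd[OF kA] ks_smul_smul[OF kA] ks_smul[OF kA])
  then show "c' \<odot>\<^bsub>A\<^esub> x \<in> ?J" using D(4)[OF e(2)] by blast
qed

lemma lspan_insertD:
  assumes c: "c \<in> carrier A" "C \<subseteq> carrier A" and s: "s \<in> lspan A (insert c C)"
  shows "\<exists>t d. t \<in> lspan A C \<and> s = t \<oplus>\<^bsub>A\<^esub> d \<odot>\<^bsub>A\<^esub> c"
proof -
  let ?J = "{j \<oplus>\<^bsub>A\<^esub> d \<odot>\<^bsub>A\<^esub> c | j d. j \<in> lspan A C}"
  note sub = submodule_add_line[OF lspan_submodule[OF kA c(2)] c(1)]
  have "x \<in> ?J" if "x \<in> insert c C" for x
  proof (cases "x = c")
    case True
    then have "x = \<zero>\<^bsub>A\<^esub> \<oplus>\<^bsub>A\<^esub> 1 \<odot>\<^bsub>A\<^esub> c" using c by (simp add: ks_simps kA)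
    then show ?thesis using lspan_zero[of A C] by blast
  next
    case False
    then have xC: "x \<in> C" using that by simp
    then have "x = x \<oplus>\<^bsub>A\<^esub> 0 \<odot>\<^bsub>A\<^esub> c" using c by (auto simp: ks_simps kA subset_iff)
    then show ?thesis using lspan_gen[OF xC, of A] by blast
  qed
  then have "lspan A (insert c C) \<subseteq> ?J" by (intro lspan_minimal[OF sub kA]) auto
  then show ?thesis using s by blast
qed

text \<open>Induction on a finite set that spans the space modulo \<open>J\<close>. Dropping one
  spanning vector \<open>c\<close> enlarges \<open>J\<close> to \<open>J\<close> + k
  \<open>c\<close>. Passing back to \<open>J\<close> costs at most one further representative: an
  element of \<open>I\<close> that lies in the enlarged space but not in \<open>J\<close>, if there
  is one.\<close>

lemma cofinite_Int_relative:
  assumes "finite C" "C \<subseteq> carrier A" "submodule I (base_field :: ('k, 'k) module) A" "submodule J (base_field :: ('k, 'k) module) A"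
    and "\<forall>x\<in>carrier A. \<exists>s\<in>lspan A C. x \<ominus>\<^bsub>A\<^esub> s \<in> J"
  shows "cofinite_in A I (I \<inter> J)"
  using assms(1,2,4,5)
proof (induction C arbitrary: J rule: finite_induct)
  case empty
  \<comment> \<open>With no spanning vectors left, \<open>J\<close> is the whole space.\<close>
  have "s = \<zero>\<^bsub>A\<^esub>" if "s \<in> lspan A {}" for s
    using that by induction (simp_all add: ks_simps kA)
  then have "x \<in> J" if "x \<in> carrier A" for x
    using empty.prems(3) that by (force simp: ks_minus_eq[OF kA] ks_simps kA)
  then show ?case
    using submoduleD(1)[OF assms(3) kA]
    by (intro cofiniteI[of "{}"]) (auto intro!: bexI[OF _ lspan_zero] simp: ks_minus_eq[OF kA] ks_simps kA subset_iff)
next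
  case (insert c C)
  note DI = submoduleD[OF assms(3) kA] and DJ = submoduleD[OF insert.prems(2) kA]
  have IA: "i \<in> carrier A" if "i \<in> I" for i using DI(1) that by auto
  have JA: "i \<in> carrier A" if "i \<in> J" for i using DJ(1) that by auto
  have c: "c \<in> carrier A" "C \<subseteq> carrier A" using insert.prems(1) by auto
  define J' where "J' = {j \<oplus>\<^bsub>A\<^esub> d \<odot>\<^bsub>A\<^esub> c | j d. j \<in> J}"
  have J'I: "j \<oplus>\<^bsub>A\<^esub> d \<odot>\<^bsub>A\<^esub> c \<in> J'" if "j \<in> J" for j d using that by (auto simp: J'_def)
  have J'E: "\<exists>j d. x = j \<oplus>\<^bsub>A\<^esub> d \<odot>\<^bsub>A\<^esub> c \<and> j \<in> J" if "x \<in> J'" for x using that by (auto simp: J'_def)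
  have J': "\<forall>x\<in>carrier A. \<exists>s\<in>lspan A C. x \<ominus>\<^bsub>A\<^esub> s \<in> J'"
  proof
    fix x assume x: "x \<in> carrier A"
    show "\<exists>s\<in>lspan A C. x \<ominus>\<^bsub>A\<^esub> s \<in> J'"
  proof -
    obtain s where s: "s \<in> lspan A (insert c C)" "x \<ominus>\<^bsub>A\<^esub> s \<in> J" using insert.prems(3) x by blast
    obtain t d where t: "t \<in> lspan A C" "s = t \<oplus>\<^bsub>A\<^esub> d \<odot>\<^bsub>A\<^esub> c" using lspan_insertD[OF c s(1)] by blast
    have tA: "t \<in> carrier A" by (rule lspan_closed[OF kA c(2) t(1)])
    have "x \<ominus>\<^bsub>A\<^esub> t = (x \<ominus>\<^bsub>A\<^esub> s) \<oplus>\<^bsub>A\<^esub> d \<odot>\<^bsub>A\<^esub> c"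
      using x tA c(1) ks_cancel2[OF kA ks_smul[OF kA c(1)], of d]
      by (simp add: t(2) ks_minus_eq[OF kA] ks_smul_radd[OF kA] ks_smul[OF kA] ks_add[OF kA] ks_add_assoc[OF kA] ks_smul_smul[OF kA]
          ks_add_comm[OF kA, of "(- d) \<odot>\<^bsub>A\<^esub> c" "d \<odot>\<^bsub>A\<^esub> c"] ks_add_zero[OF kA])
    then show ?thesis using t(1) J'I[OF s(2), of d] by (intro bexI[of _ t]) simp_all
  qed
  qed
  have cof: "cofinite_in A I (I \<inter> J')"
    by (rule insert.IH[OF c(2) _ J']) (unfold J'_def, rule submodule_add_line[OF insert.prems(2) c(1)])
  then obtain B where B: "finite B" "B \<subseteq> I" "\<forall>x\<in>I. \<exists>s\<in>lspan A B. x \<ominus>\<^bsub>A\<^esub> s \<in> I \<inter> J'"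
    by (rule cofiniteE)
  have BA: "B \<subseteq> carrier A" using B(2) IA by auto
  show ?case
  proof (cases "I \<inter> J' \<subseteq> J")
    case True
    then have "I \<inter> J' \<subseteq> I \<inter> J" by auto
    then show ?thesis by (rule cofinite_mono[OF cof])
  next
    case False
    then obtain i0 where "i0 \<in> I" "i0 \<notin> J" "i0 \<in> J'" by auto
    then obtain j0 d where i0: "i0 \<in> I" "i0 \<notin> J" "i0 = j0 \<oplus>\<^bsub>A\<^esub> d \<odot>\<^bsub>A\<^esub> c" "j0 \<in> J" using J'E[of i0] by auto
    have d: "d \<noteq> 0"
    proof
      assume "d = 0"
      then have "i0 = j0" using i0 c JA by (simp add: ks_simps kA)
      then show False using i0 by simp
    qed
    have "\<exists>s\<in>lspan A (insert i0 B). x \<ominus>\<^bsub>A\<^esub> s \<in> I \<inter> J" if x: "x \<in> I" for x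
    proof -
      obtain s where "s \<in> lspan A B" "x \<ominus>\<^bsub>A\<^esub> s \<in> I \<inter> J'" using bspec[OF B(3) x] by auto
      then obtain j e where s: "s \<in> lspan A B" "x \<ominus>\<^bsub>A\<^esub> s \<in> I" "x \<ominus>\<^bsub>A\<^esub> s = j \<oplus>\<^bsub>A\<^esub> e \<odot>\<^bsub>A\<^esub> c" "j \<in> J"
        using J'E[of "x \<ominus>\<^bsub>A\<^esub> s"] by auto
      have sA: "s \<in> carrier A" by (rule lspan_closed[OF kA BA s(1)])
      \<comment> \<open>The multiple of \<open>i0\<close> is chosen to cancel the multiple
        \<open>e\<close> of \<open>c\<close>; division by \<open>d\<close> is possible because
        \<open>i0\<close> lies outside \<open>J\<close>.\<close>
      let ?s = "s \<oplus>\<^bsub>A\<^esub> (e / d) \<odot>\<^bsub>A\<^esub> i0"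
      have "s \<in> lspan A (insert i0 B)" by (rule lspan_mono[OF s(1)]) (simp add: lspan_gen)
      then have "?s \<in> lspan A (insert i0 B)"
        by (rule lspan_add) (rule lspan_smul, rule lspan_gen, simp)
      moreover have 1: "x \<ominus>\<^bsub>A\<^esub> ?s = (x \<ominus>\<^bsub>A\<^esub> s) \<oplus>\<^bsub>A\<^esub> (- (e / d)) \<odot>\<^bsub>A\<^esub> i0"
        using IA[OF x] sA IA[OF i0(1)]
        by (simp add: ks_minus_eq[OF kA] ks_smul_radd[OF kA] ks_smul[OF kA] ks_add[OF kA] ks_add_assoc[OF kA] ks_smul_smul[OF kA])
      moreover have "(x \<ominus>\<^bsub>A\<^esub> s) \<oplus>\<^bsub>A\<^esub> (- (e / d)) \<odot>\<^bsub>A\<^esub> i0 \<in> I"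
        using s(2) i0(1) DI(3,4) by blast
      moreover have "(x \<ominus>\<^bsub>A\<^esub> s) \<oplus>\<^bsub>A\<^esub> (- (e / d)) \<odot>\<^bsub>A\<^esub> i0 = j \<oplus>\<^bsub>A\<^esub> (- (e / d)) \<odot>\<^bsub>A\<^esub> j0"
      proof -
        have "(x \<ominus>\<^bsub>A\<^esub> s) \<oplus>\<^bsub>A\<^esub> (- (e / d)) \<odot>\<^bsub>A\<^esub> i0
          = (j \<oplus>\<^bsub>A\<^esub> (- (e / d)) \<odot>\<^bsub>A\<^esub> j0) \<oplus>\<^bsub>A\<^esub> (e + - (e / d) * d) \<odot>\<^bsub>A\<^esub> c"
          unfolding s(3) unfolding i0(3) ks_smul_ladd[OF kA c(1)]
          using JA[OF s(4)] JA[OF i0(4)] c(1)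
          by (simp add: ks_smul_radd[OF kA] ks_smul[OF kA] ks_add[OF kA] ks_add_assoc[OF kA] ks_add_lcomm[OF kA] ks_smul_smul[OF kA])
        also have "e + - (e / d) * d = 0" using d by simp
        finally show ?thesis using JA[OF s(4)] JA[OF i0(4)] c(1) by (simp add: ks_simps kA)
      qed
      moreover have "j \<oplus>\<^bsub>A\<^esub> (- (e / d)) \<odot>\<^bsub>A\<^esub> j0 \<in> J" using s(4) i0(4) DJ(3,4) by blast
      ultimately show ?thesis by (intro bexI[of _ ?s]) simp_all
    qed
    then show ?thesis using B(1,2) i0(1) by (intro cofiniteI[of "insert i0 B"]) simp_all
  qed
qed

text \<open>Representatives of the space modulo \<open>I\<close>, together with representatives of
  \<open>I\<close> modulo the intersection, suffice.\<close>

lemma cofinite_Int: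
  assumes "submodule I (base_field :: ('k, 'k) module) A" "submodule J (base_field :: ('k, 'k) module) A"
    and "cofinite_in A (carrier A) I" "cofinite_in A (carrier A) J"
  shows "cofinite_in A (carrier A) (I \<inter> J)"
proof -
  obtain C where C: "finite C" "C \<subseteq> carrier A" "\<forall>x\<in>carrier A. \<exists>s\<in>lspan A C. x \<ominus>\<^bsub>A\<^esub> s \<in> J"
    by (rule cofiniteE[OF assms(4)])
  obtain B where B: "finite B" "B \<subseteq> I" "\<forall>x\<in>I. \<exists>s\<in>lspan A B. x \<ominus>\<^bsub>A\<^esub> s \<in> I \<inter> J"
    by (rule cofiniteE[OF cofinite_Int_relative[OF C(1,2) assms(1,2) C(3)]])
  obtain B' where B': "finite B'" "B' \<subseteq> carrier A" "\<forall>x\<in>carrier A. \<exists>s\<in>lspan A B'. x \<ominus>\<^bsub>A\<^esub> s \<in> I"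
    by (rule cofiniteE[OF assms(3)])
  have BA: "B \<subseteq> carrier A" using B(2) submoduleD(1)[OF assms(1) kA] by auto
  have "\<exists>s\<in>lspan A (B \<union> B'). x \<ominus>\<^bsub>A\<^esub> s \<in> I \<inter> J" if x: "x \<in> carrier A" for x
  proof -
    obtain s where s: "s \<in> lspan A B'" "x \<ominus>\<^bsub>A\<^esub> s \<in> I" using bspec[OF B'(3) x] by (rule bexE)
    obtain t where t: "t \<in> lspan A B" "(x \<ominus>\<^bsub>A\<^esub> s) \<ominus>\<^bsub>A\<^esub> t \<in> I \<inter> J" using bspec[OF B(3) s(2)] by (rule bexE)
    have c: "s \<in> carrier A" "t \<in> carrier A" using lspan_closed[OF kA B'(2) s(1)] lspan_closed[OF kA BA t(1)] by auto
    have "x \<ominus>\<^bsub>A\<^esub> (s \<oplus>\<^bsub>A\<^esub> t) = (x \<ominus>\<^bsub>A\<^esub> s) \<ominus>\<^bsub>A\<^esub> t"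
      using x c by (simp add: ks_minus_eq[OF kA] ks_smul_radd[OF kA] ks_smul[OF kA] ks_add[OF kA] ks_add_assoc[OF kA])
    moreover have "s \<oplus>\<^bsub>A\<^esub> t \<in> lspan A (B \<union> B')"
      by (rule lspan_add; rule lspan_mono[OF s(1)] lspan_mono[OF t(1)]) (simp_all add: lspan_gen)
    ultimately show ?thesis using t(2) by (intro bexI[of _ "s \<oplus>\<^bsub>A\<^esub> t"]) simp_all
  qed
  then show ?thesis using B(1) B'(1,2) BA by (intro cofiniteI[of "B \<union> B'"]) simp_all
qed

lemma kernel_submodule:
  assumes "linear_map A base_field f"
  shows "submodule {x \<in> carrier A. f x = 0} (base_field :: ('k, 'k) module) A"
  by (rule submoduleI'[OF kA])
    (use linear_mapD[OF assms] linear_map_zero[OF assms kA kspace_base_field] in \<open>auto simp: ks_simps kA\<close>)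

text \<open>Any one vector on which the form does not vanish spans the space modulo the
  kernel.\<close>

lemma cofinite_kernel:
  assumes f: "linear_map A base_field f"
  shows "cofinite_in A (carrier A) {x \<in> carrier A. f x = 0}"
proof (cases "\<exists>n\<in>carrier A. f n \<noteq> 0")
  case True
  then obtain n where n: "n \<in> carrier A" "f n \<noteq> 0" by blast
  have "x \<ominus>\<^bsub>A\<^esub> (f x / f n) \<odot>\<^bsub>A\<^esub> n \<in> {x \<in> carrier A. f x = 0}" if x: "x \<in> carrier A" for x
    using x n linear_map_minus[OF f kA kspace_base_field x ks_smul[OF kA n(1)], of "f x / f n"]
    by (simp add: linear_mapD(3)[OF f] ks_minus[OF kA] ks_smul[OF kA] ks_minus_eq[OF kspace_base_field])
  then show ?thesis using n(1)
    by (intro cofiniteI[of "{n}"]) (simp_all, blast intro: lspan_smul lspan_gen)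
next
  case False
  then show ?thesis
    by (intro cofiniteI[of "{}"]) (auto intro!: bexI[OF _ lspan_zero] simp: ks_minus_eq[OF kA] ks_simps kA)
qed

lemma cofinite_kernels:
  assumes "finite F" "\<And>f. f \<in> F \<Longrightarrow> linear_map A base_field f"
  shows "cofinite_in A (carrier A) {x \<in> carrier A. \<forall>f\<in>F. f x = 0}"
    and "submodule {x \<in> carrier A. \<forall>f\<in>F. f x = 0} (base_field :: ('k, 'k) module) A"
proof -
  have "cofinite_in A (carrier A) {x \<in> carrier A. \<forall>f\<in>F. f x = 0} \<and>
    submodule {x \<in> carrier A. \<forall>f\<in>F. f x = 0} (base_field :: ('k, 'k) module) A"
    using assms
  proof (induction F rule: finite_induct)
    case empty
    then show ?case
      using cofinite_kernel[OF linear_map_const_zero[OF kspace_base_field]]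
        kernel_submodule[OF linear_map_const_zero[OF kspace_base_field]] by simp
  next
    case (insert f F)
    have "{x \<in> carrier A. \<forall>f\<in>insert f F. f x = 0} = {x \<in> carrier A. \<forall>f\<in>F. f x = 0} \<inter> {x \<in> carrier A. f x = 0}" by auto
    then show ?case
      using insert cofinite_Int[OF _ kernel_submodule _ cofinite_kernel] submodule_Int[OF _ kernel_submodule] by auto
  qed
  then show "cofinite_in A (carrier A) {x \<in> carrier A. \<forall>f\<in>F. f x = 0}"
    "submodule {x \<in> carrier A. \<forall>f\<in>F. f x = 0} (base_field :: ('k, 'k) module) A" by blast+
qed

end

lemma finite_dual_algebra_simps:
  "carrier (finite_dual_algebra A) = {p \<in> carrier (dual A). \<exists>I. ideal I A \<and> finite_codim A I \<and> (\<forall>x\<in>I. p x = 0)}"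
  "mult (finite_dual_algebra A) = convolution A" "one (finite_dual_algebra A) = (\<lambda>x\<in>carrier A. counit A x)"
  "zero (finite_dual_algebra A) = zero (dual A)" "add (finite_dual_algebra A) = add (dual A)"
  "smult (finite_dual_algebra A) = smult (dual A)"
  by (simp_all add: finite_dual_algebra_def)

lemma finite_dual_simps:
  "carrier (finite_dual A) = carrier (finite_dual_algebra A)" "mult (finite_dual A) = convolution A"
  "one (finite_dual A) = (\<lambda>x\<in>carrier A. counit A x)" "zero (finite_dual A) = zero (finite_dual_algebra A)"
  "add (finite_dual A) = add (finite_dual_algebra A)" "smult (finite_dual A) = smult (finite_dual_algebra A)"
  "counit (finite_dual A) p = p \<one>\<^bsub>A\<^esub>"
  "comult (finite_dual A) p = (THE t. t \<in> carrier (tensor (finite_dual_algebra A) (finite_dual_algebra A)) \<and>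
        (\<forall>x\<in>carrier A. \<forall>y\<in>carrier A. teval (\<lambda>p1 p2. p1 x * p2 y) t = p (x \<otimes>\<^bsub>A\<^esub> y)))"
  by (simp_all add: finite_dual_def Let_def module.defs bialg.defs finite_dual_algebra_simps)

lemma cop_simps:
  "carrier (cop A) = carrier A" "mult (cop A) = mult A" "one (cop A) = one A" "zero (cop A) = zero A"
  "add (cop A) = add A" "smult (cop A) = smult A" "counit (cop A) = counit A"
  "comult (cop A) x = tlift (tensor A A) (\<lambda>a b. tpure A A b a) (comult A x)"
  by (simp_all add: cop_def)

section \<open>The finite dual and its coproduct\<close>

context
  fixes A :: "('k::field, 'a) bialg"
  assumes A: "k_algebra A"
begin

abbreviation (input) "FD \<equiv> finite_dual_algebra A"

lemmas kA' = k_algebraD(1)[OF A]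

text \<open>The nontrivial closure property is that under sums: forms that vanish on
  \<open>I\<close> and on \<open>J\<close> are both controlled by the intersection, which again has
  finite codimension.\<close>

lemma finite_dual_submodule: "submodule (carrier FD) (base_field :: ('k, 'k) module) (dual A)"
proof (rule submoduleI'[OF kspace_dual[OF kA']])
  note kD = kspace_dual[OF kA']
  interpret ring A by (rule k_algebraD(2)[OF A])
  show "carrier FD \<subseteq> carrier (dual A)" by (auto simp: finite_dual_algebra_simps)
  have I: "ideal (carrier A) A" by (rule oneideal)
  have "finite_codim A (carrier A)"
    unfolding finite_codim_iff[OF kA']
    by (intro cofiniteI[of "{}"]) (auto intro!: bexI[OF _ lspan_zero])
  then show "\<zero>\<^bsub>dual A\<^esub> \<in> carrier FD"
    using I ks_zero[OF kD] by (auto simp: finite_dual_algebra_simps) (auto simp: dual_simps)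
  fix p q assume "p \<in> carrier FD" "q \<in> carrier FD"
  then obtain I J where IJ: "p \<in> carrier (dual A)" "ideal I A" "finite_codim A I" "\<forall>x\<in>I. p x = 0"
    "q \<in> carrier (dual A)" "ideal J A" "finite_codim A J" "\<forall>x\<in>J. q x = 0"
    by (auto simp: finite_dual_algebra_simps)
  have "ideal (I \<inter> J) A" by (rule i_intersect[OF IJ(2,6)])
  moreover have "finite_codim A (I \<inter> J)"
    using cofinite_Int[OF kA' ideal_submodule[OF A IJ(2)] ideal_submodule[OF A IJ(6)]] IJ(3,7)
    by (simp add: finite_codim_iff[OF kA'])
  moreover have "\<forall>x\<in>I \<inter> J. (p \<oplus>\<^bsub>dual A\<^esub> q) x = 0"
    using IJ(4,8) ideal.Icarr[OF IJ(2)] by (auto simp: dual_simps)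
  ultimately show "p \<oplus>\<^bsub>dual A\<^esub> q \<in> carrier FD"
    using ks_add[OF kD IJ(1,5)] by (auto simp: finite_dual_algebra_simps)
next
  note kD = kspace_dual[OF kA']
  fix c p assume "p \<in> carrier FD"
  then obtain I where I: "p \<in> carrier (dual A)" "ideal I A" "finite_codim A I" "\<forall>x\<in>I. p x = 0"
    by (auto simp: finite_dual_algebra_simps)
  have "\<forall>x\<in>I. (c \<odot>\<^bsub>dual A\<^esub> p) x = 0" using I(4) ideal.Icarr[OF I(2)] by (auto simp: dual_simps)
  then show "c \<odot>\<^bsub>dual A\<^esub> p \<in> carrier FD"
    using I ks_smul[OF kD I(1)] by (auto simp: finite_dual_algebra_simps)
qed

lemma kspace_finite_dual: "kspace FD"
proof (rule kspace_same)
  show "kspace ((dual A)\<lparr>carrier := carrier FD\<rparr>)"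
    by (rule submodule.submodule_is_module[OF finite_dual_submodule kspace_dual[OF kA']])
  show "same_space ((dual A)\<lparr>carrier := carrier FD\<rparr>) FD"
    by (simp add: same_space_def finite_dual_algebra_simps)
qed

lemma FD_simps:
  "p \<in> carrier FD \<Longrightarrow> linear_map A base_field p" "p \<in> carrier FD \<Longrightarrow> p \<in> extensional (carrier A)"
  "x \<in> carrier A \<Longrightarrow> (p \<oplus>\<^bsub>FD\<^esub> q) x = p x + q x" "x \<in> carrier A \<Longrightarrow> (c \<odot>\<^bsub>FD\<^esub> p) x = c * p x"
  "x \<in> carrier A \<Longrightarrow> \<zero>\<^bsub>FD\<^esub> x = 0"
  by (simp_all add: finite_dual_algebra_simps dual_simps)

lemma FD_eqI: "p \<in> carrier FD \<Longrightarrow> q \<in> carrier FD \<Longrightarrow> (\<And>x. x \<in> carrier A \<Longrightarrow> p x = q x) \<Longrightarrow> p = q"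
  by (rule extensionalityI[of _ "carrier A"]) (auto simp: FD_simps)

lemma FD_eval_bilin:
  assumes "x \<in> carrier A" "y \<in> carrier A"
  shows "bilin FD FD base_field (\<lambda>p q. p x * q y)"
  by (rule bilin_times; rule linear_mapI) (simp_all add: FD_simps assms)

text \<open>Sums of pure tensors are indexed by lists because the length of the list is the
  induction parameter of \<open>tsum_eq_zero\<close>.\<close>

primrec tsum :: "(('a \<Rightarrow> 'k) \<times> ('a \<Rightarrow> 'k)) list \<Rightarrow> ('k, 'a \<Rightarrow> 'k, 'a \<Rightarrow> 'k) tens" where
  "tsum [] = \<zero>\<^bsub>tensor FD FD\<^esub>"
| "tsum (a # ps) = tpure FD FD (fst a) (snd a) \<oplus>\<^bsub>tensor FD FD\<^esub> tsum ps"

lemmas kDD = kspace_tensor[OF kspace_finite_dual kspace_finite_dual]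
lemmas pDD = tpure_bilin[OF kspace_finite_dual kspace_finite_dual]

lemma tsum_closed: "set ps \<subseteq> carrier FD \<times> carrier FD \<Longrightarrow> tsum ps \<in> carrier (tensor FD FD)"
  by (induction ps) (auto intro!: ks_zero[OF kDD] ks_add[OF kDD] bilinD(3)[OF pDD])

lemma tsum_append:
  "set ps \<subseteq> carrier FD \<times> carrier FD \<Longrightarrow> set qs \<subseteq> carrier FD \<times> carrier FD \<Longrightarrow>
    tsum (ps @ qs) = tsum ps \<oplus>\<^bsub>tensor FD FD\<^esub> tsum qs"
  by (induction ps) (auto simp: ks_zero_add[OF kDD] ks_add_assoc[OF kDD] tsum_closed bilinD(3)[OF pDD])

lemma tsum_smul:
  "set ps \<subseteq> carrier FD \<times> carrier FD \<Longrightarrow> tsum (map (\<lambda>a. (c \<odot>\<^bsub>FD\<^esub> fst a, snd a)) ps) = c \<odot>\<^bsub>tensor FD FD\<^esub> tsum ps"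
  by (induction ps) (auto simp: ks_smul_zero[OF kDD] ks_smul_radd[OF kDD] tsum_closed linear_mapD(3)[OF bilinD(2)[OF pDD]]
      bilinD(3)[OF pDD])

lemma tensor_tsum:
  assumes "t \<in> carrier (tensor FD FD)"
  shows "\<exists>ps. set ps \<subseteq> carrier FD \<times> carrier FD \<and> t = tsum ps"
proof (rule spans_induct[where P = "\<lambda>t. \<exists>ps. set ps \<subseteq> carrier FD \<times> carrier FD \<and> t = tsum ps",
      OF assms spans_tensor_pure[OF kspace_finite_dual kspace_finite_dual] kDD], goal_cases)
  case 1
  then show ?case by (intro exI[of _ "[]"]) simp
next
  case (2 s)
  then obtain p where p: "p \<in> carrier FD \<times> carrier FD" "s = tpure FD FD (fst p) (snd p)" by blast
  have "s \<in> carrier (tensor FD FD)" unfolding p(2) using p(1) by (intro bilinD(3)[OF pDD]) auto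
  then show ?case using p by (intro exI[of _ "[p]"]) (simp add: ks_add_zero[OF kDD])
next
  case (3 x y)
  then obtain ps qs where "set ps \<subseteq> carrier FD \<times> carrier FD" "x = tsum ps" "set qs \<subseteq> carrier FD \<times> carrier FD" "y = tsum qs" by blast
  then show ?case by (intro exI[of _ "ps @ qs"]) (simp add: tsum_append)
next
  case (4 x c)
  then obtain ps where ps: "set ps \<subseteq> carrier FD \<times> carrier FD" "x = tsum ps" by blast
  then show ?case
    by (intro exI[of _ "map (\<lambda>a. (c \<odot>\<^bsub>FD\<^esub> fst a, snd a)) ps"]) (auto simp: tsum_smul intro!: ks_smul[OF kspace_finite_dual])
qed

lemma teval_tsum:
  assumes "x \<in> carrier A" "y \<in> carrier A" "set ps \<subseteq> carrier FD \<times> carrier FD"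
  shows "teval (\<lambda>p q. p x * q y) (tsum ps) = (\<Sum>a\<leftarrow>ps. fst a x * snd a y)"
proof -
  note b = FD_eval_bilin[OF assms(1,2)]
  note l = tlift_linear[OF kspace_finite_dual kspace_finite_dual kspace_base_field b]
  show ?thesis using assms(3)
  proof (induction ps)
    case Nil
    then show ?case using linear_map_zero[OF l kDD kspace_base_field] by simp
  next
    case (Cons a ps)
    then show ?case
      by (auto simp: linear_mapD(2)[OF l] bilinD(3)[OF pDD] tsum_closed tlift_tpure[OF kspace_finite_dual kspace_finite_dual kspace_base_field b])
  qed
qed

text \<open>
  A tensor is determined by its values: if the first form of the first summand does not vanish at \<open>x\<close>, evaluating
  at \<open>x\<close> expresses its second form through the second forms of the other summands, which gives a shorter sum.
\<close>

lemma tsum_eq_zero: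
  assumes "set ps \<subseteq> carrier FD \<times> carrier FD"
    and "\<And>x y. x \<in> carrier A \<Longrightarrow> y \<in> carrier A \<Longrightarrow> (\<Sum>a\<leftarrow>ps. fst a x * snd a y) = 0"
  shows "tsum ps = \<zero>\<^bsub>tensor FD FD\<^esub>"
  using assms
proof (induction "length ps" arbitrary: ps)
  case 0
  then show ?case by simp
next
  case (Suc n)
  then obtain a ps' where ps: "ps = a # ps'" by (cases ps) auto
  obtain p q where a: "a = (p, q)" by (cases a)
  note kD = kspace_finite_dual
  have pq: "p \<in> carrier FD" "q \<in> carrier FD" and ps': "set ps' \<subseteq> carrier FD \<times> carrier FD" "length ps' = n"
    using Suc.prems(1) Suc.hyps(2) by (auto simp: ps a)
  have eq: "p x * q y + (\<Sum>a\<leftarrow>ps'. fst a x * snd a y) = 0" if "x \<in> carrier A" "y \<in> carrier A" for x y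
    using Suc.prems(2)[OF that] by (simp add: ps a)
  show ?case
  proof (cases "\<exists>x\<in>carrier A. p x \<noteq> 0")
    case False
    then have "p = \<zero>\<^bsub>FD\<^esub>" using pq ks_zero[OF kD] by (intro FD_eqI) (auto simp: FD_simps)
    then have "tpure FD FD p q = \<zero>\<^bsub>tensor FD FD\<^esub>" using bilin_zero(1)[OF pDD kD kD kDD pq(2)] by simp
    moreover have "tsum ps' = \<zero>\<^bsub>tensor FD FD\<^esub>"
      by (rule Suc.hyps(1)[OF ps'(2)[symmetric] ps'(1)]) (use eq False in auto)
    ultimately show ?thesis by (simp add: ps a ks_zero_add[OF kDD] ks_zero[OF kDD])
  next
    case True
    then obtain x0 where x0: "x0 \<in> carrier A" "p x0 \<noteq> 0" by blast
    define c where "c r = - (r x0 / p x0)" for r :: "'a \<Rightarrow> 'k"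
    define lsum where "lsum = (\<lambda>qs. foldr (\<lambda>a s. c (fst a) \<odot>\<^bsub>FD\<^esub> snd a \<oplus>\<^bsub>FD\<^esub> s) qs \<zero>\<^bsub>FD\<^esub>)"
    define shift where "shift = (\<lambda>a. (fst a \<oplus>\<^bsub>FD\<^esub> c (fst a) \<odot>\<^bsub>FD\<^esub> p, snd a :: 'a \<Rightarrow> 'k))"
    have lsum: "lsum qs \<in> carrier FD \<and> (\<forall>y\<in>carrier A. lsum qs y = (\<Sum>a\<leftarrow>qs. c (fst a) * snd a y))"
      if "set qs \<subseteq> carrier FD \<times> carrier FD" for qs
      using that by (induction qs) (auto simp: lsum_def ks_zero[OF kD] FD_simps intro!: ks_add[OF kD] ks_smul[OF kD])
    have shift: "set (map shift qs) \<subseteq> carrier FD \<times> carrier FD" if "set qs \<subseteq> carrier FD \<times> carrier FD" for qs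
      using that pq(1) by (auto simp: shift_def intro!: ks_add[OF kD] ks_smul[OF kD])
    have sh: "tsum (map shift qs) = tpure FD FD p (lsum qs) \<oplus>\<^bsub>tensor FD FD\<^esub> tsum qs"
      if "set qs \<subseteq> carrier FD \<times> carrier FD" for qs
      using that
    proof (induction qs)
      case Nil
      then show ?case using bilin_zero(2)[OF pDD kD kD kDD pq(1)] by (simp add: lsum_def ks_zero_add[OF kDD] ks_zero[OF kDD])
    next
      case (Cons e qs)
      obtain r s where e: "e = (r, s)" by (cases e)
      have rs: "r \<in> carrier FD" "s \<in> carrier FD" "set qs \<subseteq> carrier FD \<times> carrier FD" using Cons.prems by (auto simp: e)
      note lq = conjunct1[OF lsum[OF rs(3)]]
      note l2 = linear_mapD(2,3)[OF bilinD(1)[OF pDD pq(1)]] and l1 = linear_mapD(2,3)[OF bilinD(2)[OF pDD rs(2)]]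
      have "tsum (map shift (e # qs)) = (tpure FD FD r s \<oplus>\<^bsub>tensor FD FD\<^esub> c r \<odot>\<^bsub>tensor FD FD\<^esub> tpure FD FD p s)
          \<oplus>\<^bsub>tensor FD FD\<^esub> (tpure FD FD p (lsum qs) \<oplus>\<^bsub>tensor FD FD\<^esub> tsum qs)"
        using Cons.IH[OF rs(3)] rs pq by (simp add: e shift_def l1 ks_smul[OF kD])
      also have "\<dots> = tpure FD FD p (c r \<odot>\<^bsub>FD\<^esub> s \<oplus>\<^bsub>FD\<^esub> lsum qs) \<oplus>\<^bsub>tensor FD FD\<^esub> (tpure FD FD r s \<oplus>\<^bsub>tensor FD FD\<^esub> tsum qs)"
        using rs pq lq tsum_closed[OF rs(3)]
        by (simp add: l2 ks_smul[OF kD] bilinD(3)[OF pDD] ks_add[OF kDD] ks_smul[OF kDD] ks_add_assoc[OF kDD] ks_add_lcomm[OF kDD])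
      finally show ?case by (simp add: e lsum_def)
    qed
    have "q = lsum ps'"
    proof (rule FD_eqI[OF pq(2) conjunct1[OF lsum[OF ps'(1)]]])
      fix y assume y: "y \<in> carrier A"
      have "(\<Sum>a\<leftarrow>ps'. c (fst a) * snd a y) = - (\<Sum>a\<leftarrow>ps'. fst a x0 * snd a y) / p x0"
        by (induction ps') (simp_all add: c_def add_divide_distrib diff_divide_distrib)
      also have "\<dots> = q y" using eq[OF x0(1) y] x0(2) by (simp add: field_simps add_eq_0_iff)
      finally show "q y = lsum ps' y" using lsum[OF ps'(1)] y by simp
    qed
    then have "tsum ps = tsum (map shift ps')" by (simp add: ps a sh[OF ps'(1)])
    also have "\<dots> = \<zero>\<^bsub>tensor FD FD\<^esub>"
    proof (rule Suc.hyps(1))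
      show "n = length (map shift ps')" using ps' by simp
      show "set (map shift ps') \<subseteq> carrier FD \<times> carrier FD" by (rule shift[OF ps'(1)])
      fix x y assume xy: "x \<in> carrier A" "y \<in> carrier A"
      have "(\<Sum>a\<leftarrow>map shift qs. fst a x * snd a y) = (\<Sum>a\<leftarrow>qs. fst a x * snd a y) + p x * (\<Sum>a\<leftarrow>qs. c (fst a) * snd a y)" for qs
        by (induction qs) (simp_all add: shift_def FD_simps xy algebra_simps)
      also have "(\<Sum>a\<leftarrow>ps'. c (fst a) * snd a y) = q y"
        using lsum[OF ps'(1)] xy \<open>q = lsum ps'\<close> by simp
      finally show "(\<Sum>a\<leftarrow>map shift ps'. fst a x * snd a y) = 0" using eq[OF xy] by (simp add: add.commute)
    qed
    finally show ?thesis .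
  qed
qed

text \<open>The coproduct is a \<open>THE\<close>, so uniqueness is at stake. The difference of two
  candidates evaluates to 0 everywhere and is therefore 0 by \<open>tsum_eq_zero\<close>.\<close>

lemma finite_dual_comult_eq:
  assumes t: "t \<in> carrier (tensor FD FD)"
    and "\<And>x y. x \<in> carrier A \<Longrightarrow> y \<in> carrier A \<Longrightarrow> teval (\<lambda>p1 p2. p1 x * p2 y) t = p (x \<otimes>\<^bsub>A\<^esub> y)"
  shows "comult (finite_dual A) p = t"
  unfolding finite_dual_simps
proof (rule the_equality)
  show "t \<in> carrier (tensor FD FD) \<and> (\<forall>x\<in>carrier A. \<forall>y\<in>carrier A. teval (\<lambda>p1 p2. p1 x * p2 y) t = p (x \<otimes>\<^bsub>A\<^esub> y))"
    using assms by blast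
  fix t' assume t': "t' \<in> carrier (tensor FD FD) \<and> (\<forall>x\<in>carrier A. \<forall>y\<in>carrier A. teval (\<lambda>p1 p2. p1 x * p2 y) t' = p (x \<otimes>\<^bsub>A\<^esub> y))"
  have d: "t' \<ominus>\<^bsub>tensor FD FD\<^esub> t \<in> carrier (tensor FD FD)" using t t' by (simp add: ks_minus[OF kDD])
  obtain ps where ps: "set ps \<subseteq> carrier FD \<times> carrier FD" "t' \<ominus>\<^bsub>tensor FD FD\<^esub> t = tsum ps" using tensor_tsum[OF d] by blast
  have "tsum ps = \<zero>\<^bsub>tensor FD FD\<^esub>"
  proof (rule tsum_eq_zero[OF ps(1)])
    fix x y assume xy: "x \<in> carrier A" "y \<in> carrier A"
    note l = tlift_linear[OF kspace_finite_dual kspace_finite_dual kspace_base_field FD_eval_bilin[OF xy]]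
    have "teval (\<lambda>p1 p2. p1 x * p2 y) (t' \<ominus>\<^bsub>tensor FD FD\<^esub> t) = p (x \<otimes>\<^bsub>A\<^esub> y) \<ominus>\<^bsub>base_field\<^esub> p (x \<otimes>\<^bsub>A\<^esub> y)"
      using linear_map_minus[OF l kDD kspace_base_field] t t' assms(2) xy by simp
    then show "(\<Sum>a\<leftarrow>ps. fst a x * snd a y) = 0"
      unfolding ps(2) teval_tsum[OF xy ps(1)] by (simp add: ks_minus_self[OF kspace_base_field])
  qed
  then show "t' = t" using ps(2) t t' ks_minus_zero_iff[OF kDD, of t' t] by simp
qed

text \<open>\<open>P\<close> and \<open>c\<close> are the support and the coefficients of the chosen
  representative of \<open>t\<close>, hence the same for every \<open>F\<close>.\<close>

lemma teval_finite_sum: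
  assumes "kspace U" "t \<in> carrier (tensor U U)"
  shows "\<exists>P c. finite P \<and> P \<subseteq> carrier U \<times> carrier U \<and> (\<forall>F. teval F t = (\<Sum>p\<in>P. c p * (F (fst p) (snd p) :: 'k)))"
  using tensor_rep[OF assms(1,1) kspace_base_field assms(2)]
  by (intro exI[of _ "Poly_Mapping.keys (SOME r. r \<in> t)"] exI[of _ "Poly_Mapping.lookup (SOME r. r \<in> t)"])
    (auto simp: tlift_lc lc_def finsum_base_field)

text \<open>(A.1)-(A.4) express compatibility with coproduct, unit, product and counit, in this
  order. That the values lie in the finite dual uses (A.1) twice: in the value at a y a' the element
  y enters only through finitely many forms, and their common kernel is contained in an ideal on
  which the value of the map at \<open>u\<close> vanishes.\<close>

theorem bialgebra_map_finite_dual: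
  fixes U :: "('k, 'u, 'e) bialg_scheme"
  assumes U: "k_algebra U" and UD: "linear_map U (tensor U U) (comult U)"
    and \<Phi>: "bilinear_form U A \<Phi>" and cA: "cond_A U A \<Phi>"
  shows "bialgebra_map U (cop (finite_dual A)) \<Phi>"
proof -
  note kU = k_algebraD(1)[OF U] and kD = kspace_finite_dual
  interpret A: ring A by (rule k_algebraD(2)[OF A])
  have bf: "\<Phi> \<in> extensional (carrier U)" "\<And>u. u \<in> carrier U \<Longrightarrow> \<Phi> u \<in> extensional (carrier A)" and b: "bilin U A base_field \<Phi>"
    using \<Phi> by (simp_all add: bilinear_form_iff[OF kU kA'])
  have A1: "\<Phi> u (a \<otimes>\<^bsub>A\<^esub> a') = teval (\<lambda>u1 u2. \<Phi> u2 a * \<Phi> u1 a') (comult U u)"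
    if "u \<in> carrier U" "a \<in> carrier A" "a' \<in> carrier A" for u a a' using cA that by (simp add: cond_A_def)
  have A2: "\<Phi> \<one>\<^bsub>U\<^esub> a = counit A a" if "a \<in> carrier A" for a using cA that by (simp add: cond_A_def)
  have A3: "\<Phi> (u \<otimes>\<^bsub>U\<^esub> u') a = teval (\<lambda>a1 a2. \<Phi> u a1 * \<Phi> u' a2) (comult A a)"
    if "u \<in> carrier U" "u' \<in> carrier U" "a \<in> carrier A" for u u' a using cA that by (simp add: cond_A_def)
  have A4: "\<Phi> u \<one>\<^bsub>A\<^esub> = counit U u" if "u \<in> carrier U" for u using cA that by (simp add: cond_A_def)
  have split: "\<exists>P c. finite P \<and> P \<subseteq> carrier U \<times> carrier U \<and>
    (\<forall>a\<in>carrier A. \<forall>a'\<in>carrier A. \<Phi> u (a \<otimes>\<^bsub>A\<^esub> a') = (\<Sum>p\<in>P. c p * (\<Phi> (snd p) a * \<Phi> (fst p) a')))" if u: "u \<in> carrier U" for u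
  proof -
    obtain P c where P: "finite P" "P \<subseteq> carrier U \<times> carrier U"
      "\<And>F. teval F (comult U u) = (\<Sum>p\<in>P. c p * (F (fst p) (snd p) :: 'k))"
      using teval_finite_sum[OF kU linear_mapD(1)[OF UD u]] by blast
    then show ?thesis using A1[OF u] by (intro exI[of _ P] exI[of _ c]) simp
  qed
  have D: "\<Phi> u \<in> carrier FD" if u: "u \<in> carrier U" for u
  proof -
    obtain P c where P: "finite P" "P \<subseteq> carrier U \<times> carrier U"
      "\<And>a a'. a \<in> carrier A \<Longrightarrow> a' \<in> carrier A \<Longrightarrow> \<Phi> u (a \<otimes>\<^bsub>A\<^esub> a') = (\<Sum>p\<in>P. c p * (\<Phi> (snd p) a * \<Phi> (fst p) a'))"
      using split[OF u] by blast
    \<comment> \<open>The data of the second application of (A.1) are packed into one pair, so that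
      a single choice over \<open>P\<close> yields them.\<close>
    define R where "R u Qd \<longleftrightarrow> finite (fst Qd) \<and> fst Qd \<subseteq> carrier U \<times> carrier U \<and>
      (\<forall>a\<in>carrier A. \<forall>a'\<in>carrier A. \<Phi> u (a \<otimes>\<^bsub>A\<^esub> a') = (\<Sum>q\<in>fst Qd. snd Qd q * (\<Phi> (snd q) a * \<Phi> (fst q) a')))"
      for u and Qd :: "('u \<times> 'u) set \<times> ('u \<times> 'u \<Rightarrow> 'k)"
    have "\<exists>Qd. R u Qd" if "u \<in> carrier U" for u
      unfolding R_def split_paired_Ex fst_conv snd_conv by (rule split[OF that])
    then have "\<forall>p\<in>P. \<exists>Qd. R (fst p) Qd" using P(2) by auto
    from bchoice[OF this] obtain f where f: "\<forall>p\<in>P. R (fst p) (f p)" ..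
    define Q d where "Q p = fst (f p)" and "d p = snd (f p)" for p
    have Q: "finite (Q p)" "Q p \<subseteq> carrier U \<times> carrier U"
      "\<And>a a'. a \<in> carrier A \<Longrightarrow> a' \<in> carrier A \<Longrightarrow>
        \<Phi> (fst p) (a \<otimes>\<^bsub>A\<^esub> a') = (\<Sum>q\<in>Q p. d p q * (\<Phi> (snd q) a * \<Phi> (fst q) a'))" if "p \<in> P" for p
      using bspec[OF f that] unfolding R_def Q_def d_def by simp_all
    \<comment> \<open>The largest two-sided ideal inside the kernel of \<Phi> u.\<close>
    define I where "I = {y \<in> carrier A. \<forall>a\<in>carrier A. \<forall>a'\<in>carrier A. \<Phi> u (a \<otimes>\<^bsub>A\<^esub> (y \<otimes>\<^bsub>A\<^esub> a')) = 0}"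
    note l = bilinD(1)[OF b u]
    have l': "linear_map A base_field (\<lambda>y. \<Phi> u (a \<otimes>\<^bsub>A\<^esub> (y \<otimes>\<^bsub>A\<^esub> a')))" if "a \<in> carrier A" "a' \<in> carrier A" for a a'
      by (rule linear_map_comp[OF l bilin_right[OF k_algebra_mult_bilin[OF A] that(1) bilinD(2)[OF k_algebra_mult_bilin[OF A] that(2)]]])
    have "submodule I (base_field :: ('k, 'k) module) A"
    proof (rule submoduleI'[OF kA'])
      show "\<zero>\<^bsub>A\<^esub> \<in> I" using linear_map_zero[OF l' kA' kspace_base_field] by (simp add: I_def)
      show "x \<oplus>\<^bsub>A\<^esub> y \<in> I" if "x \<in> I" "y \<in> I" for x y using that linear_mapD(2)[OF l'] by (simp add: I_def)
      show "k \<odot>\<^bsub>A\<^esub> x \<in> I" if "x \<in> I" for k x using that linear_mapD(3)[OF l'] by (simp add: I_def ks_smul[OF kA'])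
    qed (auto simp: I_def)
    then have "ideal I A"
    proof (rule submodule_idealI[OF A])
      fix y x assume y: "y \<in> I" and x: "x \<in> carrier A"
      have yA: "y \<in> carrier A" using y by (simp add: I_def)
      have "\<Phi> u (a \<otimes>\<^bsub>A\<^esub> ((x \<otimes>\<^bsub>A\<^esub> y) \<otimes>\<^bsub>A\<^esub> a')) = \<Phi> u ((a \<otimes>\<^bsub>A\<^esub> x) \<otimes>\<^bsub>A\<^esub> (y \<otimes>\<^bsub>A\<^esub> a'))"
        if "a \<in> carrier A" "a' \<in> carrier A" for a a' using that x yA by (simp add: A.m_assoc)
      then show "x \<otimes>\<^bsub>A\<^esub> y \<in> I" using x y by (simp add: I_def)
      have "\<Phi> u (a \<otimes>\<^bsub>A\<^esub> ((y \<otimes>\<^bsub>A\<^esub> x) \<otimes>\<^bsub>A\<^esub> a')) = \<Phi> u (a \<otimes>\<^bsub>A\<^esub> (y \<otimes>\<^bsub>A\<^esub> (x \<otimes>\<^bsub>A\<^esub> a')))"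
        if "a \<in> carrier A" "a' \<in> carrier A" for a a' using that x yA by (simp add: A.m_assoc)
      then show "y \<otimes>\<^bsub>A\<^esub> x \<in> I" using x y by (simp add: I_def)
    qed
    moreover have "finite_codim A I"
    proof -
      \<comment> \<open>As (A.1) reverses the tensor factors, y is paired with the second
        components.\<close>
      define F where "F = (\<Union>p\<in>P. (\<lambda>q. \<Phi> (snd q)) ` Q p)"
      have F: "finite F" "\<And>f. f \<in> F \<Longrightarrow> linear_map A base_field f"
        using P(1) Q(1,2) bilinD(1)[OF b] by (force simp: F_def)+
      have sub: "{x \<in> carrier A. \<forall>f\<in>F. f x = 0} \<subseteq> I"
      proof
        fix y assume "y \<in> {x \<in> carrier A. \<forall>f\<in>F. f x = 0}"
        then have y: "y \<in> carrier A" "\<And>p q. p \<in> P \<Longrightarrow> q \<in> Q p \<Longrightarrow> \<Phi> (snd q) y = 0" by (auto simp: F_def)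
        have "\<Phi> u (a \<otimes>\<^bsub>A\<^esub> (y \<otimes>\<^bsub>A\<^esub> a')) = 0" if a: "a \<in> carrier A" "a' \<in> carrier A" for a a'
        proof -
          have "\<Phi> (fst p) (y \<otimes>\<^bsub>A\<^esub> a') = 0" if "p \<in> P" for p
            unfolding Q(3)[OF that y(1) a(2)] by (rule sum.neutral) (simp add: y(2)[OF that])
          then show ?thesis using P(3)[OF a(1), of "y \<otimes>\<^bsub>A\<^esub> a'"] y(1) a(2) by simp
        qed
        then show "y \<in> I" using y(1) by (simp add: I_def)
      qed
      show ?thesis
        unfolding finite_codim_iff[OF kA']
        by (rule cofinite_mono[OF cofinite_kernels(1)[OF kA' F(1)] sub]) (rule F(2))
    qed
    moreover have "\<forall>y\<in>I. \<Phi> u y = 0"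
    proof
      fix y assume "y \<in> I"
      then have "y \<in> carrier A" "\<Phi> u (\<one>\<^bsub>A\<^esub> \<otimes>\<^bsub>A\<^esub> (y \<otimes>\<^bsub>A\<^esub> \<one>\<^bsub>A\<^esub>)) = 0" by (simp_all only: I_def mem_Collect_eq A.one_closed)
      then show "\<Phi> u y = 0" by simp
    qed
    moreover have "\<Phi> u \<in> carrier (dual A)" using bf(2)[OF u] l by (simp add: dual_simps)
    ultimately show ?thesis by (auto simp: finite_dual_algebra_simps)
  qed
  let ?C = "cop (finite_dual A)"
  have sC: "same_space FD ?C" and sF: "same_space FD (finite_dual A)"
    by (simp_all add: same_space_def cop_simps finite_dual_simps)
  have eqA: "f = g" if "f \<in> extensional (carrier A)" "g \<in> extensional (carrier A)" "\<And>x. x \<in> carrier A \<Longrightarrow> f x = g x" for f g :: "'a \<Rightarrow> 'k"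
    using that by (rule extensionalityI)
  have lin: "linear_map U FD \<Phi>"
    using D \<Phi> by (simp add: linear_map_def bilinear_form_def finite_dual_algebra_simps)
  have alg: "algebra_map U ?C \<Phi>"
    unfolding algebra_map_def
  proof (intro conjI ballI)
    show "linear_map U ?C \<Phi>" using lin by (simp add: linear_map_same[OF same_space_refl sC])
    show "\<Phi> \<one>\<^bsub>U\<^esub> = \<one>\<^bsub>?C\<^esub>"
      by (rule eqA) (use bf(2) k_algebraD(6)[OF U] A2 in \<open>simp_all add: cop_simps finite_dual_simps\<close>)
    show "\<Phi> (x \<otimes>\<^bsub>U\<^esub> y) = \<Phi> x \<otimes>\<^bsub>?C\<^esub> \<Phi> y" if "x \<in> carrier U" "y \<in> carrier U" for x y
      by (rule eqA) (use bf(2) k_algebraD(5)[OF U] A3 that in \<open>simp_all add: cop_simps finite_dual_simps convolution_def\<close>)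
  qed
  have "comult ?C (\<Phi> x) = tlift (tensor ?C ?C) (\<lambda>a b. tpure ?C ?C (\<Phi> a) (\<Phi> b)) (comult U x) \<and> counit ?C (\<Phi> x) = counit U x"
    if x: "x \<in> carrier U" for x
  proof
    show "counit ?C (\<Phi> x) = counit U x" using A4[OF x] by (simp add: cop_simps finite_dual_simps)
    note xc = linear_mapD(1)[OF UD x]
    have c1: "tpure FD FD (\<Phi> b) (\<Phi> a) \<in> carrier (tensor FD FD)" if "a \<in> carrier U" "b \<in> carrier U" for a b
      using that by (intro bilinD(3)[OF pDD] D)
    \<comment> \<open>The reversed order in (A.1) makes this flipped tensor the coproduct in the
      finite dual; \<open>cop\<close> flips it back.\<close>
    let ?t = "tlift (tensor FD FD) (\<lambda>a b. tpure FD FD (\<Phi> b) (\<Phi> a)) (comult U x)"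
    have t: "?t \<in> carrier (tensor FD FD)" by (rule tlift_closed[OF kU kU kDD c1 xc])
    have "comult (finite_dual A) (\<Phi> x) = ?t"
    proof (rule finite_dual_comult_eq[OF t])
      fix a a' assume a: "a \<in> carrier A" "a' \<in> carrier A"
      note e = FD_eval_bilin[OF a]
      have "teval (\<lambda>p1 p2. p1 a * p2 a') ?t = teval (\<lambda>u1 u2. teval (\<lambda>p1 p2. p1 a * p2 a') (tpure FD FD (\<Phi> u2) (\<Phi> u1))) (comult U x)"
        by (rule tlift_post[OF kU kU tlift_linear[OF kD kD kspace_base_field e] kDD kspace_base_field c1 xc])
      also have "\<dots> = teval (\<lambda>u1 u2. \<Phi> u2 a * \<Phi> u1 a') (comult U x)"
        by (rule tlift_cong[OF kU kU kspace_base_field _ _ xc])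
          (simp_all add: tlift_tpure[OF kD kD kspace_base_field e] D)
      finally show "teval (\<lambda>p1 p2. p1 a * p2 a') ?t = \<Phi> x (a \<otimes>\<^bsub>A\<^esub> a')" by (simp add: A1 x a)
    qed
    then have "comult ?C (\<Phi> x) = tlift (tensor FD FD) (\<lambda>a b. tpure FD FD b a) ?t"
      using tensor_same[OF sF sF] by (simp add: cop_simps)
    also have "\<dots> = tlift (tensor FD FD) (\<lambda>a b. tlift (tensor FD FD) (\<lambda>a b. tpure FD FD b a) (tpure FD FD (\<Phi> b) (\<Phi> a))) (comult U x)"
      by (rule tlift_post[OF kU kU tlift_linear[OF kD kD kDD bilin_flip[OF pDD]] kDD kDD c1 xc])
    also have "\<dots> = tlift (tensor FD FD) (\<lambda>a b. tpure FD FD (\<Phi> a) (\<Phi> b)) (comult U x)"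
      by (rule tlift_cong[OF kU kU kDD _ _ xc]) (simp_all add: tlift_tpure[OF kD kD kDD bilin_flip[OF pDD]] D c1)
    also have "\<dots> = tlift (tensor ?C ?C) (\<lambda>a b. tpure ?C ?C (\<Phi> a) (\<Phi> b)) (comult U x)"
      using tensor_same[OF sC sC] by simp
    finally show "comult ?C (\<Phi> x) = tlift (tensor ?C ?C) (\<lambda>a b. tpure ?C ?C (\<Phi> a) (\<Phi> b)) (comult U x)" .
  qed
  then show ?thesis using alg by (simp add: bialgebra_map_def)
qed

end

section \<open>The pairing of the biproducts\<close>

text \<open>Describes the form on the biproducts by its values on words times group elements. The
  factor \<open>wchar \<chi> v (- h)\<close> is the action on \<open>v\<close> of the inverse
  antipode of \<open>h\<close>.\<close>

locale smash_pairing = word_pairing z \<eta> g \<chi> \<phi> s lam + U: diag_smash U JU z \<eta> prU + A: diag_smash A JA g \<chi> prA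
  for U :: "('k::field, 'u) bialg" and A :: "('k, 'a) bialg" and JU JA :: "nat set"
    and z :: "nat \<Rightarrow> 'l::ab_group_add" and g :: "nat \<Rightarrow> 'g::ab_group_add"
    and \<eta> :: "nat \<Rightarrow> 'l \<Rightarrow> 'k" and \<chi> :: "nat \<Rightarrow> 'g \<Rightarrow> 'k" and \<phi> :: "'l \<Rightarrow> 'g \<Rightarrow> 'k"
    and s :: "nat \<Rightarrow> nat" and lam :: "nat \<Rightarrow> 'k"
    and prU :: "nat list \<Rightarrow> 'l \<Rightarrow> 'u" and prA :: "nat list \<Rightarrow> 'g \<Rightarrow> 'a" +
  fixes \<Phi> :: "'u \<Rightarrow> 'a \<Rightarrow> 'k"
  assumes \<Phi>_form: "bilinear_form U A \<Phi>"
    and \<Phi>_pr: "\<And>w v y h. w \<in> lists JU \<Longrightarrow> v \<in> lists JA \<Longrightarrow>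
      \<Phi> (prU w y) (prA v h) = wchar \<chi> v (- h) * (\<phi> y h * wpair v w)"
begin

lemmas kU = k_algebraD(1)[OF U.A_alg]
lemmas kA = k_algebraD(1)[OF A.A_alg]
lemmas mU = k_algebra_mult_bilin[OF U.A_alg]
lemmas mA = k_algebra_mult_bilin[OF A.A_alg]
lemmas kB = kspace_base_field

lemma prU_closed: "w \<in> lists JU \<Longrightarrow> prU w y \<in> carrier U"
  using U.spanA by (auto simp: spans_def image_subset_iff)

lemma prA_closed: "v \<in> lists JA \<Longrightarrow> prA v h \<in> carrier A"
  using A.spanA by (auto simp: spans_def image_subset_iff)

lemma \<Phi>_bilin: "bilin U A base_field \<Phi>"
  using \<Phi>_form by (simp add: bilinear_form_iff[OF kU kA])

lemma teval_comult_U: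
  assumes "bilin U U base_field F" "w \<in> lists JU"
  shows "teval F (comult U (prU w y)) = ws z \<eta> w (\<lambda>x x'. F (prU x (wdeg z x' + y)) (prU x' y))"
  unfolding U.comult_pr[OF assms(2)]
  by (rule trans[OF linear_wsplit[OF tlift_linear[OF kU kU kB assms(1)] kspace_tensor[OF kU kU] assms(2)]
        wsplit_cong[OF assms(2)]])
    (simp_all add: tpure_closed[OF kU kU] prU_closed tlift_tpure[OF kU kU kB assms(1)])

lemma teval_comult_A:
  assumes "bilin A A base_field F" "v \<in> lists JA"
  shows "teval F (comult A (prA v h)) = ws g \<chi> v (\<lambda>x x'. F (prA x (wdeg g x' + h)) (prA x' h))"
  unfolding A.comult_pr[OF assms(2)]
  by (rule trans[OF linear_wsplit[OF tlift_linear[OF kA kA kB assms(1)] kspace_tensor[OF kA kA] assms(2)]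
        wsplit_cong[OF assms(2)]])
    (simp_all add: tpure_closed[OF kA kA] prA_closed tlift_tpure[OF kA kA kB assms(1)])

lemma wchar_\<chi>: "wchar \<chi> v (h + h') = wchar \<chi> v h * wchar \<chi> v h'" "wchar \<chi> v 0 = 1"
  using characters_mult[OF wchar_character[of \<chi> v, OF \<chi>_char]] by auto

lemma wchar_\<eta>: "wchar \<eta> v (h + h') = wchar \<eta> v h * wchar \<eta> v h'" "wchar \<eta> v 0 = 1"
  using characters_mult[OF wchar_character[of \<eta> v, OF \<eta>_char]] by auto

lemma \<phi>_simps: "\<phi> y (h + h') = \<phi> y h * \<phi> y h'" "\<phi> y 0 = 1"
  using characters_mult[OF \<phi>_char] by auto

text \<open>On words times group elements, (A.1) is \<open>wpair_append_left\<close>, where the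
  degree of \<open>x'\<close> that the coproduct puts into the group element is converted by
  \<open>wpair_\<phi>\<close>. Likewise (A.3) is \<open>wpair_append_right\<close>, where the
  character produced by multiplication is converted by \<open>wpair_\<eta>\<close>.\<close>

lemma smash_cond_A: "cond_A U A \<Phi>"
proof -
  note l = bilinD(1)[OF \<Phi>_bilin] and r = bilinD(2)[OF \<Phi>_bilin]
  have bU: "bilin U U base_field (\<lambda>u1 u2. \<Phi> u2 a * \<Phi> u1 a')" if "a \<in> carrier A" "a' \<in> carrier A" for a a'
    using bilin_flip[OF bilin_times[OF r[OF that(1)] r[OF that(2)]]] .
  have bA: "bilin A A base_field (\<lambda>a1 a2. \<Phi> u a1 * \<Phi> u' a2)" if "u \<in> carrier U" "u' \<in> carrier U" for u u'
    by (rule bilin_times[OF l[OF that(1)] l[OF that(2)]])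
  have "\<Phi> u (a \<otimes>\<^bsub>A\<^esub> a') = teval (\<lambda>u1 u2. \<Phi> u2 a * \<Phi> u1 a') (comult U u)"
    if c: "u \<in> carrier U" "a \<in> carrier A" "a' \<in> carrier A" for u a a'
  proof (rule linear_eq_on_span[where f = "\<lambda>u. \<Phi> u (a \<otimes>\<^bsub>A\<^esub> a')", OF r[OF bilinD(3)[OF mA c(2,3)]]
        linear_map_comp[OF tlift_linear[OF kU kU kB bU[OF c(2,3)]] U.comultA_linear] U.spanA kU kB _ c(1)])
    fix q assume "q \<in> (\<lambda>p. prU (fst p) (snd p)) ` (lists JU \<times> UNIV)"
    then obtain w y where w: "w \<in> lists JU" "q = prU w y" by auto
    have "\<Phi> q (a \<otimes>\<^bsub>A\<^esub> a') = ws z \<eta> w (\<lambda>x x'. \<Phi> (prU x' y) a * \<Phi> (prU x (wdeg z x' + y)) a')"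
      unfolding w(2)
    proof (rule bilin_eq_on_span[OF bilin_post[OF l[OF prU_closed[OF w(1)]] mA] ws_bilin_param[OF w(1)]
          A.spanA A.spanA kA kA kB _ c(2,3)])
      show "bilin A A base_field (\<lambda>a a'. \<Phi> (prU x' y) a * \<Phi> (prU x (wdeg z x' + y)) a')"
        if "x \<in> lists JU" "x' \<in> lists JU" for x x'
        by (rule bilin_times; rule l; simp add: prU_closed that)
      fix p p' assume "p \<in> (\<lambda>p. prA (fst p) (snd p)) ` (lists JA \<times> UNIV)" "p' \<in> (\<lambda>p. prA (fst p) (snd p)) ` (lists JA \<times> UNIV)"
      then obtain v h v' h' where v: "v \<in> lists JA" "p = prA v h" "v' \<in> lists JA" "p' = prA v' h'" by auto
      have "\<Phi> (prU w y) (p \<otimes>\<^bsub>A\<^esub> p')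
        = (wchar \<chi> v' h * (wchar \<chi> (v @ v') (- (h + h')) * \<phi> y (h + h'))) * wpair (v @ v') w"
        using v w linear_mapD(3)[OF l[OF prU_closed[OF w(1)]]]
        by (simp add: A.pr_mult prA_closed \<Phi>_pr del: wchar_simps minus_add_distrib)
      also have "\<dots> = ws z \<eta> w (\<lambda>x x'. (wchar \<chi> v' h * (wchar \<chi> (v @ v') (- (h + h')) * \<phi> y (h + h'))) * (wpair v x' * wpair v' x))"
        unfolding wpair_append_left ws_times ..
      also have "\<dots> = ws z \<eta> w (\<lambda>x x'. \<Phi> (prU x' y) p * \<Phi> (prU x (wdeg z x' + y)) p')"
      proof (rule wsplit_cong[OF w(1)])
        fix x x' assume x: "x \<in> lists JU" "x' \<in> lists JU"
        \<comment> \<open>The factor \<open>wchar \<chi> v' h\<close> comes from multiplying in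
          \<open>A\<close>; it completes the argument -(h + h') to -h'.\<close>
        have e: "wchar \<chi> v' (- h') = wchar \<chi> v' h * wchar \<chi> v' (- h - h')"
          using wchar_\<chi>(1)[of v' h "- h - h'"] by simp
        have e': "wchar \<chi> v (- h - h') = wchar \<chi> v (- h) * wchar \<chi> v (- h')"
          using wchar_\<chi>(1)[of v "- h" "- h'"] by simp
        have "\<Phi> (prU x' y) p * \<Phi> (prU x (wdeg z x' + y)) p'
          = wchar \<chi> v (- h) * \<phi> y h * wchar \<chi> v' (- h') * \<phi> y h' * wpair v' x * (\<phi> (wdeg z x') h' * wpair v x')"
          by (simp add: v \<Phi>_pr x \<phi>_add mult_ac)
        also have "\<dots> = (wchar \<chi> v (- h) * wchar \<chi> v (- h')) * (\<phi> y h * \<phi> y h') * wchar \<chi> v' (- h') * (wpair v x' * wpair v' x)"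
          unfolding wpair_\<phi> by (simp add: mult_ac)
        also have "\<dots> = (wchar \<chi> v' h * (wchar \<chi> (v @ v') (- (h + h')) * \<phi> y (h + h'))) * (wpair v x' * wpair v' x)"
          by (simp add: e e' \<phi>_simps mult_ac)
        finally show "(wchar \<chi> v' h * (wchar \<chi> (v @ v') (- (h + h')) * \<phi> y (h + h'))) * (wpair v x' * wpair v' x)
          = \<Phi> (prU x' y) p * \<Phi> (prU x (wdeg z x' + y)) p'" by simp
      qed
      finally show "\<Phi> (prU w y) (p \<otimes>\<^bsub>A\<^esub> p') = ws z \<eta> w (\<lambda>x x'. \<Phi> (prU x' y) p * \<Phi> (prU x (wdeg z x' + y)) p')" .
    qed
    then show "\<Phi> q (a \<otimes>\<^bsub>A\<^esub> a') = teval (\<lambda>u1 u2. \<Phi> u2 a * \<Phi> u1 a') (comult U q)"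
      unfolding w(2) teval_comult_U[OF bU[OF c(2,3)] w(1)] .
  qed
  moreover have "\<Phi> (u \<otimes>\<^bsub>U\<^esub> u') a = teval (\<lambda>a1 a2. \<Phi> u a1 * \<Phi> u' a2) (comult A a)"
    if c: "u \<in> carrier U" "u' \<in> carrier U" "a \<in> carrier A" for u u' a
  proof (rule linear_eq_on_span[where f = "\<lambda>a. \<Phi> (u \<otimes>\<^bsub>U\<^esub> u') a", OF l[OF bilinD(3)[OF mU c(1,2)]]
        linear_map_comp[OF tlift_linear[OF kA kA kB bA[OF c(1,2)]] A.comultA_linear] A.spanA kA kB _ c(3)])
    fix q assume "q \<in> (\<lambda>p. prA (fst p) (snd p)) ` (lists JA \<times> UNIV)"
    then obtain v h where v: "v \<in> lists JA" "q = prA v h" by auto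
    have "\<Phi> (u \<otimes>\<^bsub>U\<^esub> u') q = ws g \<chi> v (\<lambda>x x'. \<Phi> u (prA x (wdeg g x' + h)) * \<Phi> u' (prA x' h))"
      unfolding v(2)
    proof (rule bilin_eq_on_span[where f = "\<lambda>u u'. \<Phi> (u \<otimes>\<^bsub>U\<^esub> u') (prA v h)", OF bilin_post[OF r[OF prA_closed[OF v(1)]] mU]
          ws_bilin_param[OF v(1)] U.spanA U.spanA kU kU kB _ c(1,2)])
      show "bilin U U base_field (\<lambda>u u'. \<Phi> u (prA x (wdeg g x' + h)) * \<Phi> u' (prA x' h))"
        if "x \<in> lists JA" "x' \<in> lists JA" for x x'
        by (rule bilin_times; rule r; simp add: prA_closed that)
      fix p p' assume "p \<in> (\<lambda>p. prU (fst p) (snd p)) ` (lists JU \<times> UNIV)" "p' \<in> (\<lambda>p. prU (fst p) (snd p)) ` (lists JU \<times> UNIV)"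
      then obtain w y w' y' where w: "w \<in> lists JU" "p = prU w y" "w' \<in> lists JU" "p' = prU w' y'" by auto
      have "\<Phi> (p \<otimes>\<^bsub>U\<^esub> p') (prA v h)
        = (wchar \<eta> w' y * \<phi> y h * \<phi> y' h) * (wchar \<chi> v (- h) * wpair v (w @ w'))"
        using v w linear_mapD(3)[OF r[OF prA_closed[OF v(1)]]]
        by (simp add: U.pr_mult prU_closed \<Phi>_pr \<phi>_add mult_ac)
      \<comment> \<open>The action of -h is distributed over the two subwords by
        \<open>ws_prod\<close>, so that it can be compared summand by summand.\<close>
      also have "wchar \<chi> v (- h) * wpair v (w @ w')
        = ws g \<chi> v (\<lambda>x x'. (wchar \<chi> x (- h) * wchar \<chi> x' (- h)) * (wchar \<chi> x (- wdeg g x') * (wpair x w * wpair x' w')))"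
        unfolding wpair_append_right wchar_def[of \<chi> _ "- h"] by (rule ws_prod[symmetric])
      also have "(wchar \<eta> w' y * \<phi> y h * \<phi> y' h) * \<dots> = ws g \<chi> v (\<lambda>x x'. \<Phi> p (prA x (wdeg g x' + h)) * \<Phi> p' (prA x' h))"
        unfolding ws_times[symmetric]
      proof (rule wsplit_cong[OF v(1)])
        fix x x' assume x: "x \<in> lists JA" "x' \<in> lists JA"
        have "\<Phi> p (prA x (wdeg g x' + h)) * \<Phi> p' (prA x' h)
          = (wchar \<chi> x (- wdeg g x' + - h) * wchar \<chi> x' (- h)) * (\<phi> y h * \<phi> y' h) * wpair x w * (\<phi> y (wdeg g x') * wpair x' w')"
          by (simp add: w \<Phi>_pr x \<phi>_simps mult_ac)
        also have "\<dots> = wchar \<eta> w' y * \<phi> y h * \<phi> y' h *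
          (wchar \<chi> x (- h) * wchar \<chi> x' (- h) * (wchar \<chi> x (- wdeg g x') * (wpair x w * wpair x' w')))"
          unfolding wpair_\<eta>[symmetric] wchar_\<chi>(1) by (simp add: mult_ac)
        finally show "wchar \<eta> w' y * \<phi> y h * \<phi> y' h *
          (wchar \<chi> x (- h) * wchar \<chi> x' (- h) * (wchar \<chi> x (- wdeg g x') * (wpair x w * wpair x' w')))
          = \<Phi> p (prA x (wdeg g x' + h)) * \<Phi> p' (prA x' h)" by simp
      qed
      finally show "\<Phi> (p \<otimes>\<^bsub>U\<^esub> p') (prA v h) = ws g \<chi> v (\<lambda>x x'. \<Phi> p (prA x (wdeg g x' + h)) * \<Phi> p' (prA x' h))" .
    qed
    then show "\<Phi> (u \<otimes>\<^bsub>U\<^esub> u') q = teval (\<lambda>a1 a2. \<Phi> u a1 * \<Phi> u' a2) (comult A q)"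
      unfolding v(2) teval_comult_A[OF bA[OF c(1,2)] v(1)] .
  qed
  moreover have "\<Phi> \<one>\<^bsub>U\<^esub> a = counit A a" if c: "a \<in> carrier A" for a
    by (rule linear_eq_on_span[OF l[OF k_algebraD(6)[OF U.A_alg]] A.counitA_linear A.spanA kA kB _ c])
      (auto simp: U.one_pr \<Phi>_pr A.counit_pr \<phi>_0 wpair_Nil_right)
  moreover have "\<Phi> u \<one>\<^bsub>A\<^esub> = counit U u" if c: "u \<in> carrier U" for u
    by (rule linear_eq_on_span[OF r[OF k_algebraD(6)[OF A.A_alg]] U.counitA_linear U.spanA kU kB _ c])
      (auto simp: A.one_pr \<Phi>_pr U.counit_pr \<phi>_simps)
  ultimately show ?thesis unfolding cond_A_def by simp
qed

lemma \<Phi>_bialgebra_map: "bialgebra_map U (cop (finite_dual A)) \<Phi>"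
  by (rule bialgebra_map_finite_dual[OF A.A_alg U.A_alg U.comultA_linear \<Phi>_form smash_cond_A])

lemma cond_A_smashD:
  "u \<in> carrier U \<Longrightarrow> a \<in> carrier A \<Longrightarrow> a' \<in> carrier A \<Longrightarrow> \<Phi> u (a \<otimes>\<^bsub>A\<^esub> a') = teval (\<lambda>u1 u2. \<Phi> u2 a * \<Phi> u1 a') (comult U u)"
  "a \<in> carrier A \<Longrightarrow> \<Phi> \<one>\<^bsub>U\<^esub> a = counit A a" "u \<in> carrier U \<Longrightarrow> \<Phi> u \<one>\<^bsub>A\<^esub> = counit U u"
  using smash_cond_A by (simp_all add: cond_A_def)

lemma \<Phi>_dual: "u \<in> carrier U \<Longrightarrow> \<Phi> u \<in> carrier (dual A)"
  using \<Phi>_form by (auto simp: bilinear_form_def linear_map_def)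

section \<open>Characters and skew derivations of the biproduct\<close>

lemma dual_eqI:
  assumes "p \<in> carrier (dual A)" "q \<in> carrier (dual A)" "\<And>v h. v \<in> lists JA \<Longrightarrow> p (prA v h) = q (prA v h)"
  shows "p = q"
proof (rule extensionalityI[of _ "carrier A"])
  show "p \<in> extensional (carrier A)" "q \<in> extensional (carrier A)"
    using assms(1,2) by (simp_all add: dual_simps)
  have l: "linear_map A base_field p" "linear_map A base_field q"
    using assms(1,2) by (simp_all add: dual_simps)
  show "p x = q x" if "x \<in> carrier A" for x
  proof (rule linear_eq_on_span[OF l A.spanA kA kB _ that])
    fix t assume "t \<in> (\<lambda>p. prA (fst p) (snd p)) ` (lists JA \<times> UNIV)"
    then obtain v h where "v \<in> lists JA" "t = prA v h" by auto
    then show "p t = q t" by (simp add: assms(3))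
  qed
qed

lemma prA_Cons: "j \<in> JA \<Longrightarrow> v \<in> lists JA \<Longrightarrow> prA (j # v) h = prA [j] 0 \<otimes>\<^bsub>A\<^esub> prA v h"
  using A.pr_mult[of "[j]" v 0 h] prA_closed[of "j # v" h] by (simp add: wchar_\<chi> ks_smul_one[OF kA])

lemma prU_Cons: "i \<in> JU \<Longrightarrow> w \<in> lists JU \<Longrightarrow> prU (i # w) y = prU [i] 0 \<otimes>\<^bsub>U\<^esub> prU w y"
  using U.pr_mult[of "[i]" w 0 y] prU_closed[of "i # w" y] by (simp add: wchar_\<eta> ks_smul_one[OF kU])

text \<open>A nonempty word is a product whose first factor is a letter, and \<gamma> sends letters
  to 0.\<close>

lemma character_values:
  assumes "algebra_map A base_field \<gamma>" "\<And>j. j \<in> JA \<Longrightarrow> \<gamma> (prA [j] 0) = 0" "v \<in> lists JA"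
  shows "\<gamma> (prA v h) = (if v = [] then \<gamma> (prA [] h) else 0)"
proof (cases v)
  case (Cons j v')
  then have c: "j \<in> JA" "v' \<in> lists JA" using assms(3) by auto
  have "\<gamma> (prA [j] 0 \<otimes>\<^bsub>A\<^esub> prA v' h) = \<gamma> (prA [j] 0) * \<gamma> (prA v' h)"
    using assms(1) c by (simp add: algebra_map_def prA_closed)
  then show ?thesis by (simp only: Cons prA_Cons[OF c, symmetric] assms(2)[OF c(1)]) simp
qed simp

text \<open>The counit vanishes on letters, so splitting off the first letter leaves only one term
  of the derivation rule.\<close>

lemma derivation_values:
  assumes "derivation A (counit A) \<gamma> d" "j \<in> JA" "v \<in> lists JA"
  shows "d (prA (j # v) h) = d (prA [j] 0) * \<gamma> (prA v h)"
  unfolding prA_Cons[OF assms(2,3), of h]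
  using assms by (simp add: derivation_def prA_closed A.counit_pr)

lemma \<Phi>_z_algebra_map: "algebra_map A base_field (\<Phi> (prU [] y))"
proof -
  have c: "prU [] y \<in> carrier U" by (simp add: prU_closed)
  have "\<Phi> (prU [] y) (a \<otimes>\<^bsub>A\<^esub> a') = \<Phi> (prU [] y) a * \<Phi> (prU [] y) a'" if a: "a \<in> carrier A" "a' \<in> carrier A" for a a'
    using bilin_flip[OF bilin_times[OF bilinD(2)[OF \<Phi>_bilin a(1)] bilinD(2)[OF \<Phi>_bilin a(2)]]]
    by (simp add: cond_A_smashD(1)[OF c a] teval_comult_U)
  then show ?thesis
    using bilinD(1)[OF \<Phi>_bilin c] cond_A_smashD(3)[OF c] by (simp add: algebra_map_def U.counit_pr)
qed

lemma \<Phi>_u_derivation: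
  assumes "i \<in> JU"
  shows "derivation A (counit A) (\<Phi> (prU [] (z i))) (\<Phi> (prU [i] 0))"
proof -
  have c: "prU [i] 0 \<in> carrier U" using assms by (simp add: prU_closed)
  have "\<Phi> (prU [i] 0) (a \<otimes>\<^bsub>A\<^esub> a') = counit A a * \<Phi> (prU [i] 0) a' + \<Phi> (prU [i] 0) a * \<Phi> (prU [] (z i)) a'"
    if a: "a \<in> carrier A" "a' \<in> carrier A" for a a'
    using bilin_flip[OF bilin_times[OF bilinD(2)[OF \<Phi>_bilin a(1)] bilinD(2)[OF \<Phi>_bilin a(2)]]] assms
    by (simp add: cond_A_smashD(1)[OF c a] teval_comult_U) (simp add: cond_A_smashD(2)[OF a(1)] flip: U.one_pr)
  then show ?thesis using \<Phi>_dual[OF c] by (simp add: derivation_def)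
qed

abbreviation "is_character y \<gamma> \<equiv> \<gamma> \<in> carrier (dual A) \<and> algebra_map A base_field \<gamma>
  \<and> (\<forall>j\<in>JA. \<gamma> (prA [j] 0) = 0) \<and> (\<forall>h. \<gamma> (prA [] h) = \<phi> y h)"

text \<open>The equivalence gives existence and uniqueness at once and identifies the character with
  a value of \<Phi>; \<open>derivation_iff\<close> does the same for the skew derivation.\<close>

lemma character_iff: "is_character y \<gamma> \<longleftrightarrow> \<gamma> = \<Phi> (prU [] y)"
proof
  assume g: "is_character y \<gamma>"
  show "\<gamma> = \<Phi> (prU [] y)"
  proof (rule dual_eqI)
    show "\<gamma> (prA v h) = \<Phi> (prU [] y) (prA v h)" if "v \<in> lists JA" for v h
      using character_values[of \<gamma> v h] g that by (simp add: \<Phi>_pr wpair_Nil_right)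
  qed (use g \<Phi>_dual prU_closed[of "[]"] in simp_all)
next
  assume "\<gamma> = \<Phi> (prU [] y)"
  then show "is_character y \<gamma>"
    using \<Phi>_dual prU_closed[of "[]"] \<Phi>_z_algebra_map by (simp add: \<Phi>_pr)
qed

lemma derivation_iff:
  assumes "i \<in> JU"
  shows "derivation A (counit A) (\<Phi> (prU [] (z i))) d \<and> (\<forall>j\<in>JA. d (prA [j] 0) = (if s i = j then lam i else 0))
      \<and> (\<forall>h. d (prA [] h) = 0) \<longleftrightarrow> d = \<Phi> (prU [i] 0)"
proof
  have \<Phi>i: "\<Phi> (prU [i] 0) (prA [j] 0) = (if s i = j then lam i else 0)" "\<Phi> (prU [i] 0) (prA [] h) = 0" if "j \<in> JA" for j h
    using assms that by (simp_all add: \<Phi>_pr wpair_letter characters_mult[OF \<chi>_char] \<phi>_simps)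
  have \<Phi>i0: "\<Phi> (prU [i] 0) (prA [] h) = 0" for h
    using assms by (simp add: \<Phi>_pr)
  note \<Phi>d = \<Phi>_u_derivation[OF assms]
  show "derivation A (counit A) (\<Phi> (prU [] (z i))) d \<and> (\<forall>j\<in>JA. d (prA [j] 0) = (if s i = j then lam i else 0))
      \<and> (\<forall>h. d (prA [] h) = 0)" if "d = \<Phi> (prU [i] 0)"
    using \<Phi>d \<Phi>i(1) \<Phi>i0 that by simp
  assume d: "derivation A (counit A) (\<Phi> (prU [] (z i))) d \<and> (\<forall>j\<in>JA. d (prA [j] 0) = (if s i = j then lam i else 0))
      \<and> (\<forall>h. d (prA [] h) = 0)"
  show "d = \<Phi> (prU [i] 0)"
  proof (rule dual_eqI)
    show "d \<in> carrier (dual A)" using d by (simp add: derivation_def)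
    show "\<Phi> (prU [i] 0) \<in> carrier (dual A)" using \<Phi>_dual prU_closed assms by simp
    fix v h assume v: "v \<in> lists JA"
    show "d (prA v h) = \<Phi> (prU [i] 0) (prA v h)"
    proof (cases v)
      case Nil
      then show ?thesis using d \<Phi>i0 by simp
    next
      case (Cons j v')
      then show ?thesis
        using v d derivation_values[OF \<Phi>d, of j v' h] derivation_values[of _ d j v' h] \<Phi>i(1) by simp
    qed
  qed
qed

text \<open>Convolution with this character multiplies the value at \<open>prA v h\<close> by the
  nonzero scalar \<open>\<phi> y h\<close>: in the coproduct only the term with an empty right word
  contributes.\<close>

lemma convolution_character_inj:
  assumes p: "linear_map A base_field p" "p \<in> extensional (carrier A)"
    and q: "linear_map A base_field q" "q \<in> extensional (carrier A)"
    and e: "convolution A p (\<Phi> (prU [] y)) = convolution A q (\<Phi> (prU [] y))"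
  shows "p = q"
proof (rule dual_eqI)
  show "p \<in> carrier (dual A)" "q \<in> carrier (dual A)" using p q by (simp_all add: dual_simps)
  fix v h assume v: "v \<in> lists JA"
  have c: "prU [] y \<in> carrier U" by (simp add: prU_closed)
  have conv: "convolution A r (\<Phi> (prU [] y)) (prA v h) = \<phi> y h * r (prA v h)" if r: "linear_map A base_field r" for r
  proof -
    have "convolution A r (\<Phi> (prU [] y)) (prA v h)
      = ws g \<chi> v (\<lambda>x x'. r (prA x (wdeg g x' + h)) * \<Phi> (prU [] y) (prA x' h))"
      using teval_comult_A[OF bilin_times[OF r bilinD(1)[OF \<Phi>_bilin c]] v] v
      by (simp add: convolution_def prA_closed)
    also have "\<dots> = ws g \<chi> v (\<lambda>x x'. (if x' = [] then 1 else 0) * (\<phi> y h * r (prA x h)))"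
      by (rule wsplit_cong[OF v]) (simp add: \<Phi>_pr wpair_Nil_right)
    finally show ?thesis by (simp only: ws_counit_right)
  qed
  \<comment> \<open>The scalar is nonzero since it divides \<phi> y 0 = 1.\<close>
  have "\<phi> y (h + - h) = \<phi> y h * \<phi> y (- h)" by (rule \<phi>_simps)
  then have "\<phi> y h \<noteq> 0" by (auto simp: \<phi>_simps)
  then show "p (prA v h) = q (prA v h)"
    using conv[OF p(1)] conv[OF q(1)] e by simp
qed

text \<open>The group elements on which the two maps agree form a subgroup: the value at
  \<open>x - y\<close> is recovered from those at \<open>x\<close> and \<open>y\<close> by
  cancelling a convolution with a character. Letters are then prepended by multiplicativity.\<close>

lemma algebra_map_determined:
  assumes \<Psi>: "algebra_map U (finite_dual A) \<Psi>"
    and gen: "\<And>i. i \<in> JU \<Longrightarrow> \<Psi> (prU [] (z i)) = \<Phi> (prU [] (z i))" "\<And>i. i \<in> JU \<Longrightarrow> \<Psi> (prU [i] 0) = \<Phi> (prU [i] 0)"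
    and w: "w \<in> lists JU" and y: "y \<in> is_subgroup hull (z ` JU)"
  shows "\<Psi> (prU w y) = \<Phi> (prU w y)"
proof -
  note F = algebra_map_def linear_map_def finite_dual_simps
  have \<Phi>: "algebra_map U (finite_dual A) \<Phi>"
    using \<Phi>_bialgebra_map by (simp add: bialgebra_map_def algebra_map_def linear_map_def cop_simps)
  have m: "f (u \<otimes>\<^bsub>U\<^esub> u') = convolution A (f u) (f u')" if "algebra_map U (finite_dual A) f" "u \<in> carrier U" "u' \<in> carrier U" for f u u'
    using that by (simp add: F)
  have c: "linear_map A base_field (f u)" "f u \<in> extensional (carrier A)" if "algebra_map U (finite_dual A) f" "u \<in> carrier U" for f u
  proof -
    have "f u \<in> carrier (finite_dual_algebra A)" using that by (auto simp: F)
    then show "linear_map A base_field (f u)" "f u \<in> extensional (carrier A)"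
      by (simp_all add: finite_dual_algebra_simps dual_simps)
  qed
  have z: "prU [] y \<in> carrier U" for y by (simp add: prU_closed)
  have "is_subgroup {y. \<Psi> (prU [] y) = \<Phi> (prU [] y)}"
    unfolding is_subgroup_def
  proof (intro conjI ballI)
    show "0 \<in> {y. \<Psi> (prU [] y) = \<Phi> (prU [] y)}"
      using \<Psi> \<Phi> by (simp add: algebra_map_def flip: U.one_pr)
    fix x y assume "x \<in> {y. \<Psi> (prU [] y) = \<Phi> (prU [] y)}" "y \<in> {y. \<Psi> (prU [] y) = \<Phi> (prU [] y)}"
    then have xy: "\<Psi> (prU [] x) = \<Phi> (prU [] x)" "\<Psi> (prU [] y) = \<Phi> (prU [] y)" by auto
    have x: "prU [] (x - y) \<otimes>\<^bsub>U\<^esub> prU [] y = prU [] x"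
      using U.pr_mult[of "[]" "[]" "x - y" y] z by (simp add: ks_smul_one[OF kU])
    have "convolution A (\<Psi> (prU [] (x - y))) (\<Phi> (prU [] y)) = convolution A (\<Phi> (prU [] (x - y))) (\<Phi> (prU [] y))"
      using m[OF \<Psi> z z, of "x - y" y] m[OF \<Phi> z z, of "x - y" y] by (simp add: x xy)
    then show "x - y \<in> {y. \<Psi> (prU [] y) = \<Phi> (prU [] y)}"
      using convolution_character_inj[OF c[OF \<Psi> z] c[OF \<Phi> z]] by simp
  qed
  then have "is_subgroup hull (z ` JU) \<subseteq> {y. \<Psi> (prU [] y) = \<Phi> (prU [] y)}"
    by (intro hull_minimal) (use gen(1) in auto)
  then have base: "\<Psi> (prU [] y) = \<Phi> (prU [] y)" using y by auto
  show ?thesis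
    using w
  proof (induction w rule: list.induct)
    case (Cons i w)
    then have c: "i \<in> JU" "w \<in> lists JU" by auto
    show ?case
      unfolding prU_Cons[OF c, of y]
      using m[OF \<Psi>, of "prU [i] 0" "prU w y"] m[OF \<Phi>, of "prU [i] 0" "prU w y"] gen(2)[OF c(1)] Cons.IH[OF c(2)]
      by (simp add: prU_closed c)
  qed (rule base)
qed

end

section \<open>Values of the form on the biproducts\<close>

context alg_pairing
begin

lemma biproduct_form_pr:
  assumes \<beta>: "bilin NT NR base_field \<beta>" and \<tau>: "bilin K H base_field \<tau>"
  shows "bilinear_form NT.A NR.A (biproduct_form K H NT NR \<beta> \<tau>)"
    and "\<And>w v y h. w \<in> lists JT \<Longrightarrow> v \<in> lists JR \<Longrightarrow> biproduct_form K H NT NR \<beta> \<tau> (NT.pr w y) (NR.pr v h)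
      = wchar \<chi> v (- h) * \<beta> (clT w) (clR v) * \<tau> (gelt y) (gelt h)"
proof -
  let ?F = "\<lambda>t l r h1 h2. \<beta> t (act NR (antipode_inv H h1) r) * \<tau> l h2"
  let ?G = "\<lambda>t l r h. teval (?F t l r) (comult H h)"
  note kB = kspace_base_field
  note Kc = NT.Hc and Hc = NR.Hc
  have a: "linear_map H NR (\<lambda>h. act NR (antipode_inv H h) r)" if "r \<in> carrier NR" for r
    unfolding antipode_inv_eq[OF NR.H] by (rule bilin_left[OF NR.act_bilin antipode_linear[OF NR.H] that])
  have ac: "act NR h r \<in> carrier NR" if "r \<in> carrier NR" for h r by (rule bilinD(3)[OF NR.act_bilin Hc that])
  have F: "bilin H H base_field (?F t l r)" if "t \<in> carrier NT" "r \<in> carrier NR" for t l r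
    by (rule bilin_times[OF linear_map_comp[OF bilinD(1)[OF \<beta> that(1)] a[OF that(2)]] bilinD(1)[OF \<tau> Kc]])
  note cc = comult_closed[OF NR.H]
  have G1: "bilin NR H base_field (?G t l)" if t: "t \<in> carrier NT" for t l
  proof (rule bilinI)
    show "linear_map H base_field (\<lambda>h. ?G t l r h)" if "r \<in> carrier NR" for r
      by (rule tlift_comult_linear[OF NR.H kB F[OF t that]])
    show "linear_map NR base_field (\<lambda>r. ?G t l r h)" for h
      by (rule tlift_param[OF NR.kH NR.kH kB _ cc NR.kN])
        (rule linear_map_times_right[OF linear_map_comp[OF bilinD(1)[OF \<beta> t] bilinD(1)[OF NR.act_bilin Hc]]])
  qed
  have G2: "bilin NT K base_field (\<lambda>t l. ?G t l r h)" if r: "r \<in> carrier NR" for r h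
  proof (rule bilinI)
    show "linear_map K base_field (\<lambda>l. ?G t l r h)" for t
      by (rule tlift_param[OF NR.kH NR.kH kB _ cc NT.kH]) (rule linear_map_times_left[OF bilinD(2)[OF \<tau> Hc]])
    show "linear_map NT base_field (\<lambda>t. ?G t l r h)" for l
      by (rule tlift_param[OF NR.kH NR.kH kB _ cc NT.kN]) (rule linear_map_times_right[OF bilinD(2)[OF \<beta> ac[OF r]]])
  qed
  let ?\<Phi> = "\<lambda>x y. teval (\<lambda>t l. teval (?G t l) y) x"
  have b: "bilin (tensor NT K) (tensor NR H) base_field ?\<Phi>"
    by (rule tlift_tlift_bilin[OF NT.kN NT.kH NR.kN NR.kH kB G1 G2])
  have b': "bilin NT.A NR.A base_field ?\<Phi>"
    using b unfolding bilin_same[OF NT.same_BA NR.same_BA same_space_refl] .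
  have b'': "bilin NT.A NR.A base_field (biproduct_form K H NT NR \<beta> \<tau>)"
    by (rule bilin_cong[OF b' _ NT.kA NR.kA]) (simp add: biproduct_form_def)
  then show "bilinear_form NT.A NR.A (biproduct_form K H NT NR \<beta> \<tau>)"
    unfolding bilinear_form_iff[OF NT.kA NR.kA] by (simp add: biproduct_form_def)
  fix w v y h assume wv: "w \<in> lists JT" "v \<in> lists JR"
  note c = NT.cl_closed[OF wv(1)] NR.cl_closed[OF wv(2)]
  have G3: "bilin NT K base_field (\<lambda>t l. teval (?G t l) (NR.pr v h))"
    by (rule bilin_cong[OF G2[OF c(2), of "gelt h"] _ NT.kN NT.kH])
      (simp add: NR.pr_def tlift_tpure[OF NR.kN NR.kH kB G1] c Hc)
  have "biproduct_form K H NT NR \<beta> \<tau> (NT.pr w y) (NR.pr v h) = ?\<Phi> (NT.pr w y) (NR.pr v h)"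
    using wv by (simp add: biproduct_form_def NT.pr_closed NR.pr_closed)
  also have "\<dots> = ?G (clT w) (gelt y) (clR v) (gelt h)"
    unfolding NT.pr_def tlift_tpure[OF NT.kN NT.kH kB G3 c(1) Kc] unfolding NR.pr_def
    by (rule tlift_tpure[OF NR.kN NR.kH kB G1[OF c(1)] c(2) Hc])
  also have "\<dots> = ?F (clT w) (gelt y) (clR v) (gelt h) (gelt h)"
    by (rule tlift_comult_gelt[OF NR.H kB F[OF c]])
  also have "\<dots> = wchar \<chi> v (- h) * \<beta> (clT w) (clR v) * \<tau> (gelt y) (gelt h)"
    using wv by (simp add: antipode_inv_eq[OF NR.H] antipode_gelt[OF NR.H] NR.act_cl c linear_mapD(3)[OF bilinD(1)[OF \<beta> c(1)]])
  finally show "biproduct_form K H NT NR \<beta> \<tau> (NT.pr w y) (NR.pr v h)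
      = wchar \<chi> v (- h) * \<beta> (clT w) (clR v) * \<tau> (gelt y) (gelt h)" .
qed

end

section \<open>The conditions (C.1) and (C.2)\<close>

context diag_yd
begin

lemma ract_bilin: "linear_map H base_field p \<Longrightarrow> bilin H M M (\<lambda>h y. p h \<odot>\<^bsub>M\<^esub> y)"
  by (rule bilin_smul[OF kM _ linear_map_id])

lemma ract_linear: "linear_map H base_field p \<Longrightarrow> linear_map M M (\<lambda>x. ract M x p)"
  unfolding ract_def by (rule linear_map_comp[OF tlift_linear[OF kH kM kM ract_bilin] coact_linear])

lemma ract_b: "linear_map H base_field p \<Longrightarrow> j \<in> J \<Longrightarrow> ract M (b j) p = p (gelt (g j)) \<odot>\<^bsub>M\<^esub> b j"
  by (simp add: ract_def coact_b tlift_tpure[OF kH kM kM ract_bilin] Hc bM)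

lemma ract_param:
  assumes "kspace L" "\<And>h. linear_map L base_field (\<lambda>l. P l h)" "x \<in> carrier M"
  shows "linear_map L M (\<lambda>l. ract M x (P l))"
  unfolding ract_def
  by (rule tlift_param[OF kH kM kM _ linear_mapD(1)[OF coact_linear assms(3)] assms(1)])
    (rule linear_map_smul_const[OF kM assms(2)])

end

context nichols_pairing
begin

text \<open>On basis vectors and group elements both sides are multiples of \<open>lam i\<close> if
  \<open>s i = j\<close>, and 0 otherwise. The multiples agree by the hypothesis on \<eta> for (C.1)
  and by the one on \<open>\<phi> (z i)\<close> for (C.2).\<close>

lemma letters_cond_C:
  assumes \<tau>: "bilin K H base_field \<tau>" "\<And>y h. \<tau> (gelt y) (gelt h) = \<phi> y h"
    and \<beta>: "bilin W V base_field \<beta>"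
    and letters: "\<And>i j. i \<in> JW \<Longrightarrow> j \<in> JV \<Longrightarrow> \<beta> (u i) (a j) = (if s i = j then lam i else 0)"
  shows "cond_C K H \<tau> W V \<beta>"
proof -
  note Kc = W.Hc and Hc = V.Hc and kB = kspace_base_field
  note l\<tau> = bilinD(1)[OF \<tau>(1) Kc] and r\<tau> = bilinD(2)[OF \<tau>(1) Hc]
  note l\<beta> = bilinD(1)[OF \<beta>] and r\<beta> = bilinD(2)[OF \<beta>]
  have "\<beta> (act W l w) v = \<beta> w (ract V v (\<lambda>h. \<tau> l h))"
    if c: "l \<in> carrier K" "w \<in> carrier W" "v \<in> carrier V" for l w v
  proof (rule trilin_eq_on_span[where f = "\<lambda>l w v. \<beta> (act W l w) v" and f' = "\<lambda>l w v. \<beta> w (ract V v (\<lambda>h. \<tau> l h))",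
        OF _ _ _ _ W.spanH W.spanM V.spanM W.kH W.kM V.kM kB _ c])
    show "bilin W V base_field (\<lambda>w v. \<beta> (act W l w) v)" for l
      by (rule bilin_comp[OF \<beta> W.act_linear linear_map_id])
    show "bilin W V base_field (\<lambda>w v. \<beta> w (ract V v (\<tau> l)))" for l
      by (rule bilin_comp[OF \<beta> linear_map_id V.ract_linear[OF l\<tau>]])
    show "linear_map K base_field (\<lambda>l. \<beta> (act W l w) v)" if "w \<in> carrier W" "v \<in> carrier V" for w v
      by (rule linear_map_comp[OF r\<beta>[OF that(2)] bilinD(2)[OF W.act_bilin that(1)]])
    show "linear_map K base_field (\<lambda>l. \<beta> w (ract V v (\<tau> l)))" if "w \<in> carrier W" "v \<in> carrier V" for w v
      by (rule linear_map_comp[OF l\<beta>[OF that(1)] V.ract_param[OF W.kH r\<tau> that(2)]])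
    fix l' w' v' assume "l' \<in> range (gelt :: 'l \<Rightarrow> 'l \<Rightarrow>\<^sub>0 'k)" "w' \<in> u ` JW" "v' \<in> a ` JV"
    then obtain y i j where e: "l' = gelt y" "i \<in> JW" "w' = u i" "j \<in> JV" "v' = a j" by auto
    then show "\<beta> (act W l' w') v' = \<beta> w' (ract V v' (\<tau> l'))"
      by (simp add: W.act_b V.ract_b[OF l\<tau>] \<tau>(2) linear_mapD(3)[OF l\<beta>] linear_mapD(3)[OF r\<beta>] W.bM V.bM letters \<eta>_\<phi>)
        (use \<eta>_\<phi> in force)
  qed
  moreover have "\<beta> (ract W w (\<lambda>l. \<tau> l h)) v = \<beta> w (act V (antipode_inv H h) v)"
    if c: "h \<in> carrier H" "w \<in> carrier W" "v \<in> carrier V" for h w v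
    unfolding antipode_inv_eq[OF V.H]
  proof (rule trilin_eq_on_span[where f = "\<lambda>h w v. \<beta> (ract W w (\<lambda>l. \<tau> l h)) v" and f' = "\<lambda>h w v. \<beta> w (act V (antipode H h) v)",
        OF _ _ _ _ V.spanH W.spanM V.spanM V.kH W.kM V.kM kB _ c])
    show "bilin W V base_field (\<lambda>w v. \<beta> (ract W w (\<lambda>l. \<tau> l h)) v)" for h
      by (rule bilin_comp[OF \<beta> W.ract_linear[OF r\<tau>] linear_map_id])
    show "bilin W V base_field (\<lambda>w v. \<beta> w (act V (antipode H h) v))" for h
      by (rule bilin_comp[OF \<beta> linear_map_id V.act_linear])
    show "linear_map H base_field (\<lambda>h. \<beta> (ract W w (\<lambda>l. \<tau> l h)) v)" if "w \<in> carrier W" "v \<in> carrier V" for w v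
      by (rule linear_map_comp[OF r\<beta>[OF that(2)] W.ract_param[OF V.kH l\<tau> that(1)]])
    show "linear_map H base_field (\<lambda>h. \<beta> w (act V (antipode H h) v))" if "w \<in> carrier W" "v \<in> carrier V" for w v
      by (rule linear_map_comp[OF l\<beta>[OF that(1)] bilin_left[OF V.act_bilin antipode_linear[OF V.H] that(2)]])
    fix h' w' v' assume "h' \<in> range (gelt :: 'g \<Rightarrow> 'g \<Rightarrow>\<^sub>0 'k)" "w' \<in> u ` JW" "v' \<in> a ` JV"
    then obtain h i j where e: "h' = gelt h" "i \<in> JW" "w' = u i" "j \<in> JV" "v' = a j" by auto
    then show "\<beta> (ract W w' (\<lambda>l. \<tau> l h')) v' = \<beta> w' (act V (antipode H h') v')"
      by (simp add: W.ract_b[OF r\<tau>] V.act_b antipode_gelt[OF V.H] \<tau>(2) linear_mapD(3)[OF l\<beta>] linear_mapD(3)[OF r\<beta>]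
          W.bM V.bM letters characters_uminus[OF \<chi>_char])
        (use \<phi>_z in force)
  qed
  ultimately show ?thesis unfolding cond_C_def by simp
qed

end

lemma one_in_characters: "(\<lambda>_. 1) \<in> characters"
  by (simp add: characters_def)

text \<open>The last conjunct makes precise how the generators determine the map: prescribed values
  at the \<open>z i\<close> reach exactly the subgroup that they generate, so agreement is asserted
  on elements of the Nichols algebra tensored with group elements of that subgroup.\<close>

theorem corollary9p1:
  fixes W :: "('k::field, 'l::ab_group_add \<Rightarrow>\<^sub>0 'k, 'w) ydmod"
    and V :: "('k, 'g::ab_group_add \<Rightarrow>\<^sub>0 'k, 'v) ydmod"
    and n m :: nat
    and z :: "nat \<Rightarrow> 'l" and g :: "nat \<Rightarrow> 'g"
    and \<eta> :: "nat \<Rightarrow> 'l \<Rightarrow> 'k" and \<chi> :: "nat \<Rightarrow> 'g \<Rightarrow> 'k"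
    and u :: "nat \<Rightarrow> 'w" and a :: "nat \<Rightarrow> 'v"
    and \<phi> :: "'l \<Rightarrow> 'g \<Rightarrow> 'k" and s :: "nat \<Rightarrow> nat" and lam :: "nat \<Rightarrow> 'k"
    and \<tau> :: "('l \<Rightarrow>\<^sub>0 'k) \<Rightarrow> ('g \<Rightarrow>\<^sub>0 'k) \<Rightarrow> 'k" and \<beta> :: "'w \<Rightarrow> 'v \<Rightarrow> 'k"
  defines "K \<equiv> group_algebra :: ('k, 'l \<Rightarrow>\<^sub>0 'k) hopf"
    and "H \<equiv> group_algebra :: ('k, 'g \<Rightarrow>\<^sub>0 'k) hopf"
  defines "BW \<equiv> nichols K W" and "BV \<equiv> nichols H V"
  defines "U \<equiv> biproduct BW K" and "A \<equiv> biproduct BV H"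
  defines "\<Phi> \<equiv> biproduct_form K H BW BV (nichols_form K H W V \<beta>) \<tau>"
  defines "uU \<equiv> \<lambda>i. tpure BW K (nichols_incl K W (u i)) \<one>\<^bsub>K\<^esub>"
    and "zU \<equiv> \<lambda>y. tpure BW K \<one>\<^bsub>BW\<^esub> (gelt y)"
    and "aA \<equiv> \<lambda>j. tpure BV H (nichols_incl H V (a j)) \<one>\<^bsub>H\<^esub>"
    and "gA \<equiv> \<lambda>y. tpure BV H \<one>\<^bsub>BV\<^esub> (gelt y)"
  defines "is_gamma \<equiv> \<lambda>i \<gamma>. \<gamma> \<in> carrier (dual A) \<and> algebra_map A base_field \<gamma>
      \<and> (\<forall>j\<in>{1..m}. \<gamma> (aA j) = 0) \<and> (\<forall>y. \<gamma> (gA y) = \<phi> (z i) y)"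
    and "is_delta \<equiv> \<lambda>i \<gamma> d. derivation A (counit A) \<gamma> d
      \<and> (\<forall>j\<in>{1..m}. d (aA j) = \<beta> (u i) (a j)) \<and> (\<forall>y. d (gA y) = 0)"
  assumes "n > 0" and "m > 0"
    and "\<forall>i\<in>{1..n}. \<eta> i \<in> characters \<and> \<eta> i \<noteq> (\<lambda>_. 1)"
    and "\<forall>j\<in>{1..m}. \<chi> j \<in> characters \<and> \<chi> j \<noteq> (\<lambda>_. 1)"
    and "yd_module K W" and "is_basis W {1..n} u" and "\<forall>i\<in>{1..n}. u i \<in> yd_component W (z i) (\<eta> i)"
    and "yd_module H V" and "is_basis V {1..m} a" and "\<forall>j\<in>{1..m}. a j \<in> yd_component V (g j) (\<chi> j)"
    and "\<forall>y. \<phi> y \<in> characters" and "\<forall>y y' h. \<phi> (y + y') h = \<phi> y h * \<phi> y' h"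
    and "s \<in> {1..n} \<rightarrow> {1..m}"
    and "bilinear_form K H \<tau>" and "\<forall>y h. \<tau> (gelt y) (gelt h) = \<phi> y h"
    and "bilinear_form W V \<beta>"
    and "\<forall>i\<in>{1..n}. \<forall>j\<in>{1..m}. \<beta> (u i) (a j) = (if s i = j then lam i else 0)"
    and "\<forall>i\<in>{1..n}. lam i \<noteq> 0 \<longrightarrow>
          (\<forall>h. \<phi> (z i) h = inverse (\<chi> (s i) h)) \<and> (\<forall>y. \<eta> i y = \<phi> y (g (s i)))"
  shows "twist_datum K H \<tau> W V \<beta>
    \<and> bialgebra_map U (cop (finite_dual A)) \<Phi>
    \<and> (\<forall>i\<in>{1..n}. \<exists>!\<gamma>. is_gamma i \<gamma>)
    \<and> (\<forall>i\<in>{1..n}. \<forall>\<gamma>. is_gamma i \<gamma> \<longrightarrow> (\<exists>!d. is_delta i \<gamma> d))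
    \<and> (\<forall>i\<in>{1..n}. \<forall>\<gamma> d. is_gamma i \<gamma> \<and> is_delta i \<gamma> d \<longrightarrow> \<Phi> (zU (z i)) = \<gamma> \<and> \<Phi> (uU i) = d)
    \<and> (\<forall>\<Psi>. algebra_map U (finite_dual A) \<Psi>
         \<and> (\<forall>i\<in>{1..n}. \<Psi> (zU (z i)) = \<Phi> (zU (z i)) \<and> \<Psi> (uU i) = \<Phi> (uU i))
         \<longrightarrow> (\<forall>t\<in>carrier BW. \<forall>y\<in>is_subgroup hull (z ` {1..n}).
               \<Psi> (tpure BW K t (gelt y)) = \<Phi> (tpure BW K t (gelt y))))"
proof -
  \<comment> \<open>The locales ask for characters and compatibility at every index. Outside the
    given ranges the trivial character and the coefficient 0 satisfy these conditions and leave the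
    data inside unchanged.\<close>
  define \<eta>' where "\<eta>' i = (if i \<in> {1..n} then \<eta> i else (\<lambda>_. 1))" for i
  define \<chi>' where "\<chi>' j = (if j \<in> {1..m} then \<chi> j else (\<lambda>_. 1))" for j
  define lam' where "lam' i = (if i \<in> {1..n} then lam i else 0)" for i

  have K: "K = group_algebra" and H: "H = group_algebra" by (simp_all add: K_def H_def)
  interpret P: nichols_pairing K H W V "{1..n}" "{1..m}" u a z g \<eta>' \<chi>' \<phi> s lam'
  proof
    show "\<eta>' i \<in> characters" for i using assms(16) by (simp add: \<eta>'_def one_in_characters)
    show "\<chi>' j \<in> characters" for j using assms(17) by (simp add: \<chi>'_def one_in_characters)
    show "\<phi> y \<in> characters" "\<phi> (y + y') h = \<phi> y h * \<phi> y' h" for y y' h using assms(24,25) by auto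
    show "\<phi> (z i) h = inverse (\<chi>' (s i) h)" if "lam' i \<noteq> 0" for i h
      using that assms(26,31) by (auto simp: lam'_def \<chi>'_def Pi_iff split: if_splits)
    show "\<eta>' i y = \<phi> y (g (s i))" if "lam' i \<noteq> 0" for i y
      using that assms(31) by (auto simp: lam'_def \<eta>'_def split: if_splits)
    show "u i \<in> yd_component W (z i) (\<eta>' i)" if "i \<in> {1..n}" for i using that assms(20) by (simp add: \<eta>'_def)
    show "a j \<in> yd_component V (g j) (\<chi>' j)" if "j \<in> {1..m}" for j using that assms(23) by (simp add: \<chi>'_def)
  qed (use assms K H in simp_all)
  note kW = P.W.kM and kV = P.V.kM and kK = P.W.kH and kH = P.V.kH
  have \<tau>: "bilin K H base_field \<tau>" using assms(27) by (simp add: bilinear_form_iff[OF kK kH])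
  have \<beta>: "bilin W V base_field \<beta>" using assms(29) by (simp add: bilinear_form_iff[OF kW kV])
  have letters: "\<beta> (u i) (a j) = (if s i = j then lam' i else 0)" if "i \<in> {1..n}" "j \<in> {1..m}" for i j
    using assms(30) that by (simp add: lam'_def)
  have \<tau>g: "\<tau> (gelt y) (gelt h) = \<phi> y h" for y h using assms(28) by simp
  have datum: "twist_datum K H \<tau> W V \<beta>"
    unfolding twist_datum_def
    using group_algebra_hopf[OF K] antipode_bij[OF K] group_algebra_hopf[OF H] antipode_bij[OF H]
      assms(18,21,27,29) cond_A_group_algebra[OF K H \<tau> \<tau>g P.\<phi>_char P.\<phi>_add] P.letters_cond_C[OF \<tau> \<tau>g \<beta> letters] by blast
  have nf: "nichols_form K H W V \<beta> = P.NB" by (rule P.nichols_form_eq[OF \<beta> letters])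
  note form = P.P.biproduct_form_pr[OF P.NB_bilin \<tau>]
  have U: "U = P.P.NT.A" and A: "A = P.P.NR.A" by (simp_all add: U_def A_def BW_def BV_def)
  interpret S: smash_pairing U A "{1..n}" "{1..m}" z g \<eta>' \<chi>' \<phi> s lam' P.P.NT.pr P.P.NR.pr \<Phi>
  proof (intro smash_pairing.intro smash_pairing_axioms.intro P.word_pairing_axioms)
    show "diag_smash U {1..n} z \<eta>' P.P.NT.pr" unfolding U by (rule P.P.NT.biproduct_diag_smash)
    show "diag_smash A {1..m} g \<chi>' P.P.NR.pr" unfolding A by (rule P.P.NR.biproduct_diag_smash)
    show "bilinear_form U A \<Phi>" unfolding U A \<Phi>_def nf BW_def BV_def by (rule form(1))
    show "\<Phi> (P.P.NT.pr w y) (P.P.NR.pr v h) = wchar \<chi>' v (- h) * (\<phi> y h * P.wpair v w)"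
      if "w \<in> lists {1..n}" "v \<in> lists {1..m}" for w v y h
      unfolding \<Phi>_def nf BW_def BV_def using that by (simp add: form(2) P.NB_cl \<tau>g mult_ac del: One_nat_def)
  qed
  have gens: "uU i = P.P.NT.pr [i] 0" "zU y = P.P.NT.pr [] y" "aA j = P.P.NR.pr [j] 0" "gA h = P.P.NR.pr [] h" for i y j h
    by (simp_all add: uU_def zU_def aA_def gA_def P.P.NT.pr_def P.P.NR.pr_def BW_def BV_def P.W.nichols_incl_b P.V.nichols_incl_b
        P.P.NT.one_cl P.P.NR.one_cl ga_simps[OF K] ga_simps[OF H] gelt_zero)
  \<comment> \<open>Both descriptions are turned into equations with a value of \<Phi>, from which
    existence, uniqueness and the values of \<Phi> follow together.\<close>
  have gamma: "is_gamma i \<gamma> \<longleftrightarrow> \<gamma> = \<Phi> (zU (z i))" for i \<gamma>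
    unfolding is_gamma_def gens using S.character_iff by blast
  have delta: "is_delta i (\<Phi> (zU (z i))) d \<longleftrightarrow> d = \<Phi> (uU i)" if "i \<in> {1..n}" for i d
  proof -
    have "(\<forall>j\<in>{1..m}. d (aA j) = \<beta> (u i) (a j)) \<longleftrightarrow> (\<forall>j\<in>{1..m}. d (aA j) = (if s i = j then lam' i else 0))"
      by (simp add: letters[OF that])
    then show ?thesis unfolding is_delta_def gens using S.derivation_iff[OF that, of d] by simp
  qed
  \<comment> \<open>\<open>algebra_map_determined\<close> covers words; a general element of the
    Nichols algebra is reached by linearity in \<open>t\<close>.\<close>
  have determined: "\<Psi> (tpure BW K t (gelt y)) = \<Phi> (tpure BW K t (gelt y))"
    if \<Psi>: "algebra_map U (finite_dual A) \<Psi>" "\<forall>i\<in>{1..n}. \<Psi> (zU (z i)) = \<Phi> (zU (z i)) \<and> \<Psi> (uU i) = \<Phi> (uU i)"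
      and t: "t \<in> carrier BW" and y: "y \<in> is_subgroup hull (z ` {1..n})" for \<Psi> t y
  proof (rule linear_eq_on_span[where f = "\<lambda>t. \<Psi> (tpure BW K t (gelt y))" and g = "\<lambda>t. \<Phi> (tpure BW K t (gelt y))"
        and N = "finite_dual A", OF _ _ P.P.NT.spanN[folded BW_def] P.P.NT.kN[folded BW_def] _ _ t])
    have tp: "linear_map BW U (\<lambda>t. tpure BW K t (gelt y))"
      using bilinD(2)[OF P.P.NT.pB P.P.NT.Hc] unfolding U BW_def
      by (simp add: linear_map_same[OF same_space_refl P.P.NT.same_BA])
    show "linear_map BW (finite_dual A) (\<lambda>t. \<Psi> (tpure BW K t (gelt y)))"
      by (rule linear_map_comp[OF _ tp]) (use \<Psi>(1) in \<open>simp add: algebra_map_def\<close>)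
    show "linear_map BW (finite_dual A) (\<lambda>t. \<Phi> (tpure BW K t (gelt y)))"
      by (rule linear_map_comp[OF _ tp])
        (use S.\<Phi>_bialgebra_map in \<open>simp add: bialgebra_map_def algebra_map_def linear_map_def cop_simps\<close>)
    show "kspace (finite_dual A)"
      by (rule kspace_same[OF _ kspace_finite_dual[OF S.A.A_alg]]) (simp add: same_space_def finite_dual_simps)
    fix q assume "q \<in> P.W.cl ` lists {1..n}"
    then obtain w where w: "w \<in> lists {1..n}" "q = P.W.cl w" by auto
    show "\<Psi> (tpure BW K q (gelt y)) = \<Phi> (tpure BW K q (gelt y))"
      using S.algebra_map_determined[OF \<Psi>(1) _ _ w(1) y] \<Psi>(2) by (simp add: gens w(2) P.P.NT.pr_def BW_def)
  qed
  show ?thesis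
    using datum S.\<Phi>_bialgebra_map gamma delta determined by auto
qed

end
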